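(* Let $c\ge 1$, let $k=2c$ or $k=2c+1$, and let $X\subseteq\mathbb{P}^k$ be a smooth determinantal variety of codimension $c$ whose defining ideal is generated by the $3\times 3$ minors of a $(c+2)\times 3$ matrix of linear forms. Then $X$ is the critical locus for two suitable triples of projections $P_1,P_2,P_3$ and $Q_1,Q_2,Q_3$ from $\mathbb{P}^k$ (with $P_i,Q_i:\mathbb{P}^k\dashrightarrow\mathbb{P}^{h_i}$, $h_1+h_2+h_3=k+c$) if and only if one of the following holds: (a) $X\subseteq\mathbb{P}^2$ is a (smooth) cubic curve; (b) $X\subseteq\mathbb{P}^3$ is a (smooth) cubic surface; (c) $X\subseteq\mathbb{P}^4$ is a Bordiga surface. In particular, if $X$ is such a critical locus then $c\le 2$.
   Context: We work over $\mathbb{C}$. A projection $P:\mathbb{P}^k\dashrightarrow\mathbb{P}^h$ ($1\le h<k$) is given by an $(h+1)\times(k+1)$ complex matrix of rank $h+1$ (up to a nonzero scalar), also denoted $P$; its center is the linear subspace of $\mathbb{P}^k$, of dimension $k-h-1$, given by the kernel of the matrix. With $\mathbf{X}=(x_0,\dots,x_k)^T$, $Q_i(\mathbf{X})=Q_i\cdot\mathbf{X}$ is a column of $h_i+1$ linear forms. The critical locus of two triples $P_1,P_2,P_3$ and $Q_1,Q_2,Q_3$ is the subscheme of $\mathbb{P}^k$ defined by the ideal generated by the maximal minors (of order $k+4$) of the $(3+h_1+h_2+h_3)\times(k+4)$ matrix $$M=\begin{pmatrix} P_1 & Q_1(\mathbf{X}) & 0 & 0\\ P_2 & 0 & Q_2(\mathbf{X})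 & 0\\ P_3 & 0 & 0 & Q_3(\mathbf{X})\end{pmatrix}.$$ It is always required that the centers of $P_1,P_2,P_3$ have empty common intersection, that the centers of $Q_1,Q_2,Q_3$ have empty common intersection, and that the critical locus has the expected dimension $2k-h_1-h_2-h_3$. A Bordiga surface is the embedding in $\mathbb{P}^4$ of the blow-up of $\mathbb{P}^2$ at a set $Z$ of $10$ general points via the linear system of plane quartics through $Z$. Here the ideal sheaf of $Z$ has a resolution $0\to\mathcal{O}_{\mathbb{P}^2}(-5)^4\to\mathcal{O}_{\mathbb{P}^2}(-4)^5\to\mathcal{I}_Z\to 0$, and "general" means that $Z$ has this resolution and that the linear system embeds the blow-up; the ideal sheaf of the Bordiga surface $B$ has a resolution $0\to\mathcal{O}_{\mathbb{P}^4}(-4)^3\to\mathcal{O}_{\mathbb{P}^4}(-3)^4\to\mathcal{I}_B\to 0$. *)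

theory Defs
  imports
    "HOL-Library.Poly_Mapping"
    "HOL-Algebra.Ideal"
    "Jordan_Normal_Form.Matrix"
    "Jordan_Normal_Form.Determinant"
    "Jordan_Normal_Form.Matrix_Kernel"
    "Jordan_Normal_Form.DL_Rank"
    "Jordan_Normal_Form.DL_Submatrix"
begin

section \<open>Polynomials\<close>

text \<open>Polynomials are finitely supported maps from exponent vectors to coefficients. All variables
  \<open>x\<^sub>0, x\<^sub>1, \<dots>\<close> live in one type; \<open>polys k\<close> is \<open>\<complex>[x\<^sub>0,\<dots>,x\<^sub>k]\<close>.\<close>

type_synonym cpoly = "(nat \<Rightarrow>\<^sub>0 nat) \<Rightarrow>\<^sub>0 complex"

definition Const :: "complex \<Rightarrow> cpoly" where
  "Const a = Poly_Mapping.single 0 a"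

definition Var :: "nat \<Rightarrow> cpoly" where
  "Var i = Poly_Mapping.single (Poly_Mapping.single i 1) 1"

definition polys :: "nat \<Rightarrow> cpoly set" where
  "polys k = {f. \<forall>m\<in>Poly_Mapping.keys f. Poly_Mapping.keys m \<subseteq> {..k}}"

text \<open>\<open>forms k d\<close> contains \<open>0\<close> for every \<open>d\<close>.\<close>

definition forms :: "nat \<Rightarrow> nat \<Rightarrow> cpoly set" where
  "forms k d = {f \<in> polys k. \<forall>m\<in>Poly_Mapping.keys f.
     (\<Sum>i\<in>Poly_Mapping.keys m. Poly_Mapping.lookup m i) = d}"

definition poly_eval :: "cpoly \<Rightarrow> complex vec \<Rightarrow> complex" where
  "poly_eval f v = (\<Sum>m\<in>Poly_Mapping.keys f. Poly_Mapping.lookup f m *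
     (\<Prod>i\<in>Poly_Mapping.keys m. (v $ i) ^ Poly_Mapping.lookup m i))"

definition partial_deriv :: "nat \<Rightarrow> cpoly \<Rightarrow> cpoly" where
  "partial_deriv j f = (\<Sum>m\<in>Poly_Mapping.keys f. Poly_Mapping.single
     (m - Poly_Mapping.single j 1) (of_nat (Poly_Mapping.lookup m j) * Poly_Mapping.lookup f m))"

definition coord_ring :: "nat \<Rightarrow> cpoly ring" where
  "coord_ring k = \<lparr>carrier = polys k, monoid.mult = (*), one = 1, ring.zero = 0, add = (+)\<rparr>"

abbreviation poly_vecs :: "nat \<Rightarrow> nat \<Rightarrow> cpoly vec set" where
  "poly_vecs k a \<equiv> {v \<in> carrier_vec a. \<forall>i<a. v $ i \<in> polys k}"

lemma cring_coord_ring: "cring (coord_ring k)"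
proof -
  have add: "f + g \<in> polys k" if "f \<in> polys k" "g \<in> polys k" for f g
    using that Poly_Mapping.keys_add[of f g] unfolding polys_def by blast
  have mult: "f * g \<in> polys k" if "f \<in> polys k" "g \<in> polys k" for f g
  proof -
    have "Poly_Mapping.keys m \<subseteq> {..k}" if m: "m \<in> Poly_Mapping.keys (f * g)" for m
    proof -
      obtain a b where "m = a + b" "a \<in> Poly_Mapping.keys f" "b \<in> Poly_Mapping.keys g"
        using m Poly_Mapping.keys_mult[of f g] by blast
      then show ?thesis
        using \<open>f \<in> polys k\<close> \<open>g \<in> polys k\<close> Poly_Mapping.keys_add[of a b]
        unfolding polys_def by blast
    qed
    then show ?thesis unfolding polys_def by blast
  qed
  have neg: "- f \<in> polys k" if "f \<in> polys k" for f
    using that unfolding polys_def by (simp add: in_keys_iff)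
  have const: "0 \<in> polys k" "1 \<in> polys k"
    unfolding polys_def by auto
  show ?thesis
    unfolding coord_ring_def
  proof (intro cringI abelian_groupI comm_monoidI, simp_all add: add mult const algebra_simps)
    fix f assume "f \<in> polys k"
    then show "\<exists>g\<in>polys k. f + g = 0" by (intro bexI[of _ "- f"]) (auto intro: neg)
  qed
qed


section \<open>Projective varieties and subschemes\<close>

text \<open>A subset of \<open>\<P>\<^sup>k\<close> is represented by the set of all homogeneous coordinate vectors of its points,
  that is, by its affine cone without the origin.\<close>

definition proj_space :: "nat \<Rightarrow> complex vec set" where
  "proj_space k = carrier_vec (k + 1) - {0\<^sub>v (k + 1)}"

definition same_point :: "complex vec \<Rightarrow> complex vec \<Rightarrow> bool" where
  "same_point v w \<longleftrightarrow> (\<exists>a. a \<noteq> 0 \<and> w = a \<cdot>\<^sub>v v)"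

definition zeros :: "nat \<Rightarrow> cpoly set \<Rightarrow> complex vec set" where
  "zeros k G = {v \<in> proj_space k. \<forall>g\<in>G. poly_eval g v = 0}"

definition zariski_closed :: "nat \<Rightarrow> complex vec set \<Rightarrow> bool" where
  "zariski_closed k X \<longleftrightarrow> (\<exists>G \<subseteq> (\<Union>d. forms k d). X = zeros k G)"

definition irreducible_closed :: "nat \<Rightarrow> complex vec set \<Rightarrow> bool" where
  "irreducible_closed k X \<longleftrightarrow> zariski_closed k X \<and> X \<noteq> {} \<and>
     (\<forall>A B. zariski_closed k A \<and> zariski_closed k B \<and> X \<subseteq> A \<union> B \<longrightarrow> X \<subseteq> A \<or> X \<subseteq> B)"

text \<open>\<open>dim X = d\<close> as a relation; it holds for no \<open>d\<close> if \<open>X\<close> is empty.\<close>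

definition chain_of_length :: "nat \<Rightarrow> complex vec set \<Rightarrow> nat \<Rightarrow> bool" where
  "chain_of_length k X n \<longleftrightarrow> (\<exists>Z. (\<forall>i\<le>n. irreducible_closed k (Z i) \<and> Z i \<subseteq> X) \<and>
     (\<forall>i<n. Z i \<subset> Z (Suc i)))"

definition has_dim :: "nat \<Rightarrow> complex vec set \<Rightarrow> nat \<Rightarrow> bool" where
  "has_dim k X d \<longleftrightarrow> chain_of_length k X d \<and> \<not> chain_of_length k X (Suc d)"

text \<open>For the cone over a nonempty set of points this is automatically a homogeneous ideal, since \<open>\<complex>\<close> is
  infinite.\<close>

definition vanishing_ideal :: "nat \<Rightarrow> complex vec set \<Rightarrow> cpoly set" where
  "vanishing_ideal k X = {f \<in> polys k. \<forall>v\<in>X. poly_eval f v = 0}"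

definition jacobian :: "nat \<Rightarrow> cpoly list \<Rightarrow> complex vec \<Rightarrow> complex mat" where
  "jacobian k fs v =
     mat (length fs) (k + 1) (\<lambda>(i, j). poly_eval (partial_deriv j (fs ! i)) v)"

text \<open>Smoothness by the Jacobian criterion; by the Euler relation the homogeneous Jacobian matrix has
  the same rank as that of an affine chart, and the rank does not depend on the generators.\<close>

definition smooth_variety :: "nat \<Rightarrow> complex vec set \<Rightarrow> bool" where
  "smooth_variety k X \<longleftrightarrow> irreducible_closed k X \<and>
     (\<exists>d fs. has_dim k X d \<and> set fs \<subseteq> polys k \<and>
        vanishing_ideal k X = Idl\<^bsub>coord_ring k\<^esub> (set fs) \<and>
        (\<forall>v\<in>X. vec_space.rank (length fs) (jacobian k fs v) = k - d))"

text \<open>Two homogeneous ideals define the same closed subscheme of \<open>\<P>\<^sup>k\<close> iff their saturations agree.\<close>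

definition saturation :: "nat \<Rightarrow> cpoly set \<Rightarrow> cpoly set" where
  "saturation k I = {f \<in> polys k. \<exists>n. \<forall>i\<le>k. Var i ^ n * f \<in> I}"

definition same_subscheme :: "nat \<Rightarrow> cpoly set \<Rightarrow> cpoly set \<Rightarrow> bool" where
  "same_subscheme k I J \<longleftrightarrow> saturation k I = saturation k J"

text \<open>For matrices with at least as many rows as columns.\<close>

definition maximal_minors :: "cpoly mat \<Rightarrow> cpoly set" where
  "maximal_minors M = {det (submatrix M R UNIV) | R. R \<subseteq> {..<dim_row M} \<and> card R = dim_col M}"

definition cubic_hypersurface :: "nat \<Rightarrow> complex vec set \<Rightarrow> bool" where
  "cubic_hypersurface k X \<longleftrightarrow>
     (\<exists>F\<in>forms k 3. F \<noteq> 0 \<and> vanishing_ideal k X = Idl\<^bsub>coord_ring k\<^esub> {F})"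


section \<open>Critical loci of projections\<close>

definition projection :: "nat \<Rightarrow> nat \<Rightarrow> complex mat \<Rightarrow> bool" where
  "projection k h P \<longleftrightarrow> 1 \<le> h \<and> h < k \<and> P \<in> carrier_mat (h + 1) (k + 1) \<and>
     vec_space.rank (h + 1) P = h + 1"

text \<open>The triples are \<open>P 0, P 1, P 2\<close> and \<open>Q 0, Q 1, Q 2\<close>. The \<open>i\<close>-th block of rows of the critical
  matrix consists of \<open>P i\<close> followed by three columns, the \<open>i\<close>-th of which is the column of linear forms
  \<open>Q i \<cdot> (x\<^sub>0,\<dots>,x\<^sub>k)\<^sup>T\<close> while the other two vanish.\<close>

definition critical_block :: "nat \<Rightarrow> (nat \<Rightarrow> complex mat) \<Rightarrow> (nat \<Rightarrow> complex mat) \<Rightarrow> nat \<Rightarrow> cpoly mat"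
  where "critical_block k P Q i = mat (dim_row (P i)) (k + 4) (\<lambda>(r, s).
     if s \<le> k then Const (P i $$ (r, s))
     else if s = k + 1 + i then (map_mat Const (Q i) *\<^sub>v vec (k + 1) Var) $ r
     else 0)"

definition critical_matrix :: "nat \<Rightarrow> (nat \<Rightarrow> complex mat) \<Rightarrow> (nat \<Rightarrow> complex mat) \<Rightarrow> cpoly mat" where
  "critical_matrix k P Q =
     critical_block k P Q 0 @\<^sub>r critical_block k P Q 1 @\<^sub>r critical_block k P Q 2"

definition critical_ideal :: "nat \<Rightarrow> (nat \<Rightarrow> complex mat) \<Rightarrow> (nat \<Rightarrow> complex mat) \<Rightarrow> cpoly set" where
  "critical_ideal k P Q = Idl\<^bsub>coord_ring k\<^esub> (maximal_minors (critical_matrix k P Q))"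

definition admissible_triples ::
    "nat \<Rightarrow> (nat \<Rightarrow> nat) \<Rightarrow> (nat \<Rightarrow> complex mat) \<Rightarrow> (nat \<Rightarrow> complex mat) \<Rightarrow> bool" where
  "admissible_triples k h P Q \<longleftrightarrow>
     (\<forall>i<3. projection k (h i) (P i) \<and> projection k (h i) (Q i)) \<and>
     (\<Inter>i\<in>{..<3}. mat_kernel (P i)) = {0\<^sub>v (k + 1)} \<and>
     (\<Inter>i\<in>{..<3}. mat_kernel (Q i)) = {0\<^sub>v (k + 1)} \<and>
     (\<exists>d. has_dim k (zeros k (critical_ideal k P Q)) d \<and> d + (h 0 + h 1 + h 2) = 2 * k)"

definition is_critical_locus :: "nat \<Rightarrow> (nat \<Rightarrow> nat) \<Rightarrow> (nat \<Rightarrow> complex mat) \<Rightarrow>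
    (nat \<Rightarrow> complex mat) \<Rightarrow> complex vec set \<Rightarrow> bool" where
  "is_critical_locus k h P Q X \<longleftrightarrow> admissible_triples k h P Q \<and>
     same_subscheme k (critical_ideal k P Q) (vanishing_ideal k X)"


section \<open>Bordiga surfaces\<close>

definition point_set :: "complex vec set \<Rightarrow> complex vec set" where
  "point_set R = {w. \<exists>v\<in>R. same_point v w}"

text \<open>The ideal sheaf of \<open>Z \<subseteq> \<P>\<^sup>n\<close> has a resolution
  \<open>0 \<rightarrow> \<O>(-d-1)\<^sup>b \<rightarrow> \<O>(-d)\<^sup>a \<rightarrow> \<I>\<^sub>Z \<rightarrow> 0\<close>, whose maps are given by a matrix \<open>N\<close> of linear forms and a vector
  \<open>q\<close> of forms of degree \<open>d\<close>. Exactness of sheaves is exactness on the charts \<open>x\<^sub>i \<noteq> 0\<close>, that is, after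
  multiplication with powers of each \<open>x\<^sub>i\<close>; injectivity of \<open>N\<close> is unaffected by this.\<close>

definition linear_resolution :: "nat \<Rightarrow> nat \<Rightarrow> nat \<Rightarrow> nat \<Rightarrow> complex vec set \<Rightarrow> bool" where
  "linear_resolution n d a b Z \<longleftrightarrow> (\<exists>q N.
     q \<in> carrier_vec a \<and> (\<forall>j<a. q $ j \<in> forms n d) \<and>
     N \<in> carrier_mat a b \<and> (\<forall>j<a. \<forall>l<b. N $$ (j, l) \<in> forms n 1) \<and>
     (\<forall>w\<in>poly_vecs n b. N *\<^sub>v w = 0\<^sub>v a \<longrightarrow> w = 0\<^sub>v b) \<and>
     (\<forall>v\<in>poly_vecs n a. v \<bullet> q = 0 \<longleftrightarrow>
        (\<exists>e. \<forall>i\<le>n. \<exists>w\<in>poly_vecs n b. Var i ^ e \<cdot>\<^sub>v v = N *\<^sub>v w)) \<and>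
     (\<forall>f\<in>polys n. f \<in> vanishing_ideal n Z \<longleftrightarrow>
        (\<exists>e. \<forall>i\<le>n. \<exists>v\<in>poly_vecs n a. Var i ^ e * f = v \<bullet> q)))"

text \<open>\<open>q\<close> is a basis of the space of forms of degree \<open>d\<close> vanishing on \<open>Z\<close>.\<close>

definition linear_system_basis :: "nat \<Rightarrow> nat \<Rightarrow> nat \<Rightarrow> complex vec set \<Rightarrow> cpoly vec \<Rightarrow> bool" where
  "linear_system_basis n d a Z q \<longleftrightarrow>
     q \<in> carrier_vec a \<and> (\<forall>j<a. q $ j \<in> forms n d \<inter> vanishing_ideal n Z) \<and>
     (\<forall>f \<in> forms n d \<inter> vanishing_ideal n Z. \<exists>!s. s \<in> carrier_vec a \<and> f = map_vec Const s \<bullet> q)"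

text \<open>The blow-up of \<open>\<P>\<^sup>m\<close> along the subscheme defined by forms \<open>g\<^sub>0,\<dots>,g\<^sub>n\<close> of the same degree is the
  closure in \<open>\<P>\<^sup>m \<times> \<P>\<^sup>n\<close> of the graph of the rational map \<open>(g\<^sub>0 : \<dots> : g\<^sub>n)\<close>. As the graph is represented by
  its bicone, the polynomials vanishing on it form a bihomogeneous ideal.\<close>

definition graph_bicone :: "nat \<Rightarrow> nat \<Rightarrow> cpoly vec \<Rightarrow> (complex vec \<times> complex vec) set" where
  "graph_bicone m n g = {(y, x). y \<in> proj_space m \<and> x \<in> proj_space n \<and>
     same_point (map_vec (\<lambda>f. poly_eval f y) g) x}"

definition blow_up :: "nat \<Rightarrow> nat \<Rightarrow> cpoly vec \<Rightarrow> (complex vec \<times> complex vec) set" where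
  "blow_up m n g = {(y, x). y \<in> proj_space m \<and> x \<in> proj_space n \<and>
     (\<forall>F\<in>polys (m + n + 1). (\<forall>(y', x')\<in>graph_bicone m n g. poly_eval F (y' @\<^sub>v x') = 0) \<longrightarrow>
        poly_eval F (y @\<^sub>v x) = 0)}"

text \<open>The second projection is an isomorphism of \<open>W \<subseteq> \<P>\<^sup>m \<times> \<P>\<^sup>n\<close> onto its image: it is injective and its
  inverse is a morphism, that is, locally given by forms of the same degree without common zero.\<close>

definition second_projection_embeds ::
    "nat \<Rightarrow> nat \<Rightarrow> (complex vec \<times> complex vec) set \<Rightarrow> bool" where
  "second_projection_embeds m n W \<longleftrightarrow> (\<forall>x\<^sub>0\<in>snd ` W. \<exists>e G.
     G \<in> carrier_vec (m + 1) \<and> (\<forall>j<m + 1. G $ j \<in> forms n e) \<and>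
     map_vec (\<lambda>f. poly_eval f x\<^sub>0) G \<noteq> 0\<^sub>v (m + 1) \<and>
     (\<forall>(y, x)\<in>W. map_vec (\<lambda>f. poly_eval f x) G \<noteq> 0\<^sub>v (m + 1) \<longrightarrow>
        same_point (map_vec (\<lambda>f. poly_eval f x) G) y))"

text \<open>By the resolution, the quartics through \<open>Z\<close> generate its ideal sheaf. Hence \<open>blow_up 2 4 q\<close> is the
  blow-up of \<open>\<P>\<^sup>2\<close> at \<open>Z\<close>, and its second projection is the map given by the quartics.\<close>

definition bordiga_surface :: "complex vec set \<Rightarrow> bool" where
  "bordiga_surface B \<longleftrightarrow> (\<exists>R Z q.
     R \<subseteq> proj_space 2 \<and> card R = 10 \<and> pairwise (\<lambda>v w. \<not> same_point v w) R \<and> Z = point_set R \<and>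
     linear_resolution 2 4 5 4 Z \<and>
     linear_system_basis 2 4 5 Z q \<and>
     second_projection_embeds 2 4 (blow_up 2 4 q) \<and>
     B = snd ` blow_up 2 4 q)"

end

theory Submission
  imports Defs "HOL-Computational_Algebra.Fundamental_Theorem_Algebra"
begin

text \<open>The critical matrix and the \<open>(c+2)\<times>3\<close> matrix of \<open>X\<close> both present \<open>X\<close>, and for any such presentation
  smoothness says that a right kernel vector \<open>u\<close> and a left kernel vector \<open>w\<close> at a point of \<open>X\<close> satisfy
  \<open>w dM u \<noteq> 0\<close>. If \<open>k - c \<ge> 3\<close>, then counting equations yields a point at which the critical matrix violates
  this; this excludes everything except \<open>k \<in> {2, 3, 4}\<close>.

  Conversely, regard the matrix as a trilinear form in \<open>w, y, x\<close>. A choice of coordinates in \<open>y\<close> for which the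
  columns (two of them if \<open>k = 3\<close>) are killed by constant row vectors \<open>w\<close> turns the matrix into a critical matrix. For \<open>k \<ge> 3\<close> the
  possible columns are the points \<open>y \<in> \<P>\<^sup>2\<close> at which the \<open>(k+1)\<times>k\<close> matrix of linear forms in \<open>y\<close> drops rank. Its
  maximal minors satisfy the Hilbert-Burch theorem, proved here by restriction to a line missing the points, and
  the differential criterion shows that the points are reduced. Hence there are \<open>k(k+1)/2\<close> of them and they impose
  independent conditions on forms of degree \<open>k-1\<close>; in particular they are not collinear. For \<open>k = 4\<close> these are the
  ten points of the Bordiga surface, whose blow-up is the incidence variety of all \<open>(y, x)\<close> with \<open>A(x) y = 0\<close>.\<close>

section \<open>Polynomials\<close>

text \<open>The count behind the exclusion: the critical matrix has k + c + 3 rows, and k \<le> 2c +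
  1 forces some h_i \<le> c. Hence a nonzero row vector exists that kills the k + 1 constant columns
  and vanishes on the block of P_i, and for k \<ge> c + 3 the center of Q_i contains a point at
  which it kills the other two columns as well. What remains is (c, k) = (1, 2), (1, 3), (2, 4).

  The line missing the points plays the role of a depth argument: on it the matrix in y becomes a
  univariate pencil that is injective at every point of P^1, where syzygies of minors are
  elementary, and all results are lifted back modulo the equation of the line. That such a line
  exists rests on the finiteness of the locus, which comes from compactness together with the
  isolation of its points.

  The number k(k+1)/2 is the dimension of the space of ternary forms of degree k - 1. For k = 2 the
  locus in y is cut out by a single 3 x 3 determinant and is not finite, so the three columns are
  found by a separate argument. For k = 3 the third column must not be killed, and it is taken on
  the missing line.\<close>

abbreviation lk where "lk \<equiv> Poly_Mapping.lookup"
abbreviation ks where "ks \<equiv> Poly_Mapping.keys"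
abbreviation sg where "sg \<equiv> Poly_Mapping.single"

lemma sum_singles: "(\<Sum>m\<in>ks f. sg m (lk f m)) = f"
proof (rule poly_mapping_eqI)
  fix k
  have "(\<Sum>m\<in>ks f. lk (sg m (lk f m)) k) = (\<Sum>m\<in>ks f. if m = k then lk f k else 0)"
    by (intro sum.cong) (auto simp: lookup_single when_def)
  also have "\<dots> = lk f k" by (auto simp: in_keys_iff)
  finally show "lk (\<Sum>m\<in>ks f. sg m (lk f m)) k = lk f k" by (simp add: lookup_sum)
qed

lemma cpoly_induct [case_names single add]:
  fixes f :: "'a \<Rightarrow>\<^sub>0 'b::comm_monoid_add"
  assumes "\<And>m a. P (sg m a)" "\<And>f g. P f \<Longrightarrow> P g \<Longrightarrow> P (f + g)"
  shows "P f"
proof -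
  have "P (\<Sum>m\<in>S. sg m (h m))" if "finite S" for S h
    using that
  proof induction
    case empty
    show ?case using assms(1)[of undefined 0] by simp
  qed (auto intro: assms)
  from this[of "ks f" "lk f"] show ?thesis by (simp add: sum_singles)
qed

section \<open>Substitution homomorphisms and evaluation at a point\<close>

definition mono_eval :: "(nat \<Rightarrow> 'b::comm_ring_1) \<Rightarrow> (nat \<Rightarrow>\<^sub>0 nat) \<Rightarrow> 'b" where
  "mono_eval \<phi> m = (\<Prod>i\<in>ks m. \<phi> i ^ lk m i)"

lemma mono_eval_superset:
  assumes "finite S" "ks m \<subseteq> S"
  shows "mono_eval \<phi> m = (\<Prod>i\<in>S. \<phi> i ^ lk m i)"
  unfolding mono_eval_def using assms
  by (intro prod.mono_neutral_left) (auto simp: in_keys_iff)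

lemma keys_add_nat: "ks (m + m' :: nat \<Rightarrow>\<^sub>0 nat) = ks m \<union> ks m'"
  by (auto simp: in_keys_iff lookup_add)

lemma mono_eval_add: "mono_eval \<phi> (m + m') = mono_eval \<phi> m * mono_eval \<phi> m'"
  using mono_eval_superset[of "ks m \<union> ks m'" m \<phi>] mono_eval_superset[of "ks m \<union> ks m'" m' \<phi>]
    mono_eval_superset[of "ks m \<union> ks m'" "m + m'" \<phi>]
  by (simp add: keys_add_nat lookup_add power_add prod.distrib)

lemma mono_eval_0 [simp]: "mono_eval \<phi> 0 = 1"
  by (simp add: mono_eval_def)

lemma mono_eval_single [simp]: "mono_eval \<phi> (sg i n) = \<phi> i ^ n"
  by (cases "n = 0") (simp_all add: mono_eval_def)

text \<open>One map covers all uses: evaluation at a point takes \<kappa> to be the identity,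
  restriction to a line or to a parametrised curve uses constant univariate polynomials, and
  reduction modulo a point substitutes polynomials into polynomials.\<close>

definition subst :: "(complex \<Rightarrow> 'b::comm_ring_1) \<Rightarrow> (nat \<Rightarrow> 'b) \<Rightarrow> cpoly \<Rightarrow> 'b" where
  "subst \<kappa> \<phi> f = (\<Sum>m\<in>ks f. \<kappa> (lk f m) * mono_eval \<phi> m)"

context
  fixes \<kappa> :: "complex \<Rightarrow> 'b::comm_ring_1"
  assumes \<kappa>: "comm_ring_hom \<kappa>"
begin

interpretation comm_ring_hom \<kappa> by (rule \<kappa>)

lemma subst_superset:
  assumes "finite S" "ks f \<subseteq> S"
  shows "subst \<kappa> \<phi> f = (\<Sum>m\<in>S. \<kappa> (lk f m) * mono_eval \<phi> m)"
  unfolding subst_def using assms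
  by (intro sum.mono_neutral_left) (auto simp: in_keys_iff)

lemma subst_single: "subst \<kappa> \<phi> (sg m a) = \<kappa> a * mono_eval \<phi> m"
  using subst_superset[of "{m}" "sg m a"] by simp

lemma subst_add: "subst \<kappa> \<phi> (f + g) = subst \<kappa> \<phi> f + subst \<kappa> \<phi> g"
  using subst_superset[of "ks f \<union> ks g" f \<phi>] subst_superset[of "ks f \<union> ks g" g \<phi>]
    subst_superset[of "ks f \<union> ks g" "f + g" \<phi>] Poly_Mapping.keys_add[of f g]
  by (simp add: lookup_add hom_add algebra_simps sum.distrib)

lemma subst_mult: "subst \<kappa> \<phi> (f * g) = subst \<kappa> \<phi> f * subst \<kappa> \<phi> g"
proof (induction f rule: cpoly_induct)
  case (single m a)
  show ?case
    by (induction g rule: cpoly_induct)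
      (simp_all add: mult_single subst_single subst_add mono_eval_add hom_mult algebra_simps)
qed (simp add: subst_add algebra_simps)

lemma subst_hom: "comm_ring_hom (subst \<kappa> \<phi>)"
proof
  show "subst \<kappa> \<phi> 1 = 1" using subst_single[of \<phi> 0 1] by simp
  show "subst \<kappa> \<phi> 0 = 0" by (simp add: subst_def)
qed (simp_all add: subst_add subst_mult)

lemma subst_Const [simp]: "subst \<kappa> \<phi> (Const a) = \<kappa> a"
  by (simp add: Const_def subst_single)

lemma subst_Var [simp]: "subst \<kappa> \<phi> (Var i) = \<phi> i"
  by (simp add: Var_def subst_single)

end

lemma poly_eval_subst: "poly_eval f v = subst (\<lambda>x. x) (\<lambda>i. v $ i) f"
  by (simp add: poly_eval_def subst_def mono_eval_def)

lemma comm_ring_hom_id: "comm_ring_hom (\<lambda>x::complex. x)"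
  by standard auto

interpretation ev: comm_ring_hom "\<lambda>f. poly_eval f v" for v
  unfolding poly_eval_subst by (rule subst_hom[OF comm_ring_hom_id])

lemma poly_eval_Const [simp]: "poly_eval (Const a) v = a"
  by (simp add: poly_eval_subst subst_Const[OF comm_ring_hom_id])

lemma poly_eval_Var [simp]: "poly_eval (Var i) v = v $ i"
  by (simp add: poly_eval_subst subst_Var[OF comm_ring_hom_id])

interpretation Const: comm_ring_hom Const
  by standard (simp_all add: Const_def single_add mult_single)

lemma Const_eq_0_iff [simp]: "Const a = 0 \<longleftrightarrow> a = 0"
  by (metis Const.hom_zero poly_eval_Const)

lemma Var_power: "Var i ^ n = sg (sg i n) 1"
  by (induction n) (simp_all add: Var_def mult_single single_add[symmetric])

lemma single_eq_mono: "sg m a = Const a * mono_eval Var m"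
proof -
  have "(\<Prod>i\<in>S. sg (g i) (1::complex)) = sg (\<Sum>i\<in>S. g i) 1" if "finite S"
    for S and g :: "nat \<Rightarrow> nat \<Rightarrow>\<^sub>0 nat"
    using that by induction (simp_all add: mult_single)
  then have "mono_eval Var m = sg m 1"
    by (simp add: mono_eval_def Var_power sum_singles)
  then show ?thesis by (simp add: Const_def mult_single)
qed

section \<open>The polynomial rings in finitely many variables\<close>

lemma polys_closed [simp]:
  "0 \<in> polys n" "1 \<in> polys n" "Const a \<in> polys n" "i \<le> n \<Longrightarrow> Var i \<in> polys n"
  by (auto simp: polys_def Const_def Var_def split: if_splits)

lemma polys_add [simp]: "f \<in> polys n \<Longrightarrow> g \<in> polys n \<Longrightarrow> f + g \<in> polys n"
  using cring.cring_simprules(1)[OF cring_coord_ring, of f n g] by (simp add: coord_ring_def)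

lemma polys_mult [simp]: "f \<in> polys n \<Longrightarrow> g \<in> polys n \<Longrightarrow> f * g \<in> polys n"
  using cring.cring_simprules(5)[OF cring_coord_ring, of f n g] by (simp add: coord_ring_def)

lemma polys_uminus [simp]: "f \<in> polys n \<Longrightarrow> - f \<in> polys n"
  unfolding polys_def by (simp add: in_keys_iff)

lemma polys_diff [simp]: "f \<in> polys n \<Longrightarrow> g \<in> polys n \<Longrightarrow> f - g \<in> polys n"
  using polys_add[of f n "- g"] by simp

lemma polys_sum [simp]: "(\<And>i. i \<in> S \<Longrightarrow> f i \<in> polys n) \<Longrightarrow> sum f S \<in> polys n"
  by (induction S rule: infinite_finite_induct) auto

lemma polys_prod [simp]: "(\<And>i. i \<in> S \<Longrightarrow> f i \<in> polys n) \<Longrightarrow> prod f S \<in> polys n"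
  by (induction S rule: infinite_finite_induct) auto

lemma polys_power [simp]: "f \<in> polys n \<Longrightarrow> f ^ e \<in> polys n"
  by (induction e) auto

lemma polys_mono: "n \<le> n' \<Longrightarrow> polys n \<subseteq> polys n'"
  unfolding polys_def by fastforce

lemma polys_induct [consumes 1, case_names Const Var add mult]:
  assumes "f \<in> polys n" "\<And>a. P (Const a)" "\<And>i. i \<le> n \<Longrightarrow> P (Var i)"
    "\<And>f g. f \<in> polys n \<Longrightarrow> g \<in> polys n \<Longrightarrow> P f \<Longrightarrow> P g \<Longrightarrow> P (f + g)"
    "\<And>f g. f \<in> polys n \<Longrightarrow> g \<in> polys n \<Longrightarrow> P f \<Longrightarrow> P g \<Longrightarrow> P (f * g)"
  shows "P f"
proof -
  have pw: "P (Var i ^ e)" if "i \<le> n" for i e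
    using that assms(2)[of 1] by (induction e) (auto intro: assms simp: Const.hom_one)
  have pr: "P (\<Prod>i\<in>S. Var i ^ h i)" if "finite S" "S \<subseteq> {..n}" for S h
    using that assms(2)[of 1] by induction (auto intro!: assms(5) pw polys_prod polys_power polys_closed simp: Const.hom_one)
  have mon: "P (sg m a)" if "ks m \<subseteq> {..n}" for m a
    unfolding single_eq_mono mono_eval_def using that
    by (intro assms(5) pr assms(2) polys_closed polys_prod polys_power) auto
  have "P (\<Sum>m\<in>S. sg m (h m))" if "finite S" "\<forall>m\<in>S. ks m \<subseteq> {..n}" for S h
    using that
  proof induction
    case empty
    then show ?case using assms(2)[of 0] by (simp add: Const.hom_zero)
  next
    case (insert m S)
    have s: "sg m (h m) \<in> polys n" if "ks m \<subseteq> {..n}" for m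
      using that by (auto simp: polys_def)
    have "(\<Sum>m\<in>S. sg m (h m)) \<in> polys n" using insert by (intro polys_sum s) auto
    then show ?case using insert by (auto intro!: assms(4) mon s)
  qed
  from this[of "ks f" "lk f"] assms(1) show ?thesis by (simp add: sum_singles polys_def)
qed

lemma polys_det:
  assumes "A \<in> carrier_mat m m" "\<And>i j. i < m \<Longrightarrow> j < m \<Longrightarrow> A $$ (i,j) \<in> polys n"
  shows "det A \<in> polys n"
proof -
  have sgn: "signof p \<in> polys n" for p :: "nat \<Rightarrow> nat" by (simp add: sign_def)
  show ?thesis unfolding det_def'[OF assms(1)]
  proof (intro polys_sum polys_mult sgn polys_prod assms(2))
    fix p i assume "p \<in> {p. p permutes {0..<m}}" "i \<in> {0..<m}"
    then show "i < m" "p i < m" using permutes_in_image[of p "{0..<m}" i] by auto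
  qed
qed

section \<open>Degrees, forms and homogeneous components\<close>

definition mdeg :: "(nat \<Rightarrow>\<^sub>0 nat) \<Rightarrow> nat" where
  "mdeg m = (\<Sum>i\<in>ks m. lk m i)"

lemma mdeg_superset: "finite S \<Longrightarrow> ks m \<subseteq> S \<Longrightarrow> mdeg m = (\<Sum>i\<in>S. lk m i)"
  unfolding mdeg_def by (intro sum.mono_neutral_left) (auto simp: in_keys_iff)

lemma mdeg_add: "mdeg (m + m') = mdeg m + mdeg m'"
  using mdeg_superset[of "ks m \<union> ks m'" m] mdeg_superset[of "ks m \<union> ks m'" m']
    mdeg_superset[of "ks m \<union> ks m'" "m + m'"]
  by (simp add: keys_add_nat lookup_add sum.distrib)

definition homog :: "nat \<Rightarrow> cpoly \<Rightarrow> bool" where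
  "homog d f \<longleftrightarrow> (\<forall>m\<in>ks f. mdeg m = d)"

lemma forms_iff: "f \<in> forms n d \<longleftrightarrow> f \<in> polys n \<and> homog d f"
  by (auto simp: forms_def homog_def mdeg_def)

lemma forms_polys: "f \<in> forms n d \<Longrightarrow> f \<in> polys n"
  by (simp add: forms_iff)

lemma forms_0 [simp]: "0 \<in> forms n d"
  by (simp add: forms_iff homog_def)

lemma forms_add [simp]: "f \<in> forms n d \<Longrightarrow> g \<in> forms n d \<Longrightarrow> f + g \<in> forms n d"
  using Poly_Mapping.keys_add[of f g] by (auto simp: forms_iff homog_def)

lemma forms_uminus [simp]: "f \<in> forms n d \<Longrightarrow> - f \<in> forms n d"
  by (auto simp: forms_iff homog_def)

lemma forms_diff [simp]: "f \<in> forms n d \<Longrightarrow> g \<in> forms n d \<Longrightarrow> f - g \<in> forms n d"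
  using forms_add[of f n d "- g"] by simp

lemma forms_mult: "f \<in> forms n d \<Longrightarrow> g \<in> forms n e \<Longrightarrow> f * g \<in> forms n (d + e)"
  using Poly_Mapping.keys_mult[of f g] by (auto simp: forms_iff homog_def) (smt (verit) mdeg_add subsetD mem_Collect_eq)

lemma forms_sum [simp]: "(\<And>i. i \<in> S \<Longrightarrow> f i \<in> forms n d) \<Longrightarrow> sum f S \<in> forms n d"
  by (induction S rule: infinite_finite_induct) auto

lemma forms_Const [simp]: "Const a \<in> forms n 0"
  by (auto simp: forms_iff homog_def Const_def mdeg_def polys_def split: if_splits)

lemma forms_Var [simp]: "i \<le> n \<Longrightarrow> Var i \<in> forms n 1"
  by (auto simp: forms_iff homog_def Var_def mdeg_def polys_def split: if_splits)

lemma forms_Const_mult [simp]: "f \<in> forms n d \<Longrightarrow> Const a * f \<in> forms n d"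
  using forms_mult[OF forms_Const] by simp

lemma forms_Var_mult [simp]: "f \<in> forms n d \<Longrightarrow> i \<le> n \<Longrightarrow> Var i * f \<in> forms n (Suc d)"
  using forms_mult[OF forms_Var] by simp

lemma forms_power: "f \<in> forms n d \<Longrightarrow> f ^ e \<in> forms n (e * d)"
proof (induction e)
  case 0
  then show ?case using forms_Const[of 1 n] by (simp add: Const.hom_one)
next
  case (Suc e)
  then show ?case using forms_mult[of f n d "f ^ e" "e * d"] by simp
qed

lemma forms_prod:
  assumes "finite S" "\<And>i. i \<in> S \<Longrightarrow> f i \<in> forms n (d i)"
  shows "prod f S \<in> forms n (sum d S)"
  using assms
proof induction
  case empty
  then show ?case using forms_Const[of 1 n] by (simp add: Const.hom_one)
qed (simp add: forms_mult)

lemma forms_mono: "n \<le> n' \<Longrightarrow> forms n d \<subseteq> forms n' d"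
  using polys_mono[of n n'] by (auto simp: forms_iff)

text \<open>The homogeneous component of degree \<open>d\<close>. It turns membership in an ideal
  generated by forms, given with arbitrary coefficients, into membership with homogeneous
  coefficients.\<close>

definition hc :: "nat \<Rightarrow> cpoly \<Rightarrow> cpoly" where
  "hc d f = (\<Sum>m\<in>{m\<in>ks f. mdeg m = d}. sg m (lk f m))"

lemma lookup_hc: "lk (hc d f) m = (if mdeg m = d then lk f m else 0)"
proof -
  have "lk (hc d f) m = (\<Sum>m'\<in>{m\<in>ks f. mdeg m = d}. if m' = m then lk f m else 0)"
    unfolding hc_def lookup_sum by (intro sum.cong) (auto simp: lookup_single when_def)
  also have "\<dots> = (if mdeg m = d then lk f m else 0)"
    by (subst sum.delta) (auto simp: in_keys_iff)
  finally show ?thesis .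
qed

lemma hc_add: "hc d (f + g) = hc d f + hc d g"
  by (rule poly_mapping_eqI) (simp add: lookup_hc lookup_add)

lemma hc_0 [simp]: "hc d 0 = 0"
  by (simp add: hc_def)

lemma hc_sum: "hc d (sum f S) = (\<Sum>i\<in>S. hc d (f i))"
  by (induction S rule: infinite_finite_induct) (simp_all add: hc_add)

lemma hc_forms: "f \<in> polys n \<Longrightarrow> hc d f \<in> forms n d"
  by (auto simp: forms_iff homog_def polys_def in_keys_iff lookup_hc split: if_splits)

lemma hc_of_form: "f \<in> forms n d \<Longrightarrow> hc e f = (if e = d then f else 0)"
  by (rule poly_mapping_eqI) (auto simp: lookup_hc forms_iff homog_def in_keys_iff)

text \<open>The bound is allowed to grow, so that several polynomials can be expanded up to a common
  degree.\<close>

lemma sum_hc: "\<exists>D. \<forall>D'\<ge>D. f = (\<Sum>d\<le>D'. hc d f)"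
proof -
  define D where "D = (\<Sum>m\<in>ks f. mdeg m)"
  have "f = (\<Sum>d\<le>D'. hc d f)" if "D' \<ge> D" for D'
  proof (rule poly_mapping_eqI)
    fix m
    have "lk f m = 0 \<or> mdeg m \<le> D'"
    proof -
      have "mdeg m \<le> D" if "m \<in> ks f" unfolding D_def by (rule member_le_sum) (use that in auto)
      then show ?thesis using \<open>D' \<ge> D\<close> by (cases "m \<in> ks f") (auto simp: in_keys_iff)
    qed
    then show "lk f m = lk (\<Sum>d\<le>D'. hc d f) m"
      by (elim disjE) (simp_all add: lookup_sum lookup_hc)
  qed
  then show ?thesis by blast
qed

lemma hc_form_mult:
  assumes "g \<in> forms n e" "f \<in> polys n"
  shows "hc d (g * f) = (if d < e then 0 else g * hc (d - e) f)"
proof -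
  obtain D where D: "\<And>D'. D' \<ge> D \<Longrightarrow> f = (\<Sum>d\<le>D'. hc d f)" using sum_hc by blast
  have "hc d (g * f) = (\<Sum>d'\<le>D+d. hc d (g * hc d' f))"
    by (subst D[of "D+d"]) (simp_all add: sum_distrib_left hc_sum)
  also have "\<dots> = (\<Sum>d'\<le>D+d. if d' = d - e then (if d < e then 0 else g * hc (d - e) f) else 0)"
    by (intro sum.cong refl, subst hc_of_form[OF forms_mult[OF assms(1) hc_forms[OF assms(2)]]]) auto
  also have "\<dots> = (if d < e then 0 else g * hc (d - e) f)"
    by (subst sum.delta) auto
  finally show ?thesis .
qed

text \<open>Every product in the Leibniz expansion uses each column exactly once, so the degree may
  vary from column to column; a constant bordering column has degree 0.\<close>

lemma forms_det:
  assumes "A \<in> carrier_mat m m" "\<And>i j. i < m \<Longrightarrow> j < m \<Longrightarrow> A $$ (i,j) \<in> forms n (e j)"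
  shows "det A \<in> forms n (\<Sum>j<m. e j)"
proof -
  have sgn: "signof p * f \<in> forms n d" if "f \<in> forms n d" for p :: "nat \<Rightarrow> nat" and f d
    using that by (simp add: sign_def)
  show ?thesis unfolding mat_det_left_def[OF assms(1)]
  proof (intro forms_sum sgn)
    fix p assume "p \<in> {p. p permutes {0..<dim_row A}}"
    then have p: "p permutes {0..<m}" using assms(1) by auto
    have "(\<Prod>i = 0..<dim_row A. A $$ (p i, i)) \<in> forms n (\<Sum>i = 0..<dim_row A. e i)"
      using assms(1) permutes_in_image[OF p] by (intro forms_prod assms(2)) auto
    then show "(\<Prod>i = 0..<dim_row A. A $$ (p i, i)) \<in> forms n (\<Sum>j<m. e j)"
      using assms(1) by (auto simp: lessThan_atLeast0)
  qed
qed

lemma forms_eval_smult: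
  assumes "f \<in> forms n d" "dim_vec v > n"
  shows "poly_eval f (a \<cdot>\<^sub>v v) = a ^ d * poly_eval f v"
proof -
  have "(\<Prod>i\<in>ks m. ((a \<cdot>\<^sub>v v) $ i) ^ lk m i) = a ^ d * (\<Prod>i\<in>ks m. (v $ i) ^ lk m i)" if "m \<in> ks f" for m
  proof -
    have m: "ks m \<subseteq> {..n}" "mdeg m = d" using assms(1) that by (auto simp: forms_iff polys_def homog_def)
    have "(\<Prod>i\<in>ks m. ((a \<cdot>\<^sub>v v) $ i) ^ lk m i) = (\<Prod>i\<in>ks m. a ^ lk m i * (v $ i) ^ lk m i)"
      using m assms(2) by (intro prod.cong refl) (auto simp: power_mult_distrib)
    then show ?thesis using m by (simp add: prod.distrib power_sum[symmetric] mdeg_def)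
  qed
  then show ?thesis unfolding poly_eval_def by (simp add: sum_distrib_left mult.left_commute)
qed

section \<open>Splitting off the last variable\<close>

lemma polys_split:
  assumes "f \<in> polys (Suc n)"
  shows "\<exists>f0\<in>polys n. \<exists>f1\<in>polys (Suc n). f = f0 + Var (Suc n) * f1"
  using assms
proof (induction rule: polys_induct)
  case (Const a)
  show ?case by (rule bexI[of _ "Const a"], rule bexI[of _ 0]) auto
next
  case (Var i)
  show ?case
  proof (cases "i = Suc n")
    case True
    show ?thesis by (rule bexI[of _ 0], rule bexI[of _ 1]) (auto simp: True)
  next
    case False
    show ?thesis using False Var by (intro bexI[of _ "Var i"] bexI[of _ 0]) auto
  qed
next
  case (add f g)
  then obtain f0 f1 g0 g1 where "f0 \<in> polys n" "f1 \<in> polys (Suc n)" "f = f0 + Var (Suc n) * f1"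
    "g0 \<in> polys n" "g1 \<in> polys (Suc n)" "g = g0 + Var (Suc n) * g1" by blast
  then show ?case by (intro bexI[of _ "f0 + g0"] bexI[of _ "f1 + g1"]) (auto simp: algebra_simps)
next
  case (mult f g)
  then obtain f0 f1 g0 g1 where "f0 \<in> polys n" "f1 \<in> polys (Suc n)" "f = f0 + Var (Suc n) * f1"
    "g0 \<in> polys n" "g1 \<in> polys (Suc n)" "g = g0 + Var (Suc n) * g1" by blast
  then show ?case using polys_mono[of n "Suc n"]
    by (intro bexI[of _ "f0 * g0"] bexI[of _ "f0 * g1 + f1 * g"]) (auto simp: algebra_simps subset_iff)
qed

text \<open>\<open>f0\<close> is the restriction to the last coordinate hyperplane. In degree 0 the
  exponent \<open>d - 1\<close> is again 0, hence the extra clause that \<open>f1\<close> vanishes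
  there.\<close>

lemma forms_split:
  assumes "f \<in> forms (Suc n) d"
  shows "\<exists>f0\<in>forms n d. \<exists>f1\<in>forms (Suc n) (d - 1). f = f0 + Var (Suc n) * f1 \<and> (d = 0 \<longrightarrow> f1 = 0)"
proof -
  obtain f0 f1 where f: "f0 \<in> polys n" "f1 \<in> polys (Suc n)" "f = f0 + Var (Suc n) * f1"
    using polys_split[OF forms_polys[OF assms]] by blast
  have "hc d f = f" using hc_of_form[OF assms] by simp
  then have "f = hc d f0 + (if d < 1 then 0 else Var (Suc n) * hc (d - 1) f1)"
    using hc_form_mult[OF forms_Var[of "Suc n" "Suc n"] f(2)] f(3) by (simp add: hc_add)
  then show ?thesis using hc_forms[OF f(1), of d] hc_forms[OF f(2), of "d - 1"]
    by (intro bexI[of _ "hc d f0"] bexI[of _ "if d = 0 then 0 else hc (d - 1) f1"]) auto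
qed

lemma forms_0_0: "f \<in> forms 0 d \<Longrightarrow> \<exists>a. f = Const a * Var 0 ^ d"
proof -
  assume f: "f \<in> forms 0 d"
  have "lk f m = 0" if "m \<noteq> sg 0 d" for m
  proof (rule ccontr)
    assume "lk f m \<noteq> 0"
    then have m: "ks m \<subseteq> {0}" "mdeg m = d" using f by (auto simp: forms_iff polys_def homog_def in_keys_iff)
    then have "lk m i = lk (sg 0 d) i" for i
      using mdeg_superset[of "{0}" m] by (cases "i = 0") (auto simp: lookup_single in_keys_iff)
    then show False using that poly_mapping_eqI by metis
  qed
  then have "f = sg (sg 0 d) (lk f (sg 0 d))"
    by (intro poly_mapping_eqI) (metis lookup_single_eq lookup_single_not_eq)
  then have "f = Const (lk f (sg 0 d)) * Var 0 ^ d" by (simp add: Var_power Const_def mult_single)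
  then show ?thesis by blast
qed

lemma forms_degree_0: "f \<in> forms n 0 \<Longrightarrow> \<exists>a. f = Const a"
proof (induction n arbitrary: f)
  case 0
  then show ?case using forms_0_0 by fastforce
next
  case (Suc n)
  then show ?case using forms_split[OF Suc.prems] by auto
qed

lemma forms_1: "f \<in> forms n 1 \<Longrightarrow> \<exists>\<alpha>. f = (\<Sum>l\<le>n. Const (\<alpha> l) * Var l)"
proof (induction n arbitrary: f)
  case 0
  then obtain a where "f = Const a * Var 0" using forms_0_0 by fastforce
  then show ?case by (intro exI[of _ "\<lambda>_. a"]) simp
next
  case (Suc n)
  obtain f0 f1 where f: "f0 \<in> forms n 1" "f1 \<in> forms (Suc n) 0" "f = f0 + Var (Suc n) * f1"
    using forms_split[OF Suc.prems] by auto
  obtain \<alpha> where \<alpha>: "f0 = (\<Sum>l\<le>n. Const (\<alpha> l) * Var l)" using Suc.IH[OF f(1)] by blast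
  obtain a where a: "f1 = Const a" using forms_degree_0[OF f(2)] by blast
  show ?case by (rule exI[of _ "\<alpha>(Suc n := a)"]) (simp add: f(3) \<alpha> a mult.commute)
qed

section \<open>Partial derivatives\<close>

lemma partial_deriv_superset:
  "finite S \<Longrightarrow> ks f \<subseteq> S \<Longrightarrow> partial_deriv j f = (\<Sum>m\<in>S. sg (m - sg j 1) (of_nat (lk m j) * lk f m))"
  unfolding partial_deriv_def by (intro sum.mono_neutral_left) (auto simp: in_keys_iff)

lemma partial_deriv_add: "partial_deriv j (f + g) = partial_deriv j f + partial_deriv j g"
  using partial_deriv_superset[of "ks f \<union> ks g" f j] partial_deriv_superset[of "ks f \<union> ks g" g j]
    partial_deriv_superset[of "ks f \<union> ks g" "f + g" j] Poly_Mapping.keys_add[of f g]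
  by (simp add: lookup_add algebra_simps sum.distrib single_add)

lemma partial_deriv_single: "partial_deriv j (sg m a) = sg (m - sg j 1) (of_nat (lk m j) * a)"
  using partial_deriv_superset[of "{m}" "sg m a"] by simp

lemma partial_deriv_mult: "partial_deriv j (f * g) = partial_deriv j f * g + f * partial_deriv j g"
proof (induction f rule: cpoly_induct)
  case (single m a)
  show ?case
  proof (induction g rule: cpoly_induct)
    case (single m' b)
    have 1: "sg (m - sg j 1) (of_nat (lk m j) * a) * sg m' b = sg (m + m' - sg j 1) (of_nat (lk m j) * a * b)"
    proof (cases "lk m j = 0")
      case False
      then have "m - sg j 1 + m' = m + m' - sg j 1"
        by (intro poly_mapping_eqI) (auto simp: lookup_add lookup_minus lookup_single when_def)
      then show ?thesis by (simp add: mult_single)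
    qed simp
    have 2: "sg m a * sg (m' - sg j 1) (of_nat (lk m' j) * b) = sg (m + m' - sg j 1) (of_nat (lk m' j) * a * b)"
    proof (cases "lk m' j = 0")
      case False
      then have "m + (m' - sg j 1) = m + m' - sg j 1"
        by (intro poly_mapping_eqI) (auto simp: lookup_add lookup_minus lookup_single when_def)
      then show ?thesis by (simp add: mult_single mult_ac)
    qed simp
    have 3: "sg m a * sg m' b = sg (m + m') (a * b)" by (simp add: mult_single)
    have 4: "of_nat (lk (m + m') j) * (a * b) = of_nat (lk m j) * a * b + of_nat (lk m' j) * a * b"
      by (simp add: lookup_add algebra_simps)
    show ?case by (simp only: partial_deriv_single 1 2 3 4 single_add)
  qed (simp add: partial_deriv_add algebra_simps)
qed (simp add: partial_deriv_add algebra_simps)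

lemma partial_deriv_sum: "partial_deriv j (sum f S) = (\<Sum>i\<in>S. partial_deriv j (f i))"
  by (induction S rule: infinite_finite_induct) (simp_all add: partial_deriv_add, simp_all add: partial_deriv_def)

lemma partial_deriv_0 [simp]: "partial_deriv j 0 = 0"
  by (simp add: partial_deriv_def)

lemma partial_deriv_Const [simp]: "partial_deriv j (Const a) = 0"
  by (simp add: Const_def partial_deriv_single)

lemma partial_deriv_Var: "partial_deriv j (Var i) = (if i = j then 1 else 0)"
  by (simp add: Var_def partial_deriv_single lookup_single when_def)

section \<open>Linear algebra\<close>

text \<open>Coordinate vectors are plain functions of which only the first \<open>n\<close> values
  count; this keeps dimension conditions out of the linear algebra and lets contractions be written
  as finite sums.\<close>

definition nz :: "nat \<Rightarrow> (nat \<Rightarrow> 'a::zero) \<Rightarrow> bool" where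
  "nz n x \<longleftrightarrow> (\<exists>i<n. x i \<noteq> 0)"

lemma nzI: "i < n \<Longrightarrow> x i \<noteq> 0 \<Longrightarrow> nz n x"
  by (auto simp: nz_def)

lemma nzE: "nz n x \<Longrightarrow> (\<And>i. i < n \<Longrightarrow> x i \<noteq> 0 \<Longrightarrow> P) \<Longrightarrow> P"
  by (auto simp: nz_def)

lemma square_kernel:
  fixes M :: "nat \<Rightarrow> nat \<Rightarrow> 'a::field"
  shows "det (mat n n (\<lambda>(i,j). M i j)) = 0 \<longleftrightarrow> (\<exists>x. nz n x \<and> (\<forall>i<n. (\<Sum>j<n. M i j * x j) = 0))"
    (is "det ?A = 0 \<longleftrightarrow> ?R")
proof -
  have A: "?A \<in> carrier_mat n n" by simp
  show ?thesis unfolding det_0_iff_vec_prod_zero_field[OF A]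
  proof
    assume "\<exists>v. v \<in> carrier_vec n \<and> v \<noteq> 0\<^sub>v n \<and> ?A *\<^sub>v v = 0\<^sub>v n"
    then obtain v where v: "v \<in> carrier_vec n" "v \<noteq> 0\<^sub>v n" "?A *\<^sub>v v = 0\<^sub>v n" by blast
    have "\<exists>i<n. v $ i \<noteq> 0" using v(1,2) by (metis eq_vecI carrier_vecD index_zero_vec)
    moreover have "(\<Sum>j<n. M i j * v $ j) = 0" if "i < n" for i
      using arg_cong[OF v(3), of "\<lambda>w. w $ i"] v(1) that
      by (simp add: scalar_prod_def lessThan_atLeast0)
    ultimately show ?R by (intro exI[of _ "\<lambda>i. v $ i"]) (auto simp: nz_def)
  next
    assume ?R
    then obtain x where x: "nz n x" "\<forall>i<n. (\<Sum>j<n. M i j * x j) = 0" by (elim exE conjE)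
    show "\<exists>v. v \<in> carrier_vec n \<and> v \<noteq> 0\<^sub>v n \<and> ?A *\<^sub>v v = 0\<^sub>v n"
    proof (intro exI conjI)
      show "vec n x \<noteq> 0\<^sub>v n" using x(1) by (metis nzE index_vec index_zero_vec(1))
      show "?A *\<^sub>v vec n x = 0\<^sub>v n"
        using x(2) by (intro eq_vecI) (auto simp: scalar_prod_def lessThan_atLeast0)
    qed simp
  qed
qed

lemma square_left_kernel:
  fixes M :: "nat \<Rightarrow> nat \<Rightarrow> 'a::field"
  shows "det (mat n n (\<lambda>(i,j). M i j)) = 0 \<longleftrightarrow> (\<exists>x. nz n x \<and> (\<forall>j<n. (\<Sum>i<n. x i * M i j) = 0))"
proof -
  have "transpose_mat (mat n n (\<lambda>(i,j). M i j)) = mat n n (\<lambda>(i,j). M j i)" by auto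
  then have "det (mat n n (\<lambda>(i,j). M i j)) = det (mat n n (\<lambda>(i,j). M j i))"
    by (metis det_transpose mat_carrier)
  then show ?thesis by (simp add: square_kernel mult.commute)
qed

lemma square_kernel_iff:
  fixes M :: "nat \<Rightarrow> nat \<Rightarrow> 'a::field"
  shows "(\<exists>x. nz n x \<and> (\<forall>i<n. (\<Sum>j<n. M i j * x j) = 0)) \<longleftrightarrow>
    (\<exists>x. nz n x \<and> (\<forall>j<n. (\<Sum>i<n. x i * M i j) = 0))"
  unfolding square_kernel[symmetric] square_left_kernel[symmetric] ..

lemma square_det_0I:
  fixes M :: "nat \<Rightarrow> nat \<Rightarrow> 'a::field"
  assumes "nz n x" "\<forall>i<n. (\<Sum>j<n. M i j * x j) = 0"
  shows "det (mat n n (\<lambda>(i,j). M i j)) = 0"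
  unfolding square_kernel by (rule exI[of _ x]) (use assms in simp)

lemma square_det_left_0I:
  fixes M :: "nat \<Rightarrow> nat \<Rightarrow> 'a::field"
  assumes "nz n x" "\<forall>j<n. (\<Sum>i<n. x i * M i j) = 0"
  shows "det (mat n n (\<lambda>(i,j). M i j)) = 0"
  unfolding square_left_kernel by (rule exI[of _ x]) (use assms in simp)

text \<open>Padding by zero rows gives a square matrix with an obvious left kernel vector, hence
  with a right one. The index set of the equations is arbitrary because conditions of different
  origin are later collected in sum and option types.\<close>

lemma kernel_nontrivial:
  fixes M :: "'e \<Rightarrow> nat \<Rightarrow> 'a::field"
  assumes "finite E" "card E < n"
  shows "\<exists>x. nz n x \<and> (\<forall>e\<in>E. (\<Sum>j<n. M e j * x j) = 0)"
proof -
  obtain f where f: "bij_betw f {..<card E} E"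
    using ex_bij_betw_nat_finite[OF assms(1)] by (auto simp: lessThan_atLeast0)
  define M' where "M' i j = (if i < card E then M (f i) j else 0)" for i j
  have "\<exists>x. nz n x \<and> (\<forall>j<n. (\<Sum>i<n. x i * M' i j) = 0)"
    using assms(2) by (intro exI[of _ "\<lambda>i. if i = card E then 1 else 0"]) (auto simp: M'_def nz_def)
  from iffD2[OF square_kernel_iff this]
  obtain x where x: "nz n x" "\<forall>i<n. (\<Sum>j<n. M' i j * x j) = 0" by (elim exE conjE)
  have "(\<Sum>j<n. M e j * x j) = 0" if "e \<in> E" for e
  proof -
    have "e \<in> f ` {..<card E}" using f that by (simp add: bij_betw_def)
    then obtain i where i: "i < card E" "f i = e" by auto
    then have "i < n" using assms(2) by simp
    then have "(\<Sum>j<n. M' i j * x j) = 0" using x(2) by blast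
    then show ?thesis using i by (simp add: M'_def)
  qed
  then show ?thesis using x(1) by (intro exI[of _ x]) simp
qed

lemma square_solve:
  fixes M :: "nat \<Rightarrow> nat \<Rightarrow> 'a::field"
  assumes "det (mat n n (\<lambda>(i,j). M i j)) \<noteq> 0"
  shows "\<exists>x. \<forall>i<n. (\<Sum>j<n. M i j * x j) = b i"
proof -
  \<comment> \<open>The right-hand side becomes column \<open>n\<close>. A kernel vector of the
    enlarged matrix has a nonzero last coordinate, by which one divides.\<close>
  let ?M = "\<lambda>i j. if j < n then M i j else b i"
  obtain x where x: "nz (Suc n) x" "\<forall>i<n. (\<Sum>j<Suc n. ?M i j * x j) = 0"
    using kernel_nontrivial[of "{..<n}" "Suc n" ?M] by (auto simp del: sum.lessThan_Suc)
  have "x n \<noteq> 0"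
  proof
    assume "x n = 0"
    have "nz n x" using x(1) \<open>x n = 0\<close> by (metis less_Suc_eq nz_def)
    moreover have "\<forall>i<n. (\<Sum>j<n. M i j * x j) = 0" using x(2) \<open>x n = 0\<close> by simp
    ultimately show False using assms square_det_0I[of n x M] by simp
  qed
  have "(\<Sum>j<n. M i j * (- x j / x n)) = b i" if "i < n" for i
  proof -
    have "(\<Sum>j<n. M i j * x j) + b i * x n = 0" using x(2) that by simp
    then have "(\<Sum>j<n. M i j * x j) = - (b i * x n)" by (simp add: eq_neg_iff_add_eq_0)
    then have "(\<Sum>j<n. M i j * (- x j / x n)) = b i * x n / x n"
      by (simp add: sum_divide_distrib[symmetric] sum_negf)
    then show ?thesis using \<open>x n \<noteq> 0\<close> by simp
  qed
  then show ?thesis by (intro exI[of _ "\<lambda>j. - x j / x n"]) simp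
qed

section \<open>Ideals and ranks\<close>

definition pideal :: "nat \<Rightarrow> cpoly set \<Rightarrow> bool" where
  "pideal k I \<longleftrightarrow> I \<subseteq> polys k \<and> 0 \<in> I \<and> (\<forall>f\<in>I. \<forall>g\<in>I. f + g \<in> I) \<and> (\<forall>c\<in>polys k. \<forall>f\<in>I. c * f \<in> I)"

lemma coord_ring_simps [simp]:
  "carrier (coord_ring k) = polys k" "f \<otimes>\<^bsub>coord_ring k\<^esub> g = f * g" "f \<oplus>\<^bsub>coord_ring k\<^esub> g = f + g"
  "\<zero>\<^bsub>coord_ring k\<^esub> = 0" "\<one>\<^bsub>coord_ring k\<^esub> = 1"
  by (simp_all add: coord_ring_def)

lemma ideal_iff_pideal: "ideal I (coord_ring k) \<longleftrightarrow> pideal k I"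
proof
  interpret R: cring "coord_ring k" by (rule cring_coord_ring)
  assume "ideal I (coord_ring k)"
  then interpret ideal I "coord_ring k" .
  show "pideal k I" unfolding pideal_def
    using a_subset zero_closed a_closed I_l_closed by auto
next
  interpret R: cring "coord_ring k" by (rule cring_coord_ring)
  assume I: "pideal k I"
  have sub: "I \<subseteq> polys k" using I by (simp add: pideal_def)
  have neg: "- f \<in> I" if "f \<in> I" for f
    using I that polys_uminus[OF polys_closed(2), of k] unfolding pideal_def
    by (metis mult_minus1)
  show "ideal I (coord_ring k)"
  proof (rule idealI)
    show "ring (coord_ring k)" by (rule R.ring_axioms)
    show "subgroup I (add_monoid (coord_ring k))"
    proof (rule R.add.subgroupI)
      show "I \<subseteq> carrier (coord_ring k)" "I \<noteq> {}" using I by (auto simp: pideal_def)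
      show "a \<oplus>\<^bsub>coord_ring k\<^esub> b \<in> I" if "a \<in> I" "b \<in> I" for a b
        using I that by (auto simp: pideal_def)
      fix a assume a: "a \<in> I"
      have "\<ominus>\<^bsub>coord_ring k\<^esub> a = - a"
        using a sub by (intro R.minus_equality) auto
      then show "\<ominus>\<^bsub>coord_ring k\<^esub> a \<in> I" using neg[OF a] by simp
    qed
    fix a x assume "a \<in> I" "x \<in> carrier (coord_ring k)"
    then show "x \<otimes>\<^bsub>coord_ring k\<^esub> a \<in> I" "a \<otimes>\<^bsub>coord_ring k\<^esub> x \<in> I"
      using I unfolding pideal_def by (simp_all add: mult.commute[of a x])
  qed
qed

lemma pideal_Idl:
  assumes "G \<subseteq> polys k"
  shows "pideal k (Idl\<^bsub>coord_ring k\<^esub> G)" "G \<subseteq> Idl\<^bsub>coord_ring k\<^esub> G"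
proof -
  interpret R: cring "coord_ring k" by (rule cring_coord_ring)
  show "pideal k (Idl\<^bsub>coord_ring k\<^esub> G)" "G \<subseteq> Idl\<^bsub>coord_ring k\<^esub> G"
    using R.genideal_ideal[of G] R.genideal_self[of G] assms by (auto simp: ideal_iff_pideal)
qed

lemma Idl_minimal: "pideal k I \<Longrightarrow> G \<subseteq> I \<Longrightarrow> Idl\<^bsub>coord_ring k\<^esub> G \<subseteq> I"
proof -
  interpret R: cring "coord_ring k" by (rule cring_coord_ring)
  show "pideal k I \<Longrightarrow> G \<subseteq> I \<Longrightarrow> Idl\<^bsub>coord_ring k\<^esub> G \<subseteq> I"
    using R.genideal_minimal[of I G] by (simp add: ideal_iff_pideal)
qed

lemma pideal_sum:
  assumes "pideal k I" "\<And>i. i \<in> S \<Longrightarrow> f i \<in> I"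
  shows "sum f S \<in> I"
  using assms by (induction S rule: infinite_finite_induct) (auto simp: pideal_def)

lemma pidealD:
  assumes "pideal k I"
  shows "f \<in> I \<Longrightarrow> f \<in> polys k" "0 \<in> I" "f \<in> I \<Longrightarrow> g \<in> I \<Longrightarrow> f + g \<in> I"
    "c \<in> polys k \<Longrightarrow> f \<in> I \<Longrightarrow> c * f \<in> I" "f \<in> I \<Longrightarrow> - f \<in> I" "f \<in> I \<Longrightarrow> g \<in> I \<Longrightarrow> f - g \<in> I"
proof -
  show neg: "- f \<in> I" if "f \<in> I" for f
    using assms that polys_uminus[OF polys_closed(2), of k] unfolding pideal_def
    by (metis mult_minus1)
  show "f \<in> I \<Longrightarrow> g \<in> I \<Longrightarrow> f - g \<in> I"
    using neg[of g] assms unfolding pideal_def by (metis add_uminus_conv_diff)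
qed (use assms in \<open>auto simp: pideal_def\<close>)

lemma Idl_eq_combinations:
  assumes "\<And>l. l < n \<Longrightarrow> q l \<in> polys k"
  shows "Idl\<^bsub>coord_ring k\<^esub> (q ` {..<n::nat}) = {\<Sum>l<n. a l * q l | a. \<forall>l<n. a l \<in> polys k}" (is "_ = ?R")
proof
  have "pideal k ?R"
    unfolding pideal_def
  proof (intro conjI ballI)
    show "?R \<subseteq> polys k" using assms by (auto intro!: polys_sum polys_mult)
    show "0 \<in> ?R" by (intro CollectI exI[of _ "\<lambda>_. 0"]) simp
  next
    fix f g assume "f \<in> ?R" "g \<in> ?R"
    then obtain a b where "\<forall>l<n. a l \<in> polys k" "f = (\<Sum>l<n. a l * q l)" "\<forall>l<n. b l \<in> polys k" "g = (\<Sum>l<n. b l * q l)"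
      by auto
    then show "f + g \<in> ?R"
      by (intro CollectI exI[of _ "\<lambda>l. a l + b l"]) (auto simp: sum.distrib algebra_simps)
  next
    fix c f assume "c \<in> polys k" "f \<in> ?R"
    then obtain a where "\<forall>l<n. a l \<in> polys k" "f = (\<Sum>l<n. a l * q l)" by auto
    then show "c * f \<in> ?R" using \<open>c \<in> polys k\<close>
      by (intro CollectI exI[of _ "\<lambda>l. c * a l"]) (auto simp: sum_distrib_left algebra_simps)
  qed
  moreover have "q ` {..<n} \<subseteq> ?R"
  proof safe
    fix l assume "l < n"
    then show "\<exists>a. q l = (\<Sum>l<n. a l * q l) \<and> (\<forall>l<n. a l \<in> polys k)"
      by (intro exI[of _ "\<lambda>i. if i = l then 1 else 0"]) (auto simp: if_distrib[of "\<lambda>x. x * _"] cong: if_cong)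
  qed
  ultimately show "Idl\<^bsub>coord_ring k\<^esub> (q ` {..<n}) \<subseteq> ?R" by (rule Idl_minimal)
  have G: "q ` {..<n} \<subseteq> polys k" using assms by auto
  show "?R \<subseteq> Idl\<^bsub>coord_ring k\<^esub> (q ` {..<n})"
    using pideal_Idl[OF G] by (auto intro!: pideal_sum[OF pideal_Idl(1)[OF G]] pidealD(4)[OF pideal_Idl(1)[OF G]])
qed

section \<open>Rank in terms of independent columns and rows\<close>

lemma rank_independent_cols:
  fixes J :: "complex mat"
  assumes J: "J \<in> carrier_mat r nc" and rk: "vec_space.rank r J = c"
  shows "\<exists>T\<subseteq>{..<nc}. card T = c \<and> (\<forall>\<beta>. (\<forall>i<r. (\<Sum>j\<in>T. J $$ (i,j) * \<beta> j) = 0) \<longrightarrow> (\<forall>j\<in>T. \<beta> j = 0))"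
proof -
  interpret vec_space "TYPE(complex)" r .
  obtain S where S: "finite S" "maximal S (\<lambda>T. T \<subseteq> set (cols J) \<and> lin_indpt T)"
    using maximal_exists_superset[of "set (cols J)" "\<lambda>T. T \<subseteq> set (cols J) \<and> lin_indpt T" "{}"]
    by (metis (no_types, lifting) List.finite_set empty_subsetI finite_lin_indpt2 finite.emptyI empty_iff)
  have c: "card S = c" using rank_card_indpt[OF J S(2)] rk by simp
  have SS: "S \<subseteq> set (cols J)" "lin_indpt S" using S(2) by (auto simp: maximal_def)
  have "\<forall>s\<in>S. \<exists>j<nc. col J j = s"
  proof
    fix s assume "s \<in> S"
    then have "s \<in> set (cols J)" using SS by blast
    then show "\<exists>j<nc. col J j = s" using J by (auto simp: cols_def)
  qed
  then obtain \<tau> where \<tau>: "\<And>s. s \<in> S \<Longrightarrow> \<tau> s < nc \<and> col J (\<tau> s) = s" by metis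
  have inj: "inj_on \<tau> S" by (metis inj_onI \<tau>)
  have Sc: "S \<subseteq> carrier_vec r" using SS(1) cols_dim[of J] J by auto
  show ?thesis
  proof (intro exI conjI allI impI)
    show "\<tau> ` S \<subseteq> {..<nc}" using \<tau> by auto
    show "card (\<tau> ` S) = c" using card_image[OF inj] c by simp
    fix \<beta> assume \<beta>: "\<forall>i<r. (\<Sum>j\<in>\<tau> ` S. J $$ (i,j) * \<beta> j) = 0"
    have "lincomb (\<beta> \<circ> \<tau>) S = 0\<^sub>v r"
    proof (rule eq_vecI)
      show "dim_vec (lincomb (\<beta> \<circ> \<tau>) S) = dim_vec (0\<^sub>v r)" using lincomb_closed[OF Sc, of "\<beta> \<circ> \<tau>"] by auto
      fix i assume i: "i < dim_vec (0\<^sub>v r)"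
      have "lincomb (\<beta> \<circ> \<tau>) S $ i = (\<Sum>s\<in>S. \<beta> (\<tau> s) * s $ i)" using lincomb_index[of i S "\<beta> \<circ> \<tau>"] i Sc by simp
      also have "\<dots> = (\<Sum>s\<in>S. J $$ (i, \<tau> s) * \<beta> (\<tau> s))"
      proof (intro sum.cong refl)
        fix s assume "s \<in> S"
        then have "s $ i = J $$ (i, \<tau> s)" using \<tau>[of s] i J by (metis carrier_matD index_col index_zero_vec(2))
        then show "\<beta> (\<tau> s) * s $ i = J $$ (i, \<tau> s) * \<beta> (\<tau> s)" by simp
      qed
      also have "\<dots> = 0" using \<beta> i by (simp add: sum.reindex[OF inj])
      finally show "lincomb (\<beta> \<circ> \<tau>) S $ i = 0\<^sub>v r $ i" using i by simp
    qed
    have "\<forall>s\<in>S. (\<beta> \<circ> \<tau>) s = 0"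
    proof (rule ccontr)
      assume "\<not> ?thesis"
      then obtain s where "s \<in> S" "(\<beta> \<circ> \<tau>) s \<noteq> 0" by blast
      then have "lin_dep S" unfolding lin_dep_def using S(1) \<open>lincomb (\<beta> \<circ> \<tau>) S = 0\<^sub>v r\<close>
        by (intro exI[of _ S] exI[of _ "\<beta> \<circ> \<tau>"] exI[of _ s]) (auto simp: class_ring_simps)
      then show False using SS(2) by blast
    qed
    then show "\<forall>j\<in>\<tau> ` S. \<beta> j = 0" by auto
  qed
qed

text \<open>A maximal independent set of fewer than \<open>r\<close> columns is annihilated by a
  nonzero row vector, which then annihilates every column because all of them lie in the span; this
  contradicts the independence of the rows.\<close>

lemma rank_full_rows:
  fixes P :: "complex mat"
  assumes P: "P \<in> carrier_mat r nc"
    and ind: "\<And>a. (\<forall>j<nc. (\<Sum>i<r. a i * P $$ (i,j)) = 0) \<Longrightarrow> (\<forall>i<r. a i = 0)"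
  shows "vec_space.rank r P = r"
proof -
  interpret vec_space "TYPE(complex)" r .
  obtain S where S: "finite S" "maximal S (\<lambda>T. T \<subseteq> set (cols P) \<and> lin_indpt T)"
    using maximal_exists_superset[of "set (cols P)" "\<lambda>T. T \<subseteq> set (cols P) \<and> lin_indpt T" "{}"]
    by (metis (no_types, lifting) List.finite_set empty_subsetI finite_lin_indpt2 finite.emptyI empty_iff)
  have c: "rank P = card S" using rank_card_indpt[OF P S(2)] by simp
  have SS: "S \<subseteq> set (cols P)" "lin_indpt S" using S(2) by (auto simp: maximal_def)
  have Sc: "S \<subseteq> carrier_vec r" using SS(1) cols_dim[of P] P by auto
  have "card S \<le> r" using li_le_dim(2)[OF fin_dim Sc SS(2)] dim_is_n by simp
  moreover have "\<not> card S < r"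
  proof
    assume "card S < r"
    then obtain a where a: "nz r a" "\<forall>s\<in>S. (\<Sum>i<r. s $ i * a i) = 0"
      using kernel_nontrivial[OF S(1), of r "\<lambda>s i. s $ i"] by blast
    have "(\<Sum>i<r. a i * P $$ (i,j)) = 0" if j: "j < nc" for j
    proof -
      have cj: "col P j \<in> set (cols P)" "col P j \<in> carrier_vec r"
        using P j by (auto simp: cols_def)
      have "col P j \<in> span S"
      proof (cases "col P j \<in> S")
        case True
        then show ?thesis using Sc in_own_span by blast
      next
        case False
        have "lin_dep (S \<union> {col P j})"
        proof (rule ccontr)
          assume "lin_indpt (S \<union> {col P j})"
          then have "S \<union> {col P j} = S" using S(2) cj SS(1) unfolding maximal_def by blast
          then show False using False by blast
        qed
        then show ?thesis using lin_dep_iff_in_span[of S "col P j"] Sc SS(2) cj(2) False by simp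
      qed
      then obtain b where b: "lincomb b S = col P j" using finite_in_span[OF S(1) Sc] by metis
      have "(\<Sum>i<r. a i * P $$ (i,j)) = (\<Sum>i<r. a i * (\<Sum>s\<in>S. b s * s $ i))"
      proof (intro sum.cong refl)
        fix i assume i: "i \<in> {..<r}"
        have "P $$ (i,j) = lincomb b S $ i" using b i P j by auto
        then show "a i * P $$ (i,j) = a i * (\<Sum>s\<in>S. b s * s $ i)" using lincomb_index[of i S b] i Sc by simp
      qed
      also have "\<dots> = (\<Sum>s\<in>S. b s * (\<Sum>i<r. s $ i * a i))"
        unfolding sum_distrib_left by (subst sum.swap) (simp add: mult_ac)
      also have "\<dots> = 0" using a(2) by simp
      finally show ?thesis .
    qed
    then have "\<forall>i<r. a i = 0" by (intro ind) simp
    then show False using a(1) by (auto elim: nzE)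
  qed
  ultimately show ?thesis using c by simp
qed

text \<open>Equality of row rank and column rank for a square matrix whose columns are indexed by an
  arbitrary set of size \<open>m\<close>.\<close>

lemma family_dependent:
  fixes M :: "nat \<Rightarrow> 'e \<Rightarrow> 'a::field"
  assumes "finite E" "card E = m" "nz m w" "\<forall>e\<in>E. (\<Sum>i<m. w i * M i e) = 0"
  shows "\<exists>x. (\<exists>e\<in>E. x e \<noteq> 0) \<and> (\<forall>i<m. (\<Sum>e\<in>E. M i e * x e) = 0)"
proof -
  obtain f where f: "bij_betw f {..<m} E"
    using ex_bij_betw_nat_finite[OF assms(1)] unfolding assms(2) lessThan_atLeast0 by (elim exE)
  have fE: "f j \<in> E" if "j < m" for j using bij_betwE[OF f] that by simp
  have "nz m w \<and> (\<forall>j<m. (\<Sum>i<m. w i * M i (f j)) = 0)" using fE assms(3,4) by simp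
  from iffD2[OF square_kernel_iff exI, OF this]
  obtain y where y: "nz m y" "\<forall>i<m. (\<Sum>j<m. M i (f j) * y j) = 0" by (elim exE conjE)
  define x where "x e = y (inv_into {..<m} f e)" for e
  have xf: "x (f j) = y j" if "j < m" for j
    using f that by (simp add: x_def bij_betw_inv_into_left)
  have 1: "(\<Sum>e\<in>E. M i e * x e) = 0" if "i < m" for i
    using y(2) that sum.reindex_bij_betw[OF f, of "\<lambda>e. M i e * x e"] xf by simp
  obtain j where j: "j < m" "y j \<noteq> 0" using y(1) by (rule nzE)
  have 2: "f j \<in> E" using fE j(1) .
  show ?thesis
  proof (intro exI conjI)
    show "\<exists>e\<in>E. x e \<noteq> 0" using 2 j xf[of j] by (intro bexI[of _ "f j"]) simp_all
    show "\<forall>i<m. (\<Sum>e\<in>E. M i e * x e) = 0" using 1 by simp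
  qed
qed

section \<open>The differential criterion for determinantal loci\<close>

lemma cofactor_sum_col:
  assumes A: "(A :: 'a::comm_ring_1 mat) \<in> carrier_mat n n" and "s < n" "t < n"
  shows "(\<Sum>i<n. cofactor A i s * A $$ (i,t)) = (if s = t then det A else 0)"
proof -
  have "(adj_mat A * A) $$ (s,t) = (\<Sum>i<n. cofactor A i s * A $$ (i,t))"
    using assms by (simp add: adj_mat_def scalar_prod_def lessThan_atLeast0)
  then show ?thesis using adj_mat(3)[OF A] assms by (auto split: if_splits)
qed

lemma cofactor_sum_row:
  assumes A: "(A :: 'a::comm_ring_1 mat) \<in> carrier_mat n n" and "i < n" "j < n"
  shows "(\<Sum>s<n. A $$ (i,s) * cofactor A j s) = (if i = j then det A else 0)"
proof -
  have "(A * adj_mat A) $$ (i,j) = (\<Sum>s<n. A $$ (i,s) * cofactor A j s)"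
    using assms by (simp add: adj_mat_def scalar_prod_def lessThan_atLeast0)
  then show ?thesis using adj_mat(2)[OF A] assms by (auto split: if_splits)
qed

lemma (in comm_ring_hom) hom_cofactor:
  "i < dim_row A \<Longrightarrow> j < dim_col A \<Longrightarrow> cofactor (map_mat hom A) i j = hom (cofactor A i j)"
proof -
  assume "i < dim_row A" "j < dim_col A"
  have "mat_delete (map_mat hom A) i j = map_mat hom (mat_delete A i j)"
    by (rule eq_matI) (auto simp: mat_delete_def)
  then show ?thesis by (simp add: cofactor_def hom_mult hom_power hom_uminus)
qed

lemma det_replace_row_unit:
  assumes A: "(A :: 'a::comm_ring_1 mat) \<in> carrier_mat n n" and "i < n" "s < n"
  shows "det (mat n n (\<lambda>(a,b). if a = i then (if b = s then 1 else 0) else A $$ (a,b))) = cofactor A i s"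
    (is "det ?B = _")
proof -
  have B: "?B \<in> carrier_mat n n" by simp
  have "mat_delete ?B i s = mat_delete A i s"
    using assms by (intro eq_matI) (auto simp: mat_delete_def)
  then have "cofactor ?B i s = cofactor A i s" by (simp add: cofactor_def)
  moreover have "det ?B = (\<Sum>b<n. ?B $$ (i,b) * cofactor ?B i b)"
    by (rule laplace_expansion_row[OF B \<open>i < n\<close>])
  moreover have "\<dots> = (\<Sum>b<n. if b = s then cofactor ?B i s else 0)"
    using \<open>i < n\<close> by (intro sum.cong) auto
  ultimately show ?thesis using \<open>s < n\<close> by simp
qed

text \<open>Expansion along column \<open>s\<close> gives u_s det N as the sum of the cofactors
  times the entries of N u. As N u vanishes at \<open>v\<close>, only its derivative survives
  differentiation, and the values of the cofactors form a left kernel vector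
  \<open>b\<close>.\<close>

lemma minor_gradient:
  assumes N: "N \<in> carrier_mat n n" and s: "s < n" "u s \<noteq> 0"
    and ker: "\<forall>i<n. (\<Sum>t<n. poly_eval (N $$ (i,t)) v * u t) = 0"
  defines "b \<equiv> \<lambda>i. poly_eval (cofactor N i s) v / u s"
  shows "poly_eval (det N) v = 0"
    "poly_eval (partial_deriv j (det N)) v = (\<Sum>i<n. b i * (\<Sum>t<n. poly_eval (partial_deriv j (N $$ (i,t))) v * u t))"
    "t < n \<Longrightarrow> (\<Sum>i<n. b i * poly_eval (N $$ (i,t)) v) = 0"
proof -
  have eq: "(\<Sum>t<n. (\<Sum>i<n. cofactor N i s * N $$ (i,t)) * Const (u t)) = det N * Const (u s)"
  proof -
    have "(\<Sum>t<n. (\<Sum>i<n. cofactor N i s * N $$ (i,t)) * Const (u t)) = (\<Sum>t<n. if t = s then det N * Const (u s) else 0)"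
      by (intro sum.cong refl) (use cofactor_sum_col[OF N s(1)] in auto)
    then show ?thesis using s(1) by simp
  qed
  have eq': "(\<Sum>i<n. cofactor N i s * (\<Sum>t<n. N $$ (i,t) * Const (u t))) = det N * Const (u s)"
    unfolding eq[symmetric] sum_distrib_right sum_distrib_left
    by (subst sum.swap) (simp add: mult_ac)
  have ev0: "poly_eval (\<Sum>t<n. N $$ (i,t) * Const (u t)) v = 0" if "i < n" for i
    using ker that by (simp add: ev.hom_sum ev.hom_mult)
  have "poly_eval (det N) v * u s = poly_eval (det N * Const (u s)) v" by (simp add: ev.hom_mult)
  also have "\<dots> = 0" unfolding eq'[symmetric] using ev0 by (simp add: ev.hom_sum ev.hom_mult)
  finally show d0: "poly_eval (det N) v = 0" using s(2) by simp
  have "poly_eval (partial_deriv j (det N)) v * u s = poly_eval (partial_deriv j (det N * Const (u s))) v"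
    by (simp add: partial_deriv_mult ev.hom_mult)
  also have "\<dots> = (\<Sum>i<n. poly_eval (cofactor N i s) v * (\<Sum>t<n. poly_eval (partial_deriv j (N $$ (i,t))) v * u t))"
    unfolding eq'[symmetric] partial_deriv_sum partial_deriv_mult
    using ev0 by (simp add: ev.hom_sum ev.hom_mult ev.hom_add partial_deriv_sum partial_deriv_mult)
  finally show "poly_eval (partial_deriv j (det N)) v = (\<Sum>i<n. b i * (\<Sum>t<n. poly_eval (partial_deriv j (N $$ (i,t))) v * u t))"
    using s(2) by (simp add: b_def sum_divide_distrib[symmetric] field_simps)
  assume "t < n"
  have "(\<Sum>i<n. poly_eval (cofactor N i s) v * poly_eval (N $$ (i,t)) v) = poly_eval (\<Sum>i<n. cofactor N i s * N $$ (i,t)) v"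
    by (simp add: ev.hom_sum ev.hom_mult)
  also have "\<dots> = 0" using cofactor_sum_col[OF N s(1) \<open>t < n\<close>] d0 by auto
  finally show "(\<Sum>i<n. b i * poly_eval (N $$ (i,t)) v) = 0"
    by (simp add: b_def sum_divide_distrib[symmetric])
qed

lemma submatrix_rows:
  assumes "M \<in> carrier_mat m n" "R \<subseteq> {..<m}" "card R = r"
  shows "submatrix M R UNIV \<in> carrier_mat r n"
    "i < r \<Longrightarrow> j < n \<Longrightarrow> submatrix M R UNIV $$ (i,j) = M $$ (pick R i, j)"
    "i < r \<Longrightarrow> pick R i < m"
proof -
  have 1: "{i. i < dim_row M \<and> i \<in> R} = R" using assms by auto
  have 2: "{j. j < dim_col M \<and> j \<in> UNIV} = {..<n}" using assms by auto
  show "submatrix M R UNIV \<in> carrier_mat r n"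
    by (rule carrier_matI) (simp_all add: dim_submatrix[of M R UNIV] 1 2[simplified] assms(3) lessThan_def[symmetric] dim_submatrix)
  show "i < r \<Longrightarrow> j < n \<Longrightarrow> submatrix M R UNIV $$ (i,j) = M $$ (pick R i, j)"
    by (subst submatrix_index) (use 1 2 assms in \<open>auto simp: pick_UNIV\<close>)
  show "i < r \<Longrightarrow> pick R i < m"
    using assms pick_in_set_le[of i R] by auto
qed

lemma maximal_minors_polys:
  assumes "M \<in> carrier_mat m n" "\<And>i j. i < m \<Longrightarrow> j < n \<Longrightarrow> M $$ (i,j) \<in> polys k"
  shows "maximal_minors M \<subseteq> polys k"
proof
  fix f assume "f \<in> maximal_minors M"
  then obtain R where R: "f = det (submatrix M R UNIV)" "R \<subseteq> {..<m}" "card R = n"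
    using assms(1) unfolding maximal_minors_def by auto
  show "f \<in> polys k" unfolding R(1)
    by (rule polys_det[OF submatrix_rows(1)[OF assms(1) R(2,3)]])
      (simp add: submatrix_rows(2,3)[OF assms(1) R(2,3)] assms(2))
qed

lemma jacobian_rank_0:
  assumes "vec_space.rank (length fs) (jacobian k fs v) = c"
    "\<And>f j. f \<in> set fs \<Longrightarrow> j \<le> k \<Longrightarrow> poly_eval (partial_deriv j f) v = 0"
  shows "c = 0"
proof -
  have "jacobian k fs v = 0\<^sub>m (length fs) (k+1)"
    unfolding jacobian_def using assms(2) by (intro eq_matI) auto
  then show ?thesis using assms(1) vec_space.rank_0I by metis
qed

text \<open>A point of a scheme cut out, up to saturation, by the maximal minors of
  \<open>M\<close>; \<open>mn\<close> says that \<open>c\<close> is the codimension m - n + 1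
  expected of such a locus. The generators \<open>fs\<close> with Jacobian rank \<open>c\<close>
  record smoothness. The critical matrix and the (c+2) x 3 matrix both yield instances.\<close>

locale determinantal_point =
  fixes k m n c :: nat and M :: "cpoly mat" and fs :: "cpoly list" and v :: "complex vec"
  assumes M: "M \<in> carrier_mat m n" and Mp: "\<And>i j. i < m \<Longrightarrow> j < n \<Longrightarrow> M $$ (i,j) \<in> polys k"
    and mn: "m + 1 = n + c" and c1: "c \<ge> 1" and n1: "n \<ge> 1"
    and sat: "\<And>f. f \<in> set fs \<Longrightarrow> f \<in> polys k \<and> (\<exists>D. \<forall>i\<le>k. Var i ^ D * f \<in> Idl\<^bsub>coord_ring k\<^esub> (maximal_minors M))"
    and v: "\<exists>a\<le>k. v $ a \<noteq> 0"
    and rank: "vec_space.rank (length fs) (jacobian k fs v) = c"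
begin

definition mv where "mv i t = poly_eval (M $$ (i,t)) v"
definition dm where "dm j i t = poly_eval (partial_deriv j (M $$ (i,t))) v"

text \<open>The way to carry local information from the minors to the generators: the property has
  to define an ideal and to survive division by a variable that does not vanish at
  \<open>v\<close>.\<close>

lemma gradient_transfer:
  assumes "pideal k G" "maximal_minors M \<subseteq> G"
    and G: "\<And>f a D. f \<in> polys k \<Longrightarrow> a \<le> k \<Longrightarrow> v $ a \<noteq> 0 \<Longrightarrow> Var a ^ D * f \<in> G \<Longrightarrow> f \<in> G"
  shows "set fs \<subseteq> G"
proof
  fix f assume "f \<in> set fs"
  then obtain D where D: "f \<in> polys k" "\<forall>i\<le>k. Var i ^ D * f \<in> Idl\<^bsub>coord_ring k\<^esub> (maximal_minors M)"
    using sat by blast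
  obtain a where "a \<le> k" "v $ a \<noteq> 0" using v by blast
  moreover have "Idl\<^bsub>coord_ring k\<^esub> (maximal_minors M) \<subseteq> G" by (rule Idl_minimal[OF assms(1,2)])
  ultimately show "f \<in> G" using G[of f a D] D by blast
qed

text \<open>If the kernel at \<open>v\<close> has dimension at least two, every maximal minor
  vanishes at \<open>v\<close> together with its derivatives, hence so do the generators, and the
  Jacobian would have rank 0. Independence is encoded by \<open>u s \<noteq> 0\<close> and
  \<open>u' s = 0\<close>.\<close>

lemma kernel_unique:
  assumes u: "s < n" "u s \<noteq> 0" "\<forall>i<m. (\<Sum>t<n. mv i t * u t) = 0"
    and u': "nz n u'" "u' s = 0" "\<forall>i<m. (\<Sum>t<n. mv i t * u' t) = 0"
  shows False
proof -
  define G where "G = {f \<in> polys k. poly_eval f v = 0 \<and> (\<forall>j. poly_eval (partial_deriv j f) v = 0)}"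
  have "pideal k G"
    unfolding pideal_def G_def by (auto simp: ev.hom_add ev.hom_mult partial_deriv_add partial_deriv_mult)
  moreover have "maximal_minors M \<subseteq> G"
  proof
    fix f assume f: "f \<in> maximal_minors M"
    then obtain R where R: "f = det (submatrix M R UNIV)" "R \<subseteq> {..<m}" "card R = n"
      using M unfolding maximal_minors_def by auto
    let ?N = "submatrix M R UNIV"
    note N = submatrix_rows[OF M R(2,3)]
    have ker: "\<forall>i<n. (\<Sum>t<n. poly_eval (?N $$ (i,t)) v * u t) = 0"
      using u(3) N(2,3) by (simp add: mv_def)
    have "poly_eval (cofactor ?N i s) v = 0" if i: "i < n" for i
    proof -
      let ?A = "map_mat (\<lambda>f. poly_eval f v) ?N"
      have A: "?A \<in> carrier_mat n n" using N(1) by simp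
      \<comment> \<open>Row \<open>i\<close> is replaced by the unit row at \<open>s\<close>. The
        vector \<open>u'\<close> is still in the kernel because its coordinate at \<open>s\<close>
        is 0, and the determinant is the cofactor at (i, s).\<close>
      let ?B = "\<lambda>a b. if a = i then (if b = s then 1 else 0) else ?A $$ (a,b)"
      have "\<forall>a<n. (\<Sum>b<n. ?B a b * u' b) = 0"
      proof (intro allI impI)
        fix a assume a: "a < n"
        show "(\<Sum>b<n. ?B a b * u' b) = 0"
        proof (cases "a = i")
          case True
          then have "(\<Sum>b<n. ?B a b * u' b) = (\<Sum>b<n. if b = s then u' s else 0)" by (intro sum.cong) auto
          then show ?thesis using u'(2) by simp
        next
          case False
          then show ?thesis using a N u'(3) by (simp add: mv_def)
        qed
      qed
      then have "det (mat n n (\<lambda>(a,b). ?B a b)) = 0" by (rule square_det_0I[OF u'(1)])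
      then have "cofactor ?A i s = 0" using det_replace_row_unit[OF A i u(1)] by simp
      then show ?thesis using ev.hom_cofactor[of i ?N s] N(1) i u(1) by auto
    qed
    then show "f \<in> G" unfolding R(1) G_def
      using minor_gradient[OF N(1) u(1,2) ker] maximal_minors_polys[OF M Mp] f R(1)
      by auto
  qed
  moreover have "f \<in> G" if "f \<in> polys k" "v $ a \<noteq> 0" "Var a ^ D * f \<in> G" for f a D
  proof -
    have 0: "poly_eval f v = 0" using that by (auto simp: G_def ev.hom_mult ev.hom_power)
    then show ?thesis using that by (auto simp: G_def ev.hom_mult ev.hom_power partial_deriv_mult ev.hom_add)
  qed
  ultimately have "set fs \<subseteq> G" by (intro gradient_transfer)
  then have "c = 0" by (intro jacobian_rank_0[OF rank]) (auto simp: G_def)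
  then show False using c1 by simp
qed

text \<open>Every generator has a gradient of the form b C with b in the left kernel, where C_j is
  the derivative of M in direction j applied to \<open>u\<close>. If \<open>w\<close> annihilated
  all C_j, then the n - 1 columns of M(v) other than \<open>s\<close> and \<open>c\<close> suitable
  C_j would be \<open>m\<close> vectors killed by \<open>w\<close>, hence dependent. Pairing the
  dependency with each b removes its coefficients at the C_j, as the chosen Jacobian columns are
  independent; what is left contradicts \<open>kernel_unique\<close>.\<close>

lemma key:
  assumes u: "nz n u" "\<forall>i<m. (\<Sum>t<n. mv i t * u t) = 0"
    and w: "nz m w" "\<forall>t<n. (\<Sum>i<m. w i * mv i t) = 0"
  shows "\<exists>j\<le>k. (\<Sum>i<m. w i * (\<Sum>t<n. dm j i t * u t)) \<noteq> 0"
proof (rule ccontr)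
  assume "\<not> ?thesis"
  then have wC: "\<forall>j\<le>k. (\<Sum>i<m. w i * (\<Sum>t<n. dm j i t * u t)) = 0" by blast
  obtain s where s: "s < n" "u s \<noteq> 0" using u(1) by (rule nzE)
  define C where "C j i = (\<Sum>t<n. dm j i t * u t)" for j i
  define good where "good f b \<longleftrightarrow> poly_eval f v = 0 \<and> (\<forall>t<n. (\<Sum>i<m. b i * mv i t) = 0) \<and>
    (\<forall>j. poly_eval (partial_deriv j f) v = (\<Sum>i<m. b i * C j i))" for f b
  define G where "G = {f \<in> polys k. \<exists>b. good f b}"
  have "pideal k G"
    unfolding pideal_def
  proof (intro conjI ballI)
    show "G \<subseteq> polys k" by (auto simp: G_def)
    show "0 \<in> G" by (auto simp: G_def good_def intro!: exI[of _ "\<lambda>_. 0"])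
    fix f g assume "f \<in> G" "g \<in> G"
    then obtain b b' where "f \<in> polys k" "g \<in> polys k" "good f b" "good g b'" by (auto simp: G_def)
    then have "good (f + g) (\<lambda>i. b i + b' i)"
      by (auto simp: good_def ev.hom_add partial_deriv_add sum.distrib algebra_simps)
    then show "f + g \<in> G" using \<open>f \<in> polys k\<close> \<open>g \<in> polys k\<close> by (auto simp: G_def)
  next
    fix h f assume h: "h \<in> polys k" "f \<in> G"
    then obtain b where b: "f \<in> polys k" "good f b" by (auto simp: G_def)
    then have "good (h * f) (\<lambda>i. poly_eval h v * b i)"
      by (auto simp: good_def ev.hom_mult ev.hom_add partial_deriv_mult sum_distrib_left[symmetric] mult.assoc)
    then show "h * f \<in> G" using b h by (auto simp: G_def)
  qed
  moreover have "maximal_minors M \<subseteq> G"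
  proof
    fix f assume f: "f \<in> maximal_minors M"
    then obtain R where R: "f = det (submatrix M R UNIV)" "R \<subseteq> {..<m}" "card R = n"
      using M unfolding maximal_minors_def by auto
    let ?N = "submatrix M R UNIV"
    note N = submatrix_rows[OF M R(2,3)]
    have ker: "\<forall>i<n. (\<Sum>t<n. poly_eval (?N $$ (i,t)) v * u t) = 0"
      using u(2) N(2,3) by (simp add: mv_def)
    note mg = minor_gradient[OF N(1) s ker]
    define b where "b r = poly_eval (cofactor ?N r s) v / u s" for r
    define b' where "b' i = (\<Sum>r<n. if pick R r = i then b r else 0)" for i
    have b': "(\<Sum>i<m. b' i * X i) = (\<Sum>r<n. b r * X (pick R r))" for X
    proof -
      have "(\<Sum>i<m. b' i * X i) = (\<Sum>r<n. \<Sum>i<m. if i = pick R r then b r * X (pick R r) else 0)"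
        unfolding b'_def sum_distrib_right by (subst sum.swap) (intro sum.cong refl, auto)
      also have "\<dots> = (\<Sum>r<n. b r * X (pick R r))" using N(3) by (intro sum.cong refl) simp
      finally show ?thesis .
    qed
    have "good f b'"
      unfolding good_def b' R(1)
      using mg N(2,3) by (simp add: b_def mv_def C_def dm_def)
    then show "f \<in> G" using maximal_minors_polys[OF M Mp] f by (auto simp: G_def)
  qed
  \<comment> \<open>Since \<open>f\<close> vanishes at \<open>v\<close>, the product rule makes the
    gradient of the multiple equal to v_a^D times that of \<open>f\<close>, so \<open>b\<close> only
    has to be rescaled.\<close>
  moreover have "f \<in> G" if f: "f \<in> polys k" and a: "v $ a \<noteq> 0" and D: "Var a ^ D * f \<in> G" for f a D
  proof -
    obtain b where b: "good (Var a ^ D * f) b" using D by (auto simp: G_def)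
    then have 0: "poly_eval f v = 0" using a by (auto simp: good_def ev.hom_mult ev.hom_power)
    have "poly_eval (partial_deriv j f) v = (\<Sum>i<m. b i / (v $ a) ^ D * C j i)" for j
    proof -
      have "(v $ a) ^ D * poly_eval (partial_deriv j f) v = (\<Sum>i<m. b i * C j i)"
        using b 0 by (simp add: good_def partial_deriv_mult ev.hom_mult ev.hom_power ev.hom_add)
      then show ?thesis using a by (simp add: sum_divide_distrib[symmetric] field_simps)
    qed
    moreover have "\<forall>t<n. (\<Sum>i<m. b i / (v $ a) ^ D * mv i t) = 0"
      using b by (simp add: good_def sum_divide_distrib[symmetric])
    ultimately have "good f (\<lambda>i. b i / (v $ a) ^ D)" using 0 by (simp add: good_def)
    then show ?thesis using f by (auto simp: G_def)
  qed
  ultimately have "set fs \<subseteq> G" by (intro gradient_transfer)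
  then have "\<forall>f\<in>set fs. \<exists>b. good f b" by (auto simp: G_def)
  then obtain B where B: "\<And>f. f \<in> set fs \<Longrightarrow> good f (B f)" by metis
  have J: "jacobian k fs v \<in> carrier_mat (length fs) (k+1)" by (simp add: jacobian_def)
  obtain T where T: "T \<subseteq> {..<k+1}" "card T = c"
    "\<And>\<beta>. (\<forall>i<length fs. (\<Sum>j\<in>T. jacobian k fs v $$ (i,j) * \<beta> j) = 0) \<Longrightarrow> (\<forall>j\<in>T. \<beta> j = 0)"
    using rank_independent_cols[OF J rank] by metis
  have fT: "finite T" using T(1) finite_subset by blast
  \<comment> \<open>Altogether (n - 1) + c = m columns.\<close>
  define E where "E = ({..<n} - {s}) <+> T"
  define F where "F i e = (case e of Inl t \<Rightarrow> mv i t | Inr j \<Rightarrow> C j i)" for i and e :: "nat + nat"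
  have E: "finite E" "card E = m"
    using fT T(2) s(1) mn n1 by (auto simp: E_def card_Plus)
  have "\<forall>e\<in>E. (\<Sum>i<m. w i * F i e) = 0"
    using w(2) wC T(1) by (auto simp: E_def F_def C_def)
  from family_dependent[OF E w(1) this]
  obtain x where x: "\<exists>e\<in>E. x e \<noteq> 0" "\<forall>i<m. (\<Sum>e\<in>E. F i e * x e) = 0" by (elim exE conjE)
  have x': "(\<Sum>t\<in>{..<n} - {s}. mv i t * x (Inl t)) + (\<Sum>j\<in>T. C j i * x (Inr j)) = 0" if "i < m" for i
    using x(2) that fT by (simp add: E_def F_def sum.Plus)
  have xT: "\<forall>j\<in>T. x (Inr j) = 0"
  proof (rule T(3), intro allI impI)
    fix i assume i: "i < length fs"
    define b where "b = B (fs ! i)"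
    have b: "good (fs ! i) b" using B i by (simp add: b_def)
    have "(\<Sum>j\<in>T. jacobian k fs v $$ (i,j) * x (Inr j)) = (\<Sum>j\<in>T. (\<Sum>l<m. b l * C j l) * x (Inr j))"
      using b i T(1) by (intro sum.cong refl) (auto simp: jacobian_def good_def)
    also have "\<dots> = (\<Sum>l<m. b l * (\<Sum>j\<in>T. C j l * x (Inr j)))"
      unfolding sum_distrib_left sum_distrib_right by (subst sum.swap) (simp add: mult_ac)
    also have "\<dots> = (\<Sum>l<m. b l * (- (\<Sum>t\<in>{..<n} - {s}. mv l t * x (Inl t))))"
    proof (intro sum.cong refl arg_cong2[of _ _ _ _ "(*)"])
      fix l assume "l \<in> {..<m}"
      then show "(\<Sum>j\<in>T. C j l * x (Inr j)) = - (\<Sum>t\<in>{..<n} - {s}. mv l t * x (Inl t))"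
        using x'[of l] by (simp add: add_eq_0_iff)
    qed
    also have "\<dots> = - (\<Sum>t\<in>{..<n} - {s}. (\<Sum>l<m. b l * mv l t) * x (Inl t))"
      unfolding sum_distrib_left sum_distrib_right sum_negf mult_minus_right
      by (subst sum.swap) (simp add: mult_ac)
    also have "\<dots> = 0" using b by (simp add: good_def)
    finally show "(\<Sum>j\<in>T. jacobian k fs v $$ (i,j) * x (Inr j)) = 0" .
  qed
  define u' where "u' t = (if t = s then 0 else x (Inl t))" for t
  have "nz n u'"
  proof -
    obtain e where e: "e \<in> E" "x e \<noteq> 0" using x(1) by blast
    have "e \<notin> Inr ` T" using xT e(2) by auto
    then obtain t where "t < n" "t \<noteq> s" "e = Inl t" using e(1) by (auto simp: E_def)
    then show ?thesis using e by (intro nzI[of t]) (auto simp: u'_def)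
  qed
  moreover have "\<forall>i<m. (\<Sum>t<n. mv i t * u' t) = 0"
  proof (intro allI impI)
    fix i assume i: "i < m"
    have "(\<Sum>t<n. mv i t * u' t) = (\<Sum>t\<in>{..<n} - {s}. mv i t * x (Inl t))"
      using s(1) by (simp add: sum.remove[of "{..<n}" s] u'_def)
    then show "(\<Sum>t<n. mv i t * u' t) = 0" using x'[OF i] xT by simp
  qed
  ultimately show False using kernel_unique[OF s u(2), of u'] by (simp add: u'_def)
qed

end

section \<open>Smooth varieties presented by matrices\<close>

text \<open>Chains can be truncated, so the lengths that occur form an initial segment.\<close>

lemma has_dim_unique:
  assumes "has_dim k X d" "has_dim k X e"
  shows "d = e"
proof -
  have mono: "chain_of_length k X n" if c: "chain_of_length k X n'" and "n \<le> n'" for n n'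
  proof -
    obtain Z where "\<forall>i\<le>n'. irreducible_closed k (Z i) \<and> Z i \<subseteq> X" "\<forall>i<n'. Z i \<subset> Z (Suc i)"
      using c unfolding chain_of_length_def by blast
    then show ?thesis unfolding chain_of_length_def using \<open>n \<le> n'\<close>
      by (intro exI[of _ Z]) auto
  qed
  show ?thesis
  proof (rule ccontr)
    assume "d \<noteq> e"
    then consider "Suc d \<le> e" | "Suc e \<le> d" by linarith
    then show False using assms mono unfolding has_dim_def by cases blast+
  qed
qed

lemma zariski_closed_zeros:
  assumes "zariski_closed k X"
  shows "X = zeros k (vanishing_ideal k X)"
proof -
  obtain G where G: "G \<subseteq> (\<Union>d. forms k d)" "X = zeros k G"
    using assms unfolding zariski_closed_def by blast
  then have "G \<subseteq> vanishing_ideal k X"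
    unfolding vanishing_ideal_def zeros_def by (fastforce dest: forms_polys)
  then show ?thesis using G unfolding zeros_def vanishing_ideal_def by blast
qed

lemma pideal_vanishing: "pideal k (vanishing_ideal k X)"
  unfolding pideal_def vanishing_ideal_def by (auto simp: ev.hom_add ev.hom_mult)

definition mker :: "nat \<Rightarrow> nat \<Rightarrow> cpoly mat \<Rightarrow> complex vec \<Rightarrow> (nat \<Rightarrow> complex) \<Rightarrow> bool" where
  "mker m n M v u \<longleftrightarrow> (\<forall>i<m. (\<Sum>t<n. poly_eval (M $$ (i,t)) v * u t) = 0)"

definition mlker :: "nat \<Rightarrow> nat \<Rightarrow> cpoly mat \<Rightarrow> complex vec \<Rightarrow> (nat \<Rightarrow> complex) \<Rightarrow> bool" where
  "mlker m n M v w \<longleftrightarrow> (\<forall>t<n. (\<Sum>i<m. w i * poly_eval (M $$ (i,t)) v) = 0)"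

lemma vec_proj_space:
  assumes "nz (k+1) x"
  shows "vec (k+1) x \<in> proj_space k"
proof -
  obtain i where i: "i < k+1" "x i \<noteq> 0" using assms by (rule nzE)
  have "vec (k+1) x \<noteq> 0\<^sub>v (k+1)"
  proof
    assume "vec (k+1) x = 0\<^sub>v (k+1)"
    then have "vec (k+1) x $ i = 0\<^sub>v (k+1) $ i" by simp
    then show False using i by simp
  qed
  then show ?thesis by (simp add: proj_space_def)
qed

locale smooth_codim =
  fixes k c :: nat and X :: "complex vec set" and fs :: "cpoly list"
  assumes c1: "c \<ge> 1"
    and closed: "zariski_closed k X" and nonempty: "X \<noteq> {}"
    and fs: "set fs \<subseteq> polys k" "vanishing_ideal k X = Idl\<^bsub>coord_ring k\<^esub> (set fs)"
    and rank: "\<And>v. v \<in> X \<Longrightarrow> vec_space.rank (length fs) (jacobian k fs v) = c"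
begin

text \<open>Schemes are compared after saturation, since that is all a critical locus
  promises.\<close>

definition presented :: "cpoly mat \<Rightarrow> nat \<Rightarrow> nat \<Rightarrow> bool" where
  "presented M m n \<longleftrightarrow> M \<in> carrier_mat m n \<and> (\<forall>i<m. \<forall>j<n. M $$ (i,j) \<in> polys k) \<and> m + 1 = n + c \<and> n \<ge> 1 \<and>
     same_subscheme k (Idl\<^bsub>coord_ring k\<^esub> (maximal_minors M)) (vanishing_ideal k X)"

lemma X_proj: "X \<subseteq> proj_space k"
  using zariski_closed_zeros[OF closed] unfolding zeros_def by blast

lemma proj_nonzero: "v \<in> proj_space k \<Longrightarrow> \<exists>a\<le>k. v $ a \<noteq> 0"
proof (rule ccontr)
  assume v: "v \<in> proj_space k" and n: "\<not> (\<exists>a\<le>k. v $ a \<noteq> 0)"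
  have "v = 0\<^sub>v (k+1)" using v n by (intro eq_vecI) (auto simp: proj_space_def)
  then show False using v by (simp add: proj_space_def)
qed

lemma presented_sat:
  assumes "presented M m n" "f \<in> vanishing_ideal k X"
  shows "\<exists>D. \<forall>i\<le>k. Var i ^ D * f \<in> Idl\<^bsub>coord_ring k\<^esub> (maximal_minors M)"
proof -
  have "f \<in> saturation k (vanishing_ideal k X)"
    using assms(2) by (auto simp: saturation_def vanishing_ideal_def intro!: exI[of _ 0])
  then have "f \<in> saturation k (Idl\<^bsub>coord_ring k\<^esub> (maximal_minors M))"
    using assms(1) by (simp add: presented_def same_subscheme_def)
  then show ?thesis by (simp add: saturation_def)
qed

lemma presented_minors_polys: "presented M m n \<Longrightarrow> maximal_minors M \<subseteq> polys k"
  by (rule maximal_minors_polys[of M m n]) (auto simp: presented_def)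

lemma zeros_Idl: "G \<subseteq> polys k \<Longrightarrow> zeros k (Idl\<^bsub>coord_ring k\<^esub> G) = zeros k G"
proof
  assume G: "G \<subseteq> polys k"
  show "zeros k (Idl\<^bsub>coord_ring k\<^esub> G) \<subseteq> zeros k G" using pideal_Idl(2)[OF G] by (auto simp: zeros_def)
  show "zeros k G \<subseteq> zeros k (Idl\<^bsub>coord_ring k\<^esub> G)"
  proof
    fix v assume v: "v \<in> zeros k G"
    have "Idl\<^bsub>coord_ring k\<^esub> G \<subseteq> vanishing_ideal k {v}"
      using v G by (intro Idl_minimal pideal_vanishing) (auto simp: vanishing_ideal_def zeros_def)
    then show "v \<in> zeros k (Idl\<^bsub>coord_ring k\<^esub> G)" using v by (auto simp: zeros_def vanishing_ideal_def)
  qed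
qed

text \<open>At each point some coordinate is nonzero, so multiplying an equation by powers of the
  variables does not affect whether it vanishes there.\<close>

lemma presented_zeros:
  assumes p: "presented M m n"
  shows "X = zeros k (maximal_minors M)"
proof
  let ?I = "Idl\<^bsub>coord_ring k\<^esub> (maximal_minors M)"
  note I = pideal_Idl[OF presented_minors_polys[OF p]]
  show "X \<subseteq> zeros k (maximal_minors M)"
  proof
    fix v assume v: "v \<in> X"
    have "poly_eval g v = 0" if g: "g \<in> maximal_minors M" for g
    proof -
      have "g \<in> saturation k ?I" using I g presented_minors_polys[OF p]
        by (auto simp: saturation_def intro!: exI[of _ 0])
      then have "g \<in> saturation k (vanishing_ideal k X)"
        using p by (simp add: presented_def same_subscheme_def)
      then obtain D where D: "\<forall>i\<le>k. Var i ^ D * g \<in> vanishing_ideal k X"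
        unfolding saturation_def by blast
      obtain a where "a \<le> k" "v $ a \<noteq> 0" using proj_nonzero X_proj v by blast
      then show ?thesis using D v by (auto simp: vanishing_ideal_def ev.hom_mult ev.hom_power)
    qed
    then show "v \<in> zeros k (maximal_minors M)" using v X_proj by (auto simp: zeros_def)
  qed
  show "zeros k (maximal_minors M) \<subseteq> X"
  proof
    fix v assume "v \<in> zeros k (maximal_minors M)"
    then have v: "v \<in> zeros k ?I" using zeros_Idl[OF presented_minors_polys[OF p]] by simp
    obtain a where a: "a \<le> k" "v $ a \<noteq> 0" using proj_nonzero v by (auto simp: zeros_def)
    have "poly_eval f v = 0" if f: "f \<in> vanishing_ideal k X" for f
    proof -
      obtain D where "\<forall>i\<le>k. Var i ^ D * f \<in> ?I" using presented_sat[OF p f] by blast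
      then have "poly_eval (Var a ^ D * f) v = 0" using v a by (auto simp: zeros_def)
      then show ?thesis using a by (simp add: ev.hom_mult ev.hom_power)
    qed
    then show "v \<in> X" using zariski_closed_zeros[OF closed] v by (auto simp: zeros_def)
  qed
qed

lemma kernel_in_X:
  assumes p: "presented M m n" and v: "v \<in> proj_space k" and u: "nz n u" "mker m n M v u"
  shows "v \<in> X"
  unfolding presented_zeros[OF p] zeros_def
proof (intro CollectI conjI ballI v)
  fix f assume f: "f \<in> maximal_minors M"
  have M: "M \<in> carrier_mat m n" using p by (simp add: presented_def)
  obtain R where R: "f = det (submatrix M R UNIV)" "R \<subseteq> {..<m}" "card R = n"
    using f M unfolding maximal_minors_def by auto
  note N = submatrix_rows[OF M R(2,3)]
  obtain s where s: "s < n" "u s \<noteq> 0" using u(1) by (rule nzE)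
  show "poly_eval f v = 0" unfolding R(1)
    by (rule minor_gradient(1)[OF N(1), where s = s and u = u])
      (use u(2) N(2,3) s in \<open>auto simp: mker_def\<close>)
qed

lemma presented_point:
  assumes p: "presented M m n" and v: "v \<in> X"
  shows "determinantal_point k m n c M fs v"
proof
  show "M \<in> carrier_mat m n" "\<And>i j. i < m \<Longrightarrow> j < n \<Longrightarrow> M $$ (i, j) \<in> polys k" "m + 1 = n + c" "1 \<le> n"
    using p by (auto simp: presented_def)
  show "1 \<le> c" by (rule c1)
  show "\<exists>a\<le>k. v $ a \<noteq> 0" using proj_nonzero X_proj v by blast
  show "vec_space.rank (length fs) (jacobian k fs v) = c" by (rule rank[OF v])
  fix f assume f: "f \<in> set fs"
  then have "f \<in> vanishing_ideal k X" using fs pideal_Idl(2)[OF fs(1)] by auto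
  then show "f \<in> polys k \<and> (\<exists>D. \<forall>i\<le>k. Var i ^ D * f \<in> Idl\<^bsub>coord_ring k\<^esub> (maximal_minors M))"
    using presented_sat[OF p] f fs(1) by blast
qed

lemma presented_key:
  assumes p: "presented M m n" and v: "v \<in> proj_space k" and u: "nz n u" "mker m n M v u"
    and w: "nz m w" "mlker m n M v w"
  shows "\<exists>j\<le>k. (\<Sum>i<m. w i * (\<Sum>t<n. poly_eval (partial_deriv j (M $$ (i,t))) v * u t)) \<noteq> 0"
proof -
  interpret determinantal_point k m n c M fs v by (rule presented_point[OF p kernel_in_X[OF p v u]])
  show ?thesis using key[OF u(1) _ w(1)] u(2) w(2) by (simp add: mker_def mlker_def mv_def dm_def)
qed

lemma presented_kernel_unique:
  assumes p: "presented M m n" and v: "v \<in> proj_space k"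
    and u: "s < n" "u s \<noteq> 0" "mker m n M v u" and u': "nz n u'" "u' s = 0" "mker m n M v u'"
  shows False
proof -
  interpret determinantal_point k m n c M fs v
    by (rule presented_point[OF p kernel_in_X[OF p v nzI[of s n u] u(3)]]) (rule u)+
  show ?thesis using kernel_unique[of s u u'] u u' by (simp add: mker_def mv_def)
qed

end

lemma smooth_codimI:
  assumes "c \<ge> 1" "c \<le> k" "smooth_variety k X" "has_dim k X (k - c)"
  shows "\<exists>fs. smooth_codim k c X fs"
proof -
  obtain d fs where d: "has_dim k X d" "set fs \<subseteq> polys k" "vanishing_ideal k X = Idl\<^bsub>coord_ring k\<^esub> (set fs)"
    "\<forall>v\<in>X. vec_space.rank (length fs) (jacobian k fs v) = k - d" and X: "irreducible_closed k X"
    using assms(3) unfolding smooth_variety_def by blast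
  have "k - d = c" using has_dim_unique[OF d(1) assms(4)] assms(2) by simp
  then have "smooth_codim k c X fs"
    using d X assms(1) by unfold_locales (auto simp: irreducible_closed_def)
  then show ?thesis by blast
qed

section \<open>The critical matrix\<close>

lemma sum_lessThan_add: "(\<Sum>\<rho><a + b. f \<rho>) = (\<Sum>\<rho><a. f \<rho>) + (\<Sum>r<b. f (a + r))" for f :: "nat \<Rightarrow> 'a::comm_monoid_add"
  by (induction b) (simp_all add: add.assoc)

text \<open>Rows of the three stacked blocks are numbered consecutively, block i having h i + 1 of
  them; \<open>blk\<close> is the block of a row and \<open>off\<close> the number of the first row
  of a block.\<close>

definition blk :: "(nat \<Rightarrow> nat) \<Rightarrow> nat \<Rightarrow> nat" where
  "blk h \<rho> = (if \<rho> < h 0 + 1 then 0 else if \<rho> < h 0 + h 1 + 2 then 1 else 2)"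

definition off :: "(nat \<Rightarrow> nat) \<Rightarrow> nat \<Rightarrow> nat" where
  "off h i = (if i = 0 then 0 else if i = 1 then h 0 + 1 else h 0 + h 1 + 2)"

lemma blk_off:
  assumes "i < 3" "r < h i + 1"
  shows "blk h (off h i + r) = i" "off h i + r < h 0 + h 1 + h 2 + 3"
proof -
  consider "i = 0" | "i = 1" | "i = 2" using assms(1) by linarith
  then show "blk h (off h i + r) = i" "off h i + r < h 0 + h 1 + h 2 + 3"
    using assms(2) by (cases; simp add: blk_def off_def)+
qed

lemma blk_rows:
  assumes "\<rho> < h 0 + h 1 + h 2 + 3"
  shows "blk h \<rho> < 3" "off h (blk h \<rho>) \<le> \<rho>" "\<rho> - off h (blk h \<rho>) < h (blk h \<rho>) + 1"
  using assms by (auto simp: blk_def off_def)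

lemma sum_blocks:
  "(\<Sum>\<rho><h 0 + h 1 + h 2 + 3. f \<rho>) = (\<Sum>i<3. \<Sum>r<h i + 1. f (off h i + r))" for f :: "nat \<Rightarrow> 'a::comm_monoid_add"
proof -
  have "{..<3::nat} = {0,1,2}" by auto
  moreover have "h 0 + h 1 + h 2 + 3 = (h 0 + 1) + ((h 1 + 1) + (h 2 + 1))" by simp
  ultimately show ?thesis
    by (simp only: sum_lessThan_add) (simp add: off_def add.assoc del: sum.lessThan_Suc)
qed

text \<open>The coefficient of x_l in row \<rho> and column k + 1 + j of the critical
  matrix.\<close>

definition crit_lin :: "nat \<Rightarrow> (nat \<Rightarrow> nat) \<Rightarrow> (nat \<Rightarrow> complex mat) \<Rightarrow> nat \<Rightarrow> nat \<Rightarrow> nat \<Rightarrow> complex" where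
  "crit_lin k h Q \<rho> j l = (if j = blk h \<rho> then Q (blk h \<rho>) $$ (\<rho> - off h (blk h \<rho>), l) else 0)"

lemma critical_matrix_eq:
  assumes "\<And>i. i < 3 \<Longrightarrow> P i \<in> carrier_mat (h i + 1) (k + 1) \<and> Q i \<in> carrier_mat (h i + 1) (k + 1)"
  shows "critical_matrix k P Q = mat (h 0 + h 1 + h 2 + 3) (k + 4) (\<lambda>(\<rho>,s).
    if s \<le> k then Const (P (blk h \<rho>) $$ (\<rho> - off h (blk h \<rho>), s))
    else (\<Sum>l\<le>k. Const (crit_lin k h Q \<rho> (s - (k + 1)) l) * Var l))" (is "_ = ?R")
proof -
  have d: "dim_row (P i) = h i + 1" "dim_row (Q i) = h i + 1" "dim_col (Q i) = k + 1" if "i < 3" for i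
    using assms that by auto
  have b: "dim_row (critical_block k P Q i) = h i + 1" "dim_col (critical_block k P Q i) = k + 4" if "i < 3" for i
    using d that by (simp_all add: critical_block_def)
  have lin: "(map_mat Const (Q i) *\<^sub>v vec (k + 1) Var) $ r = (\<Sum>l\<le>k. Const (Q i $$ (r,l)) * Var l)"
    if "i < 3" "r < h i + 1" for i r
  proof -
    have "(map_mat Const (Q i) *\<^sub>v vec (k + 1) Var) $ r = (\<Sum>l<k+1. Const (Q i $$ (r,l)) * Var l)"
      using that d by (simp add: scalar_prod_def lessThan_atLeast0)
    then show ?thesis by (simp add: lessThan_Suc_atMost)
  qed
  have entry: "critical_block k P Q i $$ (r,s) = (if s \<le> k then Const (P i $$ (r,s)) else
      (\<Sum>l\<le>k. Const (if s - (k+1) = i then Q i $$ (r,l) else 0) * Var l))"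
    if "i < 3" "r < h i + 1" "s < k + 4" for i r s
    using that d lin[OF that(1,2)] by (auto simp: critical_block_def)
  show ?thesis
  proof (rule eq_matI)
    show "dim_row (critical_matrix k P Q) = dim_row ?R" "dim_col (critical_matrix k P Q) = dim_col ?R"
      by (simp_all add: critical_matrix_def append_rows_def b)
    fix \<rho> s assume "\<rho> < dim_row ?R" "s < dim_col ?R"
    then have \<rho>: "\<rho> < h 0 + h 1 + h 2 + 3" and s: "s < k + 4" by auto
    have "critical_matrix k P Q $$ (\<rho>,s) = critical_block k P Q (blk h \<rho>) $$ (\<rho> - off h (blk h \<rho>), s)"
      using \<rho> s by (auto simp: critical_matrix_def append_rows_def b blk_def off_def)
    also have "\<dots> = ?R $$ (\<rho>,s)"
      using entry[OF blk_rows(1,3)[OF \<rho>] s] \<rho> s by (simp add: crit_lin_def cong: if_cong)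
    finally show "critical_matrix k P Q $$ (\<rho>,s) = ?R $$ (\<rho>,s)" .
  qed
qed

lemma poly_eval_lin: "poly_eval (\<Sum>l\<le>k. Const (a l) * Var l) v = (\<Sum>l\<le>k. a l * v $ l)"
  by (simp add: ev.hom_sum ev.hom_mult)

lemma partial_deriv_lin: "j \<le> k \<Longrightarrow> poly_eval (partial_deriv j (\<Sum>l\<le>k. Const (a l) * Var l)) v = a j"
  by (simp add: partial_deriv_sum partial_deriv_mult partial_deriv_Var ev.hom_sum ev.hom_mult if_distrib
      cong: if_cong)

context smooth_codim
begin

text \<open>The contradiction is with \<open>presented_key\<close>: a point on the center of one Q_i
  is combined with a left kernel vector that vanishes on the i-th block, so the derivative of the
  corresponding column is paired with zeros only.\<close>

lemma not_critical:
  assumes kc: "k \<ge> c + 3" "k \<le> 2 * c + 1" and h: "h 0 + h 1 + h 2 = k + c"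
    and crit: "is_critical_locus k h P Q X"
  shows False
proof -
  define H where "H = h 0 + h 1 + h 2 + 3"
  have PQ: "P i \<in> carrier_mat (h i + 1) (k + 1) \<and> Q i \<in> carrier_mat (h i + 1) (k + 1)" if "i < 3" for i
    using crit that unfolding is_critical_locus_def admissible_triples_def projection_def by blast
  note CM = critical_matrix_eq[of P h k Q, OF PQ, folded H_def]
  define M where "M = critical_matrix k P Q"
  define \<beta> where "\<beta> \<rho> s = P (blk h \<rho>) $$ (\<rho> - off h (blk h \<rho>), s)" for \<rho> s
  define \<alpha> where "\<alpha> = crit_lin k h Q"
  have Mc: "M \<in> carrier_mat H (k + 4)" by (simp add: M_def CM)
  have M1: "M $$ (\<rho>,s) = Const (\<beta> \<rho> s)" if "\<rho> < H" "s \<le> k" for \<rho> s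
    using that by (simp add: M_def CM \<beta>_def)
  have M2: "M $$ (\<rho>,k+1+j) = (\<Sum>l\<le>k. Const (\<alpha> \<rho> j l) * Var l)" if "\<rho> < H" "j < 3" for \<rho> j
    using that by (simp add: M_def CM \<alpha>_def)
  have pres: "presented M H (k + 4)"
    unfolding presented_def
  proof (intro conjI allI impI Mc)
    show "M $$ (i,j) \<in> polys k" if "i < H" "j < k + 4" for i j
      using that by (cases "j \<le> k") (auto simp: M_def CM intro!: polys_sum)
  next
    show "same_subscheme k (Idl\<^bsub>coord_ring k\<^esub> maximal_minors M) (vanishing_ideal k X)"
      using crit by (simp add: is_critical_locus_def M_def critical_ideal_def)
  qed (use h in \<open>auto simp: H_def\<close>)
  \<comment> \<open>The three numbers add up to k + c \<le> 3c + 1, which is less than 3(c +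
    1).\<close>
  obtain i0 where i0: "i0 < 3" "h i0 \<le> c"
  proof -
    have "h 0 \<le> c \<or> h 1 \<le> c \<or> h 2 \<le> c" using h kc by linarith
    then show ?thesis using that[of 0] that[of 1] that[of 2] by auto
  qed
  define B where "B = {\<rho>. \<rho> < H \<and> blk h \<rho> = i0}"
  have \<alpha>0: "\<alpha> \<rho> j l = 0" if "blk h \<rho> \<noteq> j" for \<rho> j l
    using that by (simp add: \<alpha>_def crit_lin_def)
  have B: "finite B" "card B \<le> c + 1"
  proof -
    have "B \<subseteq> (\<lambda>r. off h i0 + r) ` {..<h i0 + 1}"
    proof
      fix \<rho> assume \<rho>: "\<rho> \<in> B"
      then have "\<rho> = off h i0 + (\<rho> - off h i0)" "\<rho> - off h i0 < h i0 + 1"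
        using blk_rows[of \<rho> h] by (auto simp: B_def H_def)
      then show "\<rho> \<in> (\<lambda>r. off h i0 + r) ` {..<h i0 + 1}" by blast
    qed
    then have "card B \<le> card {..<h i0 + 1}" by (meson finite_lessThan surj_card_le)
    then show "card B \<le> c + 1" using i0 by simp
    show "finite B" by (simp add: B_def)
  qed
  \<comment> \<open>At most (k + 1) + (c + 1) conditions on H = k + c + 3 coordinates:
    \<open>w\<close> kills the constant columns and vanishes on block \<open>i0\<close>.\<close>
  have "\<exists>w. nz H w \<and> (\<forall>e\<in>{..k} <+> B. (\<Sum>\<rho><H. (case e of Inl s \<Rightarrow> \<beta> \<rho> s | Inr \<rho>' \<Rightarrow> if \<rho> = \<rho>' then 1 else 0) * w \<rho>) = 0)"
    using B h by (intro kernel_nontrivial) (simp_all add: card_Plus H_def)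
  then obtain w where w: "nz H w"
    "\<forall>e\<in>{..k} <+> B. (\<Sum>\<rho><H. (case e of Inl s \<Rightarrow> \<beta> \<rho> s | Inr \<rho>' \<Rightarrow> if \<rho> = \<rho>' then 1 else 0) * w \<rho>) = 0"
    by blast
  have wP: "(\<Sum>\<rho><H. \<beta> \<rho> s * w \<rho>) = 0" if "s \<le> k" for s
    using bspec[OF w(2) InlI, of s] that by simp
  have wB: "w \<rho> = 0" if "\<rho> \<in> B" for \<rho>
    using bspec[OF w(2) InrI, of \<rho>] that by (simp add: B_def if_distrib[of "\<lambda>x. x * _"] cong: if_cong)
  \<comment> \<open>At most (c + 1) + 2 < k + 1 conditions: the point lies on the center of
    \<open>Q i0\<close>, and \<open>w\<close> kills the other two columns of linear forms there.
    This is where k \<ge> c + 3 enters.\<close>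
  have "\<exists>x. nz (k+1) x \<and> (\<forall>e\<in>B <+> ({..<3} - {i0}). (\<Sum>l<k+1. (case e of Inl \<rho> \<Rightarrow> \<alpha> \<rho> i0 l | Inr j \<Rightarrow> \<Sum>\<rho><H. w \<rho> * \<alpha> \<rho> j l) * x l) = 0)"
    using B i0 kc by (intro kernel_nontrivial) (simp_all add: card_Plus)
  then obtain x where x: "nz (k+1) x"
    "\<forall>e\<in>B <+> ({..<3} - {i0}). (\<Sum>l<k+1. (case e of Inl \<rho> \<Rightarrow> \<alpha> \<rho> i0 l | Inr j \<Rightarrow> \<Sum>\<rho><H. w \<rho> * \<alpha> \<rho> j l) * x l) = 0"
    by blast
  have x1: "(\<Sum>l\<le>k. \<alpha> \<rho> i0 l * x l) = 0" if "\<rho> < H" for \<rho>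
  proof (cases "\<rho> \<in> B")
    case True
    then show ?thesis using bspec[OF x(2) InlI, of \<rho>] by (simp add: lessThan_Suc_atMost)
  next
    case False
    then show ?thesis using that \<alpha>0 by (simp add: B_def)
  qed
  have x2: "(\<Sum>l\<le>k. (\<Sum>\<rho><H. w \<rho> * \<alpha> \<rho> j l) * x l) = 0" if "j < 3" for j
  proof (cases "j = i0")
    case True
    have "w \<rho> * \<alpha> \<rho> i0 l = 0" if "\<rho> < H" for \<rho> l
      using wB[of \<rho>] \<alpha>0[of \<rho> i0 l] that by (cases "blk h \<rho> = i0") (auto simp: B_def)
    then have "(\<Sum>\<rho><H. w \<rho> * \<alpha> \<rho> i0 l) = 0" for l by (intro sum.neutral) simp
    then show ?thesis using True by simp
  next
    case False
    then show ?thesis using bspec[OF x(2) InrI, of j] that by (simp add: lessThan_Suc_atMost)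
  qed
  define v where "v = vec (k+1) x"
  have v: "v \<in> proj_space k"
    unfolding v_def by (rule vec_proj_space[OF x(1)])
  have vl: "v $ l = x l" if "l \<le> k" for l using that by (simp add: v_def)
  \<comment> \<open>The column of \<open>Q i0\<close> vanishes at the chosen point, so its unit
    vector is a right kernel vector.\<close>
  define u where "u t = (if t = k + 1 + i0 then 1 else 0 :: complex)" for t
  have u1: "(\<Sum>t<k+4. g t * u t) = g (k+1+i0)" for g
    using i0 by (simp add: u_def if_distrib[of "\<lambda>x. _ * x"] cong: if_cong)
  have "nz (k+4) u" using i0 by (intro nzI[of "k+1+i0"]) (auto simp: u_def)
  moreover have "mker H (k+4) M v u"
    unfolding mker_def u1
  proof (intro allI impI)
    fix \<rho> assume "\<rho> < H"
    then show "poly_eval (M $$ (\<rho>, k+1+i0)) v = 0"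
      unfolding M2[OF \<open>\<rho> < H\<close> i0(1)] poly_eval_lin using x1[of \<rho>] vl by simp
  qed
  moreover have "mlker H (k+4) M v w"
    unfolding mlker_def
  proof (intro allI impI)
    fix t assume t: "t < k + 4"
    show "(\<Sum>\<rho><H. w \<rho> * poly_eval (M $$ (\<rho>,t)) v) = 0"
    proof (cases "t \<le> k")
      case True
      then show ?thesis using wP[OF True] M1 by (simp add: mult.commute)
    next
      case False
      then obtain j where j: "t = k + 1 + j" "j < 3" using t by (intro that[of "t - (k+1)"]) auto
      have "(\<Sum>\<rho><H. w \<rho> * poly_eval (M $$ (\<rho>,t)) v) = (\<Sum>\<rho><H. w \<rho> * (\<Sum>l\<le>k. \<alpha> \<rho> j l * x l))"
        using M2[OF _ j(2)] vl by (simp add: j(1) poly_eval_lin)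
      also have "\<dots> = (\<Sum>l\<le>k. (\<Sum>\<rho><H. w \<rho> * \<alpha> \<rho> j l) * x l)"
        unfolding sum_distrib_left sum_distrib_right by (subst sum.swap) (simp add: mult_ac)
      also have "\<dots> = 0" by (rule x2[OF j(2)])
      finally show ?thesis .
    qed
  qed
  ultimately obtain l where l: "l \<le> k" "(\<Sum>i<H. w i * (\<Sum>t<k+4. poly_eval (partial_deriv l (M $$ (i,t))) v * u t)) \<noteq> 0"
    using presented_key[OF pres v _ _ w(1)] by blast
  have "(\<Sum>i<H. w i * (\<Sum>t<k+4. poly_eval (partial_deriv l (M $$ (i,t))) v * u t)) = (\<Sum>i<H. w i * \<alpha> i i0 l)"
    unfolding u1 using M2[OF _ i0(1)] partial_deriv_lin[OF l(1)] by simp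
  also have "\<dots> = 0"
  proof (rule sum.neutral, rule ballI)
    fix \<rho> assume "\<rho> \<in> {..<H}"
    then show "w \<rho> * \<alpha> \<rho> i0 l = 0"
      using wB[of \<rho>] \<alpha>0[of \<rho> i0 l] by (cases "blk h \<rho> = i0") (auto simp: B_def)
  qed
  finally show False using l(2) by simp
qed

end

section \<open>Trilinear forms\<close>

text \<open>The second solution satisfies one more equation, the vanishing of a coordinate in which
  the first solution is nonzero; hence the bound \<open>card E + 2\<close>.\<close>

lemma kernel_plane:
  fixes M :: "'e \<Rightarrow> nat \<Rightarrow> 'a::field"
  assumes "finite E" "card E + 2 \<le> n"
  shows "\<exists>x1 x2. (\<forall>s t. s \<noteq> 0 \<or> t \<noteq> 0 \<longrightarrow> nz n (\<lambda>j. s * x1 j + t * x2 j)) \<and>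
    (\<forall>e\<in>E. (\<Sum>j<n. M e j * x1 j) = 0 \<and> (\<Sum>j<n. M e j * x2 j) = 0)"
proof -
  obtain x1 where x1: "nz n x1" "\<forall>e\<in>E. (\<Sum>j<n. M e j * x1 j) = 0"
    using kernel_nontrivial[OF assms(1), of n M] assms(2) by auto
  obtain a where a: "a < n" "x1 a \<noteq> 0" using x1(1) by (rule nzE)
  let ?M = "\<lambda>e j. case e of None \<Rightarrow> (if j = a then 1 else 0) | Some e \<Rightarrow> M e j"
  have "\<exists>x. nz n x \<and> (\<forall>e\<in>insert None (Some ` E). (\<Sum>j<n. ?M e j * x j) = 0)"
    using assms by (intro kernel_nontrivial) (auto simp: card_image card_insert_if)
  then obtain x2 where x2: "nz n x2" "\<forall>e\<in>insert None (Some ` E). (\<Sum>j<n. ?M e j * x2 j) = 0"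
    by blast
  have x2a: "x2 a = 0"
    using bspec[OF x2(2), of None] a(1) by (simp add: if_distrib[of "\<lambda>x. x * _"] cong: if_cong)
  have x2E: "\<forall>e\<in>E. (\<Sum>j<n. M e j * x2 j) = 0"
  proof
    fix e assume "e \<in> E"
    then show "(\<Sum>j<n. M e j * x2 j) = 0" using bspec[OF x2(2), of "Some e"] by simp
  qed
  obtain b where b: "b < n" "x2 b \<noteq> 0" using x2(1) by (rule nzE)
  have "nz n (\<lambda>j. s * x1 j + t * x2 j)" if "s \<noteq> 0 \<or> t \<noteq> 0" for s t
  proof (cases "s = 0")
    case True
    then show ?thesis using that b by (intro nzI[of b]) auto
  next
    case False
    then show ?thesis using a x2a by (intro nzI[of a]) auto
  qed
  then show ?thesis using x1(2) x2E by (intro exI[of _ x1] exI[of _ x2]) simp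
qed

lemma binary_quadratic_zero:
  fixes P Q R :: complex
  shows "\<exists>s t. (s \<noteq> 0 \<or> t \<noteq> 0) \<and> P * s\<^sup>2 + Q * s * t + R * t\<^sup>2 = 0"
proof (cases "P = 0")
  case True
  then show ?thesis by (intro exI[of _ 1] exI[of _ 0]) simp
next
  case False
  then have "degree [:R, Q, P:] \<noteq> 0" by simp
  then have "\<not> constant (poly [:R, Q, P:])" by (simp add: constant_degree)
  then obtain s where "poly [:R, Q, P:] s = 0" using fundamental_theorem_of_algebra by blast
  then show ?thesis by (intro exI[of _ s] exI[of _ 1]) (simp add: algebra_simps power2_eq_square)
qed

lemma dependent_pairs:
  fixes F0 F1 G0 G1 :: complex
  assumes "F0 * G1 = F1 * G0"
  shows "\<exists>a b. (a \<noteq> 0 \<or> b \<noteq> 0) \<and> a * F0 + b * F1 = 0 \<and> a * G0 + b * G1 = 0"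
proof (cases "F0 = 0 \<and> F1 = 0")
  case True
  show ?thesis
  proof (cases "G0 = 0 \<and> G1 = 0")
    case True2: True
    show ?thesis using True True2 by (intro exI[of _ 1] exI[of _ 1]) simp
  next
    case False
    show ?thesis using True False by (intro exI[of _ "- G1"] exI[of _ G0]) auto
  qed
next
  case False
  show ?thesis using False assms by (intro exI[of _ "- F1"] exI[of _ F0]) (auto simp: mult.commute)
qed

text \<open>Two curves of bidegree (1, 1) on P^1 x P^1 meet: the equations are linear in (a, b), and
  their determinant is a binary quadratic form in (s, t), which has a zero.\<close>

lemma bilinear_pair_zero:
  fixes f g :: "nat \<Rightarrow> nat \<Rightarrow> complex"
  obtains s t a b where "s \<noteq> 0 \<or> t \<noteq> 0" "a \<noteq> 0 \<or> b \<noteq> 0"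
    "s * a * f 0 0 + s * b * f 0 1 + t * a * f 1 0 + t * b * f 1 1 = 0"
    "s * a * g 0 0 + s * b * g 0 1 + t * a * g 1 0 + t * b * g 1 1 = 0"
proof -
  obtain s t where st: "s \<noteq> 0 \<or> t \<noteq> 0"
    "(f 0 0 * g 0 1 - f 0 1 * g 0 0) * s\<^sup>2 +
     (f 0 0 * g 1 1 + f 1 0 * g 0 1 - f 0 1 * g 1 0 - f 1 1 * g 0 0) * s * t +
     (f 1 0 * g 1 1 - f 1 1 * g 1 0) * t\<^sup>2 = 0"
    using binary_quadratic_zero[of "f 0 0 * g 0 1 - f 0 1 * g 0 0"
      "f 0 0 * g 1 1 + f 1 0 * g 0 1 - f 0 1 * g 1 0 - f 1 1 * g 0 0" "f 1 0 * g 1 1 - f 1 1 * g 1 0"] by blast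
  then have d: "(s * f 0 0 + t * f 1 0) * (s * g 0 1 + t * g 1 1) = (s * f 0 1 + t * f 1 1) * (s * g 0 0 + t * g 1 0)"
    by (simp add: algebra_simps power2_eq_square)
  obtain a b where ab: "a \<noteq> 0 \<or> b \<noteq> 0" "a * (s * f 0 0 + t * f 1 0) + b * (s * f 0 1 + t * f 1 1) = 0"
    "a * (s * g 0 0 + t * g 1 0) + b * (s * g 0 1 + t * g 1 1) = 0"
    using dependent_pairs[OF d] by blast
  show ?thesis
    by (rule that[OF st(1) ab(1)]) (use ab(2,3) in \<open>simp_all add: algebra_simps\<close>)
qed

section \<open>Contractions of a coefficient tensor\<close>

type_synonym tensor = "nat \<Rightarrow> nat \<Rightarrow> nat \<Rightarrow> complex"

definition ue :: "nat \<Rightarrow> nat \<Rightarrow> complex" where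
  "ue i i' = (if i' = i then 1 else 0)"

text \<open>The expression w A(x) y for the (c+2) x 3 matrix A(x). Reading it with y as the variable
  gives the second matrix of linear forms, whose degeneracy points are studied later.\<close>

definition tri :: "nat \<Rightarrow> nat \<Rightarrow> tensor \<Rightarrow> (nat \<Rightarrow> complex) \<Rightarrow> (nat \<Rightarrow> complex) \<Rightarrow> (nat \<Rightarrow> complex) \<Rightarrow> complex" where
  "tri m r \<alpha> w y x = (\<Sum>i<m. \<Sum>j<3. \<Sum>l<r. \<alpha> i j l * w i * y j * x l)"

lemma tri_add:
  "tri m r \<alpha> (\<lambda>i. w i + w' i) y x = tri m r \<alpha> w y x + tri m r \<alpha> w' y x"
  "tri m r \<alpha> w (\<lambda>i. y i + y' i) x = tri m r \<alpha> w y x + tri m r \<alpha> w y' x"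
  "tri m r \<alpha> w y (\<lambda>i. x i + x' i) = tri m r \<alpha> w y x + tri m r \<alpha> w y x'"
  by (simp_all only: tri_def distrib_left distrib_right sum.distrib)

lemma tri_scale:
  "tri m r \<alpha> (\<lambda>i. s * w i) y x = s * tri m r \<alpha> w y x"
  "tri m r \<alpha> w (\<lambda>i. s * y i) x = s * tri m r \<alpha> w y x"
  "tri m r \<alpha> w y (\<lambda>i. s * x i) = s * tri m r \<alpha> w y x"
  by (simp_all add: tri_def sum_distrib_left mult_ac)

lemma tri_expand:
  "tri m r \<alpha> w y x = (\<Sum>i<m. w i * tri m r \<alpha> (ue i) y x)"
  "tri m r \<alpha> w y x = (\<Sum>j<3. y j * tri m r \<alpha> w (ue j) x)"
  "tri m r \<alpha> w y x = (\<Sum>l<r. x l * tri m r \<alpha> w y (ue l))"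
proof -
  have 1: "tri m r \<alpha> (ue i) y x = (\<Sum>j<3. \<Sum>l<r. \<alpha> i j l * y j * x l)" if "i < m" for i
  proof -
    have "tri m r \<alpha> (ue i) y x = (\<Sum>i'<m. if i' = i then (\<Sum>j<3. \<Sum>l<r. \<alpha> i j l * y j * x l) else 0)"
      unfolding tri_def by (intro sum.cong refl) (auto simp: ue_def)
    then show ?thesis using that by simp
  qed
  show "tri m r \<alpha> w y x = (\<Sum>i<m. w i * tri m r \<alpha> (ue i) y x)"
    unfolding tri_def[of m r \<alpha> w] by (intro sum.cong refl) (simp add: 1 sum_distrib_left mult_ac)
  have 2: "tri m r \<alpha> w (ue j) x = (\<Sum>i<m. \<Sum>l<r. \<alpha> i j l * w i * x l)" if "j < 3" for j
  proof -
    have "tri m r \<alpha> w (ue j) x = (\<Sum>i<m. \<Sum>j'<3. if j' = j then (\<Sum>l<r. \<alpha> i j l * w i * x l) else 0)"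
      unfolding tri_def by (intro sum.cong refl) (auto simp: ue_def)
    then show ?thesis using that by simp
  qed
  show "tri m r \<alpha> w y x = (\<Sum>j<3. y j * tri m r \<alpha> w (ue j) x)"
  proof -
    have "tri m r \<alpha> w y x = (\<Sum>j<3. \<Sum>i<m. \<Sum>l<r. \<alpha> i j l * w i * y j * x l)"
      unfolding tri_def by (rule sum.swap)
    also have "\<dots> = (\<Sum>j<3. y j * tri m r \<alpha> w (ue j) x)"
      by (intro sum.cong refl) (simp add: 2 sum_distrib_left mult_ac)
    finally show ?thesis .
  qed
  have 3: "tri m r \<alpha> w y (ue l) = (\<Sum>i<m. \<Sum>j<3. \<alpha> i j l * w i * y j)" if "l < r" for l
  proof -
    have "tri m r \<alpha> w y (ue l) = (\<Sum>i<m. \<Sum>j<3. \<Sum>l'<r. if l' = l then \<alpha> i j l * w i * y j else 0)"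
      unfolding tri_def by (intro sum.cong refl) (auto simp: ue_def)
    then show ?thesis using that by simp
  qed
  show "tri m r \<alpha> w y x = (\<Sum>l<r. x l * tri m r \<alpha> w y (ue l))"
  proof -
    have "(\<Sum>l<r. x l * tri m r \<alpha> w y (ue l)) = (\<Sum>l<r. \<Sum>i<m. \<Sum>j<3. \<alpha> i j l * w i * y j * x l)"
      by (intro sum.cong refl) (simp add: 3 sum_distrib_left sum_distrib_right mult_ac)
    also have "\<dots> = (\<Sum>i<m. \<Sum>l<r. \<Sum>j<3. \<alpha> i j l * w i * y j * x l)"
      by (rule sum.swap)
    also have "\<dots> = tri m r \<alpha> w y x"
      unfolding tri_def by (intro sum.cong[OF refl]) (rule sum.swap)
    finally show ?thesis by simp
  qed
qed

lemma tri_zero_iff: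
  "(\<forall>i<m. tri m r \<alpha> (ue i) y x = 0) \<longleftrightarrow> (\<forall>w. tri m r \<alpha> w y x = 0)"
  "(\<forall>j<3. tri m r \<alpha> w (ue j) x = 0) \<longleftrightarrow> (\<forall>y. tri m r \<alpha> w y x = 0)"
  "(\<forall>l<r. tri m r \<alpha> w y (ue l) = 0) \<longleftrightarrow> (\<forall>x. tri m r \<alpha> w y x = 0)"
proof -
  show "(\<forall>i<m. tri m r \<alpha> (ue i) y x = 0) \<longleftrightarrow> (\<forall>w. tri m r \<alpha> w y x = 0)"
  proof (intro iffI allI)
    fix w assume "\<forall>i<m. tri m r \<alpha> (ue i) y x = 0"
    then show "tri m r \<alpha> w y x = 0" unfolding tri_expand(1)[of m r \<alpha> w] by (intro sum.neutral) simp
  qed simp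
  show "(\<forall>j<3. tri m r \<alpha> w (ue j) x = 0) \<longleftrightarrow> (\<forall>y. tri m r \<alpha> w y x = 0)"
  proof (intro iffI allI)
    fix y assume "\<forall>j<3. tri m r \<alpha> w (ue j) x = 0"
    then show "tri m r \<alpha> w y x = 0" unfolding tri_expand(2)[of m r \<alpha> w y] by (intro sum.neutral) simp
  qed simp
  show "(\<forall>l<r. tri m r \<alpha> w y (ue l) = 0) \<longleftrightarrow> (\<forall>x. tri m r \<alpha> w y x = 0)"
  proof (intro iffI allI)
    fix x assume "\<forall>l<r. tri m r \<alpha> w y (ue l) = 0"
    then show "tri m r \<alpha> w y x = 0" unfolding tri_expand(3)[of m r \<alpha> w y x] by (intro sum.neutral) simp
  qed simp
qed

lemma tri_ue:
  assumes "i < m" "j < 3" "l < r"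
  shows "tri m r \<alpha> (ue i) (ue j) (ue l) = \<alpha> i j l"
proof -
  have e: "\<alpha> i' j' l' * ue i i' * ue j j' * ue l l' = (if l' = l then (if j' = j then (if i' = i then \<alpha> i j l else 0) else 0) else 0)"
    for i' j' l' by (simp add: ue_def)
  show ?thesis unfolding tri_def e using assms by (simp only: sum.delta finite_lessThan lessThan_iff if_True)
qed

definition tmat :: "nat \<Rightarrow> nat \<Rightarrow> tensor \<Rightarrow> cpoly mat" where
  "tmat m r \<alpha> = mat m 3 (\<lambda>(i,j). \<Sum>l<r. Const (\<alpha> i j l) * Var l)"

lemma tmat_eval:
  assumes "i < m" "j < 3" "\<And>l. l < r \<Longrightarrow> v $ l = x l"
  shows "poly_eval (tmat m r \<alpha> $$ (i,j)) v = tri m r \<alpha> (ue i) (ue j) x"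
proof -
  have "tri m r \<alpha> (ue i) (ue j) x = (\<Sum>l<r. x l * \<alpha> i j l)"
    unfolding tri_expand(3)[of m r \<alpha> "ue i" "ue j" x] using assms by (simp add: tri_ue)
  then show ?thesis using assms by (simp add: tmat_def ev.hom_sum ev.hom_mult mult.commute)
qed

lemma lessThan_3: "{..<3::nat} = {0,1,2}"
  by auto

lemma other_two:
  assumes "p < (3::nat)"
  shows "\<exists>a b. a < 3 \<and> b < 3 \<and> a \<noteq> b \<and> a \<noteq> p \<and> b \<noteq> p \<and> {..<3} = {p,a,b}"
proof -
  consider "p = 0" | "p = 1" | "p = 2" using assms by linarith
  then show ?thesis
  proof cases
    case 1
    then show ?thesis by (intro exI[of _ 1] exI[of _ 2]) auto
  next
    case 2
    then show ?thesis by (intro exI[of _ 0] exI[of _ 2]) auto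
  next
    case 3
    then show ?thesis by (intro exI[of _ 0] exI[of _ 1]) auto
  qed
qed

lemma third_index:
  assumes "j < (3::nat)" "j' < 3" "j \<noteq> j'"
  shows "\<exists>a. a < 3 \<and> {..<3} = {a,j,j'} \<and> a \<noteq> j \<and> a \<noteq> j'"
proof -
  obtain a b where ab: "a < 3" "b < 3" "a \<noteq> b" "a \<noteq> j" "b \<noteq> j" "{..<3} = {j,a,b}"
    using other_two[OF assms(1)] by blast
  have "j' \<in> {j,a,b}" using ab(6) assms(2) by blast
  then consider "j' = a" | "j' = b" using assms(3) by blast
  then show ?thesis
  proof cases
    case 1
    have "{..<3} = {b,j,j'}" using ab(6) 1 by blast
    then show ?thesis using 1 ab by (intro exI[of _ b]) simp
  next
    case 2
    have "{..<3} = {a,j,j'}" using ab(6) 2 by blast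
    then show ?thesis using 2 ab by (intro exI[of _ a]) simp
  qed
qed

text \<open>Here the ideal of X is the ideal of minors itself, not only up to saturation. The bound
  \<open>kc\<close> follows from k \<ge> 2c and c \<ge> 1.\<close>

locale det_tensor = smooth_codim k c X fs for k c X fs +
  fixes \<alpha> :: tensor
  assumes ideal: "vanishing_ideal k X = Idl\<^bsub>coord_ring k\<^esub> (maximal_minors (tmat (c + 2) (k + 1) \<alpha>))"
    and kc: "k \<ge> c + 1"
begin

abbreviation tr where "tr \<equiv> tri (c + 2) (k + 1) \<alpha>"

lemma tmat_polys: "i < c + 2 \<Longrightarrow> j < 3 \<Longrightarrow> tmat (c + 2) (k + 1) \<alpha> $$ (i,j) \<in> forms k 1"
  using forms_Const_mult[OF forms_Var[of _ k]] by (auto simp: tmat_def intro!: forms_sum simp del: sum.lessThan_Suc)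

lemma presented_tmat: "presented (tmat (c + 2) (k + 1) \<alpha>) (c + 2) 3"
  unfolding presented_def same_subscheme_def ideal
proof (intro conjI allI impI refl)
  show "tmat (c + 2) (k + 1) \<alpha> \<in> carrier_mat (c + 2) 3" by (simp add: tmat_def)
  show "tmat (c + 2) (k + 1) \<alpha> $$ (i,j) \<in> polys k" if "i < c + 2" "j < 3" for i j
    using tmat_polys[OF that] by (rule forms_polys)
  have "pideal k (vanishing_ideal k X)" by (rule pideal_vanishing)
qed auto

lemma mker_tmat:
  "mker (c + 2) 3 (tmat (c + 2) (k + 1) \<alpha>) (vec (k + 1) x) y \<longleftrightarrow> (\<forall>w. tr w y x = 0)"
proof -
  have "(\<Sum>j<3. poly_eval (tmat (c + 2) (k + 1) \<alpha> $$ (i,j)) (vec (k + 1) x) * y j) = tr (ue i) y x" if "i < c + 2" for i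
    unfolding tri_expand(2)[of _ _ _ "ue i" y] using that by (intro sum.cong refl) (simp add: tmat_eval[where x = x])
  then have "mker (c + 2) 3 (tmat (c + 2) (k + 1) \<alpha>) (vec (k + 1) x) y \<longleftrightarrow> (\<forall>i<c+2. tr (ue i) y x = 0)"
    by (simp add: mker_def)
  also have "\<dots> \<longleftrightarrow> (\<forall>w. tr w y x = 0)" by (rule tri_zero_iff)
  finally show ?thesis .
qed

lemma mlker_tmat:
  "mlker (c + 2) 3 (tmat (c + 2) (k + 1) \<alpha>) (vec (k + 1) x) w \<longleftrightarrow> (\<forall>y. tr w y x = 0)"
proof -
  have "(\<Sum>i<c+2. w i * poly_eval (tmat (c + 2) (k + 1) \<alpha> $$ (i,j)) (vec (k + 1) x)) = tr w (ue j) x" if "j < 3" for j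
    unfolding tri_expand(1)[of _ _ _ w "ue j"] using that by (intro sum.cong refl) (simp add: tmat_eval[where x = x])
  then have "mlker (c + 2) 3 (tmat (c + 2) (k + 1) \<alpha>) (vec (k + 1) x) w \<longleftrightarrow> (\<forall>j<3. tr w (ue j) x = 0)"
    by (simp add: mlker_def)
  also have "\<dots> \<longleftrightarrow> (\<forall>y. tr w y x = 0)" by (rule tri_zero_iff)
  finally show ?thesis .
qed

text \<open>The entries are linear in x, so differentiating with respect to x_j is contracting with
  \<open>ue j\<close>; such a unit vector is the witness \<open>x'\<close>.\<close>

lemma tri_key:
  assumes "nz (k+1) x" "nz 3 y" "nz (c+2) w" "\<And>w'. tr w' y x = 0" "\<And>y'. tr w y' x = 0"
  shows "\<exists>x'. tr w y x' \<noteq> 0"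
proof -
  obtain j where j: "j \<le> k" "(\<Sum>i<c+2. w i * (\<Sum>t<3. poly_eval (partial_deriv j (tmat (c + 2) (k + 1) \<alpha> $$ (i,t))) (vec (k+1) x) * y t)) \<noteq> 0"
    using presented_key[OF presented_tmat vec_proj_space[OF assms(1)] assms(2) _ assms(3)] assms(4,5)
    unfolding mker_tmat mlker_tmat by blast
  have "(\<Sum>i<c+2. w i * (\<Sum>t<3. poly_eval (partial_deriv j (tmat (c + 2) (k + 1) \<alpha> $$ (i,t))) (vec (k+1) x) * y t))
    = (\<Sum>i<c+2. w i * (\<Sum>t<3. y t * tr (ue i) (ue t) (ue j)))"
  proof -
    have e: "poly_eval (partial_deriv j (tmat (c + 2) (k + 1) \<alpha> $$ (i,t))) (vec (k+1) x) * y t = y t * tr (ue i) (ue t) (ue j)"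
      if it: "i < c + 2" "t < 3" for i t
    proof -
      have "tmat (c + 2) (k + 1) \<alpha> $$ (i,t) = (\<Sum>l\<le>k. Const (\<alpha> i t l) * Var l)"
        using it by (simp add: tmat_def lessThan_Suc_atMost)
      moreover have "tr (ue i) (ue t) (ue j) = \<alpha> i t j" using it j(1) by (intro tri_ue) auto
      ultimately show ?thesis using partial_deriv_lin[OF j(1)] by simp
    qed
    show ?thesis
      by (rule sum.cong[OF refl], rule arg_cong[of _ _ "\<lambda>z. _ * z"], rule sum.cong[OF refl], rule e) auto
  qed
  also have "\<dots> = tr w y (ue j)"
    by (simp only: tri_expand(2)[of _ _ _ "ue _" y, symmetric] tri_expand(1)[of _ _ _ w, symmetric])
  finally show ?thesis using j(2) by (intro exI[of _ "ue j"]) simp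
qed

lemma tri_kernel_unique:
  assumes "nz (k+1) x" "\<And>w. tr w y x = 0" "\<And>w. tr w y' x = 0" "s < 3" "y s \<noteq> 0" "nz 3 y'"
  shows "y' s \<noteq> 0"
proof
  assume "y' s = 0"
  then show False
    using presented_kernel_unique[OF presented_tmat vec_proj_space[OF assms(1)], of s y y'] assms
    unfolding mker_tmat by blast
qed

lemma kernel_in_X_iff:
  assumes "nz (k+1) x" "nz 3 y" "\<And>w. tr w y x = 0"
  shows "vec (k+1) x \<in> X"
  using kernel_in_X[OF presented_tmat vec_proj_space[OF assms(1)] assms(2)] assms(3) unfolding mker_tmat by blast

text \<open>Given two independent vectors that annihilate the matrix contracted with \<open>y\<close>, a pencil in
  the kernel contains a point at which a combination of them annihilates the whole matrix.\<close>

lemma left_kernel_unique: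
  assumes y: "nz 3 y" and w: "i < c + 2" "w i \<noteq> 0" "\<And>x. tr w y x = 0"
    and w': "\<And>x. tr w' y x = 0" "nz (c+2) w'"
  shows "w' i \<noteq> 0"
proof
  assume w'i: "w' i = 0"
  obtain p where p: "p < 3" "y p \<noteq> 0" using y by (rule nzE)
  obtain i' where i': "i' < c + 2" "w' i' \<noteq> 0" using w'(2) by (rule nzE)
  then have ii: "i' \<noteq> i" using w'i by auto
  \<comment> \<open>Without rows \<open>i\<close> and \<open>i'\<close> there are \<open>c\<close>
    equations in k + 1 \<ge> c + 2 unknowns, hence a plane of solutions.\<close>
  have "finite ({..<c+2} - {i,i'})" "card ({..<c+2} - {i,i'}) + 2 \<le> k + 1"
    using kc w(1) i'(1) ii by (auto simp: card_Diff_subset)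
  then obtain x1 x2 where x12: "\<forall>s t. s \<noteq> 0 \<or> t \<noteq> 0 \<longrightarrow> nz (k+1) (\<lambda>j. s * x1 j + t * x2 j)"
    "\<forall>e\<in>{..<c+2} - {i,i'}. (\<Sum>j<k+1. tr (ue e) y (ue j) * x1 j) = 0 \<and> (\<Sum>j<k+1. tr (ue e) y (ue j) * x2 j) = 0"
    using kernel_plane[of "{..<c+2} - {i,i'}" "k+1" "\<lambda>e j. tr (ue e) y (ue j)"] by auto
  \<comment> \<open>The two omitted rows follow: as \<open>w' i = 0\<close>, the relation
    \<open>w'\<close> expresses row \<open>i'\<close> by the others, and then \<open>w\<close>
    expresses row \<open>i\<close>.\<close>
  have ker: "tr v y x = 0" if x: "\<forall>e\<in>{..<c+2} - {i,i'}. (\<Sum>j<k+1. tr (ue e) y (ue j) * x j) = 0" for v x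
  proof -
    have e: "tr (ue e) y x = 0" if "e \<in> {..<c+2} - {i,i'}" for e
      using bspec[OF x that] by (simp add: tri_expand(3)[of _ _ _ "ue e" y x] mult.commute)
    have "(\<Sum>e<c+2. u e * tr (ue e) y x) = u i * tr (ue i) y x + u i' * tr (ue i') y x" for u
    proof -
      have "(\<Sum>e<c+2. u e * tr (ue e) y x) = (\<Sum>e\<in>{i,i'}. u e * tr (ue e) y x)"
        using e w(1) i'(1) by (intro sum.mono_neutral_right) auto
      then show ?thesis using ii by simp
    qed
    then have u: "tr u y x = u i * tr (ue i) y x + u i' * tr (ue i') y x" for u
      unfolding tri_expand(1)[of _ _ _ u y x] .
    have "tr (ue i') y x = 0" using u[of w'] w'(1) w'i i'(2) by simp
    moreover from this have "tr (ue i) y x = 0" using u[of w] w by simp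
    ultimately show ?thesis using u[of v] by simp
  qed
  have k1: "tr v y x1 = 0" for v by (rule ker) (use x12(2) in blast)
  have k2: "tr v y x2 = 0" for v by (rule ker) (use x12(2) in blast)
  obtain a b where ab: "a < 3" "b < 3" "a \<noteq> b" "a \<noteq> p" "b \<noteq> p" "{..<3} = {p,a,b}"
    using other_two[OF p(1)] by blast
  let ?x = "\<lambda>l. if l = 0 then x1 else x2" and ?w = "\<lambda>l. if l = 0 then w else w'"
  \<comment> \<open>Only columns \<open>a\<close> and \<open>b\<close> have to be annihilated:
    column \<open>p\<close> then follows from the contraction with \<open>y\<close>, as y_p \<noteq>
    0.\<close>
  obtain s t u v where st: "s \<noteq> 0 \<or> t \<noteq> 0" "u \<noteq> 0 \<or> v \<noteq> 0"
    "s * u * tr w (ue a) x1 + s * v * tr w' (ue a) x1 + t * u * tr w (ue a) x2 + t * v * tr w' (ue a) x2 = 0"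
    "s * u * tr w (ue b) x1 + s * v * tr w' (ue b) x1 + t * u * tr w (ue b) x2 + t * v * tr w' (ue b) x2 = 0"
    by (rule bilinear_pair_zero[of "\<lambda>l r. tr (?w r) (ue a) (?x l)" "\<lambda>l r. tr (?w r) (ue b) (?x l)"]) auto
  define x where "x = (\<lambda>j. s * x1 j + t * x2 j)"
  define W where "W = (\<lambda>j. u * w j + v * w' j)"
  have x: "nz (k+1) x" using x12(1) st(1) by (simp add: x_def)
  have W: "nz (c+2) W"
  proof (cases "u = 0")
    case True
    then show ?thesis using st(2) i' by (intro nzI[of i']) (auto simp: W_def)
  next
    case False
    then show ?thesis using w w'i by (intro nzI[of i]) (auto simp: W_def)
  qed
  have 1: "tr z y x = 0" for z using k1 k2 by (simp add: x_def tri_add tri_scale)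
  have 2: "tr W y x' = 0" for x' using w(3) w'(1) by (simp add: W_def tri_add tri_scale)
  have a0: "tr W (ue a) x = 0" and b0: "tr W (ue b) x = 0"
    using st(3,4) by (simp_all add: W_def x_def tri_add tri_scale algebra_simps)
  have exp: "tr W z x = z p * tr W (ue p) x" for z
    unfolding tri_expand(2)[of _ _ _ W z x] ab(6) using ab(1-5) a0 b0 by simp
  have "tr W (ue p) x = 0" using exp[of y] 1[of W] p(2) by simp
  then have "tr W z x = 0" for z using exp[of z] by simp
  then show False using tri_key[OF x y W 1] 2 by blast
qed

text \<open>If one \<open>w\<close> killed both columns, it would kill the contraction with every y
  in their span. It is then enough to find such a nonzero y and an x with A(x) y = 0 and w A(x) = 0,
  contrary to \<open>tri_key\<close>. For k \<ge> c + 2 the choice of the unit vector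
  \<open>ue j\<close> works; in the remaining case k = 2 the freedom in y is used as well.\<close>

lemma left_kernels_distinct:
  assumes kc': "k \<ge> c + 2 \<or> c = 1"
    and j: "j < 3" "j' < 3" "j \<noteq> j'" and w: "\<And>x. tr w (ue j) x = 0" "\<And>x. tr w (ue j') x = 0"
  shows "\<not> nz (c+2) w"
proof
  assume nw: "nz (c+2) w"
  obtain i where i: "i < c + 2" "w i \<noteq> 0" using nw by (rule nzE)
  obtain a where a: "a < 3" "{..<3} = {a,j,j'}" "a \<noteq> j" "a \<noteq> j'"
    using third_index[OF j] by blast
  \<comment> \<open>Row \<open>i\<close> of A(x) y comes for free from w A(x) y = 0, and w A(x) has
    to be tested on the third column only.\<close>
  have fin: False if x: "nz (k+1) x" and y: "s \<noteq> 0 \<or> t \<noteq> 0" and l: "tr w (ue a) x = 0"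
    and e: "\<And>e. e < c + 2 \<Longrightarrow> e \<noteq> i \<Longrightarrow> tr (ue e) (\<lambda>b. s * ue j b + t * ue j' b) x = 0" for x s t
  proof -
    let ?y = "\<lambda>b. s * ue j b + t * ue j' b"
    have y': "nz 3 ?y"
    proof (cases "s = 0")
      case True
      then show ?thesis using y j by (intro nzI[of j']) (auto simp: ue_def)
    next
      case False
      then show ?thesis using j by (intro nzI[of j]) (auto simp: ue_def)
    qed
    have wy: "tr w ?y x' = 0" for x' using w by (simp add: tri_add tri_scale)
    have "(\<Sum>e<c+2. u e * tr (ue e) ?y x) = u i * tr (ue i) ?y x" for u
    proof -
      have "(\<Sum>e<c+2. u e * tr (ue e) ?y x) = (\<Sum>e\<in>{i}. u e * tr (ue e) ?y x)"
        using e i(1) by (intro sum.mono_neutral_right) auto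
      then show ?thesis by simp
    qed
    then have u: "tr u ?y x = u i * tr (ue i) ?y x" for u
      unfolding tri_expand(1)[of _ _ _ u ?y x] .
    have "tr (ue i) ?y x = 0" using u[of w] wy i by simp
    then have 1: "tr u ?y x = 0" for u using u[of u] by simp
    have 2: "tr w z x = 0" for z
      unfolding tri_expand(2)[of _ _ _ w z x] a(2) using a j(3) w l by simp
    show False using tri_key[OF x y' nw 1 2] wy by blast
  qed
  show False
  proof (cases "k \<ge> c + 2")
    case True
    \<comment> \<open>The c + 1 rows other than \<open>i\<close> and the third column: c + 2 < k + 1
      conditions.\<close>
    define E where "E = insert None (Some ` ({..<c+2} - {i}))"
    define M where "M e l = (case e of None \<Rightarrow> tr w (ue a) (ue l) | Some e \<Rightarrow> tr (ue e) (ue j) (ue l))" for e l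
    have "finite E" "card E < k + 1" using True i(1) by (auto simp: E_def card_image card_insert_if)
    then obtain x where x: "nz (k+1) x" "\<forall>e\<in>E. (\<Sum>l<k+1. M e l * x l) = 0"
      using kernel_nontrivial[of E "k+1" M] by auto
    have "tr w (ue a) x = 0"
      using bspec[OF x(2), of None] by (simp add: E_def M_def tri_expand(3)[of _ _ _ w _ x] mult.commute)
    moreover have "tr (ue e) (ue j) x = 0" if "e < c + 2" "e \<noteq> i" for e
      using bspec[OF x(2), of "Some e"] that
      by (simp add: E_def M_def tri_expand(3)[of _ _ _ "ue e" _ x] mult.commute)
    ultimately show False using fin[of x 1 0] x(1) by simp
  next
    case False
    then have c: "c = 1" using kc' by simp
    obtain r r' where r: "{..<3} = {i,r,r'}"
      using other_two[of i] i(1) c by auto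
    obtain x1 x2 where x12: "\<forall>s t. s \<noteq> 0 \<or> t \<noteq> 0 \<longrightarrow> nz (k+1) (\<lambda>j. s * x1 j + t * x2 j)"
      "\<forall>e\<in>{()}. (\<Sum>l<k+1. tr w (ue a) (ue l) * x1 l) = 0 \<and> (\<Sum>l<k+1. tr w (ue a) (ue l) * x2 l) = 0"
      using kernel_plane[of "{()}" "k+1" "\<lambda>e l. tr w (ue a) (ue l)"] kc c by auto
    \<comment> \<open>A pencil of points x at which \<open>w\<close> kills the third column, the
      pencil of y, and two bilinear equations from the remaining rows.\<close>
    let ?x = "\<lambda>l. if l = 0 then x1 else x2" and ?j = "\<lambda>l. if l = 0 then j else j'"
    obtain s t u v where st: "s \<noteq> 0 \<or> t \<noteq> 0" "u \<noteq> 0 \<or> v \<noteq> 0"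
      "s * u * tr (ue r) (ue j) x1 + s * v * tr (ue r) (ue j') x1 + t * u * tr (ue r) (ue j) x2 + t * v * tr (ue r) (ue j') x2 = 0"
      "s * u * tr (ue r') (ue j) x1 + s * v * tr (ue r') (ue j') x1 + t * u * tr (ue r') (ue j) x2 + t * v * tr (ue r') (ue j') x2 = 0"
      by (rule bilinear_pair_zero[of "\<lambda>l b. tr (ue r) (ue (?j b)) (?x l)" "\<lambda>l b. tr (ue r') (ue (?j b)) (?x l)"]) auto
    define x where "x = (\<lambda>j. s * x1 j + t * x2 j)"
    show False
    proof (rule fin[of x u v])
      show "nz (k+1) x" using x12(1) st(1) by (simp add: x_def)
      show "u \<noteq> 0 \<or> v \<noteq> 0" by (rule st(2))
      have "tr w (ue a) x1 = 0" "tr w (ue a) x2 = 0"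
        using x12(2) by (simp_all add: tri_expand(3)[of _ _ _ w "ue a" x1] tri_expand(3)[of _ _ _ w "ue a" x2] mult.commute)
      then show "tr w (ue a) x = 0" by (simp add: x_def tri_add tri_scale)
      fix e assume "e < c + 2" "e \<noteq> i"
      then have "e \<in> {i,r,r'}" unfolding r[symmetric] using c by simp
      then have "e = r \<or> e = r'" using \<open>e \<noteq> i\<close> by blast
      then show "tr (ue e) (\<lambda>b. u * ue j b + v * ue j' b) x = 0"
        using st(3,4) by (auto simp: x_def tri_add tri_scale algebra_simps)
    qed
  qed
qed

end

section \<open>Ideals of maximal minors\<close>

abbreviation minors_ideal :: "nat \<Rightarrow> cpoly mat \<Rightarrow> cpoly set" where
  "minors_ideal k M \<equiv> Idl\<^bsub>coord_ring k\<^esub> (maximal_minors M)"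

text \<open>Rows chosen by a function, in any order and possibly repeated, as they arise when a
  product of matrices is expanded by multilinearity; the determinant is a maximal minor up to sign,
  or 0.\<close>

definition select_rows :: "nat \<Rightarrow> 'a mat \<Rightarrow> (nat \<Rightarrow> nat) \<Rightarrow> 'a mat" where
  "select_rows n M f = mat n n (\<lambda>(i,j). M $$ (f i, j))"

lemma det_select_rows:
  fixes M :: "'a::comm_ring_1 mat"
  assumes M: "M \<in> carrier_mat m n" and f: "bij_betw f {0..<n} R" "R \<subseteq> {..<m}"
  shows "det (select_rows n M f) = det (submatrix M R UNIV) \<or> det (select_rows n M f) = - det (submatrix M R UNIV)"
proof -
  have cR: "card R = n" using bij_betw_same_card[OF f(1)] by simp
  have fin: "finite R" using f(2) finite_subset by blast
  note N = submatrix_rows[OF M f(2) cR]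
  define p where "p i = (if i < n then card {a\<in>R. a < f i} else i)" for i
  have fR: "f i \<in> R" if "i < n" for i using bij_betwE[OF f(1)] that by simp
  have pick: "pick R (p i) = f i" if "i < n" for i
    using pick_card_in_set[OF fR[OF that]] that by (simp add: p_def)
  have pn: "p i < n" if "i < n" for i
  proof -
    have "{a\<in>R. a < f i} \<subset> R" using fR[OF that] by blast
    then show ?thesis using psubset_card_mono[OF fin] that cR by (simp add: p_def)
  qed
  have "inj_on p {0..<n}"
  proof (rule inj_onI)
    fix i j assume ij: "i \<in> {0..<n}" "j \<in> {0..<n}" "p i = p j"
    then have "f i = f j" using pick[of i] pick[of j] by simp
    then show "i = j" using f(1) ij by (meson bij_betw_imp_inj_on inj_onD)
  qed
  then have "bij_betw p {0..<n} {0..<n}"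
    using pn by (intro bij_betw_imageI endo_inj_surj) auto
  then have p: "p permutes {0..<n}" by (rule bij_imp_permutes) (simp add: p_def)
  have "select_rows n M f = mat n n (\<lambda>(i,j). submatrix M R UNIV $$ (p i, j))"
    unfolding select_rows_def using N(2) pn pick by (intro eq_matI) auto
  then have "det (select_rows n M f) = signof p * det (submatrix M R UNIV)"
    using det_permute_rows[OF N(1) p] by simp
  then show ?thesis by (simp add: sign_def split: if_splits)
qed

lemma select_rows_ideal:
  assumes M: "M \<in> carrier_mat m n" and Mp: "\<And>i j. i < m \<Longrightarrow> j < n \<Longrightarrow> M $$ (i,j) \<in> polys k"
    and f: "\<And>i. i < n \<Longrightarrow> f i < m"
  shows "det (select_rows n M f) \<in> minors_ideal k M"
proof -
  have mp: "maximal_minors M \<subseteq> polys k" by (rule maximal_minors_polys[OF M Mp])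
  note I = pideal_Idl[OF mp]
  show ?thesis
  proof (cases "inj_on f {0..<n}")
    case True
    define R where "R = f ` {0..<n}"
    have R: "bij_betw f {0..<n} R" "R \<subseteq> {..<m}" using True f by (auto simp: R_def bij_betw_def)
    have cR: "card R = n" using bij_betw_same_card[OF R(1)] by simp
    have "det (submatrix M R UNIV) \<in> maximal_minors M"
      unfolding maximal_minors_def using M R(2) cR by auto
    then have "det (submatrix M R UNIV) \<in> minors_ideal k M" using I(2) by blast
    then show ?thesis using det_select_rows[OF M R] pidealD(5)[OF I(1)] by metis
  next
    case False
    then obtain i j where ij: "i < n" "j < n" "i \<noteq> j" "f i = f j" by (auto simp: inj_on_def)
    have "det (select_rows n M f) = 0"
      by (rule det_identical_rows[of _ n i j]) (use ij in \<open>auto simp: select_rows_def intro!: eq_vecI\<close>)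
    then show ?thesis using pidealD(2)[OF I(1)] by simp
  qed
qed

text \<open>A weak form of the Cauchy-Binet formula: the rows of E M are combinations of rows of M,
  and multilinearity expresses the determinant through row selections.\<close>

lemma det_mult_ideal:
  assumes M: "M \<in> carrier_mat m n" and Mp: "\<And>i j. i < m \<Longrightarrow> j < n \<Longrightarrow> M $$ (i,j) \<in> polys k"
    and E: "E \<in> carrier_mat n m" and Ep: "\<And>i j. i < n \<Longrightarrow> j < m \<Longrightarrow> E $$ (i,j) \<in> polys k"
  shows "det (E * M) \<in> minors_ideal k M"
proof -
  have mp: "maximal_minors M \<subseteq> polys k" by (rule maximal_minors_polys[OF M Mp])
  note I = pideal_Idl(1)[OF mp]
  have rM: "row M l \<in> carrier_vec n" for l using M by (auto intro: carrier_vecI)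
  have "det (E * M) = det (mat\<^sub>r n n (\<lambda>i. finsum_vec TYPE(cpoly) n (\<lambda>l. E $$ (i,l) \<cdot>\<^sub>v row M l) {0..<m}))"
    using mat_mul_finsum_alt[OF E M] by simp
  also have "\<dots> = (\<Sum>f\<in>{f. (\<forall>i\<in>{0..<n}. f i \<in> {0..<m}) \<and> (\<forall>i. i \<notin> {0..<n} \<longrightarrow> f i = i)}.
      det (mat\<^sub>r n n (\<lambda>i. E $$ (i, f i) \<cdot>\<^sub>v row M (f i))))"
    by (rule det_linear_rows_sum) (use rM in auto)
  also have "\<dots> \<in> minors_ideal k M"
  proof (rule pideal_sum[OF I])
    fix f assume f: "f \<in> {f. (\<forall>i\<in>{0..<n}. f i \<in> {0..<m}) \<and> (\<forall>i. i \<notin> {0..<n} \<longrightarrow> f i = i)}"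
    have "mat\<^sub>r n n (\<lambda>i. row M (f i)) = select_rows n M f"
      unfolding select_rows_def using f M by (intro eq_matI) auto
    then have "det (mat\<^sub>r n n (\<lambda>i. E $$ (i, f i) \<cdot>\<^sub>v row M (f i))) = (\<Prod>i\<in>{0..<n}. E $$ (i, f i)) * det (select_rows n M f)"
      using det_rows_mul[of "\<lambda>i. row M (f i)" n "\<lambda>i. E $$ (i, f i)"] rM by simp
    moreover have "det (select_rows n M f) \<in> minors_ideal k M"
      by (rule select_rows_ideal[OF M Mp]) (use f in auto)
    moreover have "(\<Prod>i\<in>{0..<n}. E $$ (i, f i)) \<in> polys k" using f Ep by (intro polys_prod) auto
    ultimately show "det (mat\<^sub>r n n (\<lambda>i. E $$ (i, f i) \<cdot>\<^sub>v row M (f i))) \<in> minors_ideal k M"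
      using pidealD(4)[OF I] by simp
  qed
  finally show ?thesis .
qed

lemma minors_ideal_mult_subset:
  assumes M: "M \<in> carrier_mat m n" and Mp: "\<And>i j. i < m \<Longrightarrow> j < n \<Longrightarrow> M $$ (i,j) \<in> polys k"
    and E: "E \<in> carrier_mat m' m" and Ep: "\<And>i j. i < m' \<Longrightarrow> j < m \<Longrightarrow> E $$ (i,j) \<in> polys k"
  shows "minors_ideal k (E * M) \<subseteq> minors_ideal k M"
proof (rule Idl_minimal[OF pideal_Idl(1)[OF maximal_minors_polys[OF M Mp]]])
  show "maximal_minors (E * M) \<subseteq> minors_ideal k M"
  proof
    fix g assume "g \<in> maximal_minors (E * M)"
    then obtain R where R: "g = det (submatrix (E * M) R UNIV)" "R \<subseteq> {..<m'}" "card R = n"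
      using E M unfolding maximal_minors_def by auto
    have EM: "E * M \<in> carrier_mat m' n" using E M by simp
    note N = submatrix_rows[OF EM R(2,3)] and N' = submatrix_rows[OF E R(2,3)]
    have "submatrix (E * M) R UNIV = submatrix E R UNIV * M"
    proof (rule eq_matI)
      fix i j assume "i < dim_row (submatrix E R UNIV * M)" "j < dim_col (submatrix E R UNIV * M)"
      then have ij: "i < n" "j < n" using N'(1) M by auto
      have "row (submatrix E R UNIV) i = row E (pick R i)"
        using N' ij E by (intro eq_vecI) auto
      then show "submatrix (E * M) R UNIV $$ (i,j) = (submatrix E R UNIV * M) $$ (i,j)"
        using N(2)[OF ij] N(3)[OF ij(1)] N'(1) E M ij by simp
    qed (use N N' M in auto)
    then show "g \<in> minors_ideal k M"
      unfolding R(1) using det_mult_ideal[OF M Mp N'(1)] N'(2,3) Ep by simp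
  qed
qed

lemma minors_ideal_mult_left:
  assumes M: "M \<in> carrier_mat m n" and Mp: "\<And>i j. i < m \<Longrightarrow> j < n \<Longrightarrow> M $$ (i,j) \<in> polys k"
    and E: "E \<in> carrier_mat m m" "\<And>i j. i < m \<Longrightarrow> j < m \<Longrightarrow> E $$ (i,j) \<in> polys k"
    and F: "F \<in> carrier_mat m m" "\<And>i j. i < m \<Longrightarrow> j < m \<Longrightarrow> F $$ (i,j) \<in> polys k" and FE: "F * E = 1\<^sub>m m"
  shows "minors_ideal k (E * M) = minors_ideal k M"
proof
  show "minors_ideal k (E * M) \<subseteq> minors_ideal k M" by (rule minors_ideal_mult_subset[OF M Mp E])
  have EM: "E * M \<in> carrier_mat m n" using E M by simp
  have p: "(E * M) $$ (i,j) \<in> polys k" if "i < m" "j < n" for i j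
    using that E M Mp by (auto simp: scalar_prod_def intro!: polys_sum polys_mult)
  have "F * (E * M) = M" using FE E F M by (simp add: assoc_mult_mat[symmetric, of F m m E m M n])
  then show "minors_ideal k M \<subseteq> minors_ideal k (E * M)"
    using minors_ideal_mult_subset[OF EM p F] by simp
qed

lemma minors_ideal_mult_right:
  assumes M: "M \<in> carrier_mat m n" and Mp: "\<And>i j. i < m \<Longrightarrow> j < n \<Longrightarrow> M $$ (i,j) \<in> polys k"
    and B: "B \<in> carrier_mat n n" and d: "det B = Const d" "d \<noteq> 0"
    and Bp: "\<And>i j. i < n \<Longrightarrow> j < n \<Longrightarrow> B $$ (i,j) \<in> polys k"
  shows "minors_ideal k (M * B) = minors_ideal k M"
proof -
  have MB: "M * B \<in> carrier_mat m n" using M B by simp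
  have p: "(M * B) $$ (i,j) \<in> polys k" if "i < m" "j < n" for i j
    using that B M Mp Bp by (auto simp: scalar_prod_def intro!: polys_sum polys_mult)
  have e: "det (submatrix (M * B) R UNIV) = det (submatrix M R UNIV) * Const d" if R: "R \<subseteq> {..<m}" "card R = n" for R
  proof -
    note N = submatrix_rows[OF MB R] and N' = submatrix_rows[OF M R]
    have "submatrix (M * B) R UNIV = submatrix M R UNIV * B"
    proof (rule eq_matI)
      fix i j assume "i < dim_row (submatrix M R UNIV * B)" "j < dim_col (submatrix M R UNIV * B)"
      then have ij: "i < n" "j < n" using N'(1) B by auto
      have "row (submatrix M R UNIV) i = row M (pick R i)"
        using N' ij M by (intro eq_vecI) auto
      then show "submatrix (M * B) R UNIV $$ (i,j) = (submatrix M R UNIV * B) $$ (i,j)"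
        using N(2)[OF ij] N(3)[OF ij(1)] N'(1) B M ij by simp
    qed (use N N' B in auto)
    then show ?thesis using det_mult[OF N'(1) B] d by simp
  qed
  have mp: "maximal_minors M \<subseteq> polys k" by (rule maximal_minors_polys[OF M Mp])
  have mp': "maximal_minors (M * B) \<subseteq> polys k" by (rule maximal_minors_polys[OF MB p])
  note I = pideal_Idl[OF mp] and I' = pideal_Idl[OF mp']
  show ?thesis
  proof
    show "minors_ideal k (M * B) \<subseteq> minors_ideal k M"
    proof (rule Idl_minimal[OF I(1)], rule subsetI)
      fix g assume "g \<in> maximal_minors (M * B)"
      then obtain R where R: "g = det (submatrix (M * B) R UNIV)" "R \<subseteq> {..<m}" "card R = n"
        unfolding maximal_minors_def using M B by auto
      have "det (submatrix M R UNIV) \<in> maximal_minors M"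
        unfolding maximal_minors_def using M R by auto
      then show "g \<in> minors_ideal k M"
        unfolding R(1) e[OF R(2,3)] using I(2) pidealD(4)[OF I(1), of "Const d" "det (submatrix M R UNIV)"] by (subst mult.commute) auto
    qed
    show "minors_ideal k M \<subseteq> minors_ideal k (M * B)"
    proof (rule Idl_minimal[OF I'(1)], rule subsetI)
      fix g assume "g \<in> maximal_minors M"
      then obtain R where R: "g = det (submatrix M R UNIV)" "R \<subseteq> {..<m}" "card R = n"
        using M unfolding maximal_minors_def by auto
      have "det (submatrix (M * B) R UNIV) \<in> maximal_minors (M * B)"
        unfolding maximal_minors_def using M B R by auto
      then have "Const (1/d) * det (submatrix (M * B) R UNIV) \<in> minors_ideal k (M * B)"
        using I'(2) pidealD(4)[OF I'(1), of "Const (1/d)" "det (submatrix (M * B) R UNIV)"] by auto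
      moreover have "Const (1/d) * det (submatrix (M * B) R UNIV) = g * (Const (1/d) * Const d)"
        unfolding e[OF R(2,3)] R(1) by simp
      moreover have "Const (1/d) * Const d = 1"
        using d(2) by (simp add: Const.hom_mult[symmetric] Const.hom_one)
      ultimately show "g \<in> minors_ideal k (M * B)" by simp
    qed
  qed
qed

text \<open>\<open>S\<close> consists of the rows (0 | A) above rows (1 | C) with arbitrary C. A
  selection of rows that misses an identity row has a zero column; any other one is, up to order,
  block triangular with a minor of \<open>A\<close> as its determinant.\<close>

lemma minors_ideal_block:
  assumes S: "S \<in> carrier_mat (m + a) (a + n)" and A: "A \<in> carrier_mat m n"
    and Sp: "\<And>i j. i < m + a \<Longrightarrow> j < a + n \<Longrightarrow> S $$ (i,j) \<in> polys k"
    and SA: "\<And>i j. i < m \<Longrightarrow> j < n \<Longrightarrow> S $$ (i, a + j) = A $$ (i,j)"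
    and S0: "\<And>i j. i < m \<Longrightarrow> j < a \<Longrightarrow> S $$ (i,j) = 0"
    and S1: "\<And>i j. i < a \<Longrightarrow> j < a \<Longrightarrow> S $$ (m + i,j) = (if i = j then 1 else 0)"
  shows "minors_ideal k S = minors_ideal k A"
proof -
  have Ap: "A $$ (i,j) \<in> polys k" if "i < m" "j < n" for i j
    using SA[OF that] Sp[of i "a + j"] that by simp
  have mp: "maximal_minors A \<subseteq> polys k" by (rule maximal_minors_polys[OF A Ap])
  have mp': "maximal_minors S \<subseteq> polys k" by (rule maximal_minors_polys[OF S Sp])
  note I = pideal_Idl[OF mp] and I' = pideal_Idl[OF mp']
  \<comment> \<open>The identity rows are put first, which makes the selected matrix block
    triangular.\<close>
  define ext where "ext g i = (if i < a then m + i else g (i - a))" for g :: "nat \<Rightarrow> nat" and i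
  have sel: "det (select_rows (a + n) S (ext g)) = det (select_rows n A g)" if g: "\<And>i. i < n \<Longrightarrow> g i < m" for g
  proof -
    have "select_rows (a + n) S (ext g) =
      four_block_mat (1\<^sub>m a) (mat a n (\<lambda>(i,j). S $$ (m + i, a + j))) (0\<^sub>m n a) (select_rows n A g)"
    proof (rule eq_matI)
      fix i j assume "i < dim_row (four_block_mat (1\<^sub>m a) (mat a n (\<lambda>(i,j). S $$ (m + i, a + j))) (0\<^sub>m n a) (select_rows n A g))"
        "j < dim_col (four_block_mat (1\<^sub>m a) (mat a n (\<lambda>(i,j). S $$ (m + i, a + j))) (0\<^sub>m n a) (select_rows n A g))"
      then have ij: "i < a + n" "j < a + n" by (auto simp: select_rows_def)
      show "select_rows (a + n) S (ext g) $$ (i,j) =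
        four_block_mat (1\<^sub>m a) (mat a n (\<lambda>(i,j). S $$ (m + i, a + j))) (0\<^sub>m n a) (select_rows n A g) $$ (i,j)"
        using ij S1[of i j] S0[of "g (i - a)" j] SA[of "g (i - a)" "j - a"] g[of "i - a"]
        by (auto simp: select_rows_def ext_def)
    qed (auto simp: select_rows_def)
    then show ?thesis
      using det_four_block_mat_lower_left_zero[of "1\<^sub>m a" a "mat a n (\<lambda>(i,j). S $$ (m + i, a + j))" n "0\<^sub>m n a" "select_rows n A g"]
      by (simp add: select_rows_def)
  qed
  show ?thesis
  proof
    show "minors_ideal k S \<subseteq> minors_ideal k A"
    proof (rule Idl_minimal[OF I(1)], rule subsetI)
      fix d assume "d \<in> maximal_minors S"
      then obtain R where R: "d = det (submatrix S R UNIV)" "R \<subseteq> {..<m + a}" "card R = a + n"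
        using S unfolding maximal_minors_def by auto
      note N = submatrix_rows[OF S R(2,3)]
      show "d \<in> minors_ideal k A"
      proof (cases "{m..<m+a} \<subseteq> R")
        case False
        then obtain s where s: "s < a" "m + s \<notin> R"
          by (metis atLeastLessThan_iff le_Suc_ex nat_add_left_cancel_less subsetI)
        have "submatrix S R UNIV $$ (i, s) = 0" if i: "i < a + n" for i
        proof -
          have "pick R i \<in> R" using pick_in_set_le[of i R] R(3) i by simp
          then have "pick R i \<noteq> m + s" using s(2) by metis
          moreover have "S $$ (p, s) = 0" if "p < m + a" "p \<noteq> m + s" for p
            using that S0[of p s] S1[of "p - m" s] s(1) by (cases "p < m") auto
          ultimately show ?thesis using N(2)[OF i, of s] N(3)[OF i] s(1) by simp
        qed
        then have "d = 0" unfolding R(1)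
          using laplace_expansion_column[OF N(1), of s] s(1) by simp
        then show ?thesis using pidealD(2)[OF I(1)] by simp
      next
        case True
        have fR: "finite R" using R(2) finite_subset by blast
        define R' where "R' = R \<inter> {..<m}"
        have RR: "R = {m..<m+a} \<union> R'" using True R(2) by (auto simp: R'_def)
        have "card R = a + card R'" unfolding RR
          by (subst card_Un_disjoint) (auto simp: R'_def)
        then have "card R' = n" using R(3) by simp
        then obtain g where g: "bij_betw g {0..<n} R'" using ex_bij_betw_nat_finite[of R'] fR by (auto simp: R'_def)
        have gm: "g i < m" "g i \<in> R'" if "i < n" for i using bij_betwE[OF g] that by (auto simp: R'_def)
        have "bij_betw (ext g) {0..<a+n} R"
        proof (rule bij_betw_imageI)
          show "inj_on (ext g) {0..<a+n}"
          proof (rule inj_onI)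
            fix i j assume ij: "i \<in> {0..<a+n}" "j \<in> {0..<a+n}" "ext g i = ext g j"
            have gi: "\<not> i < a \<Longrightarrow> g (i - a) < m" and gj: "\<not> j < a \<Longrightarrow> g (j - a) < m"
              using gm(1)[of "i - a"] gm(1)[of "j - a"] ij by auto
            show "i = j"
            proof (cases "i < a"; cases "j < a")
              assume "\<not> i < a" "\<not> j < a"
              then have "g (i - a) = g (j - a)" "i - a \<in> {0..<n}" "j - a \<in> {0..<n}" using ij by (auto simp: ext_def)
              then have "i - a = j - a" using g by (meson bij_betw_imp_inj_on inj_onD)
              then show ?thesis using \<open>\<not> i < a\<close> \<open>\<not> j < a\<close> by simp
            qed (use ij gi gj in \<open>auto simp: ext_def\<close>)
          qed
          show "ext g ` {0..<a+n} = R"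
          proof (rule card_subset_eq[OF fR])
            show "ext g ` {0..<a+n} \<subseteq> R"
            proof
              fix y assume "y \<in> ext g ` {0..<a+n}"
              then obtain i where "i < a + n" "y = ext g i" by auto
              then show "y \<in> R" using gm(2)[of "i - a"] by (cases "i < a") (auto simp: ext_def RR)
            qed
            show "card (ext g ` {0..<a+n}) = card R"
              using card_image[OF \<open>inj_on (ext g) {0..<a+n}\<close>] R(3) by simp
          qed
        qed
        from det_select_rows[OF S this R(2)] have
          "det (select_rows (a + n) S (ext g)) = d \<or> det (select_rows (a + n) S (ext g)) = - d"
          unfolding R(1) .
        moreover have "det (select_rows (a + n) S (ext g)) = det (select_rows n A g)" by (rule sel) (rule gm(1))
        ultimately have "d = det (select_rows n A g) \<or> d = - det (select_rows n A g)"
          by auto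
        moreover have "det (select_rows n A g) \<in> minors_ideal k A"
          by (rule select_rows_ideal[OF A Ap gm(1)])
        ultimately show ?thesis using pidealD(5)[OF I(1)] by auto
      qed
    qed
    show "minors_ideal k A \<subseteq> minors_ideal k S"
    proof (rule Idl_minimal[OF I'(1)], rule subsetI)
      fix d assume "d \<in> maximal_minors A"
      then obtain R where R: "d = det (submatrix A R UNIV)" "R \<subseteq> {..<m}" "card R = n"
        using A unfolding maximal_minors_def by auto
      note N = submatrix_rows[OF A R(2,3)]
      have "submatrix A R UNIV = select_rows n A (pick R)"
        using N by (intro eq_matI) (auto simp: select_rows_def)
      then have "d = det (select_rows (a + n) S (ext (pick R)))" using sel[OF N(3)] R(1) by simp
      also have "\<dots> \<in> minors_ideal k S"
      proof (rule select_rows_ideal[OF S Sp])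
        fix i assume "i < a + n"
        then have "\<not> i < a \<Longrightarrow> i - a < n" by simp
        then show "ext (pick R) i < m + a" using N(3)[of "i - a"] by (cases "i < a") (auto simp: ext_def intro: trans_less_add1)
      qed
      finally show "d \<in> minors_ideal k S" .
    qed
  qed
qed

section \<open>Completion to invertible matrices and changes of the coordinates y\<close>

lemma extend_rows:
  fixes v :: "nat \<Rightarrow> nat \<Rightarrow> complex"
  assumes "r \<le> n" "\<And>a. \<forall>j<n. (\<Sum>i<r. a i * v i j) = 0 \<Longrightarrow> \<forall>i<r. a i = 0"
  shows "\<exists>G. det (mat n n (\<lambda>(i,j). G i j)) \<noteq> 0 \<and> (\<forall>i<r. \<forall>j<n. G i j = v i j)"
  using assms
proof (induction "n - r" arbitrary: r v)
  case 0
  have "r = n" using 0(1,2) by simp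
  have "det (mat n n (\<lambda>(i,j). v i j)) \<noteq> 0"
  proof
    assume "det (mat n n (\<lambda>(i,j). v i j)) = 0"
    then obtain x where x: "nz n x" "\<forall>j<n. (\<Sum>i<n. x i * v i j) = 0"
      unfolding square_left_kernel by blast
    have "\<forall>i<r. x i = 0" by (rule 0(3)) (use x(2) \<open>r = n\<close> in simp)
    then show False using x(1) \<open>r = n\<close> by (auto elim: nzE)
  qed
  then show ?case by (intro exI[of _ v] conjI allI impI refl)
next
  case (Suc d)
  have r: "r < n" using Suc.hyps(2) by simp
  obtain x where x: "nz n x" "\<forall>i\<in>{..<r}. (\<Sum>j<n. v i j * x j) = 0"
    using kernel_nontrivial[of "{..<r}" n v] r by (metis card_lessThan finite_lessThan)
  \<comment> \<open>The new row is the conjugate of a vector x in the kernel of the previous rows: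
    pairing a linear relation with x leaves the new coefficient times the sum of |x_j|^2.\<close>
  define v' where "v' i j = (if i = r then cnj (x j) else v i j)" for i j
  have ind: "\<forall>i<Suc r. a i = 0" if a: "\<forall>j<n. (\<Sum>i<Suc r. a i * v' i j) = 0" for a
  proof -
    have a': "(\<Sum>i<r. a i * v i j) + a r * cnj (x j) = 0" if "j < n" for j
      using a that by (simp add: v'_def)
    have "0 = (\<Sum>j<n. ((\<Sum>i<r. a i * v i j) + a r * cnj (x j)) * x j)"
      using a' by simp
    also have "\<dots> = (\<Sum>i<r. a i * (\<Sum>j<n. v i j * x j)) + a r * (\<Sum>j<n. cnj (x j) * x j)"
    proof -
      have e: "(\<Sum>j<n. (\<Sum>i<r. a i * v i j) * x j) = (\<Sum>i<r. a i * (\<Sum>j<n. v i j * x j))"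
        unfolding sum_distrib_left sum_distrib_right by (subst sum.swap) (simp add: mult_ac)
      show ?thesis unfolding distrib_right sum.distrib e
        by (simp only: sum_distrib_left mult.assoc)
    qed
    also have "\<dots> = a r * (\<Sum>j<n. cnj (x j) * x j)" using x(2) by simp
    also have "(\<Sum>j<n. cnj (x j) * x j) = of_real (\<Sum>j<n. (cmod (x j))\<^sup>2)"
      unfolding of_real_sum by (intro sum.cong refl) (simp only: complex_norm_square mult.commute)
    finally have "a r * complex_of_real (\<Sum>j<n. (cmod (x j))\<^sup>2) = 0" by (rule sym)
    then have "a r = 0 \<or> (\<Sum>j<n. (cmod (x j))\<^sup>2) = 0" unfolding mult_eq_0_iff of_real_eq_0_iff .
    moreover have "(\<Sum>j<n. (cmod (x j))\<^sup>2) \<noteq> 0"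
      using x(1) by (auto simp: sum_nonneg_eq_0_iff elim!: nzE)
    ultimately have "a r = 0" by blast
    then have "\<forall>j<n. (\<Sum>i<r. a i * v i j) = 0" using a' by simp
    then have "\<forall>i<r. a i = 0" by (rule Suc.prems(2))
    then show ?thesis using \<open>a r = 0\<close> by (auto simp: less_Suc_eq)
  qed
  have "\<exists>G. det (mat n n (\<lambda>(i,j). G i j)) \<noteq> 0 \<and> (\<forall>i<Suc r. \<forall>j<n. G i j = v' i j)"
  proof (rule Suc.hyps(1))
    show "d = n - Suc r" "Suc r \<le> n" using Suc.hyps(2) r by simp_all
  qed (rule ind)
  then obtain G where G0: "det (mat n n (\<lambda>(i,j). G i j)) \<noteq> 0 \<and> (\<forall>i<Suc r. \<forall>j<n. G i j = v' i j)"
    by (rule exE)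
  note G = conjunct1[OF G0] conjunct2[OF G0]
  have "G i j = v i j" if "i < r" "j < n" for i j
    using G(2) that r by (simp add: v'_def)
  then show ?case using G(1) by (intro exI[of _ G] conjI allI impI)
qed

lemma matrix_inverse:
  fixes G :: "nat \<Rightarrow> nat \<Rightarrow> complex"
  assumes "det (mat n n (\<lambda>(i,j). G i j)) \<noteq> 0"
  shows "\<exists>B. (\<forall>i<n. \<forall>j<n. (\<Sum>s<n. G i s * B s j) = (if i = j then 1 else 0)) \<and>
    (\<forall>i<n. \<forall>j<n. (\<Sum>s<n. B i s * G s j) = (if i = j then 1 else 0))"
proof -
  let ?G = "mat n n (\<lambda>(i,j). G i j)"
  have G: "?G \<in> carrier_mat n n" by simp
  define B where "B i j = cofactor ?G j i / det ?G" for i j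
  have "(\<Sum>s<n. G i s * B s j) = (if i = j then 1 else 0)" if "i < n" "j < n" for i j
  proof -
    have "(\<Sum>s<n. G i s * B s j) = (\<Sum>s<n. ?G $$ (i,s) * cofactor ?G j s) / det ?G"
      using that by (simp add: B_def sum_divide_distrib)
    then show ?thesis using cofactor_sum_row[OF G that] assms by simp
  qed
  moreover have "(\<Sum>s<n. B i s * G s j) = (if i = j then 1 else 0)" if "i < n" "j < n" for i j
  proof -
    have "(\<Sum>s<n. B i s * G s j) = (\<Sum>s<n. cofactor ?G s i * ?G $$ (s,j)) / det ?G"
      using that by (simp add: B_def sum_divide_distrib)
    then show ?thesis using cofactor_sum_col[OF G that] assms by simp
  qed
  ultimately show ?thesis by (intro exI[of _ B]) simp
qed

text \<open>A(x) becomes A(x) G, that is, y is replaced by G y; the ideal of minors does not change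
  if \<open>G\<close> is invertible.\<close>

definition tsubst :: "(nat \<Rightarrow> nat \<Rightarrow> complex) \<Rightarrow> tensor \<Rightarrow> tensor" where
  "tsubst G \<alpha> i j l = (\<Sum>j'<3. \<alpha> i j' l * G j' j)"

lemma tri_tsubst: "tri m r (tsubst G \<alpha>) w y x = tri m r \<alpha> w (\<lambda>j'. \<Sum>j<3. G j' j * y j) x"
proof -
  have "(\<Sum>j<3. \<Sum>l<r. tsubst G \<alpha> i j l * w i * y j * x l) = (\<Sum>j'<3. \<Sum>l<r. \<alpha> i j' l * w i * (\<Sum>j<3. G j' j * y j) * x l)" for i
  proof -
    have "(\<Sum>j<3. \<Sum>l<r. tsubst G \<alpha> i j l * w i * y j * x l) = (\<Sum>j<3. \<Sum>l<r. \<Sum>j'<3. \<alpha> i j' l * G j' j * w i * y j * x l)"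
      by (simp add: tsubst_def sum_distrib_right)
    also have "\<dots> = (\<Sum>j<3. \<Sum>j'<3. \<Sum>l<r. \<alpha> i j' l * G j' j * w i * y j * x l)"
      by (intro sum.cong[OF refl]) (rule sum.swap)
    also have "\<dots> = (\<Sum>j'<3. \<Sum>j<3. \<Sum>l<r. \<alpha> i j' l * G j' j * w i * y j * x l)" by (rule sum.swap)
    also have "\<dots> = (\<Sum>j'<3. \<Sum>l<r. \<Sum>j<3. \<alpha> i j' l * G j' j * w i * y j * x l)"
      by (intro sum.cong[OF refl]) (rule sum.swap)
    also have "\<dots> = (\<Sum>j'<3. \<Sum>l<r. \<alpha> i j' l * w i * (\<Sum>j<3. G j' j * y j) * x l)"
      by (simp add: sum_distrib_left sum_distrib_right mult_ac)
    finally show ?thesis .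
  qed
  then show ?thesis unfolding tri_def by simp
qed

lemma (in det_tensor) det_tensor_tsubst:
  assumes "det (mat 3 3 (\<lambda>(i,j). G i j)) \<noteq> 0"
  shows "det_tensor k c X fs (tsubst G \<alpha>)"
proof unfold_locales
  let ?A = "tmat (c + 2) (k + 1) \<alpha>" and ?B = "mat 3 3 (\<lambda>(i,j). Const (G i j))"
  have "tmat (c + 2) (k + 1) (tsubst G \<alpha>) = ?A * ?B"
  proof (rule eq_matI)
    fix i j assume "i < dim_row (?A * ?B)" "j < dim_col (?A * ?B)"
    then have ij: "i < c + 2" "j < 3" by (auto simp: tmat_def)
    have "(?A * ?B) $$ (i,j) = (\<Sum>j'<3. (\<Sum>l<k+1. Const (\<alpha> i j' l) * Var l) * Const (G j' j))"
      using ij by (simp add: tmat_def scalar_prod_def lessThan_atLeast0)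
    also have "\<dots> = (\<Sum>l<k+1. (\<Sum>j'<3. Const (\<alpha> i j' l) * Const (G j' j)) * Var l)"
      unfolding sum_distrib_right by (subst sum.swap) (simp add: mult_ac)
    also have "\<dots> = tmat (c + 2) (k + 1) (tsubst G \<alpha>) $$ (i,j)"
      using ij by (simp add: tmat_def tsubst_def Const.hom_sum Const.hom_mult)
    finally show "tmat (c + 2) (k + 1) (tsubst G \<alpha>) $$ (i,j) = (?A * ?B) $$ (i,j)" by simp
  qed (auto simp: tmat_def)
  moreover have "?B = map_mat Const (mat 3 3 (\<lambda>(i,j). G i j))" by (intro eq_matI) auto
  then have "det ?B = Const (det (mat 3 3 (\<lambda>(i,j). G i j)))" by (simp add: Const.hom_det)
  ultimately show "vanishing_ideal k X = minors_ideal k (tmat (c + 2) (k + 1) (tsubst G \<alpha>))"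
    using minors_ideal_mult_right[of ?A "c+2" 3 k ?B "det (mat 3 3 (\<lambda>(i,j). G i j))"] assms ideal
      tmat_polys[THEN forms_polys] by (simp add: tmat_def)
qed (rule kc)

section \<open>Construction of the projections\<close>

text \<open>A column of the matrix is factored as \<open>N \<cdot> Q\<close> with constant \<open>N\<close> and linearly independent
  linear forms \<open>Q\<close>.\<close>

definition col_factor :: "nat \<Rightarrow> nat \<Rightarrow> tensor \<Rightarrow> nat \<Rightarrow> nat \<Rightarrow> (nat \<Rightarrow> nat \<Rightarrow> complex) \<Rightarrow> (nat \<Rightarrow> nat \<Rightarrow> complex) \<Rightarrow> bool" where
  "col_factor m r \<alpha> j h N Q \<longleftrightarrow> (\<forall>i<m. \<forall>l<r. \<alpha> i j l = (\<Sum>t<h+1. N i t * Q t l)) \<and>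
    (\<forall>a. (\<forall>l<r. (\<Sum>t<h+1. a t * Q t l) = 0) \<longrightarrow> (\<forall>t<h+1. a t = 0))"

context det_tensor
begin

lemma tr_column: "j < 3 \<Longrightarrow> l < k + 1 \<Longrightarrow> tr w (ue j) (ue l) = (\<Sum>i<c+2. w i * \<alpha> i j l)"
  unfolding tri_expand(1)[of _ _ _ w "ue j" "ue l"] by (intro sum.cong refl) (simp add: tri_ue)

lemma tr_column_zero_iff: "j < 3 \<Longrightarrow> (\<forall>x. tr w (ue j) x = 0) \<longleftrightarrow> (\<forall>l<k+1. (\<Sum>i<c+2. w i * \<alpha> i j l) = 0)"
  unfolding tri_zero_iff(3)[symmetric] using tr_column by auto

text \<open>If no constant row vector kills the column, its c + 2 entries are independent linear
  forms and the identity serves as constant factor, with h = c + 1.\<close>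

lemma col_factor_full:
  assumes j: "j < 3" and "\<And>w. nz (c+2) w \<Longrightarrow> \<exists>x. tr w (ue j) x \<noteq> 0"
  shows "col_factor (c + 2) (k + 1) \<alpha> j (c + 1) (\<lambda>i t. if i = t then 1 else 0) (\<lambda>t l. \<alpha> t j l)"
  unfolding col_factor_def
proof (intro conjI allI impI)
  fix i l assume "i < c + 2"
  have "(\<Sum>t<c+1+1. (if i = t then 1 else 0) * \<alpha> t j l) = (\<Sum>t<c+2. if t = i then \<alpha> i j l else 0)"
    by (intro sum.cong) auto
  then show "\<alpha> i j l = (\<Sum>t<c+1+1. (if i = t then 1 else 0) * \<alpha> t j l)" using \<open>i < c + 2\<close> by simp
next
  fix a t assume a: "\<forall>l<k+1. (\<Sum>t<c+1+1. a t * \<alpha> t j l) = 0" and t: "t < c + 1 + 1"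
  have "\<forall>x. tr a (ue j) x = 0" unfolding tr_column_zero_iff[OF j] using a by simp
  then have "\<not> nz (c+2) a" using assms(2) by blast
  then show "a t = 0" using t by (auto simp: nz_def)
qed

lemma sum_skip:
  fixes f :: "nat \<Rightarrow> 'a::comm_monoid_add"
  assumes "i0 < n + 1"
  shows "(\<Sum>i<n+1. f i) = f i0 + (\<Sum>t<n. f (if t < i0 then t else t + 1))"
proof -
  have "bij_betw (\<lambda>t. if t < i0 then t else t + 1) {..<n} ({..<n+1} - {i0})"
    by (rule bij_betw_byWitness[of _ "\<lambda>t. if t < i0 then t else t - 1"]) (use assms in auto)
  then have "(\<Sum>t<n. f (if t < i0 then t else t + 1)) = (\<Sum>i\<in>{..<n+1} - {i0}. f i)"
    by (rule sum.reindex_bij_betw)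
  then show ?thesis using sum.remove[of "{..<n+1}" i0 f] assms by (simp del: sum.lessThan_Suc)
qed

text \<open>The relation \<open>w\<close> eliminates the entry in row \<open>i0\<close>. The other c
  + 1 entries are independent, since a further relation, extended by 0 at \<open>i0\<close>, would
  contradict \<open>left_kernel_unique\<close>.\<close>

lemma col_factor_kill:
  assumes j: "j < 3" and w: "nz (c+2) w" "\<And>x. tr w (ue j) x = 0"
  shows "\<exists>N Q. col_factor (c + 2) (k + 1) \<alpha> j c N Q"
proof -
  obtain i0 where i0: "i0 < c + 2" "w i0 \<noteq> 0" using w(1) by (rule nzE)
  define \<sigma> where "\<sigma> t = (if t < i0 then t else t + 1)" for t :: nat
  define N where "N i t = (if i = i0 then - w (\<sigma> t) / w i0 else if i = \<sigma> t then 1 else 0)" for i t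
  define Q where "Q t l = \<alpha> (\<sigma> t) j l" for t l
  have skip: "(\<Sum>i<c+2. f i) = f i0 + (\<Sum>t<c+1. f (\<sigma> t))" for f :: "nat \<Rightarrow> complex"
    using sum_skip[of i0 "c+1" f] i0(1) by (simp add: \<sigma>_def)
  have wz: "(\<Sum>i<c+2. w i * \<alpha> i j l) = 0" if "l < k + 1" for l
    using w(2) tr_column[OF j that, of w] by simp
  have \<sigma>i: "\<sigma> t \<noteq> i0" and \<sigma>b: "t < c + 1 \<Longrightarrow> \<sigma> t < c + 2" for t by (auto simp: \<sigma>_def)
  have \<sigma>inj: "\<sigma> t = \<sigma> t' \<longleftrightarrow> t = t'" for t t' by (auto simp: \<sigma>_def)
  have fac: "\<alpha> i j l = (\<Sum>t<c+1. N i t * Q t l)" if i: "i < c + 2" and l: "l < k + 1" for i l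
  proof (cases "i = i0")
    case True
    have "w i0 * \<alpha> i0 j l + (\<Sum>t<c+1. w (\<sigma> t) * \<alpha> (\<sigma> t) j l) = 0"
      using wz[OF l] unfolding skip .
    then have "\<alpha> i0 j l = - (\<Sum>t<c+1. w (\<sigma> t) * \<alpha> (\<sigma> t) j l) / w i0"
      using i0(2) by (simp add: field_simps add_eq_0_iff)
    then show ?thesis using True by (simp add: N_def Q_def sum_divide_distrib sum_negf del: sum.lessThan_Suc)
  next
    case False
    obtain t where t: "t < c + 1" "i = \<sigma> t"
    proof (cases "i < i0")
      case True
      show ?thesis by (rule that[of i]) (use True i0 in \<open>auto simp: \<sigma>_def\<close>)
    next
      case False2: False
      show ?thesis by (rule that[of "i - 1"]) (use False False2 i in \<open>auto simp: \<sigma>_def\<close>)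
    qed
    have "(\<Sum>t'<c+1. N i t' * Q t' l) = (\<Sum>t'<c+1. if t' = t then Q t l else 0)"
      using False t(2) \<sigma>inj by (intro sum.cong refl) (auto simp: N_def)
    then show ?thesis using t by (simp add: Q_def del: sum.lessThan_Suc)
  qed
  have ind: "\<forall>t<c+1. a t = 0" if a: "\<forall>l<k+1. (\<Sum>t<c+1. a t * Q t l) = 0" for a
  proof (rule ccontr)
    assume "\<not> ?thesis"
    then obtain t where t: "t < c + 1" "a t \<noteq> 0" by blast
    define w' where "w' i = (if i < i0 then a i else if i = i0 then 0 else a (i - 1))" for i
    have w'\<sigma>: "w' (\<sigma> t) = a t" for t by (auto simp: w'_def \<sigma>_def)
    have w'0: "w' i0 = 0" by (simp add: w'_def)
    have "(\<Sum>i<c+2. w' i * \<alpha> i j l) = 0" if "l < k + 1" for l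
      unfolding skip using a that by (simp add: w'\<sigma> w'0 Q_def del: sum.lessThan_Suc)
    then have k: "\<forall>x. tr w' (ue j) x = 0" unfolding tr_column_zero_iff[OF j] by blast
    have "nz (c+2) w'" by (rule nzI[of "\<sigma> t"]) (use t \<sigma>b w'\<sigma> in auto)
    moreover have "nz 3 (ue j)" by (rule nzI[of j]) (use j in \<open>auto simp: ue_def\<close>)
    ultimately show False using left_kernel_unique[of "ue j" i0 w w'] i0 w(2) k w'0 by blast
  qed
  show ?thesis
  proof (intro exI)
    show "col_factor (c + 2) (k + 1) \<alpha> j c N Q" unfolding col_factor_def using fac ind by blast
  qed
qed

text \<open>With the columns written as N_j Q_j x, the matrix A is (N_0 | N_1 | N_2) times the block
  diagonal matrix with blocks Q_j x. Let \<open>G\<close> be an invertible completion of (N_0 | N_1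
  | N_2), let \<open>B\<close> be its inverse, and cut the P_i out of the last k + 1 columns of
  \<open>B\<close>. Then \<open>G\<close> times the critical matrix has rows (0 | A) above rows (1 |
  C), so both matrices have the same ideal of minors.\<close>

lemma critical_exists:
  assumes kc': "k \<ge> c + 2 \<or> c = 1" and dim: "has_dim k X (k - c)" and ck: "c \<le> k"
    and h: "h 0 + h 1 + h 2 = k + c" "\<And>j. j < 3 \<Longrightarrow> 1 \<le> h j \<and> h j < k"
    and NQ: "\<And>j. j < 3 \<Longrightarrow> col_factor (c + 2) (k + 1) \<alpha> j (h j) (N j) (Q j)"
  shows "\<exists>P Q. is_critical_locus k h P Q X"
proof -
  define H where "H = h 0 + h 1 + h 2 + 3"
  have Hk: "H = (c + 2) + (k + 1)" using h(1) by (simp add: H_def)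
  define \<N> where "\<N> i \<rho> = N (blk h \<rho>) i (\<rho> - off h (blk h \<rho>))" for i \<rho>
  have \<N>: "\<N> i (off h j + t) = N j i t" if "j < 3" "t < h j + 1" for i j t
    using blk_off(1)[where h = h, OF that] by (simp add: \<N>_def)
  have offH: "off h j + t < H" if "j < 3" "t < h j + 1" for j t
    using blk_off(2)[where h = h, OF that] by (simp add: H_def)
  have fac: "\<alpha> i j l = (\<Sum>t<h j+1. N j i t * Q j t l)" if "j < 3" "i < c + 2" "l < k + 1" for i j l
    using NQ[OF that(1)] that(2,3) unfolding col_factor_def by blast
  have indQ: "\<forall>t<h j+1. a t = 0" if "j < 3" "\<forall>l<k+1. (\<Sum>t<h j+1. a t * Q j t l) = 0" for j a
    using NQ[OF that(1)] that(2) unfolding col_factor_def by blast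
  \<comment> \<open>A row vector that kills two of the blocks N_j kills two columns of A. This gives
    the full row rank of (N_0 | N_1 | N_2) here and the ranks of the P_i below.\<close>
  have pair: "\<forall>i<c+2. b i = 0"
    if j: "j < 3" "j' < 3" "j \<noteq> j'" and b: "\<And>i t. i \<in> {j,j'} \<Longrightarrow> t < h i + 1 \<Longrightarrow> (\<Sum>s<c+2. b s * N i s t) = 0" for j j' b
  proof -
    have kill: "\<forall>x. tr b (ue i) x = 0" if i: "i \<in> {j,j'}" for i
    proof -
      have i3: "i < 3" using i j by blast
      have "(\<Sum>s<c+2. b s * \<alpha> s i l) = 0" if l: "l < k + 1" for l
      proof -
        have "(\<Sum>s<c+2. b s * \<alpha> s i l) = (\<Sum>s<c+2. b s * (\<Sum>t<h i+1. N i s t * Q i t l))"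
          by (intro sum.cong refl arg_cong2[of _ _ _ _ "(*)"]) (use fac[OF i3 _ l] in auto)
        also have "\<dots> = (\<Sum>t<h i+1. (\<Sum>s<c+2. b s * N i s t) * Q i t l)"
          unfolding sum_distrib_left sum_distrib_right by (subst sum.swap) (simp add: mult_ac del: sum.lessThan_Suc)
        also have "\<dots> = 0" by (intro sum.neutral ballI) (use b[OF i] in simp)
        finally show ?thesis .
      qed
      then show ?thesis unfolding tr_column_zero_iff[OF i3] by blast
    qed
    have "\<not> nz (c+2) b" by (rule left_kernels_distinct[OF kc' j]) (use kill in blast)+
    then show ?thesis by (auto simp: nz_def)
  qed
  have "\<exists>G. det (mat H H (\<lambda>(i,j). G i j)) \<noteq> 0 \<and> (\<forall>i<c+2. \<forall>j<H. G i j = \<N> i j)"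
  proof (rule extend_rows)
    show "c + 2 \<le> H" using Hk by simp
    fix b assume b: "\<forall>\<rho><H. (\<Sum>i<c+2. b i * \<N> i \<rho>) = 0"
    show "\<forall>i<c+2. b i = 0"
    proof (rule pair[of 0 1])
      fix i t assume i: "i \<in> {0,1::nat}" and t: "t < h i + 1"
      then have i3: "i < 3" by auto
      have "(\<Sum>s<c+2. b s * \<N> s (off h i + t)) = 0" using b offH[OF i3 t] by blast
      then show "(\<Sum>s<c+2. b s * N i s t) = 0" by (simp only: \<N>[OF i3 t])
    qed auto
  qed
  then obtain G where G0: "det (mat H H (\<lambda>(i,j). G i j)) \<noteq> 0 \<and> (\<forall>i<c+2. \<forall>j<H. G i j = \<N> i j)" by (rule exE)
  note G = conjunct1[OF G0] conjunct2[OF G0]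
  obtain B where B0: "(\<forall>i<H. \<forall>j<H. (\<Sum>s<H. G i s * B s j) = (if i = j then 1 else 0)) \<and>
    (\<forall>i<H. \<forall>j<H. (\<Sum>s<H. B i s * G s j) = (if i = j then 1 else 0))"
    using matrix_inverse[OF G(1)] by (rule exE)
  note GB = conjunct1[OF B0, rule_format] and BG = conjunct2[OF B0, rule_format]
  define P where "P i = mat (h i + 1) (k + 1) (\<lambda>(t,s). B (off h i + t) (c + 2 + s))" for i
  define R where "R i = mat (h i + 1) (k + 1) (\<lambda>(t,l). Q i t l)" for i
  have PR: "P i \<in> carrier_mat (h i + 1) (k + 1) \<and> R i \<in> carrier_mat (h i + 1) (k + 1)" for i
    by (simp add: P_def R_def)
  have rankR: "vec_space.rank (h i + 1) (R i) = h i + 1" if i: "i < 3" for i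
  proof (rule rank_full_rows)
    show "R i \<in> carrier_mat (h i + 1) (k + 1)" using PR by blast
    fix a assume a: "\<forall>j<k+1. (\<Sum>t<h i+1. a t * R i $$ (t,j)) = 0"
    show "\<forall>t<h i+1. a t = 0"
    proof (rule indQ[OF i], intro allI impI)
      fix l assume l: "l < k + 1"
      have "(\<Sum>t<h i+1. a t * Q i t l) = (\<Sum>t<h i+1. a t * R i $$ (t,l))"
        by (intro sum.cong refl) (use l in \<open>simp add: R_def\<close>)
      then show "(\<Sum>t<h i+1. a t * Q i t l) = 0" using a l by simp
    qed
  qed
  have rankP: "vec_space.rank (h i + 1) (P i) = h i + 1" if i: "i < 3" for i
  proof (rule rank_full_rows)
    show "P i \<in> carrier_mat (h i + 1) (k + 1)" using PR by blast
    fix a assume a: "\<forall>j<k+1. (\<Sum>t<h i+1. a t * P i $$ (t,j)) = 0"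
    \<comment> \<open>Extended by zero, \<open>a\<close> annihilates the last k + 1 columns of
      \<open>B\<close>, so it is a combination \<open>b\<close> of the first c + 2 rows of
      \<open>G\<close>. As it vanishes on the other two blocks, \<open>pair\<close> gives b =
      0.\<close>
    define a' where "a' \<rho> = (if blk h \<rho> = i then a (\<rho> - off h i) else 0)" for \<rho>
    have a'1: "a' (off h i + t) = a t" if "t < h i + 1" for t using blk_off(1)[where h = h, OF i that] by (simp add: a'_def)
    have a'0: "a' (off h j + t) = 0" if "j < 3" "t < h j + 1" "j \<noteq> i" for j t
      using blk_off(1)[where h = h, OF that(1,2)] that(3) by (simp add: a'_def)
    define b where "b s = (\<Sum>\<rho><H. a' \<rho> * B \<rho> s)" for s
    have bz: "b (c + 2 + s) = 0" if s: "s < k + 1" for s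
    proof -
      have "b (c + 2 + s) = (\<Sum>j<3. \<Sum>t<h j+1. a' (off h j + t) * B (off h j + t) (c + 2 + s))"
        unfolding b_def H_def by (rule sum_blocks)
      also have "\<dots> = (\<Sum>j<3. if j = i then (\<Sum>t<h i+1. a t * B (off h i + t) (c + 2 + s)) else 0)"
      proof (intro sum.cong refl)
        fix j assume "j \<in> {..<3::nat}"
        then have j: "j < 3" by simp
        show "(\<Sum>t<h j+1. a' (off h j + t) * B (off h j + t) (c + 2 + s)) =
          (if j = i then (\<Sum>t<h i+1. a t * B (off h i + t) (c + 2 + s)) else 0)"
        proof (cases "j = i")
          case True
          have "(\<Sum>t<h i+1. a' (off h i + t) * B (off h i + t) (c + 2 + s)) = (\<Sum>t<h i+1. a t * B (off h i + t) (c + 2 + s))"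
            by (intro sum.cong refl) (use a'1 in simp)
          then show ?thesis using True by simp
        next
          case False
          have "(\<Sum>t<h j+1. a' (off h j + t) * B (off h j + t) (c + 2 + s)) = 0"
            by (intro sum.neutral ballI) (use a'0[OF j _ False] in simp)
          then show ?thesis using False by simp
        qed
      qed
      also have "\<dots> = (\<Sum>t<h i+1. a t * B (off h i + t) (c + 2 + s))" using i by (simp del: sum.lessThan_Suc)
      also have "\<dots> = (\<Sum>t<h i+1. a t * P i $$ (t,s))"
        by (intro sum.cong refl) (use s in \<open>simp add: P_def\<close>)
      finally show ?thesis using a s by simp
    qed
    have a'G: "a' \<sigma> = (\<Sum>s<c+2. b s * \<N> s \<sigma>)" if \<sigma>: "\<sigma> < H" for \<sigma>
    proof -
      have "(\<Sum>s<H. b s * G s \<sigma>) = (\<Sum>\<rho><H. a' \<rho> * (\<Sum>s<H. B \<rho> s * G s \<sigma>))"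
        unfolding b_def sum_distrib_left sum_distrib_right by (subst sum.swap) (simp add: mult_ac)
      also have "\<dots> = (\<Sum>\<rho><H. if \<rho> = \<sigma> then a' \<sigma> else 0)"
        by (intro sum.cong refl) (use BG[OF _ \<sigma>] in auto)
      also have "\<dots> = a' \<sigma>" using \<sigma> by simp
      finally have "a' \<sigma> = (\<Sum>s<c+2+(k+1). b s * G s \<sigma>)" by (simp only: Hk)
      also have "\<dots> = (\<Sum>s<c+2. b s * G s \<sigma>) + (\<Sum>s<k+1. b (c + 2 + s) * G (c + 2 + s) \<sigma>)"
        by (rule sum_lessThan_add)
      also have "(\<Sum>s<k+1. b (c + 2 + s) * G (c + 2 + s) \<sigma>) = 0"
        by (intro sum.neutral ballI) (use bz in simp)
      also have "(\<Sum>s<c+2. b s * G s \<sigma>) = (\<Sum>s<c+2. b s * \<N> s \<sigma>)"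
        by (intro sum.cong refl) (use G(2) \<sigma> in simp)
      finally show ?thesis by simp
    qed
    obtain j j' where j: "j < 3" "j' < 3" "j \<noteq> j'" "j \<noteq> i" "j' \<noteq> i" using other_two[OF i] by blast
    have b0: "\<forall>s<c+2. b s = 0"
    proof (rule pair[OF j(1-3)])
      fix e t assume e: "e \<in> {j,j'}" and t: "t < h e + 1"
      have e3: "e < 3" "e \<noteq> i" using e j by auto
      have "(\<Sum>s<c+2. b s * \<N> s (off h e + t)) = 0"
        using a'G[OF offH[OF e3(1) t]] a'0[OF e3(1) t e3(2)] by simp
      then show "(\<Sum>s<c+2. b s * N e s t) = 0" by (simp only: \<N>[OF e3(1) t])
    qed
    show "\<forall>t<h i+1. a t = 0"
    proof (intro allI impI)
      fix t assume t: "t < h i + 1"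
      have "a t = (\<Sum>s<c+2. b s * \<N> s (off h i + t))" using a'G[OF offH[OF i t]] a'1[OF t] by simp
      also have "\<dots> = 0" by (intro sum.neutral ballI) (use b0 in simp)
      finally show "a t = 0" .
    qed
  qed
  define M where "M = critical_matrix k P R"
  note CM = critical_matrix_eq[of P h k R, OF PR, folded H_def]
  have Mc: "M \<in> carrier_mat H (k + 1 + 3)" unfolding M_def CM by (simp add: algebra_simps)
  have M1: "M $$ (\<rho>,s) = Const (B \<rho> (c + 2 + s))" if "\<rho> < H" "s < k + 1" for \<rho> s
  proof -
    have "blk h \<rho> < 3" "off h (blk h \<rho>) \<le> \<rho>" "\<rho> - off h (blk h \<rho>) < h (blk h \<rho>) + 1"
      using blk_rows[of \<rho> h] that(1) by (auto simp: H_def)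
    then show ?thesis using that by (simp add: M_def CM P_def)
  qed
  have M2: "M $$ (off h i + t,k+1+j) = (if i = j then (\<Sum>l<k+1. Const (Q j t l) * Var l) else 0)"
    if "i < 3" "t < h i + 1" "j < 3" for i j t
  proof -
    have 1: "crit_lin k h R (off h i + t) j l = (if i = j then Q j t l else 0)" if "l \<le> k" for l
      unfolding crit_lin_def blk_off(1)[where h = h, OF \<open>i < 3\<close> \<open>t < h i + 1\<close>] R_def
      using that \<open>t < h i + 1\<close> by auto
    have "M $$ (off h i + t,k+1+j) = (\<Sum>l\<le>k. Const (crit_lin k h R (off h i + t) j l) * Var l)"
      using that offH[OF that(1,2)] by (simp add: M_def CM)
    also have "\<dots> = (\<Sum>l\<le>k. Const (if i = j then Q j t l else 0) * Var l)"
      by (intro sum.cong refl) (use 1 in simp)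
    finally show ?thesis by (cases "i = j") (simp_all add: lessThan_Suc_atMost)
  qed
  have Mp: "M $$ (\<rho>,s) \<in> polys k" if "\<rho> < H" "s < k + 1 + 3" for \<rho> s
    using that by (cases "s \<le> k") (auto simp: M_def CM intro!: polys_sum)
  define Gm where "Gm = mat H H (\<lambda>(i,j). Const (G i j))"
  define Bm where "Bm = mat H H (\<lambda>(i,j). Const (B i j))"
  have GBm: "Bm * Gm = 1\<^sub>m H"
  proof (rule eq_matI)
    fix i j assume "i < dim_row (1\<^sub>m H :: cpoly mat)" "j < dim_col (1\<^sub>m H :: cpoly mat)"
    then have ij: "i < H" "j < H" by auto
    have "(Bm * Gm) $$ (i,j) = Const (\<Sum>s<H. B i s * G s j)"
      using ij by (simp add: Bm_def Gm_def scalar_prod_def lessThan_atLeast0 Const.hom_sum Const.hom_mult)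
    then show "(Bm * Gm) $$ (i,j) = 1\<^sub>m H $$ (i,j)" unfolding BG[OF ij] using ij by (simp add: Const.hom_one)
  qed (auto simp: Bm_def Gm_def)
  define S where "S = Gm * M"
  have Sentry: "S $$ (i,s) = (\<Sum>\<rho><H. Const (G i \<rho>) * M $$ (\<rho>,s))" if "i < H" "s < k + 1 + 3" for i s
    using that Mc by (simp add: S_def Gm_def scalar_prod_def lessThan_atLeast0)
  have S1: "S $$ (i,s) = (if i = c + 2 + s then 1 else 0)" if i: "i < H" and s: "s < k + 1" for i s
  proof -
    have "S $$ (i,s) = (\<Sum>\<rho><H. Const (G i \<rho>) * Const (B \<rho> (c + 2 + s)))"
      unfolding Sentry[OF i, of s, OF trans_less_add1[OF s]] by (intro sum.cong refl) (use M1[OF _ s] in simp)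
    also have "\<dots> = Const (\<Sum>\<rho><H. G i \<rho> * B \<rho> (c + 2 + s))" by (simp add: Const.hom_sum Const.hom_mult)
    also have "\<dots> = (if i = c + 2 + s then 1 else 0)" using GB[OF i, of "c + 2 + s"] s Hk by (simp add: Const.hom_one)
    finally show ?thesis .
  qed
  have S2: "S $$ (i,k+1+j) = tmat (c + 2) (k + 1) \<alpha> $$ (i,j)" if i: "i < c + 2" and j: "j < 3" for i j
  proof -
    have iH: "i < H" using i Hk by simp
    have "S $$ (i,k+1+j) = (\<Sum>\<rho><H. Const (\<N> i \<rho>) * M $$ (\<rho>,k+1+j))"
      unfolding Sentry[OF iH add_strict_left_mono[OF j]] by (intro sum.cong refl) (use G(2) i in simp)
    also have "\<dots> = (\<Sum>e<3. \<Sum>t<h e+1. Const (\<N> i (off h e + t)) * M $$ (off h e + t,k+1+j))"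
      unfolding H_def by (rule sum_blocks)
    also have "\<dots> = (\<Sum>e<3. if e = j then (\<Sum>t<h j+1. Const (N j i t) * (\<Sum>l<k+1. Const (Q j t l) * Var l)) else 0)"
    proof (intro sum.cong refl)
      fix e assume "e \<in> {..<3::nat}"
      then have e: "e < 3" by simp
      have "(\<Sum>t<h e+1. Const (\<N> i (off h e + t)) * M $$ (off h e + t,k+1+j)) =
        (\<Sum>t<h e+1. if e = j then Const (N j i t) * (\<Sum>l<k+1. Const (Q j t l) * Var l) else 0)"
        by (intro sum.cong refl) (use M2[OF e _ j] \<N>[OF e] in \<open>simp del: sum.lessThan_Suc\<close>)
      then show "(\<Sum>t<h e+1. Const (\<N> i (off h e + t)) * M $$ (off h e + t,k+1+j)) =
        (if e = j then (\<Sum>t<h j+1. Const (N j i t) * (\<Sum>l<k+1. Const (Q j t l) * Var l)) else 0)" by (cases "e = j") simp_all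
    qed
    also have "\<dots> = (\<Sum>t<h j+1. Const (N j i t) * (\<Sum>l<k+1. Const (Q j t l) * Var l))" using j by (simp del: sum.lessThan_Suc)
    also have "\<dots> = (\<Sum>l<k+1. (\<Sum>t<h j+1. Const (N j i t) * Const (Q j t l)) * Var l)"
      unfolding sum_distrib_left sum_distrib_right by (subst sum.swap) (simp add: mult_ac del: sum.lessThan_Suc)
    also have "\<dots> = (\<Sum>l<k+1. Const (\<alpha> i j l) * Var l)"
    proof (intro sum.cong refl arg_cong2[of _ _ _ _ "(*)"])
      fix l assume "l \<in> {..<k+1}"
      then show "(\<Sum>t<h j+1. Const (N j i t) * Const (Q j t l)) = Const (\<alpha> i j l)"
        using fac[OF j i, of l] by (simp add: Const.hom_sum Const.hom_mult Const.hom_add)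
    qed
    also have "\<dots> = tmat (c + 2) (k + 1) \<alpha> $$ (i,j)" using i j by (simp add: tmat_def)
    finally show ?thesis .
  qed
  have Sc: "S \<in> carrier_mat ((c + 2) + (k + 1)) (k + 1 + 3)"
    unfolding S_def Hk[symmetric] by (rule mult_carrier_mat[OF _ Mc]) (simp add: Gm_def)
  have Sp: "S $$ (i,s) \<in> polys k" if "i < (c + 2) + (k + 1)" "s < k + 1 + 3" for i s
  proof -
    have "i < H" using that Hk by simp
    then show ?thesis unfolding Sentry[OF \<open>i < H\<close> that(2)] using Mp that(2) by (intro polys_sum polys_mult) auto
  qed
  have "minors_ideal k S = minors_ideal k (tmat (c + 2) (k + 1) \<alpha>)"
  proof (rule minors_ideal_block[OF Sc _ Sp S2])
    show "tmat (c + 2) (k + 1) \<alpha> \<in> carrier_mat (c + 2) 3" by (simp add: tmat_def)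
    show "S $$ (i,j) = 0" if "i < c + 2" "j < k + 1" for i j
      using S1[of i j] that Hk by simp
    show "S $$ (c + 2 + i,j) = (if i = j then 1 else 0)" if "i < k + 1" "j < k + 1" for i j
      using S1[of "c + 2 + i" j] that Hk by simp
  qed
  moreover have "minors_ideal k S = minors_ideal k M"
    unfolding S_def
  proof (rule minors_ideal_mult_left[OF Mc Mp])
    show "Gm \<in> carrier_mat H H" "Bm \<in> carrier_mat H H" by (simp_all add: Gm_def Bm_def)
    show "Bm * Gm = 1\<^sub>m H" by (rule GBm)
  qed (auto simp: Gm_def Bm_def)
  ultimately have ci: "critical_ideal k P R = vanishing_ideal k X"
    by (simp add: critical_ideal_def M_def ideal)
  have zX: "zeros k (critical_ideal k P R) = X" unfolding ci by (rule zariski_closed_zeros[OF closed, symmetric])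
  \<comment> \<open>The stacked P_i are columns of an invertible matrix; multiplying by the dual
    rows of \<open>G\<close> recovers the coordinates of \<open>v\<close>.\<close>
  have kerP: "v = 0\<^sub>v (k+1)" if v: "v \<in> carrier_vec (k+1)" and kv: "\<And>i. i < 3 \<Longrightarrow> P i *\<^sub>v v = 0\<^sub>v (h i + 1)" for v
  proof (rule eq_vecI)
    have z: "(\<Sum>s<k+1. B \<rho> (c + 2 + s) * v $ s) = 0" if \<rho>: "\<rho> < H" for \<rho>
    proof -
      define i where "i = blk h \<rho>"
      define t where "t = \<rho> - off h i"
      have it: "i < 3" "\<rho> = off h i + t" "t < h i + 1"
        using blk_rows[of \<rho> h] \<rho> by (auto simp: H_def i_def t_def)
      have "(P i *\<^sub>v v) $ t = (\<Sum>s<k+1. B \<rho> (c + 2 + s) * v $ s)"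
        using it v by (simp add: P_def scalar_prod_def lessThan_atLeast0)
      then show ?thesis using kv[OF it(1)] it(3) by simp
    qed
    fix s assume "s < dim_vec (0\<^sub>v (k+1))"
    then have s: "s < k + 1" by simp
    have "0 = (\<Sum>\<rho><H. G (c + 2 + s) \<rho> * (\<Sum>s'<k+1. B \<rho> (c + 2 + s') * v $ s'))"
      by (rule sym, intro sum.neutral ballI) (use z in simp)
    also have "\<dots> = (\<Sum>s'<k+1. (\<Sum>\<rho><H. G (c + 2 + s) \<rho> * B \<rho> (c + 2 + s')) * v $ s')"
      unfolding sum_distrib_left sum_distrib_right by (subst sum.swap) (simp add: mult_ac del: sum.lessThan_Suc)
    also have "\<dots> = (\<Sum>s'<k+1. if s' = s then v $ s else 0)"
    proof (intro sum.cong refl)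
      fix s' assume "s' \<in> {..<k+1}"
      then show "(\<Sum>\<rho><H. G (c + 2 + s) \<rho> * B \<rho> (c + 2 + s')) * v $ s' = (if s' = s then v $ s else 0)"
        using GB[of "c + 2 + s" "c + 2 + s'"] s Hk by auto
    qed
    also have "\<dots> = v $ s" using s by (simp del: sum.lessThan_Suc)
    finally show "v $ s = 0\<^sub>v (k+1) $ s" using s by simp
  qed (use v in simp)
  \<comment> \<open>At a common point of the centers A(x) would be the zero matrix, whereas
    \<open>tri_kernel_unique\<close> forbids two independent kernel vectors.\<close>
  have kerR: "v = 0\<^sub>v (k+1)" if v: "v \<in> carrier_vec (k+1)" and kv: "\<And>i. i < 3 \<Longrightarrow> R i *\<^sub>v v = 0\<^sub>v (h i + 1)" for v
  proof (rule ccontr)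
    assume "v \<noteq> 0\<^sub>v (k+1)"
    then have "v \<in> proj_space k" using v by (simp add: proj_space_def)
    then obtain l where l': "l \<le> k" "v $ l \<noteq> 0" using proj_nonzero by blast
    then have l: "l < k + 1" "v $ l \<noteq> 0" by simp_all
    define x where "x l = v $ l" for l
    have nx: "nz (k+1) x" by (rule nzI[OF l(1)]) (use l in \<open>simp add: x_def\<close>)
    have Qx: "(\<Sum>l<k+1. Q j t l * x l) = 0" if "j < 3" "t < h j + 1" for j t
    proof -
      have "(R j *\<^sub>v v) $ t = (\<Sum>l<k+1. Q j t l * x l)"
        using that v by (simp add: R_def x_def scalar_prod_def lessThan_atLeast0)
      then show ?thesis using kv[OF that(1)] that(2) by simp
    qed
    have ux: "tr (ue i) (ue j) x = 0" if "i < c + 2" "j < 3" for i j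
    proof -
      have "tr (ue i) (ue j) x = (\<Sum>l<k+1. x l * (\<Sum>t<h j+1. N j i t * Q j t l))"
        unfolding tri_expand(3)[of _ _ _ "ue i" "ue j" x]
        by (intro sum.cong refl arg_cong2[of _ _ _ _ "(*)"]) (use fac[OF that(2,1)] that in \<open>simp add: tri_ue\<close>)
      also have "\<dots> = (\<Sum>t<h j+1. N j i t * (\<Sum>l<k+1. Q j t l * x l))"
        unfolding sum_distrib_left by (subst sum.swap) (simp add: mult_ac del: sum.lessThan_Suc)
      also have "\<dots> = 0" by (intro sum.neutral ballI) (use Qx[OF that(2)] in \<open>simp del: sum.lessThan_Suc\<close>)
      finally show ?thesis .
    qed
    have jx: "tr w (ue j) x = 0" if "j < 3" for w j
    proof -
      have "\<forall>i<c+2. tr (ue i) (ue j) x = 0" using ux that by blast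
      then show ?thesis unfolding tri_zero_iff(1) by blast
    qed
    have "ue 1 0 \<noteq> (0::complex)"
    proof (rule tri_kernel_unique[OF nx, of "ue 0"])
      show "tr w (ue 0) x = 0" "tr w (ue 1) x = 0" for w by (rule jx; simp)+
      show "nz 3 (ue 1)" by (rule nzI[of 1]) (simp_all add: ue_def)
    qed (simp_all add: ue_def)
    then show False by (simp add: ue_def)
  qed
  have mk: "(\<Inter>i\<in>{..<3}. mat_kernel (A i)) = {0\<^sub>v (k + 1)}"
    if cA: "\<And>i. A i \<in> carrier_mat (h i + 1) (k + 1)"
      and kA: "\<And>v. v \<in> carrier_vec (k+1) \<Longrightarrow> (\<And>i. i < 3 \<Longrightarrow> A i *\<^sub>v v = 0\<^sub>v (h i + 1)) \<Longrightarrow> v = 0\<^sub>v (k+1)" for A :: "nat \<Rightarrow> complex mat"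
  proof (intro equalityI subsetI)
    fix v assume v: "v \<in> (\<Inter>i\<in>{..<3}. mat_kernel (A i))"
    have "v \<in> mat_kernel (A i)" if "i < 3" for i using v that by blast
    then have 1: "v \<in> carrier_vec (k+1) \<and> A i *\<^sub>v v = 0\<^sub>v (h i + 1)" if i: "i < 3" for i
      using mat_kernelD[OF cA[of i]] i by blast
    have "v \<in> carrier_vec (k+1)" using 1[of 0] by simp
    then have "v = 0\<^sub>v (k + 1)" by (rule kA) (use 1 in blast)
    then show "v \<in> {0\<^sub>v (k + 1)}" by simp
  next
    fix v :: "complex vec" assume "v \<in> {0\<^sub>v (k + 1)}"
    then have v: "v = 0\<^sub>v (k + 1)" by simp
    show "v \<in> (\<Inter>i\<in>{..<3}. mat_kernel (A i))"
    proof
      fix i assume "i \<in> {..<3::nat}"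
      show "v \<in> mat_kernel (A i)" unfolding v
        by (rule mat_kernelI[OF cA]) (use cA[of i] in auto)
    qed
  qed
  have "is_critical_locus k h P R X"
    unfolding is_critical_locus_def admissible_triples_def
  proof (intro conjI allI impI)
    show "projection k (h i) (P i)" "projection k (h i) (R i)" if "i < 3" for i
      unfolding projection_def using h(2)[OF that] PR rankP[OF that] rankR[OF that] by auto
    show "(\<Inter>i\<in>{..<3}. mat_kernel (P i)) = {0\<^sub>v (k + 1)}" by (rule mk) (use PR kerP in blast)+
    show "(\<Inter>i\<in>{..<3}. mat_kernel (R i)) = {0\<^sub>v (k + 1)}" by (rule mk) (use PR kerR in blast)+
    show "\<exists>d. has_dim k (zeros k (critical_ideal k P R)) d \<and> d + (h 0 + h 1 + h 2) = 2 * k"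
      unfolding zX using dim h(1) ck by (intro exI[of _ "k - c"]) auto
    show "same_subscheme k (critical_ideal k P R) (vanishing_ideal k X)" by (simp add: ci same_subscheme_def)
  qed
  then show ?thesis by (intro exI)
qed

end

section \<open>Syzygies of maximal minors\<close>

definition bm :: "nat \<Rightarrow> (nat \<Rightarrow> nat \<Rightarrow> 'a::comm_ring_1) \<Rightarrow> (nat \<Rightarrow> 'a) \<Rightarrow> 'a mat" where
  "bm k N p = mat (k+1) (k+1) (\<lambda>(l,i). if i < k then N l i else p l)"

text \<open>The signed maximal minors, as cofactors of a matrix bordered by an arbitrary column.\<close>

definition crs :: "nat \<Rightarrow> (nat \<Rightarrow> nat \<Rightarrow> 'a::comm_ring_1) \<Rightarrow> nat \<Rightarrow> 'a" where
  "crs k N l = cofactor (bm k N (\<lambda>_. 0)) l k"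

lemma bm_carrier [simp]: "bm k N p \<in> carrier_mat (k+1) (k+1)"
  by (simp add: bm_def)

lemma bm_cofactor: "l < k + 1 \<Longrightarrow> cofactor (bm k N p) l k = crs k N l"
proof -
  assume "l < k + 1"
  have "mat_delete (bm k N p) l k = mat_delete (bm k N (\<lambda>_. 0)) l k"
    by (rule eq_matI) (auto simp: mat_delete_def bm_def)
  then show ?thesis by (simp add: crs_def cofactor_def)
qed

lemma bm_index: "l < k + 1 \<Longrightarrow> i < k + 1 \<Longrightarrow> bm k N p $$ (l,i) = (if i < k then N l i else p l)"
  by (simp add: bm_def)

lemma det_bm: "det (bm k N p) = (\<Sum>l<k+1. p l * crs k N l)"
proof -
  have "det (bm k N p) = (\<Sum>l<k+1. bm k N p $$ (l,k) * cofactor (bm k N p) l k)"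
    by (rule laplace_expansion_column[OF bm_carrier]) simp
  also have "\<dots> = (\<Sum>l<k+1. p l * crs k N l)"
    by (intro sum.cong refl arg_cong2[of _ _ _ _ "(*)"]) (simp_all add: bm_cofactor bm_index)
  finally show ?thesis .
qed

lemma crs_kill: "j < k \<Longrightarrow> (\<Sum>l<k+1. crs k N l * N l j) = 0"
proof -
  assume j: "j < k"
  have "(\<Sum>l<k+1. crs k N l * N l j) = (\<Sum>l<k+1. cofactor (bm k N (\<lambda>_. 0)) l k * bm k N (\<lambda>_. 0) $$ (l,j))"
    using j by (intro sum.cong refl) (simp add: crs_def bm_index)
  also have "\<dots> = 0" using cofactor_sum_col[OF bm_carrier, of k k j N "\<lambda>_. 0"] j by simp
  finally show ?thesis .
qed

text \<open>The product of a bordered matrix and its adjugate, applied to \<open>a\<close>, with the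
  contribution of the border split off. If \<open>a\<close> is a syzygy of the minors this
  contribution is 0, and a multiple of \<open>a\<close> lies in the column span of
  \<open>N\<close>.\<close>

lemma bm_cramer:
  assumes "l < k + 1"
  shows "(\<Sum>s<k. N l s * (\<Sum>e<k+1. cofactor (bm k N p) e s * a e)) + p l * (\<Sum>e<k+1. crs k N e * a e)
    = det (bm k N p) * a l"
proof -
  let ?A = "bm k N p"
  have "(\<Sum>s<k+1. ?A $$ (l,s) * (\<Sum>e<k+1. cofactor ?A e s * a e)) = (\<Sum>e<k+1. (\<Sum>s<k+1. ?A $$ (l,s) * cofactor ?A e s) * a e)"
    unfolding sum_distrib_left sum_distrib_right by (subst sum.swap) (simp add: mult_ac del: sum.lessThan_Suc)
  also have "\<dots> = (\<Sum>e<k+1. if e = l then det ?A * a l else 0)"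
  proof (intro sum.cong refl)
    fix e assume "e \<in> {..<k+1}"
    then have e: "e < k + 1" by simp
    show "(\<Sum>s<k+1. ?A $$ (l,s) * cofactor ?A e s) * a e = (if e = l then det ?A * a l else 0)"
      unfolding cofactor_sum_row[OF bm_carrier assms e] by simp
  qed
  also have "\<dots> = det ?A * a l" using assms by (simp del: sum.lessThan_Suc)
  finally have 1: "(\<Sum>s<k+1. ?A $$ (l,s) * (\<Sum>e<k+1. cofactor ?A e s * a e)) = det ?A * a l" .
  have "(\<Sum>s<k+1. ?A $$ (l,s) * (\<Sum>e<k+1. cofactor ?A e s * a e)) =
    (\<Sum>s<k. ?A $$ (l,s) * (\<Sum>e<k+1. cofactor ?A e s * a e)) + ?A $$ (l,k) * (\<Sum>e<k+1. cofactor ?A e k * a e)"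
    by simp
  also have "(\<Sum>s<k. ?A $$ (l,s) * (\<Sum>e<k+1. cofactor ?A e s * a e)) = (\<Sum>s<k. N l s * (\<Sum>e<k+1. cofactor ?A e s * a e))"
    by (intro sum.cong refl) (use assms in \<open>simp add: bm_index\<close>)
  also have "(\<Sum>e<k+1. cofactor ?A e k * a e) = (\<Sum>e<k+1. crs k N e * a e)"
    by (intro sum.cong refl) (simp add: bm_cofactor)
  also have "?A $$ (l,k) = p l" using assms by (simp add: bm_index)
  finally show ?thesis using 1 by simp
qed

lemma (in comm_ring_hom) crs_hom: "l < k + 1 \<Longrightarrow> crs k (\<lambda>l i. hom (N l i)) l = hom (crs k N l)"
proof -
  assume l: "l < k + 1"
  have "bm k (\<lambda>l i. hom (N l i)) (\<lambda>_. 0) = map_mat hom (bm k N (\<lambda>_. 0))"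
    by (rule eq_matI) (auto simp: bm_def)
  then show ?thesis unfolding crs_def using hom_cofactor[of l "bm k N (\<lambda>_. 0)" k] l by (simp add: bm_def)
qed

lemma crs_zero_iff:
  fixes N :: "nat \<Rightarrow> nat \<Rightarrow> complex"
  shows "(\<forall>l<k+1. crs k N l = 0) \<longleftrightarrow> (\<exists>w. nz k w \<and> (\<forall>l<k+1. (\<Sum>i<k. N l i * w i) = 0))"
proof
  assume "\<exists>w. nz k w \<and> (\<forall>l<k+1. (\<Sum>i<k. N l i * w i) = 0)"
  then obtain w where w: "nz k w" "\<forall>l<k+1. (\<Sum>i<k. N l i * w i) = 0" by blast
  obtain i where i: "i < k" "w i \<noteq> 0" using w(1) by (rule nzE)
  define w' where "w' i = (if i < k then w i else 0)" for i
  show "\<forall>l<k+1. crs k N l = 0"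
  proof (intro allI impI)
    fix l assume l: "l < k + 1"
    have "det (mat (k+1) (k+1) (\<lambda>(l',i). if i < k then N l' i else (if l' = l then 1 else 0))) = 0"
    proof (rule square_det_0I)
      show "nz (k+1) w'" by (rule nzI[of i]) (use i in \<open>auto simp: w'_def\<close>)
      show "\<forall>i<k+1. (\<Sum>j<k+1. (if j < k then N i j else (if i = l then 1 else 0)) * w' j) = 0"
        using w(2) by (simp add: w'_def)
    qed
    then have "det (bm k N (\<lambda>l'. if l' = l then 1 else 0)) = 0" by (simp add: bm_def)
    moreover have "(\<Sum>l'<k+1. (if l' = l then 1 else 0) * crs k N l') = (\<Sum>l'<k+1. if l' = l then crs k N l else 0)"
      by (intro sum.cong) auto
    ultimately show "crs k N l = 0" unfolding det_bm using l by (simp del: sum.lessThan_Suc)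
  qed
next
  assume z: "\<forall>l<k+1. crs k N l = 0"
  obtain x where x: "nz (k+1) x" "\<forall>i\<in>{..<k}. (\<Sum>l<k+1. N l i * x l) = 0"
    using kernel_nontrivial[of "{..<k}" "k+1" "\<lambda>i l. N l i"] by (metis card_lessThan finite_lessThan less_add_one)
  \<comment> \<open>The border is the conjugate of a left kernel vector \<open>x\<close> of N.
    Pairing a kernel vector of the bordered matrix with \<open>x\<close> shows that its last
    coordinate is 0, so it is a kernel vector of \<open>N\<close>.\<close>
  have "det (mat (k+1) (k+1) (\<lambda>(l,i). if i < k then N l i else cnj (x l))) = 0"
    using det_bm[of k N "\<lambda>l. cnj (x l)"] z by (simp add: bm_def)
  then obtain u where u: "nz (k+1) u" "\<forall>l<k+1. (\<Sum>i<k+1. (if i < k then N l i else cnj (x l)) * u i) = 0"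
    unfolding square_kernel by blast
  have u': "(\<Sum>i<k. N l i * u i) + cnj (x l) * u k = 0" if "l < k + 1" for l
    using u(2) that by simp
  have "0 = (\<Sum>l<k+1. x l * ((\<Sum>i<k. N l i * u i) + cnj (x l) * u k))" using u' by simp
  also have "\<dots> = (\<Sum>l<k+1. x l * (\<Sum>i<k. N l i * u i)) + u k * (\<Sum>l<k+1. x l * cnj (x l))"
    unfolding distrib_left sum.distrib by (simp only: sum_distrib_left mult_ac)
  also have "(\<Sum>l<k+1. x l * (\<Sum>i<k. N l i * u i)) = (\<Sum>i<k. (\<Sum>l<k+1. N l i * x l) * u i)"
    unfolding sum_distrib_left sum_distrib_right by (subst sum.swap) (simp add: mult_ac del: sum.lessThan_Suc)
  also have "\<dots> = 0" by (intro sum.neutral ballI) (use x(2) in simp)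
  also have "(\<Sum>l<k+1. x l * cnj (x l)) = complex_of_real (\<Sum>l<k+1. (cmod (x l))\<^sup>2)"
    unfolding of_real_sum by (intro sum.cong refl) (simp only: complex_norm_square)
  finally have "u k * complex_of_real (\<Sum>l<k+1. (cmod (x l))\<^sup>2) = 0" by simp
  then have "u k = 0 \<or> (\<Sum>l<k+1. (cmod (x l))\<^sup>2) = 0" unfolding mult_eq_0_iff of_real_eq_0_iff .
  moreover have "(\<Sum>l<k+1. (cmod (x l))\<^sup>2) \<noteq> 0"
    using x(1) by (auto simp: sum_nonneg_eq_0_iff simp del: sum.lessThan_Suc elim!: nzE)
  ultimately have uk: "u k = 0" by blast
  have "nz k u"
  proof -
    obtain i where "i < k + 1" "u i \<noteq> 0" using u(1) by (rule nzE)
    then show ?thesis using uk by (intro nzI[of i]) (auto simp: less_Suc_eq)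
  qed
  then show "\<exists>w. nz k w \<and> (\<forall>l<k+1. (\<Sum>i<k. N l i * w i) = 0)" using u' uk by (intro exI[of _ u]) simp
qed

text \<open>A pencil of full rank at every point of the projective line.\<close>

locale full_pencil =
  fixes k :: nat and a b :: "nat \<Rightarrow> nat \<Rightarrow> complex"
  assumes inj: "\<And>s w. (\<forall>l<k+1. (\<Sum>i<k. (b l i + s * a l i) * w i) = 0) \<Longrightarrow> (\<forall>i<k. w i = 0)"
    and top: "\<And>w. (\<forall>l<k+1. (\<Sum>i<k. a l i * w i) = 0) \<Longrightarrow> (\<forall>i<k. w i = 0)"
begin

definition pn :: "nat \<Rightarrow> nat \<Rightarrow> complex poly" where "pn l i = [:b l i, a l i:]"

text \<open>At a root s of \<open>f\<close> the left side vanishes, and injectivity of the pencil at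
  s makes all \<open>w i\<close> vanish there; X - s can be cancelled, and \<open>f\<close> is used
  up by induction on its degree.\<close>

lemma divide_out:
  assumes "f \<noteq> 0" "\<forall>l<k+1. f * v l = (\<Sum>i<k. pn l i * w i)"
  shows "\<exists>w. \<forall>l<k+1. v l = (\<Sum>i<k. pn l i * w i)"
  using assms
proof (induction "degree f" arbitrary: f w)
  case 0
  then obtain c where c: "f = [:c:]" by (metis degree_eq_zeroE)
  then have c0: "c \<noteq> 0" using 0(2) by simp
  have "v l = (\<Sum>i<k. pn l i * ([:1/c:] * w i))" if "l < k + 1" for l
  proof -
    have "[:1/c:] * ([:c:] * v l) = [:1/c:] * (\<Sum>i<k. pn l i * w i)" using 0(3) that c by simp
    moreover have "[:1/c:] * ([:c:] * v l) = v l" using c0 by simp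
    ultimately show ?thesis by (simp only: sum_distrib_left mult.left_commute)
  qed
  then show ?case by (intro exI[of _ "\<lambda>i. [:1/c:] * w i"]) blast
next
  case (Suc d)
  have "\<not> constant (poly f)" using Suc.hyps(2) by (simp add: constant_degree)
  then obtain s where s: "poly f s = 0" using fundamental_theorem_of_algebra by blast
  let ?m = "[:-s, 1:]"
  have "\<forall>i<k. poly (w i) s = 0"
  proof (rule inj[of s], intro allI impI)
    fix l assume "l < k + 1"
    then have "poly (f * v l) s = poly (\<Sum>i<k. pn l i * w i) s" using Suc.prems(2) by simp
    then show "(\<Sum>i<k. (b l i + s * a l i) * poly (w i) s) = 0" using s by (simp add: poly_sum pn_def algebra_simps sum.distrib)
  qed
  then have "\<forall>i<k. ?m dvd w i" by (simp add: poly_eq_0_iff_dvd)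
  then have w2: "\<forall>i<k. w i = ?m * (w i div ?m)" by (intro allI impI, subst dvd_mult_div_cancel) blast+
  obtain f2 where f2: "f = ?m * f2" using s by (auto simp: poly_eq_0_iff_dvd)
  have f20: "f2 \<noteq> 0" using f2 Suc.prems(1) by auto
  have "degree f = Suc (degree f2)" using f20 unfolding f2 by (subst degree_mult_eq) auto
  then have d: "d = degree f2" using Suc.hyps(2) by simp
  have "f2 * v l = (\<Sum>i<k. pn l i * (w i div ?m))" if l: "l < k + 1" for l
  proof -
    have "?m * (f2 * v l) = (\<Sum>i<k. pn l i * w i)"
      unfolding mult.assoc[symmetric] f2[symmetric] using Suc.prems(2) l by blast
    also have "\<dots> = (\<Sum>i<k. pn l i * (?m * (w i div ?m)))"
      by (intro sum.cong refl arg_cong2[of _ _ _ _ "(*)"]) (use w2 in simp)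
    also have "\<dots> = ?m * (\<Sum>i<k. pn l i * (w i div ?m))" by (simp only: sum_distrib_left mult.left_commute)
    finally show ?thesis by (simp only: mult_cancel_left) simp
  qed
  then have "\<forall>l<k+1. f2 * v l = (\<Sum>i<k. pn l i * (w i div ?m))" by blast
  then show ?case by (rule Suc.hyps(1)[OF d f20])
qed

text \<open>The Hilbert-Burch theorem in one variable: some minor is nonzero, Cramer's rule puts its
  multiple of \<open>v\<close> into the column span, and \<open>divide_out\<close> removes the
  factor.\<close>

lemma full_pencil_syzygy:
  assumes v: "(\<Sum>l<k+1. crs k pn l * v l) = 0"
  shows "\<exists>w. \<forall>l<k+1. v l = (\<Sum>i<k. pn l i * w i)"
proof -
  have "\<exists>l0<k+1. crs k pn l0 \<noteq> 0"
  proof (rule ccontr)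
    assume "\<not> ?thesis"
    then have z: "\<forall>l<k+1. crs k pn l = 0" by blast
    interpret p0: comm_ring_hom "\<lambda>p. poly p (0::complex)" by standard auto
    have "crs k (\<lambda>l i. poly (pn l i) 0) l = 0" if l: "l < k + 1" for l
      unfolding p0.crs_hom[OF l] using z l by simp
    then have "\<forall>l<k+1. crs k (\<lambda>l i. poly (pn l i) 0) l = 0" by blast
    then obtain w where w: "nz k w" "\<forall>l<k+1. (\<Sum>i<k. poly (pn l i) 0 * w i) = 0" unfolding crs_zero_iff by blast
    have "\<forall>i<k. w i = 0" by (rule inj[of 0]) (use w(2) in \<open>simp add: pn_def\<close>)
    then show False using w(1) by (auto elim: nzE)
  qed
  then obtain l0 where l0: "l0 < k + 1" "crs k pn l0 \<noteq> 0" by blast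
  let ?p = "\<lambda>l. if l = l0 then 1 else 0 :: complex poly"
  have "det (bm k pn ?p) = (\<Sum>l<k+1. if l = l0 then crs k pn l0 else 0)"
    unfolding det_bm by (intro sum.cong) auto
  then have d: "det (bm k pn ?p) = crs k pn l0" using l0(1) by (simp del: sum.lessThan_Suc)
  have "crs k pn l0 * v l = (\<Sum>s<k. pn l s * (\<Sum>e<k+1. cofactor (bm k pn ?p) e s * v e))" if "l < k + 1" for l
    using bm_cramer[OF that, of pn ?p v] unfolding v d mult_zero_right add_0_right by (rule sym)
  then have "\<forall>l<k+1. crs k pn l0 * v l = (\<Sum>s<k. pn l s * (\<Sum>e<k+1. cofactor (bm k pn ?p) e s * v e))" by blast
  then show ?thesis by (rule divide_out[OF l0(2)])
qed

text \<open>Leading coefficients cannot cancel because the pencil is injective at infinity, so the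
  degree bound for \<open>w\<close> is one lower than that for \<open>v\<close>.\<close>

lemma full_pencil_degree:
  assumes v: "\<forall>l<k+1. v l = (\<Sum>i<k. pn l i * w i)" and d: "\<forall>l<k+1. \<forall>e\<ge>d. coeff (v l) e = 0"
    and i: "i < k" and e: "d \<le> e + 1"
  shows "coeff (w i) e = 0"
proof (rule ccontr)
  assume ne: "coeff (w i) e \<noteq> 0"
  define S where "S = {e. d \<le> e + 1 \<and> (\<exists>i<k. coeff (w i) e \<noteq> 0)}"
  have "S \<subseteq> (\<Union>i<k. {..degree (w i)})" by (auto simp: S_def intro: le_degree)
  then have fS: "finite S" by (rule finite_subset) simp
  have "e \<in> S" using ne i e by (auto simp: S_def)
  define m where "m = Max S"
  have m: "m \<in> S" "\<And>e. e \<in> S \<Longrightarrow> e \<le> m"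
    using Max_in[OF fS] Max_ge[OF fS] \<open>e \<in> S\<close> unfolding m_def by blast+
  have z: "coeff (w i) (Suc m) = 0" if "i < k" for i
  proof (rule ccontr)
    assume "coeff (w i) (Suc m) \<noteq> 0"
    then have "Suc m \<in> S" using m(1) that by (auto simp: S_def)
    then show False using m(2) by fastforce
  qed
  have "\<forall>i<k. coeff (w i) m = 0"
  proof (rule top, intro allI impI)
    fix l assume l: "l < k + 1"
    have "coeff (v l) (Suc m) = 0" using d l m(1) by (auto simp: S_def)
    then have "(\<Sum>i<k. coeff (pn l i * w i) (Suc m)) = 0" using v l by (simp add: coeff_sum)
    moreover have "coeff (pn l i * w i) (Suc m) = a l i * coeff (w i) m" if "i < k" for i
      using z[OF that] by (simp add: pn_def)
    ultimately show "(\<Sum>i<k. a l i * coeff (w i) m) = 0" by simp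
  qed
  then show False using m(1) by (auto simp: S_def)
qed

end

section \<open>Restriction of ternary forms to a line\<close>

text \<open>Restriction to the line x_2 = 0 in the affine coordinate x_0, with x_1 = 1. The degree
  of a form is lost, so it reappears as a separate bound on coefficients.\<close>

definition rst :: "cpoly \<Rightarrow> complex poly" where
  "rst = subst (\<lambda>c. [:c:]) (\<lambda>i. if i = 0 then [:0, 1:] else if i = 1 then 1 else 0)"

lemma comm_ring_hom_const_poly: "comm_ring_hom (\<lambda>c::complex. [:c:])"
  by standard (auto simp: one_pCons)

interpretation rst: comm_ring_hom rst
  unfolding rst_def by (rule subst_hom[OF comm_ring_hom_const_poly])

lemma rst_Const [simp]: "rst (Const a) = [:a:]"
  by (simp add: rst_def subst_Const[OF comm_ring_hom_const_poly])

lemma rst_Var [simp]: "rst (Var 0) = [:0, 1:]" "rst (Var (Suc 0)) = 1" "rst (Var 2) = 0"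
  by (simp_all add: rst_def subst_Var[OF comm_ring_hom_const_poly])

lemma binary_forms:
  "f \<in> forms 1 d \<Longrightarrow> \<exists>c. f = (\<Sum>i\<le>d. Const (c i) * Var 0 ^ i * Var 1 ^ (d - i))"
proof (induction d arbitrary: f)
  case 0
  then obtain a where "f = Const a" using forms_degree_0 by blast
  then show ?case by (intro exI[of _ "\<lambda>_. a"]) simp
next
  case (Suc d)
  obtain f0 f1 where f: "f0 \<in> forms 0 (Suc d)" "f1 \<in> forms 1 d" "f = f0 + Var 1 * f1"
    using forms_split[of f 0 "Suc d"] Suc.prems by auto
  obtain a where a: "f0 = Const a * Var 0 ^ Suc d" using forms_0_0[OF f(1)] by blast
  obtain c where c: "f1 = (\<Sum>i\<le>d. Const (c i) * Var 0 ^ i * Var 1 ^ (d - i))" using Suc.IH[OF f(2)] by (rule exE)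
  have "Var 1 * f1 = (\<Sum>i\<le>d. Const (c i) * Var 0 ^ i * Var 1 ^ (Suc d - i))"
    unfolding c sum_distrib_left by (intro sum.cong refl) (simp add: Suc_diff_le mult_ac)
  also have "\<dots> = (\<Sum>i\<le>d. Const ((c(Suc d := a)) i) * Var 0 ^ i * Var 1 ^ (Suc d - i))"
    by (intro sum.cong refl) auto
  finally have "Var 1 * f1 = (\<Sum>i\<le>d. Const ((c(Suc d := a)) i) * Var 0 ^ i * Var 1 ^ (Suc d - i))" .
  then have "f = (\<Sum>i\<le>Suc d. Const ((c(Suc d := a)) i) * Var 0 ^ i * Var 1 ^ (Suc d - i))"
    using f(3) a by simp
  then show ?case by (intro exI[of _ "c(Suc d := a)"])
qed

lemma rst_binary: "rst (\<Sum>i\<le>d. Const (c i) * Var 0 ^ i * Var 1 ^ (d - i)) = (\<Sum>i\<le>d. monom (c i) i)"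
  by (simp add: rst.hom_sum rst.hom_mult rst.hom_power monom_altdef)

lemma coeff_sum_monom: "coeff (\<Sum>i\<le>d. monom (c i) i) e = (if e \<le> d then c e else 0)"
  by (simp add: coeff_sum)

lemma rst_coeff:
  assumes "f \<in> forms 2 d" "e > d"
  shows "coeff (rst f) e = 0"
proof -
  obtain f0 f1 where f: "f0 \<in> forms 1 d" "f = f0 + Var 2 * f1"
    using forms_split[of f 1 d] assms(1) by (auto simp: numeral_2_eq_2)
  obtain c where c: "f0 = (\<Sum>i\<le>d. Const (c i) * Var 0 ^ i * Var 1 ^ (d - i))" using binary_forms[OF f(1)] by (rule exE)
  have "rst f = (\<Sum>i\<le>d. monom (c i) i)" unfolding f(2) c rst.hom_add rst.hom_mult rst_binary by simp
  then show ?thesis using assms(2) by (simp add: coeff_sum_monom)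
qed

lemma rst_zero:
  assumes "f \<in> forms 2 d" "rst f = 0"
  shows "\<exists>g\<in>forms 2 (d - 1). f = Var 2 * g \<and> (d = 0 \<longrightarrow> g = 0)"
proof -
  obtain f0 f1 where f: "f0 \<in> forms 1 d" "f1 \<in> forms 2 (d - 1)" "f = f0 + Var 2 * f1" "d = 0 \<longrightarrow> f1 = 0"
    using forms_split[of f 1 d] assms(1) by (auto simp: numeral_2_eq_2)
  obtain c where c: "f0 = (\<Sum>i\<le>d. Const (c i) * Var 0 ^ i * Var 1 ^ (d - i))" using binary_forms[OF f(1)] by (rule exE)
  have "rst f = (\<Sum>i\<le>d. monom (c i) i)" unfolding f(3) c rst.hom_add rst.hom_mult rst_binary by simp
  then have "c i = 0" if "i \<le> d" for i
    using coeff_sum_monom[of c d i] assms(2) that by simp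
  then have "f0 = 0" unfolding c by (intro sum.neutral) simp
  then show ?thesis using f by (intro bexI[of _ f1]) auto
qed

lemma rst_surj:
  assumes "\<forall>e>d. coeff p e = 0"
  shows "\<exists>f\<in>forms 2 d. rst f = p"
proof (intro bexI)
  let ?f = "\<Sum>i\<le>d. Const (coeff p i) * Var 0 ^ i * Var 1 ^ (d - i)"
  show "rst ?f = p" unfolding rst_binary using assms
    by (intro poly_eqI) (simp add: coeff_sum_monom)
  have "Const (coeff p i) * Var 0 ^ i * Var 1 ^ (d - i) \<in> forms 2 d" if "i \<le> d" for i
  proof -
    have "Var 0 ^ i * Var 1 ^ (d - i) \<in> forms 2 (i * 1 + (d - i) * 1)"
      by (intro forms_mult forms_power forms_Var) auto
    then show ?thesis using that forms_Const_mult[of _ 2 d] by (simp add: mult.assoc)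
  qed
  then show "?f \<in> forms 2 d" by (intro forms_sum) simp
qed

section \<open>The ideal of minors of a matrix of ternary linear forms\<close>

text \<open>The case k = c + 2. The tensor is read as a (k+1) x k matrix \<open>N\<close> of linear
  forms in y, with rows indexed by x and columns by w. The two assumptions are all that is kept of
  the smoothness of X, and they are invariant under changes of the coordinates y.\<close>

locale smooth_tensor =
  fixes k :: nat and \<alpha> :: tensor
  assumes k2: "k \<ge> 2"
    and key: "\<And>x y w. nz (k+1) x \<Longrightarrow> nz 3 y \<Longrightarrow> nz k w \<Longrightarrow> (\<And>w'. tri k (k+1) \<alpha> w' y x = 0) \<Longrightarrow>
      (\<And>y'. tri k (k+1) \<alpha> w y' x = 0) \<Longrightarrow> \<exists>x'. tri k (k+1) \<alpha> w y x' \<noteq> 0"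
    and left_unique: "\<And>y i w w'. nz 3 y \<Longrightarrow> i < k \<Longrightarrow> w i \<noteq> 0 \<Longrightarrow> (\<And>x. tri k (k+1) \<alpha> w y x = 0) \<Longrightarrow>
      (\<And>x. tri k (k+1) \<alpha> w' y x = 0) \<Longrightarrow> nz k w' \<Longrightarrow> w' i \<noteq> 0"
begin

abbreviation tr where "tr \<equiv> tri k (k+1) \<alpha>"

definition N :: "nat \<Rightarrow> nat \<Rightarrow> cpoly" where
  "N l i = (\<Sum>j<3. Const (\<alpha> i j l) * Var j)"

definition q :: "nat \<Rightarrow> cpoly" where "q l = crs k N l"

definition inZ :: "(nat \<Rightarrow> complex) \<Rightarrow> bool" where
  "inZ y \<longleftrightarrow> nz 3 y \<and> (\<exists>w. nz k w \<and> (\<forall>x. tr w y x = 0))"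

lemma N_forms: "N l i \<in> forms 2 1"
  unfolding N_def using forms_Const_mult[OF forms_Var[of _ 2]] by (intro forms_sum) auto

lemma N_eval: "i < k \<Longrightarrow> l < k + 1 \<Longrightarrow> poly_eval (N l i) v = tr (ue i) (\<lambda>j. v $ j) (ue l)"
proof -
  assume il: "i < k" "l < k + 1"
  have "tr (ue i) (\<lambda>j. v $ j) (ue l) = (\<Sum>j<3. v $ j * \<alpha> i j l)"
    unfolding tri_expand(2)[of k "k+1" \<alpha> "ue i" "\<lambda>j. v $ j" "ue l"]
    by (intro sum.cong refl arg_cong2[of _ _ _ _ "(*)"]) (use il in \<open>simp add: tri_ue\<close>)
  then show ?thesis by (simp add: N_def ev.hom_sum ev.hom_mult mult.commute)
qed

lemma N_kernel: "(\<forall>l<k+1. (\<Sum>i<k. tr (ue i) y (ue l) * w i) = 0) \<longleftrightarrow> (\<forall>x. tr w y x = 0)"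
proof -
  have "(\<Sum>i<k. tr (ue i) y (ue l) * w i) = tr w y (ue l)" for l
    unfolding tri_expand(1)[of _ _ _ w y "ue l"] by (simp add: mult.commute)
  then show ?thesis by (simp add: tri_zero_iff(3)[symmetric])
qed

lemma q_zero_iff:
  "(\<forall>l<k+1. poly_eval (q l) v = 0) \<longleftrightarrow> (\<exists>w. nz k w \<and> (\<forall>x. tr w (\<lambda>j. v $ j) x = 0))"
proof -
  have "(\<forall>l<k+1. poly_eval (q l) v = 0) \<longleftrightarrow> (\<forall>l<k+1. crs k (\<lambda>l i. poly_eval (N l i) v) l = 0)"
    using ev.crs_hom[of _ k N] by (simp add: q_def)
  also have "\<dots> \<longleftrightarrow> (\<exists>w. nz k w \<and> (\<forall>l<k+1. (\<Sum>i<k. poly_eval (N l i) v * w i) = 0))" by (rule crs_zero_iff)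
  also have "\<dots> \<longleftrightarrow> (\<exists>w. nz k w \<and> (\<forall>l<k+1. (\<Sum>i<k. tr (ue i) (\<lambda>j. v $ j) (ue l) * w i) = 0))"
    using N_eval by simp
  finally show ?thesis unfolding N_kernel .
qed

lemma cofactor_forms:
  assumes "l < k + 1" "s < k + 1"
  shows "cofactor (bm k N (\<lambda>l. Const (p l))) l s \<in> forms 2 (if s = k then k else k - 1)"
proof -
  let ?A = "bm k N (\<lambda>l. Const (p l))"
  \<comment> \<open>The degree of column j after deleting column \<open>s\<close>: 1 for columns of
    \<open>N\<close>, 0 for the constant border at position \<open>k\<close>.\<close>
  define e where "e j = (if (if j < s then j else j + 1) < k then 1 else 0 :: nat)" for j
  have D: "mat_delete ?A l s \<in> carrier_mat k k" by (simp add: mat_delete_def bm_def)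
  have "det (mat_delete ?A l s) \<in> forms 2 (\<Sum>j<k. e j)"
  proof (rule forms_det[OF D])
    fix i j assume ij: "i < k" "j < k"
    have "mat_delete ?A l s $$ (i,j) = ?A $$ (if i < l then i else i + 1, if j < s then j else j + 1)"
      using ij by (simp add: mat_delete_def bm_def)
    also have "\<dots> = (if (if j < s then j else j + 1) < k then N (if i < l then i else i + 1) (if j < s then j else j + 1)
        else Const (p (if i < l then i else i + 1)))"
      using ij by (simp add: bm_index)
    also have "\<dots> \<in> forms 2 (e j)" using N_forms by (simp add: e_def)
    finally show "mat_delete ?A l s $$ (i,j) \<in> forms 2 (e j)" .
  qed
  moreover have "(\<Sum>j<k. e j) = (if s = k then k else k - 1)"
  proof -
    have "(\<Sum>j<k. e j) = card {j\<in>{..<k}. (if j < s then j else j + 1) < k}" by (simp add: e_def sum.If_cases Int_def)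
    also have "{j\<in>{..<k}. (if j < s then j else j + 1) < k} = (if s = k then {..<k} else {..<k-1})"
      using assms(2) by (auto split: if_splits)
    finally show ?thesis by simp
  qed
  ultimately show ?thesis unfolding cofactor_def
    by (cases "even (l + s)") (auto simp: minus_one_power_iff)
qed

lemma q_forms: "l < k + 1 \<Longrightarrow> q l \<in> forms 2 k"
  using cofactor_forms[of l k "\<lambda>_. 0"] by (simp add: q_def crs_def Const.hom_zero)

lemma N_q: "i < k \<Longrightarrow> (\<Sum>l<k+1. N l i * q l) = 0"
  using crs_kill[of i k N] by (simp add: q_def mult.commute del: sum.lessThan_Suc)

definition inI :: "cpoly \<Rightarrow> bool" where
  "inI f \<longleftrightarrow> (\<exists>a. (\<forall>l<k+1. a l \<in> polys 2) \<and> f = (\<Sum>l<k+1. a l * q l))"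

lemma inI_iff: "{f. inI f} = Idl\<^bsub>coord_ring 2\<^esub> (q ` {..<k+1})"
  using Idl_eq_combinations[of "k+1" q 2] q_forms[THEN forms_polys] by (auto simp: inI_def)

lemma pideal_inI: "pideal 2 {f. inI f}"
  unfolding inI_iff using q_forms[THEN forms_polys] by (intro pideal_Idl) auto

lemma inI_combination: "(\<And>l. l < k + 1 \<Longrightarrow> a l \<in> polys 2) \<Longrightarrow> inI (\<Sum>l<k+1. a l * q l)"
  unfolding inI_def by (intro exI[of _ a]) simp

text \<open>Taking the component of degree \<open>n\<close> makes the coefficients homogeneous of
  degree n - k. In particular the ideal starts in degree k, which later forces forms of low degree
  to vanish.\<close>

lemma inI_homogeneous:
  assumes "inI f" "f \<in> forms 2 n"
  shows "(n < k \<and> f = 0) \<or> (k \<le> n \<and> (\<exists>a. (\<forall>l<k+1. a l \<in> forms 2 (n - k)) \<and> f = (\<Sum>l<k+1. a l * q l)))"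
proof -
  obtain a where a: "\<forall>l<k+1. a l \<in> polys 2" "f = (\<Sum>l<k+1. a l * q l)" using assms(1) unfolding inI_def by blast
  have "f = hc n f" using hc_of_form[OF assms(2)] by simp
  also have "\<dots> = (\<Sum>l<k+1. hc n (q l * a l))" unfolding a(2) hc_sum by (simp only: mult.commute)
  also have "\<dots> = (\<Sum>l<k+1. if n < k then 0 else q l * hc (n - k) (a l))"
    by (intro sum.cong refl) (use hc_form_mult[OF q_forms] a(1) in simp)
  finally have f: "f = (\<Sum>l<k+1. if n < k then 0 else q l * hc (n - k) (a l))" .
  show ?thesis
  proof (cases "n < k")
    case True
    then show ?thesis using f by simp
  next
    case False
    have "f = (\<Sum>l<k+1. hc (n - k) (a l) * q l)" using f False by (simp add: mult.commute del: sum.lessThan_Suc)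
    moreover have "\<forall>l<k+1. hc (n - k) (a l) \<in> forms 2 (n - k)" using a(1) hc_forms by blast
    ultimately show ?thesis using False by (intro disjI2 conjI exI[of _ "\<lambda>l. hc (n - k) (a l)"]) simp_all
  qed
qed

end

section \<open>Syzygies and saturation\<close>

text \<open>The homogenization of \<open>p\<close> in degree \<open>D\<close>, in the variable x_j
  and with respect to x_2.\<close>

definition hp :: "nat \<Rightarrow> nat \<Rightarrow> complex poly \<Rightarrow> cpoly" where
  "hp j D p = (\<Sum>i\<le>D. Const (coeff p i) * Var j ^ i * Var 2 ^ (D - i))"

lemma hp_Suc:
  assumes "degree p \<le> D"
  shows "hp j (Suc D) p = Var 2 * hp j D p"
proof -
  have "coeff p (Suc D) = 0" using assms by (simp add: coeff_eq_0)
  then have "hp j (Suc D) p = (\<Sum>i\<le>D. Const (coeff p i) * Var j ^ i * Var 2 ^ (Suc D - i))"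
    by (simp add: hp_def Const.hom_zero)
  also have "\<dots> = Var 2 * hp j D p"
    unfolding hp_def sum_distrib_left by (intro sum.cong refl) (simp add: Suc_diff_le mult_ac)
  finally show ?thesis .
qed

lemma hp_shift: "degree p \<le> D \<Longrightarrow> hp j (D + E) p = Var 2 ^ E * hp j D p"
  by (induction E) (simp_all add: hp_Suc mult_ac)

lemma hp_linear_factor:
  assumes "degree p \<le> D"
  shows "hp j (Suc D) ([:-s, 1:] * p) = (Var j - Const s * Var 2) * hp j D p"
proof -
  have "hp j (Suc D) (pCons 0 p) = (\<Sum>i\<le>D. Const (coeff p i) * Var j ^ Suc i * Var 2 ^ (D - i))"
    unfolding hp_def sum.atMost_Suc_shift by (simp add: Const.hom_zero)
  also have "\<dots> = Var j * hp j D p"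
    unfolding hp_def sum_distrib_left by (intro sum.cong refl) (simp add: mult_ac)
  finally have 1: "hp j (Suc D) (pCons 0 p) = Var j * hp j D p" .
  have "hp j (Suc D) (smult s p) = Const s * hp j (Suc D) p"
    unfolding hp_def sum_distrib_left by (intro sum.cong refl) (simp add: Const.hom_mult mult_ac)
  then have 2: "hp j (Suc D) (smult s p) = Const s * Var 2 * hp j D p" using hp_Suc[OF assms] by (simp add: mult_ac)
  have "hp j (Suc D) ([:-s, 1:] * p) = hp j (Suc D) (pCons 0 p) - hp j (Suc D) (smult s p)"
    unfolding hp_def sum_subtractf[symmetric]
    by (intro sum.cong refl) (simp add: Const.hom_minus left_diff_distrib del: coeff_pCons_0 coeff_pCons_Suc)
  then show ?thesis unfolding 1 2 by (simp add: algebra_simps)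
qed

lemma hp_polys: "j \<le> 2 \<Longrightarrow> hp j D p \<in> polys 2"
  unfolding hp_def by (intro polys_sum polys_mult polys_power polys_closed) auto

text \<open>For each root s of \<open>p\<close> some power of x_2 lies in T up to a multiple of x_j
  - s x_2. Multiplied by this power, the homogenization of \<open>p\<close> without that root lies
  in T again, so the roots are removed one by one until a constant is left.\<close>

lemma power_in_ideal:
  assumes "p \<noteq> 0" "degree p \<le> D" "hp j D p \<in> T" "j \<le> 2" "pideal 2 T"
    and "\<And>s. \<exists>E t h. t \<in> T \<and> h \<in> polys 2 \<and> Var 2 ^ E = t + (Var j - Const s * Var 2) * h"
  shows "\<exists>E. Var 2 ^ E \<in> T"
  using assms(1-3)
proof (induction "degree p" arbitrary: p D)
  case 0
  then obtain c where c: "p = [:c:]" by (metis degree_eq_zeroE)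
  have "hp j D p = (\<Sum>i\<le>D. if i = 0 then Const c * Var 2 ^ D else 0)"
    unfolding hp_def c by (intro sum.cong refl) (auto simp: coeff_pCons Const.hom_zero split: nat.splits)
  then have "Const c * Var 2 ^ D \<in> T" using 0(4) by simp
  then have "Const (1/c) * (Const c * Var 2 ^ D) \<in> T" by (rule pidealD(4)[OF assms(5), rotated]) simp
  moreover have "Const (1/c) * (Const c * Var 2 ^ D) = Var 2 ^ D"
    using 0(2) c by (simp add: mult.assoc[symmetric] Const.hom_mult[symmetric] Const.hom_one)
  ultimately show ?case by (intro exI[of _ D]) simp
next
  case (Suc d)
  have "\<not> constant (poly p)" using Suc.hyps(2) by (simp add: constant_degree)
  then obtain s where s: "poly p s = 0" using fundamental_theorem_of_algebra by blast
  obtain p' where p': "p = [:-s, 1:] * p'" using s unfolding poly_eq_0_iff_dvd by (rule dvdE)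
  have p'0: "p' \<noteq> 0" using p' Suc.prems(1) by auto
  have "degree p = Suc (degree p')" using p'0 unfolding p' by (subst degree_mult_eq) auto
  then have d: "d = degree p'" using Suc.hyps(2) by simp
  obtain D' where D': "D = Suc D'" "degree p' \<le> D'"
    using Suc.prems(2) \<open>degree p = Suc (degree p')\<close> by (cases D) auto
  have "\<exists>E t h. t \<in> T \<and> h \<in> polys 2 \<and> Var 2 ^ E = t + (Var j - Const s * Var 2) * h" by (rule assms(6))
  then obtain E t h where E: "t \<in> T" "h \<in> polys 2" "Var 2 ^ E = t + (Var j - Const s * Var 2) * h" by blast
  have "hp j (D' + E) p' = Var 2 ^ E * hp j D' p'" by (rule hp_shift[OF D'(2)])
  also have "\<dots> = hp j D' p' * t + h * hp j D p"
    unfolding E(3) D'(1) p' hp_linear_factor[OF D'(2)] by (simp add: algebra_simps)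
  also have "\<dots> \<in> T"
    by (intro pidealD(3)[OF assms(5)] pidealD(4)[OF assms(5)] E Suc.prems(3) hp_polys assms(4))
  finally show ?case using Suc.hyps(1)[OF d p'0, of "D' + E"] D'(2) by simp
qed

section \<open>Ternary forms at a point and their monomial basis\<close>

definition lin0 :: "complex \<Rightarrow> cpoly" where "lin0 a = Var 0 - Const a * Var 2"
definition lin1 :: "complex \<Rightarrow> cpoly" where "lin1 b = Var 1 - Const b * Var 2"

lemma lin_forms: "lin0 a \<in> forms 2 1" "lin1 a \<in> forms 2 1"
  unfolding lin0_def lin1_def using forms_Var[of 0 2] forms_Var[of 1 2] forms_Var[of 2 2]
  by (auto intro!: forms_diff forms_Const_mult)

definition pt :: "complex \<Rightarrow> complex \<Rightarrow> nat \<Rightarrow> complex" where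
  "pt a b j = (if j = 0 then a else if j = 1 then b else 1)"

lemma lin_eval: "poly_eval (lin0 a) (vec 3 y) = y 0 - a * y 2" "poly_eval (lin1 b) (vec 3 y) = y 1 - b * y 2"
  by (simp_all add: lin0_def lin1_def ev.hom_minus ev.hom_mult)

text \<open>Substituting x_0 = a x_2 and x_1 = b x_2 changes a polynomial by an element of the ideal
  of the point (a : b : 1), and turns a form of degree n into its value there times x_2^n.\<close>

lemma form_mod_point:
  assumes f: "f \<in> forms 2 n"
  shows "\<exists>g\<in>polys 2. \<exists>h\<in>polys 2. f = lin0 a * g + lin1 b * h + Const (poly_eval f (vec 3 (pt a b))) * Var 2 ^ n"
proof -
  define \<phi> where "\<phi> i = Const (pt a b i) * Var 2" for i :: nat
  define \<sigma> where "\<sigma> = subst Const \<phi>"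
  interpret \<sigma>: comm_ring_hom \<sigma> unfolding \<sigma>_def by (rule subst_hom) unfold_locales
  have C: "comm_ring_hom Const" by unfold_locales
  have lin: "lin0 a \<in> polys 2" "lin1 b \<in> polys 2" using lin_forms forms_polys by blast+
  have "\<exists>g\<in>polys 2. \<exists>h\<in>polys 2. f = lin0 a * g + lin1 b * h + \<sigma> f \<and> \<sigma> f \<in> polys 2" if "f \<in> polys 2" for f
    using that
  proof (induction rule: polys_induct)
    case (Const c)
    show ?case by (rule bexI[of _ 0], rule bexI[of _ 0]) (simp_all add: \<sigma>_def subst_Const[OF C])
  next
    case (Var i)
    have s: "\<sigma> (Var i) = \<phi> i" by (simp add: \<sigma>_def subst_Var[OF C])
    consider "i = 0" | "i = 1" | "i = 2" using Var by linarith
    then show ?case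
    proof cases
      case 1
      show ?thesis unfolding s by (rule bexI[of _ 1], rule bexI[of _ 0]) (simp_all add: 1 \<phi>_def lin0_def pt_def)
    next
      case 2
      show ?thesis unfolding s by (rule bexI[of _ 0], rule bexI[of _ 1]) (simp_all add: 2 \<phi>_def lin1_def pt_def)
    next
      case 3
      show ?thesis unfolding s by (rule bexI[of _ 0], rule bexI[of _ 0]) (simp_all add: 3 \<phi>_def pt_def Const.hom_one)
    qed
  next
    case (add f f')
    obtain g h where g: "g \<in> polys 2" "h \<in> polys 2" "f = lin0 a * g + lin1 b * h + \<sigma> f" "\<sigma> f \<in> polys 2"
      using add(3) by blast
    obtain g' h' where g': "g' \<in> polys 2" "h' \<in> polys 2" "f' = lin0 a * g' + lin1 b * h' + \<sigma> f'" "\<sigma> f' \<in> polys 2"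
      using add(4) by blast
    have "f + f' = (lin0 a * g + lin1 b * h + \<sigma> f) + (lin0 a * g' + lin1 b * h' + \<sigma> f')"
      by (rule arg_cong2[OF g(3) g'(3)])
    also have "\<dots> = lin0 a * (g + g') + lin1 b * (h + h') + \<sigma> (f + f')"
      unfolding \<sigma>.hom_add by (simp only: distrib_left add_ac)
    finally have e: "f + f' = lin0 a * (g + g') + lin1 b * (h + h') + \<sigma> (f + f')" .
    show ?case
      by (rule bexI[of _ "g + g'"], rule bexI[of _ "h + h'"], rule conjI, rule e)
        (use g(1,2,4) g'(1,2,4) in \<open>simp_all only: \<sigma>.hom_add polys_add\<close>)
  next
    case (mult f f')
    obtain g h where g: "g \<in> polys 2" "h \<in> polys 2" "f = lin0 a * g + lin1 b * h + \<sigma> f" "\<sigma> f \<in> polys 2"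
      using mult(3) by blast
    obtain g' h' where g': "g' \<in> polys 2" "h' \<in> polys 2" "f' = lin0 a * g' + lin1 b * h' + \<sigma> f'" "\<sigma> f' \<in> polys 2"
      using mult(4) by blast
    have r: "F = P + S \<Longrightarrow> F' = P' + S' \<Longrightarrow> F * F' = P * F' + S * P' + S * S'" for F P S F' P' S' :: cpoly
      by (simp add: algebra_simps)
    have "f * f' = (lin0 a * g + lin1 b * h) * f' + \<sigma> f * (lin0 a * g' + lin1 b * h') + \<sigma> f * \<sigma> f'"
      by (rule r[OF g(3) g'(3)])
    also have "\<dots> = lin0 a * (g * f' + \<sigma> f * g') + lin1 b * (h * f' + \<sigma> f * h') + \<sigma> (f * f')"
      unfolding \<sigma>.hom_mult by (simp only: distrib_left distrib_right add_ac mult_ac)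
    finally have e: "f * f' = lin0 a * (g * f' + \<sigma> f * g') + lin1 b * (h * f' + \<sigma> f * h') + \<sigma> (f * f')" .
    show ?case
      by (rule bexI[of _ "g * f' + \<sigma> f * g'"], rule bexI[of _ "h * f' + \<sigma> f * h'"], rule conjI, rule e)
        (use g(1,2,4) g'(1,2,4) mult(1,2) in \<open>simp_all only: \<sigma>.hom_mult polys_add polys_mult\<close>)
  qed
  then obtain g h where gh: "g \<in> polys 2" "h \<in> polys 2" "f = lin0 a * g + lin1 b * h + \<sigma> f"
    using forms_polys[OF f] by blast
  have "\<sigma> f = (\<Sum>m\<in>ks f. Const (lk f m) * mono_eval \<phi> m)" by (simp add: \<sigma>_def subst_def)
  also have "\<dots> = (\<Sum>m\<in>ks f. Const (lk f m * (\<Prod>i\<in>ks m. pt a b i ^ lk m i)) * Var 2 ^ n)"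
  proof (intro sum.cong refl)
    fix m assume m: "m \<in> ks f"
    then have "mdeg m = n" using f by (simp add: forms_iff homog_def)
    then show "Const (lk f m) * mono_eval \<phi> m = Const (lk f m * (\<Prod>i\<in>ks m. pt a b i ^ lk m i)) * Var 2 ^ n"
      by (simp add: mono_eval_def \<phi>_def power_mult_distrib prod.distrib Const.hom_mult Const.hom_prod Const.hom_power
          power_sum[symmetric] mdeg_def mult_ac)
  qed
  also have "\<dots> = Const (\<Sum>m\<in>ks f. lk f m * (\<Prod>i\<in>ks m. pt a b i ^ lk m i)) * Var 2 ^ n"
    by (simp add: Const.hom_sum sum_distrib_right)
  also have "(\<Sum>m\<in>ks f. lk f m * (\<Prod>i\<in>ks m. pt a b i ^ lk m i)) = poly_eval f (vec 3 (pt a b))"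
    unfolding poly_eval_def
  proof (intro sum.cong refl arg_cong2[of _ _ _ _ "(*)"] prod.cong)
    fix m i assume "m \<in> ks f" "i \<in> ks m"
    then have "i \<le> 2" using forms_polys[OF f] by (auto simp: polys_def)
    then show "pt a b i ^ lk m i = vec 3 (pt a b) $ i ^ lk m i" by simp
  qed
  finally show ?thesis using gh by auto
qed

lemma forms_step:
  "f \<in> forms n (Suc d) \<Longrightarrow> \<exists>g. (\<forall>i\<le>n. g i \<in> forms n d) \<and> f = (\<Sum>i\<le>n. Var i * g i)"
proof (induction n arbitrary: f)
  case 0
  obtain a where "f = Const a * Var 0 ^ Suc d" using forms_0_0[OF 0] by blast
  moreover have "Const a * Var 0 ^ d \<in> forms 0 d" using forms_power[OF forms_Var[of 0 0], of d] by simp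
  ultimately show ?case by (intro exI[of _ "\<lambda>_. Const a * Var 0 ^ d"]) (simp add: mult_ac)
next
  case (Suc n)
  obtain f0 f1 where f: "f0 \<in> forms n (Suc d)" "f1 \<in> forms (Suc n) d" "f = f0 + Var (Suc n) * f1"
    using forms_split[OF Suc.prems] by auto
  obtain g where g: "\<forall>i\<le>n. g i \<in> forms n d" "f0 = (\<Sum>i\<le>n. Var i * g i)" using Suc.IH[OF f(1)] by blast
  have gi: "g i \<in> forms (Suc n) d" if "i \<le> n" for i using g(1) that forms_mono[of n "Suc n" d] by auto
  have "f = (\<Sum>i\<le>Suc n. Var i * (g(Suc n := f1)) i)" unfolding f(3) g(2) by simp
  moreover have "\<forall>i\<le>Suc n. (g(Suc n := f1)) i \<in> forms (Suc n) d" using gi f(2) by (auto simp: le_Suc_eq)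
  ultimately show ?case by (intro exI[of _ "g(Suc n := f1)"] conjI)
qed

text \<open>The exponents of x_0 and x_1 in the monomials of degree \<open>d\<close> in three
  variables; for d = k - 1 there are k(k+1)/2 of them.\<close>

definition exps :: "nat \<Rightarrow> (nat \<times> nat) set" where
  "exps d = (SIGMA a:{..d}. {..d - a})"

definition mono3 :: "nat \<Rightarrow> nat \<times> nat \<Rightarrow> cpoly" where
  "mono3 d e = Var 0 ^ fst e * Var 1 ^ snd e * Var 2 ^ (d - fst e - snd e)"

lemma finite_exps [simp]: "finite (exps d)"
  by (simp add: exps_def)

lemma mono3_forms: "e \<in> exps d \<Longrightarrow> mono3 d e \<in> forms 2 d"
proof -
  assume e: "e \<in> exps d"
  have "mono3 d e \<in> forms 2 (fst e * 1 + snd e * 1 + (d - fst e - snd e) * 1)"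
    unfolding mono3_def by (intro forms_mult forms_power forms_Var) auto
  moreover have "fst e * 1 + snd e * 1 + (d - fst e - snd e) * 1 = d" using e by (auto simp: exps_def)
  ultimately show ?thesis by simp
qed

lemma forms_mono3: "f \<in> forms 2 d \<Longrightarrow> \<exists>c. f = (\<Sum>e\<in>exps d. Const (c e) * mono3 d e)"
proof -
  assume f: "f \<in> forms 2 d"
  define ex :: "nat \<times> nat \<Rightarrow> nat \<Rightarrow>\<^sub>0 nat" where "ex e = sg 0 (fst e) + sg 1 (snd e) + sg 2 (d - fst e - snd e)" for e
  have exl: "lk (ex e) 0 = fst e" "lk (ex e) 1 = snd e" "lk (ex e) 2 = d - fst e - snd e" for e
    by (simp_all add: ex_def lookup_add lookup_single when_def)
  have m3: "Const c * mono3 d e = sg (ex e) c" for c e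
    by (simp add: mono3_def Var_power Const_def mult_single ex_def add.assoc)
  have inj: "inj_on ex (exps d)" by (rule inj_onI) (metis exl(1,2) prod_eqI)
  have "ks f \<subseteq> ex ` exps d"
  proof
    fix m assume m: "m \<in> ks f"
    then have mk: "ks m \<subseteq> {..2}" "mdeg m = d" using f by (auto simp: forms_iff polys_def homog_def)
    then have s: "lk m 0 + lk m 1 + lk m 2 = d"
      using mdeg_superset[of "{..2}" m] by (simp add: numeral_2_eq_2)
    have "m = ex (lk m 0, lk m 1)"
    proof (rule poly_mapping_eqI)
      fix i
      show "lk m i = lk (ex (lk m 0, lk m 1)) i"
      proof (cases "i \<le> 2")
        case True
        then consider "i = 0" | "i = 1" | "i = 2" by linarith
        then show ?thesis using exl[of "(lk m 0, lk m 1)"] s by cases auto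
      next
        case False
        then have "lk m i = 0" using mk(1) by (auto simp: in_keys_iff)
        then show ?thesis using False by (simp add: ex_def lookup_add lookup_single when_def)
      qed
    qed
    moreover have "(lk m 0, lk m 1) \<in> exps d" using s by (auto simp: exps_def)
    ultimately show "m \<in> ex ` exps d" by blast
  qed
  then have "(\<Sum>m\<in>ks f. sg m (lk f m)) = (\<Sum>m\<in>ex ` exps d. sg m (lk f m))"
    by (intro sum.mono_neutral_left) (auto simp: in_keys_iff)
  then have "f = (\<Sum>e\<in>exps d. sg (ex e) (lk f (ex e)))" by (simp add: sum_singles sum.reindex[OF inj])
  then have "f = (\<Sum>e\<in>exps d. Const (lk f (ex e)) * mono3 d e)" by (simp add: m3)
  then show ?thesis by (intro exI[of _ "\<lambda>e. lk f (ex e)"])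
qed

lemma mono3_independent:
  assumes "(\<Sum>e\<in>exps d. Const (c e) * mono3 d e) = 0" "e \<in> exps d"
  shows "c e = 0"
proof -
  define ex :: "nat \<times> nat \<Rightarrow> nat \<Rightarrow>\<^sub>0 nat" where "ex e = sg 0 (fst e) + sg 1 (snd e) + sg 2 (d - fst e - snd e)" for e
  have exl: "lk (ex e) 0 = fst e" "lk (ex e) 1 = snd e" for e
    by (simp_all add: ex_def lookup_add lookup_single when_def)
  have m3: "Const c * mono3 d e = sg (ex e) c" for c e
    by (simp add: mono3_def Var_power Const_def mult_single ex_def add.assoc)
  have inj: "ex e' = ex e \<longleftrightarrow> e' = e" for e' by (metis exl prod_eqI)
  have "0 = lk (\<Sum>e\<in>exps d. Const (c e) * mono3 d e) (ex e)" using assms(1) by simp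
  also have "\<dots> = (\<Sum>e'\<in>exps d. if e' = e then c e else 0)"
    unfolding lookup_sum m3 by (intro sum.cong refl) (auto simp: lookup_single when_def inj)
  finally show ?thesis using assms(2) by simp
qed

section \<open>The Hilbert-Burch theorem by restriction to the line x_2 = 0\<close>

locale line_free = smooth_tensor +
  assumes lf: "\<And>y w. nz 3 y \<Longrightarrow> y 2 = 0 \<Longrightarrow> nz k w \<Longrightarrow> \<exists>x. tri k (k+1) \<alpha> w y x \<noteq> 0"
begin

lemma tr_line: "i < k \<Longrightarrow> l < k + 1 \<Longrightarrow> tr (ue i) y (ue l) = y 0 * \<alpha> i 0 l + y 1 * \<alpha> i 1 l + y 2 * \<alpha> i 2 l"
proof -
  assume il: "i < k" "l < k + 1"
  have "tr (ue i) y (ue l) = (\<Sum>j<3. y j * \<alpha> i j l)"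
    unfolding tri_expand(2)[of k "k+1" \<alpha> "ue i" y "ue l"]
    by (intro sum.cong refl arg_cong2[of _ _ _ _ "(*)"]) (use il in \<open>simp add: tri_ue\<close>)
  then show ?thesis unfolding lessThan_3 by simp
qed

lemma pencil_zero:
  assumes "\<forall>l<k+1. (\<Sum>i<k. (y 0 * \<alpha> i 0 l + y 1 * \<alpha> i 1 l) * w i) = 0" "nz 3 y" "y 2 = 0"
  shows "\<forall>i<k. w i = 0"
proof (rule ccontr)
  assume "\<not> ?thesis"
  then have nw: "nz k w" by (auto simp: nz_def)
  have "\<forall>l<k+1. (\<Sum>i<k. tr (ue i) y (ue l) * w i) = 0"
  proof (intro allI impI)
    fix l assume l: "l < k + 1"
    have "(\<Sum>i<k. tr (ue i) y (ue l) * w i) = (\<Sum>i<k. (y 0 * \<alpha> i 0 l + y 1 * \<alpha> i 1 l) * w i)"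
      by (intro sum.cong refl) (use tr_line[OF _ l] assms(3) in simp)
    then show "(\<Sum>i<k. tr (ue i) y (ue l) * w i) = 0" using assms(1) l by simp
  qed
  then show False using lf[OF assms(2,3) nw] unfolding N_kernel by blast
qed

text \<open>The points (s : 1 : 0) and (1 : 0 : 0) exhaust the line, so the absence of degeneracy
  points on it is injectivity of the pencil at every s and at infinity.\<close>

sublocale pencil: full_pencil k "\<lambda>l i. \<alpha> i 0 l" "\<lambda>l i. \<alpha> i 1 l"
proof
  fix s w assume a: "\<forall>l<k+1. (\<Sum>i<k. (\<alpha> i 1 l + s * \<alpha> i 0 l) * w i) = 0"
  show "\<forall>i<k. w i = 0"
    by (rule pencil_zero[of "\<lambda>j. if j = 0 then s else if j = 1 then 1 else 0"])
      (use a in \<open>auto simp: add.commute intro!: nzI[of 1]\<close>)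
next
  fix w assume a: "\<forall>l<k+1. (\<Sum>i<k. \<alpha> i 0 l * w i) = 0"
  show "\<forall>i<k. w i = 0"
    by (rule pencil_zero[of "\<lambda>j. if j = 0 then 1 else 0"])
      (use a in \<open>auto intro!: nzI[of 0]\<close>)
qed

lemma rst_N: "rst (N l i) = pencil.pn l i"
proof -
  have "N l i = Const (\<alpha> i 0 l) * Var 0 + Const (\<alpha> i 1 l) * Var (Suc 0) + Const (\<alpha> i 2 l) * Var 2"
    unfolding N_def lessThan_3 by simp
  then show ?thesis unfolding pencil.pn_def by (simp add: rst.hom_add rst.hom_mult)
qed

lemma rst_q: "l < k + 1 \<Longrightarrow> rst (q l) = crs k pencil.pn l"
  using rst.crs_hom[of l k N] by (simp add: rst_N q_def)

lemma N_w_q: "(\<Sum>l<k+1. (\<Sum>i<k. N l i * w i) * q l) = 0"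
proof -
  have "(\<Sum>l<k+1. (\<Sum>i<k. N l i * w i) * q l) = (\<Sum>i<k. (\<Sum>l<k+1. N l i * q l) * w i)"
    unfolding sum_distrib_right by (subst sum.swap) (simp add: mult_ac del: sum.lessThan_Suc)
  also have "\<dots> = 0" by (intro sum.neutral ballI) (use N_q in \<open>simp del: sum.lessThan_Suc\<close>)
  finally show ?thesis .
qed

text \<open>On the line the hypothesis becomes a syzygy of the minors of the pencil, so the
  restricted coefficients are combinations of its columns, with a degree bound that allows lifting
  \<open>w\<close> to forms of degree d - 1. The difference restricts to 0 and is therefore
  divisible by x_2. In degree 0 there is no room for \<open>w\<close>, and everything
  vanishes.\<close>

lemma lift:
  assumes a: "\<forall>l<k+1. a l \<in> forms 2 d" and z: "rst (\<Sum>l<k+1. a l * q l) = 0"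
  shows "\<exists>w a'. (\<forall>i<k. w i \<in> forms 2 (d - 1)) \<and> (\<forall>l<k+1. a' l \<in> forms 2 (d - 1)) \<and>
    (\<forall>l<k+1. a l = (\<Sum>i<k. N l i * w i) + Var 2 * a' l) \<and> (d = 0 \<longrightarrow> (\<forall>l<k+1. a l = 0 \<and> a' l = 0) \<and> (\<forall>i<k. w i = 0))"
proof -
  have "rst (\<Sum>l<k+1. a l * q l) = (\<Sum>l<k+1. crs k pencil.pn l * rst (a l))"
    unfolding rst.hom_sum rst.hom_mult by (intro sum.cong refl) (simp add: rst_q mult.commute)
  then have "(\<Sum>l<k+1. crs k pencil.pn l * rst (a l)) = 0" using z by simp
  from pencil.full_pencil_syzygy[OF this]
  obtain w0 where w0: "\<forall>l<k+1. rst (a l) = (\<Sum>i<k. pencil.pn l i * w0 i)" by (rule exE)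
  have w0c: "coeff (w0 i) e = 0" if "i < k" "d \<le> e" for i e
    by (rule pencil.full_pencil_degree[OF w0, of "Suc d"]) (use a rst_coeff that in auto)
  show ?thesis
  proof (cases "d = 0")
    case True
    have "w0 i = 0" if "i < k" for i by (rule poly_eqI) (use w0c[OF that] True in simp)
    then have "rst (a l) = 0" if "l < k + 1" for l using w0 that by simp
    then have "a l = 0" if "l < k + 1" for l using rst_zero[of "a l" d] a that True by auto
    then show ?thesis using True by (intro exI[of _ "\<lambda>_. 0"]) simp
  next
    case False
    have "\<forall>i. \<exists>w. i < k \<longrightarrow> w \<in> forms 2 (d - 1) \<and> rst w = w0 i"
    proof
      fix i
      show "\<exists>w. i < k \<longrightarrow> w \<in> forms 2 (d - 1) \<and> rst w = w0 i"
      proof (cases "i < k")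
        case True
        have "\<forall>e>d-1. coeff (w0 i) e = 0" using w0c[OF True] by auto
        then show ?thesis using rst_surj[of "d - 1" "w0 i"] by blast
      qed simp
    qed
    from choice[OF this] obtain w where w: "\<forall>i. i < k \<longrightarrow> w i \<in> forms 2 (d - 1) \<and> rst (w i) = w0 i" by (rule exE)
    have "\<forall>l. \<exists>g. l < k + 1 \<longrightarrow> g \<in> forms 2 (d - 1) \<and> a l - (\<Sum>i<k. N l i * w i) = Var 2 * g"
    proof
      fix l
      show "\<exists>g. l < k + 1 \<longrightarrow> g \<in> forms 2 (d - 1) \<and> a l - (\<Sum>i<k. N l i * w i) = Var 2 * g"
      proof (cases "l < k + 1")
        case True
        have "(\<Sum>i<k. N l i * w i) \<in> forms 2 (1 + (d - 1))"
          using w by (intro forms_sum forms_mult N_forms) auto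
        then have "a l - (\<Sum>i<k. N l i * w i) \<in> forms 2 d" using a True False by (intro forms_diff) auto
        moreover have "rst (a l - (\<Sum>i<k. N l i * w i)) = 0"
          using w0 w True by (simp add: rst.hom_minus rst.hom_sum rst.hom_mult rst_N)
        ultimately show ?thesis using rst_zero by blast
      qed simp
    qed
    from choice[OF this] obtain g where g: "\<forall>l. l < k + 1 \<longrightarrow> g l \<in> forms 2 (d - 1) \<and> a l - (\<Sum>i<k. N l i * w i) = Var 2 * g l" by (rule exE)
    show ?thesis
    proof (rule exI[of _ w], rule exI[of _ g], intro conjI allI impI)
      fix l assume "l < k + 1"
      then show "a l = (\<Sum>i<k. N l i * w i) + Var 2 * g l" using g by (simp add: algebra_simps)
    qed (use w g False in auto)
  qed
qed

lemma Var_nonzero: "Var i \<noteq> 0"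
  by (simp add: Var_def) (metis lookup_single_eq lookup_zero zero_neq_one)

text \<open>Each lift splits off a combination of the columns of \<open>N\<close>, which is itself a
  syzygy; the rest is x_2 times a syzygy of one degree less.\<close>

lemma syzygy:
  assumes "\<forall>l<k+1. a l \<in> forms 2 d" "(\<Sum>l<k+1. a l * q l) = 0"
  shows "\<exists>w. (\<forall>i<k. w i \<in> forms 2 (d - 1)) \<and> (\<forall>l<k+1. a l = (\<Sum>i<k. N l i * w i)) \<and> (d = 0 \<longrightarrow> (\<forall>l<k+1. a l = 0))"
  using assms
proof (induction d arbitrary: a)
  case 0
  obtain w a' where "(\<forall>i<k. w i \<in> forms 2 (0 - 1)) \<and> (\<forall>l<k+1. a' l \<in> forms 2 (0 - 1)) \<and>
    (\<forall>l<k+1. a l = (\<Sum>i<k. N l i * w i) + Var 2 * a' l) \<and> (0 = (0::nat) \<longrightarrow> (\<forall>l<k+1. a l = 0 \<and> a' l = 0) \<and> (\<forall>i<k. w i = 0))"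
    using lift[OF 0(1)] unfolding 0(2) rst.hom_zero by blast
  then show ?case by (intro exI[of _ w]) simp
next
  case (Suc d)
  have "rst (\<Sum>l<k+1. a l * q l) = 0" unfolding Suc.prems(2) by (rule rst.hom_zero)
  from lift[OF Suc.prems(1) this] obtain w a' where w: "\<forall>i<k. w i \<in> forms 2 d" "\<forall>l<k+1. a' l \<in> forms 2 d"
    "\<forall>l<k+1. a l = (\<Sum>i<k. N l i * w i) + Var 2 * a' l" by auto
  have "0 = (\<Sum>l<k+1. ((\<Sum>i<k. N l i * w i) + Var 2 * a' l) * q l)"
    unfolding Suc.prems(2)[symmetric] by (intro sum.cong refl) (use w(3) in simp)
  also have "\<dots> = Var 2 * (\<Sum>l<k+1. a' l * q l)"
    unfolding distrib_right sum.distrib N_w_q by (simp add: sum_distrib_left mult.assoc del: sum.lessThan_Suc)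
  finally have "(\<Sum>l<k+1. a' l * q l) = 0" using Var_nonzero[of 2] by simp
  from Suc.IH[OF w(2) this] obtain w' where w': "\<forall>i<k. w' i \<in> forms 2 (d - 1)" "\<forall>l<k+1. a' l = (\<Sum>i<k. N l i * w' i)"
    "d = 0 \<longrightarrow> (\<forall>l<k+1. a' l = 0)" by blast
  show ?case
  proof (cases "d = 0")
    case True
    then show ?thesis using w w'(3) by (intro exI[of _ w]) simp
  next
    case False
    show ?thesis
    proof (intro exI[of _ "\<lambda>i. w i + Var 2 * w' i"] conjI allI impI)
      fix i assume "i < k"
      moreover have "Var 2 * w' i \<in> forms 2 d" if "i < k" for i
        using forms_Var_mult[of "w' i" 2 "d - 1" 2] w'(1) that False by simp
      ultimately show "w i + Var 2 * w' i \<in> forms 2 (Suc d - 1)" using w(1) by simp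
    next
      fix l assume l: "l < k + 1"
      have "a l = (\<Sum>i<k. N l i * w i) + Var 2 * (\<Sum>i<k. N l i * w' i)" using w(3) w'(2) l by simp
      then show "a l = (\<Sum>i<k. N l i * (w i + Var 2 * w' i))"
        by (simp add: distrib_left sum.distrib sum_distrib_left mult.left_commute)
    qed simp
  qed
qed

text \<open>x_2 is not a zero divisor modulo the ideal: the coefficients of x_2 f restrict to a
  syzygy on the line, and after lifting only their multiples of x_2 contribute.\<close>

lemma inI_cancel1:
  assumes f: "f \<in> forms 2 n" and I: "inI (Var 2 * f)"
  shows "inI f"
proof -
  have I0: "inI 0" using pidealD(2)[OF pideal_inI] by simp
  have f': "Var 2 * f \<in> forms 2 (Suc n)" using f by simp
  from inI_homogeneous[OF I f']
  consider "Var 2 * f = 0" | a where "k \<le> Suc n" "\<forall>l<k+1. a l \<in> forms 2 (Suc n - k)" "Var 2 * f = (\<Sum>l<k+1. a l * q l)"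
    by blast
  then show ?thesis
  proof cases
    case 1
    then show ?thesis using Var_nonzero[of 2] I0 by simp
  next
    case (2 a)
    have "rst (\<Sum>l<k+1. a l * q l) = 0" unfolding 2(3)[symmetric] by (simp add: rst.hom_mult)
    from lift[OF 2(2) this] obtain w a' where w: "\<forall>l<k+1. a' l \<in> forms 2 (Suc n - k - 1)"
      "\<forall>l<k+1. a l = (\<Sum>i<k. N l i * w i) + Var 2 * a' l" by blast
    have "Var 2 * f = (\<Sum>l<k+1. ((\<Sum>i<k. N l i * w i) + Var 2 * a' l) * q l)"
      unfolding 2(3) by (intro sum.cong refl) (use w(2) in simp)
    also have "\<dots> = Var 2 * (\<Sum>l<k+1. a' l * q l)"
      unfolding distrib_right sum.distrib N_w_q by (simp add: sum_distrib_left mult.assoc del: sum.lessThan_Suc)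
    finally have "f = (\<Sum>l<k+1. a' l * q l)" using Var_nonzero[of 2] by simp
    then show ?thesis using inI_combination[of a'] w(1) forms_polys by blast
  qed
qed

lemma inI_cancel: "f \<in> forms 2 n \<Longrightarrow> inI (Var 2 ^ e * f) \<Longrightarrow> inI f"
proof (induction e arbitrary: n f)
  case (Suc e)
  have "inI (Var 2 ^ e * (Var 2 * f))" using Suc.prems(2) by (simp add: mult_ac)
  then have "inI (Var 2 * f)" using Suc.IH[of "Var 2 * f" "Suc n"] Suc.prems(1) by simp
  then show ?case using inI_cancel1[OF Suc.prems(1)] by blast
qed simp

text \<open>By \<open>lift\<close> in degree 0 the k + 1 restricted minors are independent, so they
  form a basis of the binary forms of degree k on the line.\<close>

lemma forms_k_split:
  assumes f: "f \<in> forms 2 k"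
  shows "\<exists>g\<in>forms 2 (k - 1). inI (f - Var 2 * g)"
proof -
  define C where "C e l = coeff (rst (q l)) e" for e l
  have "det (mat (k+1) (k+1) (\<lambda>(e,l). C e l)) \<noteq> 0"
  proof
    assume "det (mat (k+1) (k+1) (\<lambda>(e,l). C e l)) = 0"
    then obtain a where a: "nz (k+1) a" "\<forall>e<k+1. (\<Sum>l<k+1. C e l * a l) = 0" unfolding square_kernel by blast
    let ?a = "\<lambda>l. Const (a l)"
    have "rst (\<Sum>l<k+1. ?a l * q l) = 0"
    proof (rule poly_eqI)
      fix e
      have "coeff (rst (\<Sum>l<k+1. ?a l * q l)) e = (\<Sum>l<k+1. C e l * a l)"
        unfolding rst.hom_sum rst.hom_mult rst_Const coeff_sum by (intro sum.cong refl) (simp add: C_def)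
      also have "\<dots> = 0"
      proof (cases "e < k + 1")
        case True
        then show ?thesis using a(2) by blast
      next
        case False
        then have "C e l = 0" if "l < k + 1" for l using rst_coeff[OF q_forms[OF that], of e] by (simp add: C_def)
        then show ?thesis by (intro sum.neutral) simp
      qed
      finally show "coeff (rst (\<Sum>l<k+1. ?a l * q l)) e = coeff 0 e" by simp
    qed
    moreover have "\<forall>l<k+1. ?a l \<in> forms 2 0" by simp
    ultimately have "\<forall>l<k+1. ?a l = 0" using lift[of ?a 0] by blast
    then show False using a(1) by (auto elim!: nzE)
  qed
  from square_solve[OF this, of "\<lambda>e. coeff (rst f) e"]
  obtain a where a: "\<forall>e<k+1. (\<Sum>l<k+1. C e l * a l) = coeff (rst f) e" by (rule exE)
  have "rst (f - (\<Sum>l<k+1. Const (a l) * q l)) = 0"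
  proof (rule poly_eqI)
    fix e
    have "coeff (rst (f - (\<Sum>l<k+1. Const (a l) * q l))) e = coeff (rst f) e - (\<Sum>l<k+1. C e l * a l)"
      unfolding rst.hom_minus rst.hom_sum rst.hom_mult rst_Const coeff_diff coeff_sum
      by (intro arg_cong2[of _ _ _ _ "(-)"] sum.cong refl) (simp add: C_def)
    also have "\<dots> = 0"
    proof (cases "e < k + 1")
      case False
      then have "C e l = 0" if "l < k + 1" for l using rst_coeff[OF q_forms[OF that], of e] by (simp add: C_def)
      moreover have "coeff (rst f) e = 0" using rst_coeff[OF f, of e] False by simp
      ultimately show ?thesis by (simp add: sum.neutral)
    qed (use a in simp)
    finally show "coeff (rst (f - (\<Sum>l<k+1. Const (a l) * q l))) e = coeff 0 e" by simp
  qed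
  moreover have "f - (\<Sum>l<k+1. Const (a l) * q l) \<in> forms 2 k"
    by (intro forms_diff f forms_sum forms_Const_mult q_forms) auto
  ultimately obtain g where g: "g \<in> forms 2 (k - 1)" "f - (\<Sum>l<k+1. Const (a l) * q l) = Var 2 * g"
    using rst_zero by blast
  have "f - Var 2 * g = (\<Sum>l<k+1. Const (a l) * q l)" using g(2) by (simp add: algebra_simps)
  then show ?thesis using g(1) inI_combination[of "\<lambda>l. Const (a l)"] by (intro bexI[of _ g]) auto
qed

text \<open>Modulo the ideal, multiplication by x_2 maps onto every degree from k on. This is why
  the points are counted by forms of degree k - 1.\<close>

lemma forms_reduce:
  "f \<in> forms 2 (k - 1 + e) \<Longrightarrow> \<exists>g\<in>forms 2 (k - 1). inI (f - Var 2 ^ e * g)"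
proof (induction e arbitrary: f)
  case 0
  then show ?case using pidealD(2)[OF pideal_inI] by (intro bexI[of _ f]) auto
next
  case (Suc e)
  note I = pideal_inI
  from forms_step[of f 2 "k - 1 + e"] Suc.prems
  obtain fi where fi: "\<forall>i\<le>2. fi i \<in> forms 2 (k - 1 + e)" "f = (\<Sum>i\<le>2. Var i * fi i)" by auto
  have "\<forall>i. \<exists>g. i \<le> 2 \<longrightarrow> g \<in> forms 2 (k - 1) \<and> inI (Var i * fi i - Var 2 ^ Suc e * g)"
  proof
    fix i :: nat
    show "\<exists>g. i \<le> 2 \<longrightarrow> g \<in> forms 2 (k - 1) \<and> inI (Var i * fi i - Var 2 ^ Suc e * g)"
    proof (cases "i \<le> 2")
      case True
      obtain g where g: "g \<in> forms 2 (k - 1)" "inI (fi i - Var 2 ^ e * g)" using Suc.IH fi(1) True by blast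
      have "Var i * g \<in> forms 2 k" using forms_Var_mult[OF g(1) True] k2 by simp
      then obtain g' where g': "g' \<in> forms 2 (k - 1)" "inI (Var i * g - Var 2 * g')" using forms_k_split by blast
      have "Var i * (fi i - Var 2 ^ e * g) + Var 2 ^ e * (Var i * g - Var 2 * g') \<in> {f. inI f}"
        using g(2) g'(2) True by (intro pidealD(3)[OF I] pidealD(4)[OF I]) auto
      moreover have "Var i * (fi i - Var 2 ^ e * g) + Var 2 ^ e * (Var i * g - Var 2 * g') = Var i * fi i - Var 2 ^ Suc e * g'"
        by (simp add: algebra_simps)
      ultimately show ?thesis using g'(1) by (intro exI[of _ g']) auto
    qed simp
  qed
  from choice[OF this] obtain g where g: "\<forall>i. i \<le> 2 \<longrightarrow> g i \<in> forms 2 (k - 1) \<and> inI (Var i * fi i - Var 2 ^ Suc e * g i)" by (rule exE)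
  have "(\<Sum>i\<le>2. Var i * fi i - Var 2 ^ Suc e * g i) \<in> {f. inI f}" using g by (intro pideal_sum[OF I]) auto
  moreover have "(\<Sum>i\<le>2. Var i * fi i - Var 2 ^ Suc e * g i) = f - Var 2 ^ Suc e * (\<Sum>i\<le>2. g i)"
    unfolding fi(2) sum_subtractf sum_distrib_left ..
  ultimately show ?case using g by (intro bexI[of _ "\<Sum>i\<le>2. g i"]) (auto intro!: forms_sum)
qed

end

section \<open>Reducedness and the number of points\<close>

declare One_nat_def [simp del]

lemma sum_only:
  fixes f :: "nat \<Rightarrow> 'a::comm_monoid_add"
  assumes "s < n" "\<And>i. i < n \<Longrightarrow> i \<noteq> s \<Longrightarrow> f i = 0"
  shows "sum f {..<n} = f s"
proof -
  have "sum f {..<n} = sum f {s}" by (rule sum.mono_neutral_right) (use assms in auto)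
  then show ?thesis by simp
qed

lemma sum_plus1: "(\<Sum>i<n+1. f i) = (\<Sum>i<n. f i) + f n" for f :: "nat \<Rightarrow> 'a::comm_monoid_add"
  by (simp add: One_nat_def)

context smooth_tensor begin

text \<open>The relation \<open>w\<close> makes row \<open>s\<close> redundant, which leaves k - 1
  equations in k + 1 unknowns. The second solution is made orthogonal to the first by one more
  equation with conjugated coefficients, indexed by \<open>k\<close>.\<close>

lemma left_basis:
  assumes "s < k" "w s \<noteq> 0" "\<And>x. tr w y x = 0"
  shows "\<exists>x1 x2. nz (k+1) x1 \<and> nz (k+1) x2 \<and> (\<forall>w'. tr w' y x1 = 0) \<and> (\<forall>w'. tr w' y x2 = 0) \<and>
    (\<Sum>l<k+1. cnj (x1 l) * x2 l) = 0"
proof -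
  have left: "tr w' y x = 0" if e: "\<forall>i\<in>{..<k}-{s}. (\<Sum>l<k+1. tr (ue i) y (ue l) * x l) = 0" for x w'
  proof -
    have 1: "tr (ue i) y x = 0" if "i < k" "i \<noteq> s" for i
      unfolding tri_expand(3)[of k "k+1" \<alpha> "ue i" y x] using e that by (simp add: mult.commute del: sum.lessThan_Suc)
    have "0 = (\<Sum>i<k. w i * tr (ue i) y x)" unfolding tri_expand(1)[of k "k+1" \<alpha> w y x, symmetric] assms(3) ..
    also have "\<dots> = w s * tr (ue s) y x" by (rule sum_only[OF assms(1)]) (simp add: 1)
    finally have "tr (ue s) y x = 0" using assms(2) by simp
    then have "\<forall>i<k. tr (ue i) y x = 0" using 1 by blast
    then show ?thesis unfolding tri_zero_iff(1) by blast
  qed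
  obtain x1 where x1: "nz (k+1) x1" "\<forall>i\<in>{..<k}-{s}. (\<Sum>l<k+1. tr (ue i) y (ue l) * x1 l) = 0"
    using kernel_nontrivial[of "{..<k}-{s}" "k+1" "\<lambda>i l. tr (ue i) y (ue l)"] card_Diff1_le[of "{..<k}" s]
    by (auto simp: le_less_trans)
  have "card (insert k ({..<k}-{s})) < k + 1" using assms(1) by simp
  from kernel_nontrivial[OF _ this, of "\<lambda>e l. if e = k then cnj (x1 l) else tr (ue e) y (ue l)"]
  obtain x2 where x2: "nz (k+1) x2"
    "\<forall>e\<in>insert k ({..<k}-{s}). (\<Sum>l<k+1. (if e = k then cnj (x1 l) else tr (ue e) y (ue l)) * x2 l) = 0"
    by auto
  have x2': "\<forall>i\<in>{..<k}-{s}. (\<Sum>l<k+1. tr (ue i) y (ue l) * x2 l) = 0"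
  proof
    fix i assume i: "i \<in> {..<k}-{s}"
    then have "i \<noteq> k" by simp
    then show "(\<Sum>l<k+1. tr (ue i) y (ue l) * x2 l) = 0" using x2(2)[rule_format, of i] i by (simp del: sum.lessThan_Suc)
  qed
  have o: "(\<Sum>l<k+1. cnj (x1 l) * x2 l) = 0" using x2(2)[rule_format, of k] by (simp del: sum.lessThan_Suc)
  show ?thesis
    by (rule exI[of _ x1], rule exI[of _ x2], intro conjI allI x1(1) x2(1) o left[OF x1(2)] left[OF x2'])
qed

end

lemma sum_cnj_nonzero: "nz n x \<Longrightarrow> (\<Sum>l<n. cnj (x l) * x l) \<noteq> 0"
proof -
  assume x: "nz n x"
  have "(\<Sum>l<n. cnj (x l) * x l) = complex_of_real (\<Sum>l<n. (cmod (x l))\<^sup>2)"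
    unfolding of_real_sum by (intro sum.cong refl) (simp only: complex_norm_square mult.commute)
  moreover have "(\<Sum>l<n. (cmod (x l))\<^sup>2) \<noteq> 0" using x by (auto simp: sum_nonneg_eq_0_iff elim!: nzE)
  ultimately show ?thesis by (simp only: of_real_eq_0_iff) simp
qed

context smooth_tensor begin

text \<open>Let \<open>w\<close> span the kernel at the point z. The combination of the columns of
  \<open>N\<close> with weights \<open>w\<close> has entries in the ideal of z. Pairing it with the
  cofactors of column \<open>s\<close> of (N | p) gives a relation A_0 lin0 + A_1 lin1 in the ideal
  for each constant border p, and the determinant \<Delta> of two such relations multiplies both
  linear forms into the ideal. That \<Delta> is nonzero at z is the smoothness criterion; so locally
  the ideal is that of a reduced point.\<close>

lemma separating_form:
  assumes Z: "inZ (pt a b)"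
  shows "\<exists>\<Delta>\<in>forms 2 (2 * (k - 1)). poly_eval \<Delta> (vec 3 (pt a b)) \<noteq> 0 \<and> inI (\<Delta> * lin0 a) \<and> inI (\<Delta> * lin1 b)"
proof -
  let ?z = "pt a b" let ?v = "vec 3 ?z"
  obtain w where w: "nz k w" "\<And>x. tr w ?z x = 0" using Z unfolding inZ_def by blast
  obtain s where s: "s < k" "w s \<noteq> 0" using w(1) by (rule nzE)
  have ptnz: "nz 3 ?z" using Z unfolding inZ_def by blast
  define c where "c j l = tr w (ue j) (ue l)" for j l
  define cof where "cof p l = cofactor (bm k N (\<lambda>l. Const (p l))) l s" for p l
  define A where "A j p = (\<Sum>l<k+1. cof p l * Const (c j l))" for j p
  \<comment> \<open>The coefficient of x_2 is determined by the other two, since \<open>w\<close>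
    kills the contraction with z = (a, b, 1).\<close>
  have cc: "c 2 l = - (a * c 0 l + b * c 1 l)" for l
  proof -
    have "0 = tr w ?z (ue l)" using w(2) by simp
    also have "\<dots> = (\<Sum>j<3. ?z j * tr w (ue j) (ue l))" by (rule tri_expand(2))
    also have "\<dots> = a * c 0 l + b * c 1 l + c 2 l" unfolding lessThan_3 by (simp add: pt_def c_def)
    finally show ?thesis by (intro minus_unique[symmetric]) simp
  qed
  have L: "(\<Sum>i<k. Const (w i) * N l i) = Const (c 0 l) * lin0 a + Const (c 1 l) * lin1 b" if l: "l < k + 1" for l
  proof -
    have cs: "c j l = (\<Sum>i<k. w i * \<alpha> i j l)" if "j < 3" for j
      unfolding c_def tri_expand(1)[of k "k+1" \<alpha> w] using that l by (intro sum.cong refl) (simp add: tri_ue)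
    have "(\<Sum>i<k. Const (w i) * N l i) = (\<Sum>j<3. (\<Sum>i<k. Const (w i * \<alpha> i j l)) * Var j)"
      unfolding N_def sum_distrib_left sum_distrib_right Const.hom_mult by (subst sum.swap) (simp only: mult_ac)
    also have "\<dots> = (\<Sum>j<3. Const (c j l) * Var j)"
      by (intro sum.cong refl arg_cong2[of _ _ _ _ "(*)"]) (simp add: cs Const.hom_sum)
    also have "\<dots> = Const (c 0 l) * Var 0 + Const (c 1 l) * Var 1 + Const (c 2 l) * Var 2"
      unfolding lessThan_3 by (simp add: add.assoc)
    also have "Const (c 2 l) = - (Const a * Const (c 0 l) + Const b * Const (c 1 l))"
      unfolding cc by (simp only: Const.hom_uminus Const.hom_add Const.hom_mult)
    finally show ?thesis unfolding lin0_def lin1_def by (simp add: algebra_simps)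
  qed
  have cofN: "(\<Sum>l<k+1. cof p l * bm k N (\<lambda>l. Const (p l)) $$ (l,i)) = (if i = s then det (bm k N (\<lambda>l. Const (p l))) else 0)"
    if "i < k + 1" for p i
    using cofactor_sum_col[OF bm_carrier, of s k i N "\<lambda>l. Const (p l)"] that s(1) unfolding cof_def by auto
  have cofi: "(\<Sum>l<k+1. cof p l * N l i) = (if i = s then det (bm k N (\<lambda>l. Const (p l))) else 0)" if i: "i < k" for p i
  proof -
    have "(\<Sum>l<k+1. cof p l * N l i) = (\<Sum>l<k+1. cof p l * bm k N (\<lambda>l. Const (p l)) $$ (l,i))"
      by (intro sum.cong refl) (use i in \<open>simp add: bm_index\<close>)
    then show ?thesis using cofN[of i p] i by simp
  qed
  have cofk: "(\<Sum>l<k+1. cof p l * Const (p l)) = 0" for p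
  proof -
    have "(\<Sum>l<k+1. cof p l * Const (p l)) = (\<Sum>l<k+1. cof p l * bm k N (\<lambda>l. Const (p l)) $$ (l,k))"
      by (intro sum.cong refl) (simp add: bm_index)
    then show ?thesis using cofN[of k p] s(1) by simp
  qed
  have detI: "inI (det (bm k N (\<lambda>l. Const (p l))))" for p
    unfolding det_bm q_def[symmetric] by (rule inI_combination) simp
  have AI: "inI (A 0 p * lin0 a + A 1 p * lin1 b)" for p
  proof -
    have "A 0 p * lin0 a + A 1 p * lin1 b = (\<Sum>l<k+1. cof p l * (Const (c 0 l) * lin0 a + Const (c 1 l) * lin1 b))"
      unfolding A_def sum_distrib_right sum.distrib[symmetric] by (simp only: distrib_left mult.assoc)
    also have "\<dots> = (\<Sum>l<k+1. cof p l * (\<Sum>i<k. Const (w i) * N l i))"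
      by (intro sum.cong refl) (simp only: L lessThan_iff)
    also have "\<dots> = (\<Sum>i<k. Const (w i) * (\<Sum>l<k+1. cof p l * N l i))"
      unfolding sum_distrib_left by (subst sum.swap) (simp only: mult_ac)
    also have "\<dots> = Const (w s) * (\<Sum>l<k+1. cof p l * N l s)"
      by (rule sum_only[OF s(1)]) (simp add: cofi del: sum.lessThan_Suc)
    also have "\<dots> = Const (w s) * det (bm k N (\<lambda>l. Const (p l)))" unfolding cofi[OF s(1)] by simp
    finally have e: "A 0 p * lin0 a + A 1 p * lin1 b = Const (w s) * det (bm k N (\<lambda>l. Const (p l)))" .
    show ?thesis unfolding e using pidealD(4)[OF pideal_inI, of "Const (w s)" "det (bm k N (\<lambda>l. Const (p l)))"] detI[of p] by simp
  qed
  \<comment> \<open>The cofactors evaluated at z form a vector that the matrix contracted with z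
    annihilates (\<open>XL\<close>) and that pairs to zero with the border
    (\<open>Xp\<close>).\<close>
  define X where "X p l = poly_eval (cof p l) ?v" for p l
  have XL: "tr w' ?z (X p) = 0" for w' p
  proof -
    have q0: "poly_eval (det (bm k N (\<lambda>l. Const (p l)))) ?v = 0"
    proof -
      have "\<exists>w. nz k w \<and> (\<forall>x. tr w (\<lambda>j. ?v $ j) x = 0)"
      proof (intro exI[of _ w] conjI allI)
        fix x
        have "tr w (\<lambda>j. ?v $ j) x = tr w ?z x" unfolding tri_def by (intro sum.cong refl) simp
        then show "tr w (\<lambda>j. ?v $ j) x = 0" using w(2) by simp
      qed (rule w(1))
      then have "\<forall>l<k+1. poly_eval (q l) ?v = 0" unfolding q_zero_iff .
      then show ?thesis unfolding det_bm ev.hom_sum ev.hom_mult q_def[symmetric] by (intro sum.neutral) simp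
    qed
    have "tr (ue i) ?z (X p) = 0" if i: "i < k" for i
    proof -
      have "tr (ue i) ?z (X p) = (\<Sum>l<k+1. X p l * tr (ue i) ?z (ue l))" by (rule tri_expand(3))
      also have "\<dots> = (\<Sum>l<k+1. X p l * poly_eval (N l i) ?v)"
      proof (intro sum.cong refl arg_cong2[of _ _ _ _ "(*)"])
        fix l assume "l \<in> {..<k+1}"
        then have l: "l < k + 1" by simp
        show "tr (ue i) ?z (ue l) = poly_eval (N l i) ?v" unfolding N_eval[OF i l]
          unfolding tri_def by (intro sum.cong refl) simp
      qed
      also have "\<dots> = poly_eval (\<Sum>l<k+1. cof p l * N l i) ?v" unfolding ev.hom_sum ev.hom_mult X_def ..
      also have "\<dots> = 0" unfolding cofi[OF i] using q0 by auto
      finally show ?thesis .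
    qed
    then have "\<forall>i<k. tr (ue i) ?z (X p) = 0" by blast
    then show ?thesis unfolding tri_zero_iff(1) by blast
  qed
  have Xp: "(\<Sum>l<k+1. X p l * p l) = 0" for p
  proof -
    have "poly_eval (\<Sum>l<k+1. cof p l * Const (p l)) ?v = 0" unfolding cofk by simp
    then show ?thesis unfolding ev.hom_sum ev.hom_mult poly_eval_Const X_def .
  qed
  obtain x1 x2 where x: "nz (k+1) x1" "nz (k+1) x2" "\<forall>w'. tr w' ?z x1 = 0" "\<forall>w'. tr w' ?z x2 = 0"
    "(\<Sum>l<k+1. cnj (x1 l) * x2 l) = 0" using left_basis[of s w ?z, OF s w(2)] by blast
  \<comment> \<open>The pairing is the determinant of N(z) with column \<open>s\<close> replaced by
    the conjugate of \<open>x'\<close> and with the conjugate of \<open>x\<close> as border. Pairing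
    with \<open>x\<close> and \<open>x'\<close> shows that a kernel vector has zero coordinates at
    these two columns; what remains is a kernel vector at z without coordinate \<open>s\<close>,
    contrary to \<open>left_unique\<close>.\<close>
  have Xne: "(\<Sum>l<k+1. cnj (x' l) * X (\<lambda>l. cnj (x l)) l) \<noteq> 0"
    if x: "nz (k+1) x" "nz (k+1) x'" "\<forall>w'. tr w' ?z x = 0" "\<forall>w'. tr w' ?z x' = 0"
    "(\<Sum>l<k+1. cnj (x l) * x' l) = 0" for x x'
  proof
    assume z: "(\<Sum>l<k+1. cnj (x' l) * X (\<lambda>l. cnj (x l)) l) = 0"
    have o': "(\<Sum>l<k+1. x l * cnj (x' l)) = 0"
      using arg_cong[OF x(5), of cnj] by simp
    let ?p = "\<lambda>l. cnj (x l)"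
    let ?B = "map_mat (\<lambda>f. poly_eval f ?v) (bm k N (\<lambda>l. Const (?p l)))"
    let ?C = "\<lambda>l i. if i = s then cnj (x' l) else if i < k then tr (ue i) ?z (ue l) else cnj (x l)"
    let ?CM = "mat (k+1) (k+1) (\<lambda>(l,i). ?C l i)"
    have Nz: "poly_eval (N l i) ?v = tr (ue i) ?z (ue l)" if "i < k" "l < k + 1" for i l
      unfolding N_eval[OF that] unfolding tri_def by (intro sum.cong refl) simp
    have "det ?CM = (\<Sum>l<k+1. ?CM $$ (l,s) * cofactor ?CM l s)"
      by (rule laplace_expansion_column) (use s(1) in auto)
    also have "\<dots> = (\<Sum>l<k+1. cnj (x' l) * X ?p l)"
    proof (intro sum.cong refl arg_cong2[of _ _ _ _ "(*)"])
      fix l assume "l \<in> {..<k+1}"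
      then have l: "l < k + 1" by simp
      show "?CM $$ (l,s) = cnj (x' l)" using l s(1) by simp
      have "mat_delete ?CM l s = mat_delete ?B l s"
        by (rule eq_matI) (use l s(1) in \<open>auto simp: mat_delete_def bm_def Nz\<close>)
      then have "cofactor ?CM l s = cofactor ?B l s" by (simp add: cofactor_def)
      also have "\<dots> = X ?p l" unfolding X_def cof_def using s(1) l
        by (intro ev.hom_cofactor) (simp_all add: bm_def)
      finally show "cofactor ?CM l s = X ?p l" .
    qed
    finally have "det ?CM = 0" using z by simp
    then obtain u where u: "nz (k+1) u" "\<forall>l<k+1. (\<Sum>i<k+1. ?C l i * u i) = 0" unfolding square_kernel by blast
    have u': "(\<Sum>i<k. (if i = s then 0 else u i) * tr (ue i) ?z (ue l)) + cnj (x' l) * u s + cnj (x l) * u k = 0"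
      if l: "l < k + 1" for l
    proof -
      have "0 = (\<Sum>i<k. ?C l i * u i) + cnj (x l) * u k"
        using u(2)[rule_format, OF l] s(1) unfolding sum_plus1 by auto
      also have "(\<Sum>i<k. ?C l i * u i) = (\<Sum>i<k. (if i = s then 0 else u i) * tr (ue i) ?z (ue l) + (if i = s then cnj (x' l) * u s else 0))"
        by (intro sum.cong refl) auto
      also have "\<dots> = (\<Sum>i<k. (if i = s then 0 else u i) * tr (ue i) ?z (ue l)) + cnj (x' l) * u s"
        using s(1) by (simp add: sum.distrib)
      finally show ?thesis by simp
    qed
    define u0 where "u0 i = (if i = s then 0 else u i)" for i
    have dot: "(\<Sum>l<k+1. X l * cnj (x' l)) * u s + (\<Sum>l<k+1. X l * cnj (x l)) * u k = 0"
      if X: "\<forall>w'. tr w' ?z X = 0" for X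
    proof -
      have "0 = (\<Sum>l<k+1. X l * ((\<Sum>i<k. u0 i * tr (ue i) ?z (ue l)) + cnj (x' l) * u s + cnj (x l) * u k))"
        by (rule sym, rule sum.neutral) (use u' in \<open>simp add: u0_def\<close>)
      also have "\<dots> = (\<Sum>l<k+1. X l * tr u0 ?z (ue l)) + (\<Sum>l<k+1. X l * cnj (x' l)) * u s + (\<Sum>l<k+1. X l * cnj (x l)) * u k"
        unfolding tri_expand(1)[of k "k+1" \<alpha> u0 ?z] distrib_left sum.distrib sum_distrib_right by (simp only: mult_ac)
      also have "(\<Sum>l<k+1. X l * tr u0 ?z (ue l)) = 0"
        unfolding tri_expand(3)[of k "k+1" \<alpha> u0 ?z X, symmetric] using X by blast
      finally show ?thesis by simp
    qed
    have uk: "u k = 0" using dot[OF x(3)] o' sum_cnj_nonzero[OF x(1)] by (simp add: mult.commute del: sum.lessThan_Suc)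
    have us: "u s = 0" using dot[OF x(4)] uk sum_cnj_nonzero[OF x(2)] by (simp add: mult.commute del: sum.lessThan_Suc)
    obtain i where i: "i < k + 1" "u i \<noteq> 0" using u(1) by (rule nzE)
    then have "i \<noteq> k" "i \<noteq> s" using uk us by auto
    then have nu: "nz k u0" using i by (intro nzI[of i]) (auto simp: u0_def)
    have tu: "tr u0 ?z X = 0" for X
    proof -
      have "\<forall>l<k+1. tr u0 ?z (ue l) = 0"
        using u' uk us unfolding tri_expand(1)[of k "k+1" \<alpha> u0 ?z] by (simp add: u0_def)
      then show ?thesis unfolding tri_zero_iff(3) by blast
    qed
    have "u0 s \<noteq> 0" by (rule left_unique[OF ptnz s w(2) tu nu])
    then show False by (simp add: u0_def)
  qed
  have x5': "(\<Sum>l<k+1. cnj (x2 l) * x1 l) = 0"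
    using arg_cong[OF x(5), of cnj] by (simp add: mult.commute)
  define X1 X2 where "X1 = X (\<lambda>l. cnj (x1 l))" and "X2 = X (\<lambda>l. cnj (x2 l))"
  have X12: "(\<Sum>l<k+1. cnj (x2 l) * X1 l) \<noteq> 0" "(\<Sum>l<k+1. cnj (x1 l) * X2 l) \<noteq> 0"
    "(\<Sum>l<k+1. cnj (x1 l) * X1 l) = 0" "(\<Sum>l<k+1. cnj (x2 l) * X2 l) = 0"
    using Xne[OF x] Xne[OF x(2,1,4,3) x5'] Xp[of "\<lambda>l. cnj (x1 l)"] Xp[of "\<lambda>l. cnj (x2 l)"]
    by (simp_all add: X1_def X2_def mult.commute del: sum.lessThan_Suc)
  \<comment> \<open>The two borders are the conjugates of the orthogonal vectors x1 and x2, so X1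
    and X2 are independent by \<open>X12\<close>.\<close>
  define \<Delta> where "\<Delta> = A 0 (\<lambda>l. cnj (x1 l)) * A 1 (\<lambda>l. cnj (x2 l)) - A 0 (\<lambda>l. cnj (x2 l)) * A 1 (\<lambda>l. cnj (x1 l))"
  have Aeval: "poly_eval (A j p) ?v = tr w (ue j) (X p)" for j p
    unfolding A_def ev.hom_sum ev.hom_mult poly_eval_Const tri_expand(3)[of k "k+1" \<alpha> w "ue j" "X p"] c_def X_def ..
  have cofF: "cof p l \<in> forms 2 (k - 1)" if "l < k + 1" for p l
    using cofactor_forms[OF that, of s p] s(1) by (simp add: cof_def)
  have AF: "A j p \<in> forms 2 (k - 1)" for j p
    unfolding A_def using cofF forms_Const_mult by (intro forms_sum) (simp add: mult.commute)
  have "\<Delta> \<in> forms 2 ((k - 1) + (k - 1))" unfolding \<Delta>_def by (intro forms_diff forms_mult AF)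
  then have 1: "\<Delta> \<in> forms 2 (2 * (k - 1))" by (simp add: mult_2)
  have Ap: "A j p \<in> polys 2" for j p using forms_polys[OF AF] .
  have 2: "inI (\<Delta> * lin0 a)"
  proof -
    let ?p = "\<lambda>l. cnj (x1 l)" let ?p' = "\<lambda>l. cnj (x2 l)"
    have "A 1 ?p' * (A 0 ?p * lin0 a + A 1 ?p * lin1 b) - A 1 ?p * (A 0 ?p' * lin0 a + A 1 ?p' * lin1 b) \<in> {f. inI f}"
      by (intro pidealD(6)[OF pideal_inI] pidealD(4)[OF pideal_inI] Ap) (simp_all add: AI)
    moreover have "A 1 ?p' * (A 0 ?p * lin0 a + A 1 ?p * lin1 b) - A 1 ?p * (A 0 ?p' * lin0 a + A 1 ?p' * lin1 b) = \<Delta> * lin0 a"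
      unfolding \<Delta>_def by (simp add: algebra_simps)
    ultimately show ?thesis by simp
  qed
  have 3: "inI (\<Delta> * lin1 b)"
  proof -
    let ?p = "\<lambda>l. cnj (x1 l)" let ?p' = "\<lambda>l. cnj (x2 l)"
    have "A 0 ?p * (A 0 ?p' * lin0 a + A 1 ?p' * lin1 b) - A 0 ?p' * (A 0 ?p * lin0 a + A 1 ?p * lin1 b) \<in> {f. inI f}"
      by (intro pidealD(6)[OF pideal_inI] pidealD(4)[OF pideal_inI] Ap) (simp_all add: AI)
    moreover have "A 0 ?p * (A 0 ?p' * lin0 a + A 1 ?p' * lin1 b) - A 0 ?p' * (A 0 ?p * lin0 a + A 1 ?p * lin1 b) = \<Delta> * lin1 b"
      unfolding \<Delta>_def by (simp add: algebra_simps)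
    ultimately show ?thesis by simp
  qed
  have 4: "poly_eval \<Delta> ?v \<noteq> 0"
  proof
    assume z: "poly_eval \<Delta> ?v = 0"
    have "tr w (ue 0) X1 * tr w (ue 1) X2 = tr w (ue 0) X2 * tr w (ue 1) X1"
      using z unfolding \<Delta>_def ev.hom_minus ev.hom_mult Aeval X1_def X2_def by simp
    then obtain e f where ef: "e \<noteq> 0 \<or> f \<noteq> 0" "e * tr w (ue 0) X1 + f * tr w (ue 0) X2 = 0" "e * tr w (ue 1) X1 + f * tr w (ue 1) X2 = 0"
      using dependent_pairs[of "tr w (ue 0) X1" "tr w (ue 1) X2" "tr w (ue 0) X2" "tr w (ue 1) X1"] by blast
    \<comment> \<open>If \<Delta> vanished at z, this combination of X1 and X2 would be annihilated
      by \<open>w\<close> in columns 0 and 1, hence in all three, contrary to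
      \<open>key\<close>.\<close>
    define X0 where "X0 l = e * X1 l + f * X2 l" for l
    have X0: "tr w' y X0 = e * tr w' y X1 + f * tr w' y X2" for w' y
      unfolding X0_def tri_add tri_scale ..
    have dot: "(\<Sum>l<k+1. p l * X0 l) = e * (\<Sum>l<k+1. p l * X1 l) + f * (\<Sum>l<k+1. p l * X2 l)" for p
      unfolding X0_def distrib_left sum.distrib sum_distrib_left by (simp only: mult_ac)
    have n0: "nz (k+1) X0"
    proof (rule ccontr)
      assume "\<not> ?thesis"
      then have "X0 l = 0" if "l < k + 1" for l using that by (auto simp: nz_def)
      then have "(\<Sum>l<k+1. p l * X0 l) = 0" for p by (intro sum.neutral) simp
      then have "e * (\<Sum>l<k+1. p l * X1 l) + f * (\<Sum>l<k+1. p l * X2 l) = 0" for p unfolding dot .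
      from this[of "\<lambda>l. cnj (x1 l)"] this[of "\<lambda>l. cnj (x2 l)"] show False using X12 ef(1) by simp
    qed
    have Xl: "tr w' ?z X0 = 0" for w' unfolding X0 X1_def X2_def XL by simp
    have w01: "tr w (ue 0) X0 = 0" "tr w (ue 1) X0 = 0" unfolding X0 using ef by simp_all
    have "tr w ?z X0 = (\<Sum>j<3. ?z j * tr w (ue j) X0)" by (rule tri_expand(2))
    also have "\<dots> = tr w (ue 2) X0" unfolding lessThan_3 using w01 by (simp add: pt_def)
    finally have "tr w (ue 2) X0 = 0" using Xl by simp
    then have "\<forall>j<3. tr w (ue j) X0 = 0" using w01 using lessThan_3 by (metis insertE lessThan_iff singletonD)
    then have "\<And>y'. tr w y' X0 = 0" unfolding tri_zero_iff(2) by blast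
    from key[OF n0 ptnz w(1) Xl this] w(2) show False by simp
  qed
  show ?thesis using 1 2 3 4 by blast
qed

end

context smooth_tensor begin

lemma inI_eval: "inI f \<Longrightarrow> inZ (pt a b) \<Longrightarrow> poly_eval f (vec 3 (pt a b)) = 0"
proof -
  assume f: "inI f" and Z: "inZ (pt a b)"
  obtain w where w: "nz k w" "\<And>x. tr w (pt a b) x = 0" using Z unfolding inZ_def by blast
  have "\<exists>w. nz k w \<and> (\<forall>x. tr w (\<lambda>j. vec 3 (pt a b) $ j) x = 0)"
  proof (intro exI[of _ w] conjI allI)
    fix x
    have "tr w (\<lambda>j. vec 3 (pt a b) $ j) x = tr w (pt a b) x" unfolding tri_def by (intro sum.cong refl) simp
    then show "tr w (\<lambda>j. vec 3 (pt a b) $ j) x = 0" using w(2) by simp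
  qed (rule w(1))
  then have q: "\<forall>l<k+1. poly_eval (q l) (vec 3 (pt a b)) = 0" unfolding q_zero_iff .
  obtain c where "f = (\<Sum>l<k+1. c l * q l)" using f unfolding inI_def by blast
  then show ?thesis using q by (simp add: ev.hom_sum ev.hom_mult)
qed

lemma q_nonzero: "\<not> inZ (pt a b) \<Longrightarrow> \<exists>l<k+1. poly_eval (q l) (vec 3 (pt a b)) \<noteq> 0"
proof (rule ccontr)
  assume Z: "\<not> inZ (pt a b)" and "\<not> (\<exists>l<k+1. poly_eval (q l) (vec 3 (pt a b)) \<noteq> 0)"
  then have "\<forall>l<k+1. poly_eval (q l) (vec 3 (pt a b)) = 0" by blast
  then obtain w where w: "nz k w" "\<forall>x. tr w (\<lambda>j. vec 3 (pt a b) $ j) x = 0" unfolding q_zero_iff by blast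
  have "tr w (pt a b) x = 0" for x
  proof -
    have "tr w (\<lambda>j. vec 3 (pt a b) $ j) x = tr w (pt a b) x" unfolding tri_def by (intro sum.cong refl) simp
    then show ?thesis using w(2) by simp
  qed
  moreover have "nz 3 (pt a b)" by (rule nzI[of 2]) (simp_all add: pt_def)
  ultimately show False using Z w(1) unfolding inZ_def by blast
qed

lemma q_inI: "l < k + 1 \<Longrightarrow> inI (q l)"
proof -
  assume l: "l < k + 1"
  have "(\<Sum>l'<k+1. (if l' = l then 1 else 0) * q l') = q l"
    by (subst sum_only[OF l]) auto
  then show ?thesis using inI_combination[of "\<lambda>l'. if l' = l then 1 else 0"] by simp
qed

end

section \<open>Eliminants, radicality and the number of points\<close>

context line_free begin

text \<open>Modulo the ideal the D + 1 monomials of degree D in x_j and x_2 reduce to x_2^e times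
  forms of degree k - 1; a linear dependency among these reductions gives \<open>p\<close>.\<close>

lemma eliminant:
  "\<exists>D p. p \<noteq> 0 \<and> degree p \<le> D \<and> inI (hp j D p)" if j: "j \<le> 2"
proof -
  \<comment> \<open>The exponent is taken equal to the dimension of the space of forms of degree k -
    1, so that D + 1 = k + e exceeds it.\<close>
  define e where "e = card (exps (k - 1))"
  define D where "D = k - 1 + e"
  have "\<forall>i. \<exists>c. i < D + 1 \<longrightarrow> inI (Var j ^ i * Var 2 ^ (D - i) - Var 2 ^ e * (\<Sum>\<epsilon>\<in>exps (k-1). Const (c \<epsilon>) * mono3 (k-1) \<epsilon>))"
  proof
    fix i
    show "\<exists>c. i < D + 1 \<longrightarrow> inI (Var j ^ i * Var 2 ^ (D - i) - Var 2 ^ e * (\<Sum>\<epsilon>\<in>exps (k-1). Const (c \<epsilon>) * mono3 (k-1) \<epsilon>))"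
    proof (cases "i < D + 1")
      case True
      have "Var j ^ i * Var 2 ^ (D - i) \<in> forms 2 (i * 1 + (D - i) * 1)"
        by (intro forms_mult forms_power forms_Var j order_refl)
      then have "Var j ^ i * Var 2 ^ (D - i) \<in> forms 2 (k - 1 + e)" using True by (simp add: D_def)
      from forms_reduce[OF this] obtain g where g: "g \<in> forms 2 (k - 1)" "inI (Var j ^ i * Var 2 ^ (D - i) - Var 2 ^ e * g)" by (rule bexE)
      from forms_mono3[OF g(1)] obtain c where "g = (\<Sum>\<epsilon>\<in>exps (k-1). Const (c \<epsilon>) * mono3 (k-1) \<epsilon>)" by (rule exE)
      then show ?thesis using g(2) by (intro exI[of _ c]) simp
    qed simp
  qed
  from choice[OF this] obtain c where c: "\<forall>i. i < D + 1 \<longrightarrow> inI (Var j ^ i * Var 2 ^ (D - i) - Var 2 ^ e * (\<Sum>\<epsilon>\<in>exps (k-1). Const (c i \<epsilon>) * mono3 (k-1) \<epsilon>))" by (rule exE)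
  have "card (exps (k-1)) < D + 1" by (simp add: D_def e_def)
  from kernel_nontrivial[OF finite_exps this, of "\<lambda>\<epsilon> i. c i \<epsilon>"]
  obtain x where x: "nz (D+1) x" "\<forall>\<epsilon>\<in>exps (k-1). (\<Sum>i<D+1. c i \<epsilon> * x i) = 0" by blast
  define p where "p = (\<Sum>i\<le>D. monom (x i) i)"
  have px: "coeff p i = x i" if "i \<le> D" for i using coeff_sum_monom[of x D i] that by (simp add: p_def)
  obtain i where i: "i < D + 1" "x i \<noteq> 0" using x(1) by (rule nzE)
  then have p0: "p \<noteq> 0" using px[of i] by auto
  have "degree p \<le> D" by (rule degree_le) (simp add: p_def coeff_sum_monom)
  moreover have "inI (hp j D p)"
  proof -
    let ?t = "\<lambda>i. Var j ^ i * Var 2 ^ (D - i) - Var 2 ^ e * (\<Sum>\<epsilon>\<in>exps (k-1). Const (c i \<epsilon>) * mono3 (k-1) \<epsilon>)"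
    have "(\<Sum>i<D+1. Const (x i) * ?t i) \<in> {f. inI f}"
      by (rule pideal_sum[OF pideal_inI], rule pidealD(4)[OF pideal_inI]) (use c in auto)
    moreover have "(\<Sum>i<D+1. Const (x i) * ?t i) = hp j D p"
    proof -
      have "(\<Sum>i<D+1. Const (x i) * ?t i) = (\<Sum>i<D+1. Const (x i) * (Var j ^ i * Var 2 ^ (D - i)))
        - (\<Sum>i<D+1. Const (x i) * (Var 2 ^ e * (\<Sum>\<epsilon>\<in>exps (k-1). Const (c i \<epsilon>) * mono3 (k-1) \<epsilon>)))"
        unfolding right_diff_distrib sum_subtractf ..
      also have "(\<Sum>i<D+1. Const (x i) * (Var 2 ^ e * (\<Sum>\<epsilon>\<in>exps (k-1). Const (c i \<epsilon>) * mono3 (k-1) \<epsilon>)))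
        = Var 2 ^ e * (\<Sum>\<epsilon>\<in>exps (k-1). Const (\<Sum>i<D+1. c i \<epsilon> * x i) * mono3 (k-1) \<epsilon>)"
        unfolding sum_distrib_left Const.hom_sum sum_distrib_right Const.hom_mult by (subst sum.swap) (simp only: mult_ac)
      also have "(\<Sum>\<epsilon>\<in>exps (k-1). Const (\<Sum>i<D+1. c i \<epsilon> * x i) * mono3 (k-1) \<epsilon>) = 0"
        by (intro sum.neutral ballI) (use x(2) in \<open>simp add: Const.hom_zero\<close>)
      also have "(\<Sum>i<D+1. Const (x i) * (Var j ^ i * Var 2 ^ (D - i))) = hp j D p"
        unfolding hp_def by (intro sum.cong) (auto simp: px mult.assoc)
      finally show ?thesis by simp
    qed
    ultimately show ?thesis by simp
  qed
  ultimately show ?thesis using p0 by (intro exI[of _ D] exI[of _ p]) simp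
qed

text \<open>The ideal is saturated with respect to \<open>x\<^sub>2\<close>, and separating forms show that locally it is the ideal
  of a point; eliminants glue this to a power of \<open>x\<^sub>2\<close> lying in the transporter of \<open>f\<close>.\<close>

lemma radical:
  assumes f: "f \<in> forms 2 n" and z: "\<And>a b. inZ (pt a b) \<Longrightarrow> poly_eval f (vec 3 (pt a b)) = 0"
  shows "inI f"
proof -
  note I = pideal_inI
  have fp: "f \<in> polys 2" using forms_polys[OF f] .
  define T where "T = {g \<in> polys 2. inI (g * f)}"
  have T: "pideal 2 T"
    unfolding pideal_def
  proof (intro conjI ballI)
    show "0 \<in> T" using pidealD(2)[OF I] by (simp add: T_def)
    fix g h assume "g \<in> T" "h \<in> T"
    then show "g + h \<in> T" using pidealD(3)[OF I, of "g * f" "h * f"] by (simp add: T_def distrib_right)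
  next
    fix c g assume "c \<in> polys 2" "g \<in> T"
    then show "c * g \<in> T" using pidealD(4)[OF I, of c "g * f"] by (simp add: T_def mult.assoc)
  qed (auto simp: T_def)
  have IT: "inI g \<Longrightarrow> g \<in> T" for g
    using pidealD(1)[OF I, of g] pidealD(4)[OF I fp, of g] by (simp add: T_def mult.commute)
  have lp: "lin0 a \<in> polys 2" "lin1 b \<in> polys 2" for a b using lin_forms forms_polys by blast+
  \<comment> \<open>Off the locus some minor is nonzero at the point. On the locus the separating
    form multiplies \<open>f\<close> into the ideal, because \<open>f\<close> lies in the ideal of
    the point. In both cases division by the value at the point yields a power of x_2.\<close>
  have local: "\<exists>E t h h'. t \<in> T \<and> h \<in> polys 2 \<and> h' \<in> polys 2 \<and> Var 2 ^ E = t + lin0 a * h + lin1 b * h'" for a b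
  proof -
    let ?v = "vec 3 (pt a b)"
    have "\<exists>\<Delta> m. \<Delta> \<in> forms 2 m \<and> poly_eval \<Delta> ?v \<noteq> 0 \<and> \<Delta> \<in> T"
    proof (cases "inZ (pt a b)")
      case False
      then obtain l where l: "l < k + 1" "poly_eval (q l) ?v \<noteq> 0" using q_nonzero by blast
      then show ?thesis using q_forms[OF l(1)] IT[OF q_inI[OF l(1)]] by blast
    next
      case True
      obtain \<Delta> where D: "\<Delta> \<in> forms 2 (2 * (k - 1))" "poly_eval \<Delta> ?v \<noteq> 0" "inI (\<Delta> * lin0 a)" "inI (\<Delta> * lin1 b)"
        using separating_form[OF True] by blast
      obtain g h where gh: "g \<in> polys 2" "h \<in> polys 2" "f = lin0 a * g + lin1 b * h + Const (poly_eval f ?v) * Var 2 ^ n"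
        using form_mod_point[OF f, of a b] by blast
      have fe: "f = lin0 a * g + lin1 b * h" using gh(3) unfolding z[OF True] by (simp add: Const.hom_zero)
      have "\<Delta> * f = g * (\<Delta> * lin0 a) + h * (\<Delta> * lin1 b)" unfolding fe by (simp add: algebra_simps)
      also have "\<dots> \<in> {f. inI f}"
        by (rule pidealD(3)[OF I pidealD(4)[OF I gh(1)] pidealD(4)[OF I gh(2)]]) (use D in auto)
      finally have "\<Delta> \<in> T" using forms_polys[OF D(1)] by (simp add: T_def)
      then show ?thesis using D by blast
    qed
    then obtain \<Delta> m where D: "\<Delta> \<in> forms 2 m" "poly_eval \<Delta> ?v \<noteq> 0" "\<Delta> \<in> T" by blast
    let ?d = "poly_eval \<Delta> ?v"
    obtain g h where gh: "g \<in> polys 2" "h \<in> polys 2" "\<Delta> = lin0 a * g + lin1 b * h + Const ?d * Var 2 ^ m"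
      using form_mod_point[OF D(1), of a b] by blast
    have c1: "Const (1 / ?d) * Const ?d = 1" using D(2) by (simp add: Const.hom_mult[symmetric] Const.hom_one)
    have gen: "V = C * D' + l0 * (- (C * g')) + l1 * (- (C * h'))" if "D' = l0 * g' + l1 * h' + d * V" "C * d = 1"
      for C D' V l0 l1 d g' h' :: cpoly
    proof -
      have "C * D' = C * l0 * g' + C * l1 * h' + (C * d) * V" unfolding that(1) by (simp add: algebra_simps)
      then show ?thesis unfolding that(2) by (simp add: algebra_simps)
    qed
    show ?thesis
    proof (rule exI[of _ m], rule exI[of _ "Const (1 / ?d) * \<Delta>"], rule exI[of _ "- (Const (1 / ?d) * g)"],
        rule exI[of _ "- (Const (1 / ?d) * h)"], intro conjI)
      show "Const (1 / ?d) * \<Delta> \<in> T" using pidealD(4)[OF T _ D(3)] by simp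
      show "Var 2 ^ m = Const (1 / ?d) * \<Delta> + lin0 a * (- (Const (1 / ?d) * g)) + lin1 b * (- (Const (1 / ?d) * h))"
        by (rule gen[OF gh(3) c1])
    qed (use gh in simp_all)
  qed
  have row: "\<exists>E t h. t \<in> T \<and> h \<in> polys 2 \<and> Var 2 ^ E = t + (Var 0 - Const a * Var 2) * h" for a
  proof -
    \<comment> \<open>All points with x_0 = a x_2 are treated at once: the roots of an eliminant in
      x_1 bound the values b that matter.\<close>
    define Ta where "Ta = {t + lin0 a * h | t h. t \<in> T \<and> h \<in> polys 2}"
    have TaI: "t \<in> T \<Longrightarrow> h \<in> polys 2 \<Longrightarrow> t + lin0 a * h \<in> Ta" for t h unfolding Ta_def by blast
    have Ta: "pideal 2 Ta"
      unfolding pideal_def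
    proof (intro conjI ballI subsetI)
      show "0 \<in> Ta" using TaI[OF pidealD(2)[OF T], of 0] by simp
    next
      fix x assume "x \<in> Ta"
      then obtain t h where "t \<in> T" "h \<in> polys 2" "x = t + lin0 a * h" unfolding Ta_def by blast
      then show "x \<in> polys 2" using pidealD(1)[OF T] lp by simp
    next
      fix x y assume "x \<in> Ta" "y \<in> Ta"
      then obtain t h t' h' where *: "t \<in> T" "h \<in> polys 2" "x = t + lin0 a * h" "t' \<in> T" "h' \<in> polys 2" "y = t' + lin0 a * h'"
        unfolding Ta_def by blast
      have "x + y = (t + t') + lin0 a * (h + h')" unfolding *(3,6) by (simp add: algebra_simps)
      also have "\<dots> \<in> Ta" by (rule TaI) (use * pidealD(3)[OF T] in auto)
      finally show "x + y \<in> Ta" .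
    next
      fix c x assume c: "c \<in> polys 2" and "x \<in> Ta"
      then obtain t h where *: "t \<in> T" "h \<in> polys 2" "x = t + lin0 a * h" unfolding Ta_def by blast
      have "c * x = c * t + lin0 a * (c * h)" unfolding *(3) by (simp add: algebra_simps)
      also have "\<dots> \<in> Ta" by (rule TaI) (use * c pidealD(4)[OF T] in auto)
      finally show "c * x \<in> Ta" .
    qed
    obtain D p where p: "p \<noteq> 0" "degree p \<le> D" "inI (hp 1 D p)" using eliminant[of 1] by auto
    have "hp 1 D p \<in> Ta" using TaI[OF IT[OF p(3)], of 0] by simp
    note hpT = this
    have sl: "\<exists>E t h. t \<in> Ta \<and> h \<in> polys 2 \<and> Var 2 ^ E = t + (Var 1 - Const s * Var 2) * h" for s
    proof -
      obtain E t h h' where *: "t \<in> T" "h \<in> polys 2" "h' \<in> polys 2" "Var 2 ^ E = t + lin0 a * h + lin1 s * h'" using local by blast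
      show ?thesis
        by (rule exI[of _ E], rule exI[of _ "t + lin0 a * h"], rule exI[of _ h']) (use * TaI in \<open>simp add: lin1_def\<close>)
    qed
    have "\<exists>E. Var 2 ^ E \<in> Ta" by (rule power_in_ideal[OF p(1,2) hpT _ Ta sl]) simp
    then obtain E where "Var 2 ^ E \<in> Ta" by (rule exE)
    then show ?thesis unfolding Ta_def lin0_def by blast
  qed
  obtain D p where p: "p \<noteq> 0" "degree p \<le> D" "inI (hp 0 D p)" using eliminant[of 0] by auto
  \<comment> \<open>The same gluing over the roots of an eliminant in x_0.\<close>
  have "\<exists>E. Var 2 ^ E \<in> T" by (rule power_in_ideal[OF p(1,2) IT[OF p(3)] _ T row]) simp
  then obtain E where "Var 2 ^ E \<in> T" by (rule exE)
  then have "inI (Var 2 ^ E * f)" by (simp add: T_def)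
  then show ?thesis by (rule inI_cancel[OF f])
qed

definition Zpts :: "(complex \<times> complex) set" where "Zpts = {(a, b). inZ (pt a b)}"

lemma eval_mono3_form:
  assumes "f = (\<Sum>\<epsilon>\<in>exps d. Const (c \<epsilon>) * mono3 d \<epsilon>)"
  shows "poly_eval f v = (\<Sum>\<epsilon>\<in>exps d. c \<epsilon> * poly_eval (mono3 d \<epsilon>) v)"
  unfolding assms by (simp add: ev.hom_sum ev.hom_mult)

text \<open>With more points than dim of the forms of degree k - 1, the evaluations on such forms
  would satisfy a linear relation. By \<open>forms_reduce\<close> and x_2 = 1 at the points it would
  persist in all higher degrees, where a product of lines separates one point from the
  others.\<close>

lemma finite_points_bound:
  assumes S: "finite S" "S \<subseteq> Zpts"
  shows "card S \<le> card (exps (k - 1))"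
proof (rule ccontr)
  assume "\<not> ?thesis"
  then have c: "card (exps (k-1)) < card S" by simp
  obtain \<sigma> where \<sigma>: "bij_betw \<sigma> {..<card S} S" using ex_bij_betw_nat_finite[OF S(1)] by (auto simp: lessThan_atLeast0)
  define v where "v i = vec 3 (pt (fst (\<sigma> i)) (snd (\<sigma> i)))" for i
  have Zi: "inZ (pt (fst (\<sigma> i)) (snd (\<sigma> i)))" if "i < card S" for i
    using that \<sigma> S(2) unfolding bij_betw_def Zpts_def by fastforce
  obtain x where x: "nz (card S) x" "\<forall>\<epsilon>\<in>exps (k-1). (\<Sum>i<card S. poly_eval (mono3 (k-1) \<epsilon>) (v i) * x i) = 0"
    using kernel_nontrivial[OF finite_exps c, of "\<lambda>\<epsilon> i. poly_eval (mono3 (k-1) \<epsilon>) (v i)"] by blast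
  have g0: "(\<Sum>i<card S. poly_eval g (v i) * x i) = 0" if g: "g \<in> forms 2 (k-1)" for g
  proof -
    obtain c where "g = (\<Sum>\<epsilon>\<in>exps (k-1). Const (c \<epsilon>) * mono3 (k-1) \<epsilon>)" using forms_mono3[OF g] by (rule exE)
    then have "(\<Sum>i<card S. poly_eval g (v i) * x i) = (\<Sum>i<card S. (\<Sum>\<epsilon>\<in>exps (k-1). c \<epsilon> * poly_eval (mono3 (k-1) \<epsilon>) (v i)) * x i)"
      using eval_mono3_form by simp
    also have "\<dots> = (\<Sum>\<epsilon>\<in>exps (k-1). c \<epsilon> * (\<Sum>i<card S. poly_eval (mono3 (k-1) \<epsilon>) (v i) * x i))"
      unfolding sum_distrib_left sum_distrib_right by (subst sum.swap) (simp only: mult.assoc)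
    also have "\<dots> = 0" by (intro sum.neutral ballI) (use x(2) in simp)
    finally show ?thesis .
  qed
  have f0: "(\<Sum>i<card S. poly_eval f (v i) * x i) = 0" if f: "f \<in> forms 2 (k-1+e)" for f e
  proof -
    obtain g where g: "g \<in> forms 2 (k-1)" "inI (f - Var 2 ^ e * g)" using forms_reduce[OF f] by (rule bexE)
    have "poly_eval f (v i) = poly_eval g (v i)" if "i < card S" for i
    proof -
      have "poly_eval (f - Var 2 ^ e * g) (v i) = 0" unfolding v_def by (rule inI_eval[OF g(2) Zi[OF that]])
      then show ?thesis by (simp add: ev.hom_minus ev.hom_mult ev.hom_power v_def pt_def)
    qed
    then have "(\<Sum>i<card S. poly_eval f (v i) * x i) = (\<Sum>i<card S. poly_eval g (v i) * x i)" by simp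
    then show ?thesis using g0[OF g(1)] by simp
  qed
  obtain i0 where i0: "i0 < card S" "x i0 \<noteq> 0" using x(1) by (rule nzE)
  \<comment> \<open>A line through point \<open>i\<close> that misses point \<open>i0\<close>. The
    power of x_2 below only raises the degree into the range of \<open>f0\<close>.\<close>
  define L where "L i = (if fst (\<sigma> i) = fst (\<sigma> i0) then lin1 (snd (\<sigma> i)) else lin0 (fst (\<sigma> i)))" for i
  define f where "f = Var 2 ^ (k-1) * (\<Prod>i\<in>{..<card S}-{i0}. L i)"
  have "f \<in> forms 2 ((k-1) * 1 + (\<Sum>i\<in>{..<card S}-{i0}. 1))"
    unfolding f_def by (intro forms_mult forms_power forms_Var forms_prod) (auto simp: L_def lin_forms)
  then have "(\<Sum>i<card S. poly_eval f (v i) * x i) = 0" using f0[of f] by simp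
  moreover have "poly_eval f (v i) = 0" if "i < card S" "i \<noteq> i0" for i
  proof -
    have "poly_eval (L i) (v i) = 0" by (simp add: L_def v_def lin_eval pt_def)
    then have "(\<Prod>i'\<in>{..<card S}-{i0}. poly_eval (L i') (v i)) = 0" using that by (intro prod_zero) auto
    then show ?thesis by (simp add: f_def ev.hom_mult ev.hom_prod)
  qed
  then have "(\<Sum>i<card S. poly_eval f (v i) * x i) = poly_eval f (v i0) * x i0"
    by (intro sum_only i0(1)) simp
  ultimately have "poly_eval f (v i0) = 0" using i0(2) by simp
  then have "\<exists>i\<in>{..<card S}-{i0}. poly_eval (L i) (v i0) = 0"
    by (auto simp: f_def ev.hom_mult ev.hom_prod ev.hom_power v_def pt_def)
  then obtain i where i: "i < card S" "i \<noteq> i0" "poly_eval (L i) (v i0) = 0" by blast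
  then have "\<sigma> i = \<sigma> i0" by (auto simp: L_def v_def lin_eval pt_def prod_eq_iff split: if_splits)
  then show False using \<sigma> i i0(1) unfolding bij_betw_def inj_on_def by blast
qed

lemma finite_Zpts: "finite Zpts"
proof (rule ccontr)
  assume "infinite Zpts"
  then obtain S where "S \<subseteq> Zpts" "finite S" "card S = Suc (card (exps (k - 1)))"
    using infinite_arbitrarily_large by blast
  then show False using finite_points_bound[of S] by simp
qed

text \<open>With fewer points a nonzero form of degree k - 1 would vanish on all of them and lie in
  the ideal by \<open>radical\<close>, but the ideal starts in degree k.\<close>

lemma card_Zpts: "card Zpts = card (exps (k - 1))"
proof (rule antisym[OF finite_points_bound[OF finite_Zpts order_refl]], rule ccontr)
  assume "\<not> card (exps (k - 1)) \<le> card Zpts"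
  then have c: "card Zpts < card (exps (k-1))" by simp
  obtain \<epsilon> where \<epsilon>: "bij_betw \<epsilon> {..<card (exps (k-1))} (exps (k-1))"
    using ex_bij_betw_nat_finite[OF finite_exps] by (auto simp: lessThan_atLeast0)
  obtain x where x: "nz (card (exps (k-1))) x"
    "\<forall>s\<in>Zpts. (\<Sum>i<card (exps (k-1)). poly_eval (mono3 (k-1) (\<epsilon> i)) (vec 3 (pt (fst s) (snd s))) * x i) = 0"
    using kernel_nontrivial[OF finite_Zpts c, of "\<lambda>s i. poly_eval (mono3 (k-1) (\<epsilon> i)) (vec 3 (pt (fst s) (snd s)))"] by blast
  define x' where "x' e = x (inv_into {..<card (exps (k-1))} \<epsilon> e)" for e
  have x'\<epsilon>: "x' (\<epsilon> i) = x i" if "i < card (exps (k-1))" for i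
    using bij_betw_inv_into_left[OF \<epsilon>, of i] that by (simp add: x'_def)
  define f where "f = (\<Sum>e\<in>exps (k-1). Const (x' e) * mono3 (k-1) e)"
  have ff: "f \<in> forms 2 (k-1)" unfolding f_def by (intro forms_sum forms_Const_mult mono3_forms)
  have "inI f"
  proof (rule radical[OF ff])
    fix a b assume "inZ (pt a b)"
    then have s: "(a,b) \<in> Zpts" by (simp add: Zpts_def)
    have "poly_eval f (vec 3 (pt a b)) = (\<Sum>e\<in>exps (k-1). x' e * poly_eval (mono3 (k-1) e) (vec 3 (pt a b)))"
      by (rule eval_mono3_form[OF f_def])
    also have "\<dots> = (\<Sum>i<card (exps (k-1)). x' (\<epsilon> i) * poly_eval (mono3 (k-1) (\<epsilon> i)) (vec 3 (pt a b)))"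
      by (rule sum.reindex_bij_betw[OF \<epsilon>, symmetric])
    also have "\<dots> = (\<Sum>i<card (exps (k-1)). poly_eval (mono3 (k-1) (\<epsilon> i)) (vec 3 (pt a b)) * x i)"
      by (intro sum.cong refl) (simp add: x'\<epsilon>)
    also have "\<dots> = 0" using x(2)[rule_format, OF s] by simp
    finally show "poly_eval f (vec 3 (pt a b)) = 0" .
  qed
  then have "f = 0" using inI_homogeneous[OF _ ff] k2 by auto
  obtain i where i: "i < card (exps (k-1))" "x i \<noteq> 0" using x(1) by (rule nzE)
  have "x' (\<epsilon> i) = 0" by (rule mono3_independent[of x' "k-1"]) (use \<open>f = 0\<close> f_def \<epsilon> i(1) in \<open>auto simp: bij_betw_def\<close>)
  then show False using x'\<epsilon>[OF i(1)] i(2) by simp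
qed

text \<open>A linear form vanishing on all the points would lie in the ideal, which starts in degree
  k \<ge> 2.\<close>

lemma Z_noncollinear:
  assumes "nz 3 \<mu>"
  shows "\<exists>y. inZ y \<and> (\<Sum>j<3. \<mu> j * y j) \<noteq> 0"
proof (rule ccontr)
  assume "\<not> ?thesis"
  then have z: "inZ y \<Longrightarrow> (\<Sum>j<3. \<mu> j * y j) = 0" for y by blast
  define f where "f = (\<Sum>j<3. Const (\<mu> j) * Var j)"
  have fe: "poly_eval f v = (\<Sum>j<3. \<mu> j * v $ j)" for v by (simp add: f_def ev.hom_sum ev.hom_mult)
  have ff: "f \<in> forms 2 1" unfolding f_def by (intro forms_sum forms_Const_mult forms_Var) auto
  have "inI f"
  proof (rule radical[OF ff])
    fix a b assume Z: "inZ (pt a b)"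
    have "poly_eval f (vec 3 (pt a b)) = (\<Sum>j<3. \<mu> j * pt a b j)" unfolding fe by (intro sum.cong refl) simp
    then show "poly_eval f (vec 3 (pt a b)) = 0" using z[OF Z] by simp
  qed
  then have "f = 0" using inI_homogeneous[OF _ ff] k2 by auto
  then have "(\<Sum>j<3. \<mu> j * v $ j) = 0" for v unfolding fe[symmetric] by simp
  from this[of "vec 3 (\<lambda>j. cnj (\<mu> j))"] have "(\<Sum>j<3. cnj (\<mu> j) * \<mu> j) = 0" by (simp add: mult.commute)
  then show False using sum_cnj_nonzero[OF assms] by simp
qed

end

section \<open>Finiteness and a line missing the points\<close>

lemma tendsto_poly_eval:
  assumes "f \<in> polys 2" "\<And>i. i \<le> 2 \<Longrightarrow> (\<lambda>n. y n i) \<longlonglongrightarrow> y0 i"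
  shows "(\<lambda>n. poly_eval f (vec 3 (y n))) \<longlonglongrightarrow> poly_eval f (vec 3 y0)"
  using assms(1)
proof (induction rule: polys_induct)
  case (Var i)
  then show ?case using assms(2)[of i] by simp
next
  case (add f g)
  show ?case unfolding ev.hom_add by (intro tendsto_add add(3,4))
next
  case (mult f g)
  show ?case unfolding ev.hom_mult by (intro tendsto_mult mult(3,4))
qed simp

lemma bounded_pair_subseq:
  fixes s :: "nat \<Rightarrow> complex \<times> complex"
  assumes "\<And>n. cmod (fst (s n)) \<le> 1" "\<And>n. cmod (snd (s n)) \<le> 1"
  obtains r a b where "strict_mono (r :: nat \<Rightarrow> nat)" "(\<lambda>n. fst (s (r n))) \<longlonglongrightarrow> a" "(\<lambda>n. snd (s (r n))) \<longlonglongrightarrow> b"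
proof -
  have "\<forall>n. cmod (fst (s n)) \<le> 1" using assms(1) by blast
  from Bolzano_Weierstrass_complex_disc[OF this]
  obtain f a where f: "strict_mono (f :: nat \<Rightarrow> nat)" "\<forall>e>0. \<exists>N. \<forall>n\<ge>N. cmod (fst (s (f n)) - a) < e" by blast
  have "\<forall>n. cmod (snd (s (f n))) \<le> 1" using assms(2) by blast
  from Bolzano_Weierstrass_complex_disc[OF this]
  obtain g b where g: "strict_mono (g :: nat \<Rightarrow> nat)" "\<forall>e>0. \<exists>N. \<forall>n\<ge>N. cmod (snd (s (f (g n))) - b) < e" by blast
  have fa: "(\<lambda>n. fst (s (f n))) \<longlonglongrightarrow> a" using f(2) by (simp add: LIMSEQ_iff)
  have gb: "(\<lambda>n. snd (s (f (g n)))) \<longlonglongrightarrow> b" using g(2) by (simp add: LIMSEQ_iff)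
  show thesis
    by (rule that[of "f \<circ> g" a b]) (use strict_mono_o[OF f(1) g(1)] LIMSEQ_subseq_LIMSEQ[OF fa g(1)] gb in \<open>simp_all add: o_def\<close>)
qed

lemma sum_lessThan_3: "(\<Sum>j<3. f j) = f 0 + f 1 + f (2::nat)" for f :: "nat \<Rightarrow> 'a::comm_monoid_add"
  unfolding lessThan_3 by (simp add: add.assoc)

lemma all_lessThan_3: "(\<forall>j<3. P j) \<longleftrightarrow> P 0 \<and> P 1 \<and> P (2::nat)"
  using lessThan_3 by (metis insertE insertI1 insertI2 lessThan_iff singletonD)

context smooth_tensor begin

text \<open>The forms of \<open>separating_form\<close> show that every point of the locus is isolated.\<close>

lemma finite_chart: "finite {s. inZ (pt (fst s) (snd s)) \<and> cmod (fst s) \<le> 1 \<and> cmod (snd s) \<le> 1}"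
proof (rule ccontr)
  assume "\<not> ?thesis"
  from infinite_countable_subset[OF this]
  obtain s :: "nat \<Rightarrow> complex \<times> complex" where s: "inj s"
    "range s \<subseteq> {s. inZ (pt (fst s) (snd s)) \<and> cmod (fst s) \<le> 1 \<and> cmod (snd s) \<le> 1}" by blast
  have sn: "inZ (pt (fst (s n)) (snd (s n)))" "cmod (fst (s n)) \<le> 1" "cmod (snd (s n)) \<le> 1" for n using s(2) by auto
  obtain r a b where r: "strict_mono (r :: nat \<Rightarrow> nat)" "(\<lambda>n. fst (s (r n))) \<longlonglongrightarrow> a" "(\<lambda>n. snd (s (r n))) \<longlonglongrightarrow> b"
    using bounded_pair_subseq[of s, OF sn(2,3)] by blast
  define y where "y n = pt (fst (s (r n))) (snd (s (r n)))" for n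
  have yl: "(\<lambda>n. y n i) \<longlonglongrightarrow> pt a b i" for i
    unfolding y_def pt_def using r(2,3) by simp
  have lim: "(\<lambda>n. poly_eval f (vec 3 (y n))) \<longlonglongrightarrow> poly_eval f (vec 3 (pt a b))" if "f \<in> polys 2" for f
    by (rule tendsto_poly_eval[OF that yl])
  have zn: "poly_eval f (vec 3 (y n)) = 0" if "inI f" for f n
    unfolding y_def by (rule inI_eval[OF that sn(1)])
  have z0: "poly_eval f (vec 3 (pt a b)) = 0" if "inI f" for f
  proof -
    have "f \<in> polys 2" using pidealD(1)[OF pideal_inI, of f] that by simp
    from lim[OF this] have "(\<lambda>n. 0) \<longlonglongrightarrow> poly_eval f (vec 3 (pt a b))" unfolding zn[OF that] .
    from LIMSEQ_unique[OF tendsto_const this] show ?thesis by simp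
  qed
  \<comment> \<open>The minors are continuous, so the limit belongs to the locus. Its separating
    form is nonzero nearby and forces late members of the sequence to coincide with the
    limit.\<close>
  have Z: "inZ (pt a b)"
  proof (rule ccontr)
    assume "\<not> ?thesis"
    from q_nonzero[OF this] obtain l where "l < k + 1" "poly_eval (q l) (vec 3 (pt a b)) \<noteq> 0" by blast
    then show False using z0[OF q_inI] by simp
  qed
  obtain \<Delta> where D: "\<Delta> \<in> forms 2 (2 * (k - 1))" "poly_eval \<Delta> (vec 3 (pt a b)) \<noteq> 0"
    "inI (\<Delta> * lin0 a)" "inI (\<Delta> * lin1 b)" using separating_form[OF Z] by blast
  have "\<forall>\<^sub>F n in sequentially. poly_eval \<Delta> (vec 3 (y n)) \<noteq> 0"
    by (rule tendsto_imp_eventually_ne[OF lim[OF forms_polys[OF D(1)]] D(2)])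
  then obtain n where n: "\<And>m. m \<ge> n \<Longrightarrow> poly_eval \<Delta> (vec 3 (y m)) \<noteq> 0" unfolding eventually_sequentially by blast
  have "s (r m) = (a, b)" if "m \<ge> n" for m
  proof (rule prod_eqI)
    show "fst (s (r m)) = fst (a, b)"
      using zn[OF D(3), of m] n[OF that] by (simp add: ev.hom_mult lin_eval) (simp add: y_def pt_def)
    show "snd (s (r m)) = snd (a, b)"
      using zn[OF D(4), of m] n[OF that] by (simp add: ev.hom_mult lin_eval) (simp add: y_def pt_def)
  qed
  then have "s (r n) = s (r (Suc n))" by simp
  then have "r n = r (Suc n)" using s(1) by (simp add: inj_eq)
  moreover have "r n < r (Suc n)" using r(1) by (simp add: strict_mono_Suc_iff)
  ultimately show False by simp
qed

lemma smooth_tensor_tsubst: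
  assumes "det (mat 3 3 (\<lambda>(i,j). G i j)) \<noteq> 0"
  shows "smooth_tensor k (tsubst G \<alpha>)"
    and "smooth_tensor.inZ k (tsubst G \<alpha>) y \<longleftrightarrow> inZ (\<lambda>j'. \<Sum>j<3. G j' j * y j)"
proof -
  have nzG: "nz 3 (\<lambda>j'. \<Sum>j<3. G j' j * y j)" if "nz 3 y" for y
  proof (rule ccontr)
    assume "\<not> ?thesis"
    then have "\<forall>i<3. (\<Sum>j<3. G i j * y j) = 0" by (auto simp: nz_def)
    then show False using square_det_0I[OF that, of G] assms by blast
  qed
  have surj: "\<exists>y. tri k (k+1) \<alpha> w y' x = tri k (k+1) \<alpha> w (\<lambda>j'. \<Sum>j<3. G j' j * y j) x" for w y' x
  proof -
    obtain y where y: "\<forall>i<3. (\<Sum>j<3. G i j * y j) = y' i" using square_solve[OF assms, of y'] by (rule exE)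
    then have "tri k (k+1) \<alpha> w y' x = tri k (k+1) \<alpha> w (\<lambda>j'. \<Sum>j<3. G j' j * y j) x"
      unfolding tri_def by (intro sum.cong refl) simp
    then show ?thesis by blast
  qed
  show S: "smooth_tensor k (tsubst G \<alpha>)"
  proof
    fix x y w assume a: "nz (k+1) x" "nz 3 y" "nz k w" "\<And>w'. tri k (k+1) (tsubst G \<alpha>) w' y x = 0"
      "\<And>y'. tri k (k+1) (tsubst G \<alpha>) w y' x = 0"
    show "\<exists>x'. tri k (k+1) (tsubst G \<alpha>) w y x' \<noteq> 0"
      unfolding tri_tsubst
    proof (rule key[OF a(1) nzG[OF a(2)] a(3)])
      fix w' show "tr w' (\<lambda>j'. \<Sum>j<3. G j' j * y j) x = 0" using a(4) unfolding tri_tsubst .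
    next
      fix y'
      obtain y2 where "tr w y' x = tr w (\<lambda>j'. \<Sum>j<3. G j' j * y2 j) x" using surj by blast
      then show "tr w y' x = 0" using a(5) unfolding tri_tsubst by simp
    qed
  next
    fix y i w w' assume a: "nz 3 y" "i < k" "w i \<noteq> 0" "\<And>x. tri k (k+1) (tsubst G \<alpha>) w y x = 0"
      "\<And>x. tri k (k+1) (tsubst G \<alpha>) w' y x = 0" "nz k w'"
    show "w' i \<noteq> 0"
      by (rule left_unique[of "\<lambda>j'. \<Sum>j<3. G j' j * y j" i w w', OF nzG[OF a(1)] a(2,3) a(4,5)[unfolded tri_tsubst] a(6)])
  qed (rule k2)
  have "nz 3 y" if "nz 3 (\<lambda>j'. \<Sum>j<3. G j' j * y j)"
  proof (rule ccontr)
    assume "\<not> nz 3 y"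
    then have "\<forall>j<3. y j = 0" by (auto simp: nz_def)
    then have "(\<Sum>j<3. G i j * y j) = 0" for i by simp
    then show False using that by (simp add: nz_def)
  qed
  then have iff: "nz 3 y \<longleftrightarrow> nz 3 (\<lambda>j'. \<Sum>j<3. G j' j * y j)" using nzG[of y] by (rule iffI[rotated])
  show "smooth_tensor.inZ k (tsubst G \<alpha>) y \<longleftrightarrow> inZ (\<lambda>j'. \<Sum>j<3. G j' j * y j)"
    unfolding smooth_tensor.inZ_def[OF S] inZ_def tri_tsubst iff ..
qed

lemma inZ_scale: "a \<noteq> 0 \<Longrightarrow> inZ (\<lambda>j. a * y j) \<longleftrightarrow> inZ y"
  unfolding inZ_def tri_scale by (auto simp: nz_def)

lemma inZ_cong: "(\<And>j. j < 3 \<Longrightarrow> y j = y' j) \<Longrightarrow> inZ y \<longleftrightarrow> inZ y'"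
proof -
  assume e: "\<And>j. j < 3 \<Longrightarrow> y j = y' j"
  have "tr w y x = tr w y' x" for w x unfolding tri_def by (intro sum.cong refl) (simp add: e)
  moreover have "nz 3 y \<longleftrightarrow> nz 3 y'" using e by (auto simp: nz_def)
  ultimately show ?thesis unfolding inZ_def by simp
qed

text \<open>Every point is represented in one of the three charts by coordinates of modulus at most one.\<close>

lemma finite_representatives:
  "\<exists>S. finite S \<and> (\<forall>y\<in>S. nz 3 y) \<and> (\<forall>y. inZ y \<longrightarrow> (\<exists>y'\<in>S. \<exists>a. a \<noteq> 0 \<and> (\<forall>j<3. y j = a * y' j)))"
proof -
  \<comment> \<open>The transposition of \<open>p\<close> and 2, with \<open>G\<close> its
    permutation matrix: it moves the chart y_p \<noteq> 0 to the chart of \<open>pt\<close>. Below,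
    p is an index at which y has maximal modulus.\<close>
  define \<pi> :: "nat \<Rightarrow> nat \<Rightarrow> nat" where "\<pi> p j = (if j = p then 2 else if j = 2 then p else j)" for p j
  define G :: "nat \<Rightarrow> nat \<Rightarrow> nat \<Rightarrow> complex" where "G p j' j = (if j = \<pi> p j' then 1 else 0)" for p j' j
  have \<pi>3: "\<pi> p j < 3" if "p < 3" "j < 3" for p j using that by (auto simp: \<pi>_def)
  have \<pi>\<pi>: "\<pi> p (\<pi> p j) = j" for p j by (auto simp: \<pi>_def)
  have Gy: "(\<Sum>j<3. G p j' j * y j) = y (\<pi> p j')" if "p < 3" "j' < 3" for p j' y
    by (subst sum_only[OF \<pi>3[OF that]]) (auto simp: G_def)
  have detG: "det (mat 3 3 (\<lambda>(i,j). G p i j)) \<noteq> 0" if p: "p < 3" for p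
  proof
    assume "det (mat 3 3 (\<lambda>(i,j). G p i j)) = 0"
    then obtain y where y: "nz 3 y" "\<forall>i<3. (\<Sum>j<3. G p i j * y j) = 0" unfolding square_kernel by blast
    obtain j where j: "j < 3" "y j \<noteq> 0" using y(1) by (rule nzE)
    show False using y(2)[rule_format, OF \<pi>3[OF p j(1)]] Gy[OF p \<pi>3[OF p j(1)], of y] j(2) by (simp add: \<pi>\<pi>)
  qed
  define C where "C p = {s. smooth_tensor.inZ k (tsubst (G p) \<alpha>) (pt (fst s) (snd s)) \<and> cmod (fst s) \<le> 1 \<and> cmod (snd s) \<le> 1}" for p
  define S where "S = (\<Union>p<3. (\<lambda>s j. pt (fst s) (snd s) (\<pi> p j)) ` C p)"
  have "finite (C p)" if "p < 3" for p
    unfolding C_def by (rule smooth_tensor.finite_chart[OF smooth_tensor_tsubst(1)[OF detG[OF that]]])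
  then have "finite S" unfolding S_def by auto
  moreover have "\<forall>y\<in>S. nz 3 y"
  proof
    fix y assume "y \<in> S"
    then obtain p s where p: "p < 3" "y = (\<lambda>j. pt (fst s) (snd s) (\<pi> p j))" unfolding S_def by auto
    show "nz 3 y" by (rule nzI[of p]) (use p in \<open>simp_all add: \<pi>_def pt_def\<close>)
  qed
  moreover have "\<forall>y. inZ y \<longrightarrow> (\<exists>y'\<in>S. \<exists>a. a \<noteq> 0 \<and> (\<forall>j<3. y j = a * y' j))"
  proof (intro allI impI)
    fix y assume Z: "inZ y"
    obtain p where p: "p < 3" "\<forall>j<3. cmod (y j) \<le> cmod (y p)"
    proof -
      have fin: "finite ((\<lambda>j. cmod (y j)) ` {..<3::nat})" "(\<lambda>j. cmod (y j)) ` {..<3::nat} \<noteq> {}"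
        unfolding lessThan_3 by auto
      obtain p where p: "p \<in> {..<3}" "Max ((\<lambda>j. cmod (y j)) ` {..<3::nat}) = cmod (y p)" using Max_in[OF fin] by (rule imageE)
      have "cmod (y j) \<le> cmod (y p)" if "j < 3" for j
        unfolding p(2)[symmetric] by (rule Max_ge[OF fin(1)]) (use that in simp)
      then show thesis using that[of p] p(1) by simp
    qed
    obtain j where "j < 3" "y j \<noteq> 0" using Z unfolding inZ_def by (auto elim: nzE)
    then have yp: "y p \<noteq> 0" using p(2) by fastforce
    define s where "s = (y (\<pi> p 0) / y p, y (\<pi> p 1) / y p)"
    have pts: "y p * pt (fst s) (snd s) j = y (\<pi> p j)" if "j < 3" for j
    proof -
      have "\<forall>j<3. y p * pt (fst s) (snd s) j = y (\<pi> p j)" unfolding all_lessThan_3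
        using yp by (simp add: s_def pt_def) (simp add: \<pi>_def)
      then show ?thesis using that by blast
    qed
    have "inZ (\<lambda>j'. \<Sum>j<3. G p j' j * pt (fst s) (snd s) j)"
    proof -
      have "inZ (\<lambda>j. y p * (\<Sum>j'<3. G p j j' * pt (fst s) (snd s) j'))"
      proof (subst inZ_cong[of _ y])
        fix j :: nat assume j: "j < 3"
        show "y p * (\<Sum>j'<3. G p j j' * pt (fst s) (snd s) j') = y j"
          unfolding Gy[OF p(1) j] pts[OF \<pi>3[OF p(1) j]] \<pi>\<pi> ..
      qed (rule Z)
      then show ?thesis unfolding inZ_scale[OF yp] .
    qed
    then have "smooth_tensor.inZ k (tsubst (G p) \<alpha>) (pt (fst s) (snd s))"
      unfolding smooth_tensor_tsubst(2)[OF detG[OF p(1)]] .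
    moreover have "cmod (fst s) \<le> 1" "cmod (snd s) \<le> 1"
      using p(2) \<pi>3[OF p(1), of 0] \<pi>3[OF p(1), of 1] yp by (simp_all add: s_def norm_divide divide_le_eq_1)
    ultimately have "s \<in> C p" by (simp add: C_def)
    then have "(\<lambda>j. pt (fst s) (snd s) (\<pi> p j)) \<in> S" using p(1) unfolding S_def by blast
    moreover have "\<forall>j<3. y j = y p * pt (fst s) (snd s) (\<pi> p j)"
    proof (intro allI impI)
      fix j :: nat assume "j < 3"
      show "y j = y p * pt (fst s) (snd s) (\<pi> p j)" unfolding pts[OF \<pi>3[OF p(1) \<open>j < 3\<close>]] \<pi>\<pi> ..
    qed
    ultimately show "\<exists>y'\<in>S. \<exists>a. a \<noteq> 0 \<and> (\<forall>j<3. y j = a * y' j)" using yp by (intro bexI exI[of _ "y p"] conjI)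
  qed
  ultimately show ?thesis by (intro exI[of _ S]) simp
qed

text \<open>Any point lies on at most two of the lines y_2 + \<tau> y_1 + \<tau>^2 y_0 = 0, so all
  but finitely many \<tau> miss the finite locus. \<open>G\<close> carries the line y_2 = 0 to such
  a line.\<close>

lemma line_free_coordinates:
  "\<exists>G. det (mat 3 3 (\<lambda>(i,j). G i j)) \<noteq> 0 \<and> line_free k (tsubst G \<alpha>)"
proof -
  obtain S where S: "finite S" "\<forall>y\<in>S. nz 3 y" "\<forall>y. inZ y \<longrightarrow> (\<exists>y'\<in>S. \<exists>a. a \<noteq> 0 \<and> (\<forall>j<3. y j = a * y' j))"
    using finite_representatives by blast
  have "finite (\<Union>y\<in>S. {\<tau>. poly [:y 2, y 1, y 0:] \<tau> = 0})"
  proof (intro finite_UN_I S(1) poly_roots_finite)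
    fix y assume "y \<in> S"
    then have "nz 3 y" using S(2) by blast
    then show "[:y 2, y 1, y 0:] \<noteq> 0" using all_lessThan_3[of "\<lambda>j. y j = 0"] by (auto simp: nz_def)
  qed
  from ex_new_if_finite[OF infinite_UNIV_char_0 this]
  obtain \<tau> where \<tau>: "\<forall>y\<in>S. poly [:y 2, y 1, y 0:] \<tau> \<noteq> 0" by blast
  define G :: "nat \<Rightarrow> nat \<Rightarrow> complex" where
    "G j' j = (if j' = j then 1 else if j' = 2 then (if j = 1 then - \<tau> else - (\<tau>\<^sup>2)) else 0)" for j' j
  have Gy: "(\<Sum>j<3. G 0 j * y j) = y 0" "(\<Sum>j<3. G 1 j * y j) = y 1" "(\<Sum>j<3. G 2 j * y j) = y 2 - \<tau> * y 1 - \<tau>\<^sup>2 * y 0" for y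
    unfolding sum_lessThan_3 by (simp_all add: G_def)
  have detG: "det (mat 3 3 (\<lambda>(i,j). G i j)) \<noteq> 0"
  proof
    assume "det (mat 3 3 (\<lambda>(i,j). G i j)) = 0"
    then obtain y where y: "nz 3 y" "\<forall>i<3. (\<Sum>j<3. G i j * y j) = 0" unfolding square_kernel by blast
    then have "\<forall>j<3. y j = 0" unfolding all_lessThan_3 Gy by auto
    then show False using y(1) by (auto simp: nz_def)
  qed
  interpret S: smooth_tensor k "tsubst G \<alpha>" by (rule smooth_tensor_tsubst(1)[OF detG])
  have "line_free k (tsubst G \<alpha>)"
  proof
    fix y w :: "nat \<Rightarrow> complex" assume y: "nz 3 y" "y 2 = 0" "nz k w"
    show "\<exists>x. S.tr w y x \<noteq> 0"
    proof (rule ccontr)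
      assume "\<not> ?thesis"
      then have "S.inZ y" using y unfolding S.inZ_def by blast
      then have "inZ (\<lambda>j'. \<Sum>j<3. G j' j * y j)" unfolding smooth_tensor_tsubst(2)[OF detG] .
      then obtain y' a where y': "y' \<in> S" "a \<noteq> 0" "\<forall>j<3. (\<Sum>i<3. G j i * y i) = a * y' j" using S(3) by blast
      have **: "y 0 = a * y' 0 \<and> y 1 = a * y' 1 \<and> 0 - \<tau> * y 1 - \<tau>\<^sup>2 * y 0 = a * y' 2"
        using y'(3) unfolding all_lessThan_3 Gy y(2) .
      note * = conjunct1[OF **] conjunct1[OF conjunct2[OF **]] conjunct2[OF conjunct2[OF **]]
      have "a * poly [:y' 2, y' 1, y' 0:] \<tau> = a * y' 2 + \<tau> * (a * y' 1) + \<tau>\<^sup>2 * (a * y' 0)"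
        by (simp add: algebra_simps power2_eq_square)
      also have "\<dots> = 0" unfolding *[symmetric] by simp
      finally show False using \<tau> y'(1,2) by simp
    qed
  qed
  then show ?thesis using detG by blast
qed

end

section \<open>Resolution and linear system\<close>

text \<open>Along the ray through \<open>v\<close> the polynomial becomes univariate in t, with the
  values of its components as coefficients, and has infinitely many zeros.\<close>

lemma hc_eval_zero:
  assumes f: "f \<in> polys n" and v: "dim_vec v > n" and z: "\<And>t. t \<noteq> 0 \<Longrightarrow> poly_eval f (t \<cdot>\<^sub>v v) = 0"
  shows "poly_eval (hc d f) v = 0"
proof -
  obtain D0 where D0: "\<forall>D'\<ge>D0. f = (\<Sum>e\<le>D'. hc e f)" using sum_hc[of f] by (rule exE)
  define D where "D = max D0 d"
  have fD: "f = (\<Sum>e\<le>D. hc e f)" using D0 unfolding D_def by (rule allE[of _ "max D0 d"]) simp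
  define p where "p = (\<Sum>e\<le>D. monom (poly_eval (hc e f) v) e)"
  have "poly p t = 0" if t: "t \<noteq> 0" for t
  proof -
    have "poly p t = (\<Sum>e\<le>D. poly_eval (hc e f) (t \<cdot>\<^sub>v v))"
      unfolding p_def poly_sum by (intro sum.cong refl) (simp add: poly_monom forms_eval_smult[OF hc_forms[OF f] v])
    also have "\<dots> = poly_eval (\<Sum>e\<le>D. hc e f) (t \<cdot>\<^sub>v v)" unfolding ev.hom_sum ..
    finally show ?thesis using z[OF t] fD by simp
  qed
  then have "UNIV - {0} \<subseteq> {t. poly p t = 0}" by auto
  moreover have "infinite (UNIV - {0::complex})" using infinite_UNIV_char_0 by (rule Diff_infinite_finite[rotated]) simp
  ultimately have "infinite {t. poly p t = 0}" by (metis finite_subset)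
  then have "p = 0" using poly_roots_finite[of p] by blast
  then have "coeff p d = 0" by simp
  then show ?thesis unfolding p_def coeff_sum_monom by (simp add: D_def)
qed

context line_free begin

lemma normalize:
  assumes "inZ y"
  shows "y 2 \<noteq> 0" "(y 0 / y 2, y 1 / y 2) \<in> Zpts" "\<And>j. j < 3 \<Longrightarrow> y 2 * pt (y 0 / y 2) (y 1 / y 2) j = y j"
proof -
  obtain w where w: "nz 3 y" "nz k w" "\<forall>x. tr w y x = 0" using assms unfolding inZ_def by blast
  show y2: "y 2 \<noteq> 0" using lf[OF w(1) _ w(2)] w(3) by blast
  have "\<forall>j<3. y 2 * pt (y 0 / y 2) (y 1 / y 2) j = y j" unfolding all_lessThan_3 using y2 by (simp add: pt_def)
  then show e: "y 2 * pt (y 0 / y 2) (y 1 / y 2) j = y j" if "j < 3" for j using that by blast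
  have "inZ (\<lambda>j. y 2 * pt (y 0 / y 2) (y 1 / y 2) j)" using inZ_cong[OF e] assms by simp
  then show "(y 0 / y 2, y 1 / y 2) \<in> Zpts" unfolding inZ_scale[OF y2] Zpts_def by simp
qed

definition reps :: "complex vec set" where "reps = (\<lambda>s. vec 3 (pt (fst s) (snd s))) ` Zpts"

lemma reps:
  "reps \<subseteq> proj_space 2" "card reps = card (exps (k - 1))" "pairwise (\<lambda>v w. \<not> same_point v w) reps"
proof -
  have p2: "vec 3 (pt a b) $ 2 = 1" "vec 3 (pt a b) $ 0 = a" "vec 3 (pt a b) $ 1 = b" for a b by (simp_all add: pt_def)
  show "reps \<subseteq> proj_space 2"
  proof
    fix v assume "v \<in> reps"
    then obtain a b where v: "v = vec 3 (pt a b)" unfolding reps_def by auto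
    have "v $ 2 = 1" unfolding v by (rule p2(1))
    then have "v \<noteq> 0\<^sub>v 3" by auto
    then show "v \<in> proj_space 2" by (simp add: proj_space_def v)
  qed
  have "inj_on (\<lambda>s. vec 3 (pt (fst s) (snd s))) Zpts"
    by (rule inj_onI) (metis p2(2,3) prod_eqI)
  then show "card reps = card (exps (k - 1))" unfolding reps_def card_Zpts[symmetric] by (rule card_image)
  show "pairwise (\<lambda>v w. \<not> same_point v w) reps"
    unfolding pairwise_def
  proof (intro ballI impI notI)
    fix v w assume a: "v \<in> reps" "w \<in> reps" "v \<noteq> w" "same_point v w"
    obtain a b where v: "v = vec 3 (pt a b)" using a(1) unfolding reps_def by auto
    obtain a' b' where w: "w = vec 3 (pt a' b')" using a(2) unfolding reps_def by auto
    obtain c where c: "w = c \<cdot>\<^sub>v v" using a(4) unfolding same_point_def by blast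
    have "w $ 2 = c * v $ 2" unfolding c by (simp add: v)
    then have "c = 1" unfolding v w p2 by simp
    then show False using c a(3) by (simp add: v)
  qed
qed

lemma point_set_reps: "v \<in> point_set reps \<longleftrightarrow> v \<in> proj_space 2 \<and> inZ (\<lambda>j. v $ j)"
proof
  assume "v \<in> point_set reps"
  then obtain a b c where s: "(a,b) \<in> Zpts" "c \<noteq> 0" "v = c \<cdot>\<^sub>v vec 3 (pt a b)"
    unfolding point_set_def reps_def same_point_def by auto
  have "v $ 2 = c" unfolding s(3) by (simp add: pt_def)
  then have "v \<noteq> 0\<^sub>v 3" using s(2) by auto
  moreover have "v \<in> carrier_vec 3" unfolding s(3) by simp
  moreover have "inZ (\<lambda>j. v $ j)"
  proof (subst inZ_cong[of _ "\<lambda>j. c * pt a b j"])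
    show "inZ (\<lambda>j. c * pt a b j)" unfolding inZ_scale[OF s(2)] using s(1) by (simp add: Zpts_def)
  qed (simp add: s(3))
  ultimately show "v \<in> proj_space 2 \<and> inZ (\<lambda>j. v $ j)" by (simp add: proj_space_def)
next
  assume a: "v \<in> proj_space 2 \<and> inZ (\<lambda>j. v $ j)"
  note n = normalize[OF conjunct2[OF a]]
  have "v = v $ 2 \<cdot>\<^sub>v vec 3 (pt (v $ 0 / v $ 2) (v $ 1 / v $ 2))"
    by (rule eq_vecI) (use a n(3) in \<open>auto simp: proj_space_def\<close>)
  then have "same_point (vec 3 (pt (v $ 0 / v $ 2) (v $ 1 / v $ 2))) v" unfolding same_point_def using n(1) by blast
  moreover have "vec 3 (pt (v $ 0 / v $ 2) (v $ 1 / v $ 2)) \<in> reps" unfolding reps_def using n(2) by force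
  ultimately show "v \<in> point_set reps" unfolding point_set_def by blast
qed

lemma inI_vanishes: "inI f \<Longrightarrow> v \<in> point_set reps \<Longrightarrow> poly_eval f v = 0"
proof -
  assume f: "inI f" and "v \<in> point_set reps"
  then have "\<exists>w. nz k w \<and> (\<forall>x. tr w (\<lambda>j. v $ j) x = 0)" unfolding point_set_reps inZ_def by blast
  then have q: "\<forall>l<k+1. poly_eval (q l) v = 0" unfolding q_zero_iff .
  obtain c where "f = (\<Sum>l<k+1. c l * q l)" using f unfolding inI_def by blast
  then show ?thesis using q by (simp add: ev.hom_sum ev.hom_mult)
qed

text \<open>The point set is a cone, so all homogeneous components of \<open>f\<close> vanish on it
  and \<open>radical\<close> applies to each.\<close>

lemma vanishing_point_set: "f \<in> polys 2 \<Longrightarrow> f \<in> vanishing_ideal 2 (point_set reps) \<longleftrightarrow> inI f"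
proof
  assume fp: "f \<in> polys 2" and f: "f \<in> vanishing_ideal 2 (point_set reps)"
  obtain D where D: "\<forall>D'\<ge>D. f = (\<Sum>d\<le>D'. hc d f)" using sum_hc[of f] by (rule exE)
  have "inI (hc d f)" for d
  proof (rule radical[OF hc_forms[OF fp]])
    fix a b assume Z: "inZ (pt a b)"
    show "poly_eval (hc d f) (vec 3 (pt a b)) = 0"
    proof (rule hc_eval_zero[OF fp])
      fix t :: complex assume t: "t \<noteq> 0"
      have "t \<cdot>\<^sub>v vec 3 (pt a b) \<in> point_set reps"
        unfolding point_set_def reps_def same_point_def Zpts_def using Z t by force
      then show "poly_eval f (t \<cdot>\<^sub>v vec 3 (pt a b)) = 0" using f unfolding vanishing_ideal_def by blast
    qed simp
  qed
  then have "(\<Sum>d\<le>D. hc d f) \<in> {f. inI f}" by (intro pideal_sum[OF pideal_inI]) simp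
  moreover have "f = (\<Sum>d\<le>D. hc d f)" using D by (rule allE[of _ D]) simp
  ultimately show "inI f" by simp
next
  assume "f \<in> polys 2" "inI f"
  then show "f \<in> vanishing_ideal 2 (point_set reps)" using inI_vanishes unfolding vanishing_ideal_def by blast
qed

definition qv :: "cpoly vec" where "qv = vec (k + 1) q"
definition Nm :: "cpoly mat" where "Nm = mat (k + 1) k (\<lambda>(l,i). N l i)"

lemma dot_q: "v \<bullet> qv = (\<Sum>l<k+1. v $ l * q l)"
  unfolding scalar_prod_def qv_def by (simp add: lessThan_atLeast0)

lemma Nm_mult: "w \<in> carrier_vec k \<Longrightarrow> l < k + 1 \<Longrightarrow> (Nm *\<^sub>v w) $ l = (\<Sum>i<k. N l i * w $ i)"
  by (simp add: Nm_def scalar_prod_def lessThan_atLeast0)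

lemma q_not_all_zero: "\<exists>l<k+1. q l \<noteq> 0"
proof (rule ccontr)
  assume "\<not> ?thesis"
  then have "\<forall>l<k+1. poly_eval (q l) (vec 3 (ue 0)) = 0" by simp
  then obtain w where w: "nz k w" "\<forall>x. tr w (\<lambda>j. vec 3 (ue 0) $ j) x = 0" unfolding q_zero_iff by blast
  have "tr w (\<lambda>j. vec 3 (ue 0) $ j) x = tr w (ue 0) x" for x
    unfolding tri_def by (intro sum.cong refl) simp
  then have "\<forall>x. tr w (ue 0) x = 0" using w(2) by simp
  moreover have "nz 3 (ue 0)" "ue 0 2 = 0" by (auto simp: ue_def intro!: nzI[of 0])
  ultimately show False using lf[of "ue 0" w] w(1) by blast
qed

text \<open>Some minor \<open>q l0\<close> is nonzero. Bordering by a unit column turns it into a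
  determinant, whose cofactors form a left inverse of \<open>N\<close> up to the factor
  \<open>q l0\<close>.\<close>

lemma N_injective:
  assumes "\<forall>l<k+1. (\<Sum>i<k. N l i * w i) = 0" "s < k"
  shows "w s = 0"
proof -
  obtain l0 where l0: "l0 < k + 1" "q l0 \<noteq> 0" using q_not_all_zero by blast
  let ?B = "bm k N (\<lambda>l. if l = l0 then 1 else 0)"
  have "det ?B = (\<Sum>l<k+1. (if l = l0 then 1 else 0) * q l)" unfolding det_bm q_def ..
  also have "\<dots> = q l0" by (subst sum_only[OF l0(1)]) auto
  finally have d: "det ?B = q l0" .
  have c: "(\<Sum>l<k+1. cofactor ?B l s * N l i) = (if i = s then q l0 else 0)" if i: "i < k" for i
  proof -
    have "(\<Sum>l<k+1. cofactor ?B l s * N l i) = (\<Sum>l<k+1. cofactor ?B l s * ?B $$ (l,i))"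
      by (intro sum.cong refl) (use i in \<open>simp add: bm_index\<close>)
    also have "\<dots> = (if i = s then q l0 else 0)"
      using cofactor_sum_col[OF bm_carrier, of s k i N "\<lambda>l. if l = l0 then 1 else 0"] i assms(2) unfolding d by auto
    finally show ?thesis .
  qed
  have "0 = (\<Sum>l<k+1. cofactor ?B l s * (\<Sum>i<k. N l i * w i))"
    by (rule sym, rule sum.neutral) (use assms(1) in simp)
  also have "\<dots> = (\<Sum>i<k. (\<Sum>l<k+1. cofactor ?B l s * N l i) * w i)"
    unfolding sum_distrib_left sum_distrib_right by (subst sum.swap) (simp only: mult.assoc)
  also have "\<dots> = (\<Sum>i<k. (if i = s then q l0 else 0) * w i)"
    by (intro sum.cong refl) (simp only: c lessThan_iff)
  also have "\<dots> = q l0 * w s" by (subst sum_only[OF assms(2)]) auto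
  finally show ?thesis using l0(2) by simp
qed

lemma syzygy_polys:
  assumes a: "\<forall>l<k+1. a l \<in> polys 2" and z: "(\<Sum>l<k+1. a l * q l) = 0"
  shows "\<exists>w. (\<forall>i<k. w i \<in> polys 2) \<and> (\<forall>l<k+1. a l = (\<Sum>i<k. N l i * w i))"
proof -
  have "\<forall>d. \<exists>w. (\<forall>i<k. w i \<in> polys 2) \<and> (\<forall>l<k+1. hc d (a l) = (\<Sum>i<k. N l i * w i))"
  proof
    fix d
    have f: "\<forall>l<k+1. hc d (a l) \<in> forms 2 d" using a hc_forms by blast
    have "(\<Sum>l<k+1. hc d (a l) * q l) = (\<Sum>l<k+1. hc (d + k) (q l * a l))"
      by (intro sum.cong refl) (use hc_form_mult[OF q_forms] a in \<open>simp add: mult.commute\<close>)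
    also have "\<dots> = hc (d + k) (\<Sum>l<k+1. a l * q l)" unfolding hc_sum by (simp only: mult.commute)
    also have "\<dots> = 0" unfolding z by simp
    finally have s: "(\<Sum>l<k+1. hc d (a l) * q l) = 0" .
    obtain w where w: "(\<forall>i<k. w i \<in> forms 2 (d - 1)) \<and> (\<forall>l<k+1. hc d (a l) = (\<Sum>i<k. N l i * w i)) \<and> (d = 0 \<longrightarrow> (\<forall>l<k+1. hc d (a l) = 0))"
      using syzygy[OF f s] by (rule exE)
    have wp: "\<forall>i<k. w i \<in> polys 2" using conjunct1[OF w] forms_polys by blast
    show "\<exists>w. (\<forall>i<k. w i \<in> polys 2) \<and> (\<forall>l<k+1. hc d (a l) = (\<Sum>i<k. N l i * w i))"
      by (rule exI[of _ w], rule conjI[OF wp conjunct1[OF conjunct2[OF w]]])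
  qed
  from choice[OF this] obtain W where W: "\<forall>d. (\<forall>i<k. W d i \<in> polys 2) \<and> (\<forall>l<k+1. hc d (a l) = (\<Sum>i<k. N l i * W d i))" by (rule exE)
  have "\<forall>l. \<exists>D. \<forall>D'\<ge>D. a l = (\<Sum>d\<le>D'. hc d (a l))" by (intro allI sum_hc)
  from choice[OF this] obtain D where D: "\<forall>l. \<forall>D'\<ge>D l. a l = (\<Sum>d\<le>D'. hc d (a l))" by (rule exE)
  define E where "E = (\<Sum>l<k+1. D l)"
  have aE: "a l = (\<Sum>d\<le>E. hc d (a l))" if "l < k + 1" for l
  proof -
    have "D l \<le> E" unfolding E_def by (rule member_le_sum) (use that in auto)
    then show ?thesis using D by blast
  qed
  show ?thesis
  proof (intro exI[of _ "\<lambda>i. \<Sum>d\<le>E. W d i"] conjI allI impI)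
    fix i assume "i < k"
    then show "(\<Sum>d\<le>E. W d i) \<in> polys 2" using W by (intro polys_sum) blast
  next
    fix l assume l: "l < k + 1"
    have "(\<Sum>i<k. N l i * (\<Sum>d\<le>E. W d i)) = (\<Sum>d\<le>E. \<Sum>i<k. N l i * W d i)"
      unfolding sum_distrib_left by (rule sum.swap)
    also have "\<dots> = (\<Sum>d\<le>E. hc d (a l))" by (intro sum.cong refl) (use W l in simp)
    finally show "a l = (\<Sum>i<k. N l i * (\<Sum>d\<le>E. W d i))" using aE[OF l] by simp
  qed
qed

text \<open>Exactness holds even for polynomials, so the exponent 0 serves in one direction. In the
  other a power of a variable is cancelled, because there are no zero divisors and because x_2 is
  nonzero at all the points.\<close>

lemma linear_resolution_point_set: "linear_resolution 2 k (k + 1) k (point_set reps)"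
  unfolding linear_resolution_def
proof (rule exI[of _ qv], rule exI[of _ Nm], intro conjI allI impI ballI)
  show "qv \<in> carrier_vec (k+1)" by (simp add: qv_def)
  show "Nm \<in> carrier_mat (k+1) k" by (simp add: Nm_def)
  show "qv $ l \<in> forms 2 k" if "l < k + 1" for l using q_forms[OF that] that by (simp add: qv_def)
  show "Nm $$ (l,i) \<in> forms 2 1" if "l < k + 1" "i < k" for l i using N_forms that by (simp add: Nm_def)
next
  fix w assume w: "w \<in> poly_vecs 2 k" "Nm *\<^sub>v w = 0\<^sub>v (k+1)"
  have wc: "w \<in> carrier_vec k" using w(1) by simp
  have "(\<Sum>i<k. N l i * w $ i) = 0" if l: "l < k + 1" for l
    using Nm_mult[OF wc l] l unfolding w(2) by simp
  then have "w $ s = 0" if "s < k" for s using N_injective[of "\<lambda>i. w $ i"] that by blast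
  then show "w = 0\<^sub>v k" using wc by (intro eq_vecI) auto
next
  fix v assume v: "v \<in> poly_vecs 2 (k+1)"
  show "v \<bullet> qv = 0 \<longleftrightarrow> (\<exists>e. \<forall>i\<le>2. \<exists>w\<in>poly_vecs 2 k. Var i ^ e \<cdot>\<^sub>v v = Nm *\<^sub>v w)"
  proof
    assume "v \<bullet> qv = 0"
    then have "(\<Sum>l<k+1. v $ l * q l) = 0" unfolding dot_q .
    from syzygy_polys[OF _ this] v
    obtain w where w: "(\<forall>i<k. w i \<in> polys 2) \<and> (\<forall>l<k+1. v $ l = (\<Sum>i<k. N l i * w i))" by auto
    have wp: "vec k w \<in> poly_vecs 2 k" using w by simp
    have ve: "v = Nm *\<^sub>v vec k w"
    proof (rule eq_vecI)
      show "dim_vec v = dim_vec (Nm *\<^sub>v vec k w)" using v by (simp add: Nm_def)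
      fix l assume "l < dim_vec (Nm *\<^sub>v vec k w)"
      then have l: "l < k + 1" by (simp add: Nm_def)
      show "v $ l = (Nm *\<^sub>v vec k w) $ l" unfolding Nm_mult[OF vec_carrier l] using w l by simp
    qed
    have "\<forall>i\<le>2. \<exists>w\<in>poly_vecs 2 k. Var i ^ 0 \<cdot>\<^sub>v v = Nm *\<^sub>v w"
      by (intro allI impI, rule bexI[OF _ wp]) (simp only: power_0 one_smult_vec ve[symmetric])
    then show "\<exists>e. \<forall>i\<le>2. \<exists>w\<in>poly_vecs 2 k. Var i ^ e \<cdot>\<^sub>v v = Nm *\<^sub>v w" by (rule exI[of _ 0])
  next
    assume "\<exists>e. \<forall>i\<le>2. \<exists>w\<in>poly_vecs 2 k. Var i ^ e \<cdot>\<^sub>v v = Nm *\<^sub>v w"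
    then obtain e where H: "\<forall>i\<le>2. \<exists>w\<in>poly_vecs 2 k. Var i ^ e \<cdot>\<^sub>v v = Nm *\<^sub>v w" by (rule exE)
    obtain w where w: "w \<in> poly_vecs 2 k" "Var 0 ^ e \<cdot>\<^sub>v v = Nm *\<^sub>v w"
      using H[rule_format, of 0, OF zero_le] by (rule bexE)
    have vc: "v \<in> carrier_vec (k+1)" and wc: "w \<in> carrier_vec k" using v w(1) by auto
    have e: "Var 0 ^ e * v $ l = (\<Sum>i<k. N l i * w $ i)" if l: "l < k + 1" for l
      unfolding Nm_mult[OF wc l, symmetric] w(2)[symmetric] using l vc by simp
    have "Var 0 ^ e * (\<Sum>l<k+1. v $ l * q l) = (\<Sum>l<k+1. (\<Sum>i<k. N l i * w $ i) * q l)"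
      unfolding sum_distrib_left by (intro sum.cong refl) (simp add: e mult.assoc[symmetric])
    also have "\<dots> = 0" by (rule N_w_q)
    finally show "v \<bullet> qv = 0" unfolding dot_q using Var_nonzero[of 0] by simp
  qed
next
  fix f assume f: "f \<in> polys 2"
  show "f \<in> vanishing_ideal 2 (point_set reps) \<longleftrightarrow> (\<exists>e. \<forall>i\<le>2. \<exists>v\<in>poly_vecs 2 (k+1). Var i ^ e * f = v \<bullet> qv)"
  proof
    assume "f \<in> vanishing_ideal 2 (point_set reps)"
    then have "inI f" using vanishing_point_set[OF f] by blast
    then obtain a where a: "\<forall>l<k+1. a l \<in> polys 2" "f = (\<Sum>l<k+1. a l * q l)" unfolding inI_def by blast
    have fe: "f = vec (k+1) a \<bullet> qv" unfolding dot_q a(2) by (intro sum.cong refl) simp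
    have ap: "vec (k+1) a \<in> poly_vecs 2 (k+1)" using a(1) by simp
    have "\<forall>i\<le>2. \<exists>v\<in>poly_vecs 2 (k+1). Var i ^ 0 * f = v \<bullet> qv"
      by (intro allI impI, rule bexI[OF _ ap]) (simp only: power_0 mult_1 fe[symmetric])
    then show "\<exists>e. \<forall>i\<le>2. \<exists>v\<in>poly_vecs 2 (k+1). Var i ^ e * f = v \<bullet> qv" by (rule exI[of _ 0])
  next
    assume "\<exists>e. \<forall>i\<le>2. \<exists>v\<in>poly_vecs 2 (k+1). Var i ^ e * f = v \<bullet> qv"
    then obtain e where H: "\<forall>i\<le>2. \<exists>v\<in>poly_vecs 2 (k+1). Var i ^ e * f = v \<bullet> qv" by (rule exE)
    obtain v where v: "v \<in> poly_vecs 2 (k+1)" "Var 2 ^ e * f = v \<bullet> qv"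
      using H[rule_format, of 2, OF order_refl] by (rule bexE)
    have I: "inI (Var 2 ^ e * f)" unfolding v(2) dot_q by (rule inI_combination) (use v(1) in simp)
    have "poly_eval f u = 0" if u: "u \<in> point_set reps" for u
    proof -
      have "u $ 2 \<noteq> 0" using u normalize(1) unfolding point_set_reps by blast
      moreover have "poly_eval (Var 2 ^ e * f) u = 0" by (rule inI_vanishes[OF I u])
      ultimately show ?thesis by (simp add: ev.hom_mult ev.hom_power)
    qed
    then show "f \<in> vanishing_ideal 2 (point_set reps)" using f unfolding vanishing_ideal_def by blast
  qed
qed

text \<open>Forms of degree k in the ideal are combinations with constant coefficients, and these
  are unique because there are no syzygies in degree 0.\<close>

lemma linear_system_basis_point_set: "linear_system_basis 2 k (k + 1) (point_set reps) qv"
  unfolding linear_system_basis_def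
proof (intro conjI allI impI ballI)
  show "qv \<in> carrier_vec (k+1)" by (simp add: qv_def)
  show "qv $ l \<in> forms 2 k \<inter> vanishing_ideal 2 (point_set reps)" if l: "l < k + 1" for l
    using q_forms[OF l] vanishing_point_set[OF forms_polys[OF q_forms[OF l]]] q_inI[OF l] l by (simp add: qv_def)
  fix f assume f: "f \<in> forms 2 k \<inter> vanishing_ideal 2 (point_set reps)"
  then have ff: "f \<in> forms 2 k" by blast
  have "inI f" using f vanishing_point_set[OF forms_polys[OF ff]] by blast
  from inI_homogeneous[OF this ff] obtain a where a: "\<forall>l<k+1. a l \<in> forms 2 0" "f = (\<Sum>l<k+1. a l * q l)" by auto
  have "\<forall>l. \<exists>s. l < k + 1 \<longrightarrow> a l = Const s" using a(1) forms_degree_0 by blast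
  from choice[OF this] obtain s where s: "\<forall>l. l < k + 1 \<longrightarrow> a l = Const (s l)" by (rule exE)
  have dot: "map_vec Const u \<bullet> qv = (\<Sum>l<k+1. Const (u $ l) * q l)" if "u \<in> carrier_vec (k+1)" for u
    unfolding dot_q by (intro sum.cong refl) (use that in simp)
  show "\<exists>!s. s \<in> carrier_vec (k+1) \<and> f = map_vec Const s \<bullet> qv"
  proof (rule ex1I[of _ "vec (k+1) s"], rule conjI)
    show "f = map_vec Const (vec (k+1) s) \<bullet> qv"
      unfolding dot[OF vec_carrier] a(2) by (intro sum.cong refl) (use s in simp)
  next
    fix u assume u: "u \<in> carrier_vec (k+1) \<and> f = map_vec Const u \<bullet> qv"
    have "(\<Sum>l<k+1. (Const (u $ l) - a l) * q l) = 0"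
      unfolding left_diff_distrib sum_subtractf a(2)[symmetric] using u dot[of u] by simp
    moreover have "\<forall>l<k+1. Const (u $ l) - a l \<in> forms 2 0" using a(1) by simp
    ultimately have "\<forall>l<k+1. Const (u $ l) - a l = 0" using syzygy[of "\<lambda>l. Const (u $ l) - a l" 0] by blast
    then have "u $ l = s l" if "l < k + 1" for l
      using s that Const_eq_0_iff[of "u $ l - s l"] by (simp add: Const.hom_minus)
    then show "u = vec (k+1) s" using u by (intro eq_vecI) auto
  qed simp
qed

end

section \<open>The blow-up as an incidence variety\<close>

lemma poly_subst:
  assumes "f \<in> polys n" "\<And>i. i \<le> n \<Longrightarrow> u $ i = poly (\<phi> i) t"
  shows "poly (subst (\<lambda>c. [:c:]) \<phi> f) t = poly_eval f u"
  using assms(1)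
proof (induction rule: polys_induct)
  case (Const a)
  show ?case unfolding subst_Const[OF comm_ring_hom_const_poly] by simp
next
  case (Var i)
  show ?case unfolding subst_Var[OF comm_ring_hom_const_poly] using assms(2)[OF Var] by simp
next
  case (add f g)
  show ?case unfolding subst_add[OF comm_ring_hom_const_poly] ev.hom_add poly_add add(3,4) ..
next
  case (mult f g)
  show ?case unfolding subst_mult[OF comm_ring_hom_const_poly] ev.hom_mult poly_mult mult(3,4) ..
qed

lemma poly_cofinite_zero:
  fixes p :: "complex poly"
  assumes "finite S" "\<And>t. t \<notin> S \<Longrightarrow> poly p t = 0"
  shows "p = 0"
proof (rule ccontr)
  assume "p \<noteq> 0"
  then have "finite {t. poly p t = 0}" by (rule poly_roots_finite)
  moreover have "UNIV - S \<subseteq> {t. poly p t = 0}" using assms(2) by blast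
  ultimately have "finite (UNIV - S)" by (rule finite_subset[rotated])
  then have "finite (UNIV :: complex set)" using assms(1) by (metis finite_Diff2)
  then show False using infinite_UNIV_char_0 by blast
qed

text \<open>The common power of t is extracted so that the remaining vector is nonzero at t = 0;
  this extends the rational map along a curve through a base point.\<close>

lemma vec_order:
  fixes Q :: "nat \<Rightarrow> complex poly"
  assumes "l0 < n" "Q l0 \<noteq> 0"
  shows "\<exists>m xt. (\<forall>l<n. Q l = [:0,1:] ^ m * xt l) \<and> (\<exists>l<n. poly (xt l) 0 \<noteq> 0)"
  using assms(2)
proof (induction "degree (Q l0)" arbitrary: Q rule: less_induct)
  case less
  show ?case
  proof (cases "\<exists>l<n. poly (Q l) 0 \<noteq> 0")
    case True
    then show ?thesis by (intro exI[of _ 0] exI[of _ Q]) simp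
  next
    case False
    then have "\<forall>l. \<exists>r. l < n \<longrightarrow> Q l = [:0,1:] * r" using poly_eq_0_iff_dvd[of _ 0] by (auto simp: dvd_def)
    from choice[OF this] obtain R where R: "\<forall>l. l < n \<longrightarrow> Q l = [:0,1:] * R l" by (rule exE)
    have Ql: "Q l0 = [:0,1:] * R l0" using R assms(1) by blast
    then have R0: "R l0 \<noteq> 0" using less.prems by auto
    have "degree (Q l0) = Suc (degree (R l0))" unfolding Ql using R0 by (subst degree_mult_eq) auto
    then have "degree (R l0) < degree (Q l0)" by simp
    from less.hyps[of R, OF this R0] obtain m where "\<exists>xt. (\<forall>l<n. R l = [:0,1:] ^ m * xt l) \<and> (\<exists>l<n. poly (xt l) 0 \<noteq> 0)" by (rule exE)
    then obtain xt where xt: "(\<forall>l<n. R l = [:0,1:] ^ m * xt l) \<and> (\<exists>l<n. poly (xt l) 0 \<noteq> 0)" by (rule exE)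
    have "\<forall>l<n. Q l = [:0,1:] ^ Suc m * xt l"
    proof (intro allI impI)
      fix l assume l: "l < n"
      have "Q l = [:0,1:] * ([:0,1:] ^ m * xt l)" using R conjunct1[OF xt] l by metis
      then show "Q l = [:0,1:] ^ Suc m * xt l" by (simp only: power_Suc mult.assoc)
    qed
    then show ?thesis using conjunct2[OF xt] by (rule exI[of _ "Suc m", OF exI[of _ xt, OF conjI]])
  qed
qed

text \<open>Multiplying \<open>x\<close> into the matrix bordered by \<open>p\<close> leaves only
  the last coordinate; the adjugate then compares \<open>x\<close> with the signed minors. The test
  vector \<open>p\<close> avoids a division.\<close>

lemma left_kernel_crs:
  fixes M :: "nat \<Rightarrow> nat \<Rightarrow> complex"
  assumes x: "\<And>i. i < k \<Longrightarrow> (\<Sum>l<k+1. x l * M l i) = 0" and e: "e < k + 1"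
  shows "x e * (\<Sum>l<k+1. p l * crs k M l) = (\<Sum>l<k+1. x l * p l) * crs k M e"
proof -
  let ?B = "bm k M p"
  have c: "(\<Sum>l<k+1. x l * ?B $$ (l,s)) = (if s = k then (\<Sum>l<k+1. x l * p l) else 0)" if s: "s < k + 1" for s
  proof (cases "s = k")
    case True
    then show ?thesis by (simp add: bm_index)
  next
    case False
    then have "s < k" using s by simp
    have "(\<Sum>l<k+1. x l * ?B $$ (l,s)) = (\<Sum>l<k+1. x l * M l s)"
      by (intro sum.cong refl) (use \<open>s < k\<close> in \<open>simp add: bm_index\<close>)
    then show ?thesis using x[OF \<open>s < k\<close>] False by simp
  qed
  have "x e * (\<Sum>l<k+1. p l * crs k M l) = (\<Sum>l<k+1. x l * (if l = e then det ?B else 0))"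
    unfolding det_bm[symmetric] by (subst sum_only[OF e]) auto
  also have "\<dots> = (\<Sum>l<k+1. x l * (\<Sum>s<k+1. ?B $$ (l,s) * cofactor ?B e s))"
  proof (intro sum.cong refl arg_cong2[of _ _ _ _ "(*)"])
    fix l assume "l \<in> {..<k+1}"
    then have "l < k + 1" by simp
    from cofactor_sum_row[OF bm_carrier this e, of M p]
    show "(if l = e then det ?B else 0) = (\<Sum>s<k+1. ?B $$ (l,s) * cofactor ?B e s)" by simp
  qed
  also have "\<dots> = (\<Sum>s<k+1. (\<Sum>l<k+1. x l * ?B $$ (l,s)) * cofactor ?B e s)"
    unfolding sum_distrib_left sum_distrib_right by (subst sum.swap) (simp only: mult.assoc)
  also have "\<dots> = (\<Sum>s<k+1. (if s = k then (\<Sum>l<k+1. x l * p l) else 0) * cofactor ?B e s)"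
    by (intro sum.cong refl) (simp only: c lessThan_iff)
  also have "\<dots> = (\<Sum>l<k+1. x l * p l) * cofactor ?B e k" by (subst sum_only[of k]) auto
  finally show ?thesis unfolding bm_cofactor[OF e] .
qed

lemma vec_proj: "nz n x \<Longrightarrow> vec n x \<in> carrier_vec n - {0\<^sub>v n}"
  by (auto simp: nz_def) (metis index_vec index_zero_vec(1))

lemma proj_nz: "v \<in> carrier_vec n - {0\<^sub>v n} \<Longrightarrow> nz n (\<lambda>i. v $ i)"
proof (rule ccontr)
  assume v: "v \<in> carrier_vec n - {0\<^sub>v n}" and "\<not> nz n (\<lambda>i. v $ i)"
  then have "v = 0\<^sub>v n" by (intro eq_vecI) (auto simp: nz_def)
  then show False using v by simp
qed

lemma vec_of_proj: "v \<in> carrier_vec n - {0\<^sub>v n} \<Longrightarrow> v = vec n (\<lambda>i. v $ i)"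
  by (intro eq_vecI) auto

section \<open>Curves through base points and the incidence variety\<close>

context line_free begin

definition qe :: "(nat \<Rightarrow> complex) \<Rightarrow> nat \<Rightarrow> complex" where
  "qe y l = poly_eval (q l) (vec 3 y)"

lemma tr_vec3: "tr w (\<lambda>j. vec 3 y $ j) x = tr w y x"
  unfolding tri_def by (intro sum.cong refl) simp

lemma qe_eq: "l < k + 1 \<Longrightarrow> qe y l = crs k (\<lambda>l i. poly_eval (N l i) (vec 3 y)) l"
  unfolding qe_def q_def by (rule ev.crs_hom[symmetric])

lemma qe_kernel: "tr w y (qe y) = 0"
proof -
  have "tr (ue i) y (qe y) = 0" if i: "i < k" for i
  proof -
    have "tr (ue i) y (qe y) = (\<Sum>l<k+1. qe y l * tr (ue i) y (ue l))" by (rule tri_expand(3))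
    also have "\<dots> = (\<Sum>l<k+1. poly_eval (q l) (vec 3 y) * poly_eval (N l i) (vec 3 y))"
      by (intro sum.cong refl) (simp add: qe_def N_eval[OF i] tr_vec3)
    also have "\<dots> = poly_eval (\<Sum>l<k+1. N l i * q l) (vec 3 y)" unfolding ev.hom_sum ev.hom_mult by (simp only: mult.commute)
    also have "\<dots> = 0" unfolding N_q[OF i] by simp
    finally show ?thesis .
  qed
  then have "\<forall>i<k. tr (ue i) y (qe y) = 0" by blast
  then show ?thesis unfolding tri_zero_iff(1) by blast
qed

lemma qe_zero_iff: "nz 3 y \<Longrightarrow> (\<forall>l<k+1. qe y l = 0) \<longleftrightarrow> inZ y"
  unfolding qe_def q_zero_iff tr_vec3 inZ_def by simp

lemma qe_unique:
  assumes x: "\<And>w. tr w y x = 0" and l: "l < k + 1" "qe y l \<noteq> 0"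
  shows "\<exists>a. \<forall>e<k+1. x e = a * qe y e"
proof -
  let ?M = "\<lambda>l i. poly_eval (N l i) (vec 3 y)"
  have xM: "(\<Sum>l<k+1. x l * ?M l i) = 0" if i: "i < k" for i
  proof -
    have "(\<Sum>l<k+1. x l * ?M l i) = (\<Sum>l<k+1. x l * tr (ue i) y (ue l))"
      by (intro sum.cong refl) (simp add: N_eval[OF i] tr_vec3)
    also have "\<dots> = tr (ue i) y x" by (rule tri_expand(3)[symmetric])
    finally show ?thesis using x by simp
  qed
  have "x e * (\<Sum>l<k+1. cnj (qe y l) * qe y l) = (\<Sum>l<k+1. x l * cnj (qe y l)) * qe y e" if e: "e < k + 1" for e
  proof -
    have "(\<Sum>l<k+1. cnj (qe y l) * qe y l) = (\<Sum>l<k+1. cnj (qe y l) * crs k ?M l)"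
      by (intro sum.cong refl) (simp add: qe_eq)
    then show ?thesis using left_kernel_crs[of k x ?M e "\<lambda>l. cnj (qe y l)", OF xM e] qe_eq[OF e] by simp
  qed
  moreover have "(\<Sum>l<k+1. cnj (qe y l) * qe y l) \<noteq> 0" using l by (intro sum_cnj_nonzero nzI[of l]) auto
  ultimately have "x e = ((\<Sum>l<k+1. x l * cnj (qe y l)) / (\<Sum>l<k+1. cnj (qe y l) * qe y l)) * qe y e" if "e < k + 1" for e
    using that by (simp add: nonzero_eq_divide_eq)
  then show ?thesis by blast
qed

text \<open>At a base point \<open>y\<close> the vector \<open>x\<close> is the limit of the minors along the line through \<open>y\<close> in a direction
  \<open>v\<close> with \<open>tr w v x = 0\<close>, where \<open>w\<close> spans the kernel at \<open>y\<close>.\<close>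

lemma limit_direction:
  assumes Z: "inZ y" and x: "nz (k+1) x" "\<And>w. tr w y x = 0"
  obtains v m xt \<kappa> where "\<And>t. nz 3 (\<lambda>j. y j + t * v j)" "\<kappa> \<noteq> 0"
    "\<And>t l. l < k + 1 \<Longrightarrow> qe (\<lambda>j. y j + t * v j) l = t ^ m * poly (xt l) t"
    "\<And>l. l < k + 1 \<Longrightarrow> x l = \<kappa> * poly (xt l) 0"
proof -
  obtain w where w: "nz 3 y" "nz k w" "\<And>x. tr w y x = 0" using Z unfolding inZ_def by blast
  obtain p where p: "p < 3" "y p \<noteq> 0" using w(1) by (rule nzE)
  \<comment> \<open>Two conditions on three coordinates: \<open>tr w v x = 0\<close>, and v_p = 0,
    which makes \<open>v\<close> independent of \<open>y\<close> as y_p \<noteq> 0.\<close>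
  have "card {0::nat, 1} < 3" by simp
  from kernel_nontrivial[OF _ this, of "\<lambda>e j. if e = 0 then tr w (ue j) x else if j = p then 1 else 0"]
  obtain v where v: "nz 3 v" "\<forall>e\<in>{0::nat,1}. (\<Sum>j<3. (if e = 0 then tr w (ue j) x else if j = p then 1 else 0) * v j) = 0"
    by auto
  have vx: "tr w v x = 0" unfolding tri_expand(2)[of k "k+1" \<alpha> w v x] using v(2) by (simp add: mult.commute)
  have "(\<Sum>j<3. (if j = p then 1 else 0) * v j) = 0" using v(2) by simp
  then have vp: "v p = 0" by (subst (asm) sum_only[OF p(1)]) auto
  have nzl: "nz 3 (\<lambda>j. y j + t * v j)" for t by (rule nzI[OF p(1)]) (use p(2) vp in simp)
  define Q where "Q l = subst (\<lambda>c. [:c:]) (\<lambda>i. [:y i, v i:]) (q l)" for l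
  have Qe: "poly (Q l) t = qe (\<lambda>j. y j + t * v j) l" if "l < k + 1" for l t
    unfolding Q_def qe_def by (rule poly_subst[OF forms_polys[OF q_forms[OF that]]]) simp
  \<comment> \<open>Otherwise a whole line would consist of points of the finite locus.\<close>
  have "\<exists>l<k+1. Q l \<noteq> 0"
  proof (rule ccontr)
    assume "\<not> ?thesis"
    then have "\<forall>l<k+1. qe (\<lambda>j. y j + t * v j) l = 0" for t using Qe by (metis poly_0)
    then have Zt: "inZ (\<lambda>j. y j + t * v j)" for t unfolding qe_zero_iff[OF nzl] .
    have y2: "y 2 \<noteq> 0" using normalize(1)[OF Z] .
    have v2: "v 2 = 0"
    proof (rule ccontr)
      assume "v 2 \<noteq> 0"
      then show False using normalize(1)[OF Zt[of "- (y 2 / v 2)"]] by simp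
    qed
    let ?s = "\<lambda>t. ((y 0 + t * v 0) / y 2, (y 1 + t * v 1) / y 2)"
    have "v 0 \<noteq> 0 \<or> v 1 \<noteq> 0" using v(1) v2 all_lessThan_3[of "\<lambda>j. v j = 0"] unfolding nz_def by blast
    then have inj: "inj ?s" using y2 by (intro injI) auto
    have rng: "range ?s \<subseteq> Zpts"
    proof
      fix s assume "s \<in> range ?s"
      then obtain t where s: "s = ?s t" by blast
      show "s \<in> Zpts" using normalize(2)[OF Zt[of t]] unfolding s v2 by simp
    qed
    have "finite (UNIV :: complex set)" by (rule finite_imageD[OF finite_subset[OF rng finite_Zpts] inj])
    then show False using infinite_UNIV_char_0 by blast
  qed
  then obtain l0 where l0: "l0 < k + 1" "Q l0 \<noteq> 0" by blast
  obtain m where "\<exists>xt. (\<forall>l<k+1. Q l = [:0,1:] ^ m * xt l) \<and> (\<exists>l<k+1. poly (xt l) 0 \<noteq> 0)"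
    using vec_order[of l0 "k+1" Q, OF l0] by (rule exE)
  then obtain xt where "(\<forall>l<k+1. Q l = [:0,1:] ^ m * xt l) \<and> (\<exists>l<k+1. poly (xt l) 0 \<noteq> 0)" by (rule exE)
  then have xt: "\<forall>l<k+1. Q l = [:0,1:] ^ m * xt l" "\<exists>l<k+1. poly (xt l) 0 \<noteq> 0" by (rule conjunct1, rule conjunct2)
  have qxt: "qe (\<lambda>j. y j + t * v j) l = t ^ m * poly (xt l) t" if l: "l < k + 1" for t l
    unfolding Qe[OF l, symmetric] using xt(1) l by simp
  define x0 where "x0 l = poly (xt l) 0" for l
  have n0: "nz (k+1) x0" using xt(2) unfolding nz_def x0_def .
  have ker: "tr w' y (\<lambda>l. poly (xt l) t) + t * tr w' v (\<lambda>l. poly (xt l) t) = 0" if t: "t \<noteq> 0" for w' t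
  proof -
    have "0 = tr w' (\<lambda>j. y j + t * v j) (qe (\<lambda>j. y j + t * v j))" by (rule qe_kernel[symmetric])
    also have "\<dots> = tr w' (\<lambda>j. y j + t * v j) (\<lambda>l. t ^ m * poly (xt l) t)"
      unfolding tri_def by (intro sum.cong refl) (simp add: qxt)
    also have "\<dots> = t ^ m * (tr w' y (\<lambda>l. poly (xt l) t) + t * tr w' v (\<lambda>l. poly (xt l) t))"
      unfolding tri_add tri_scale by (simp only: distrib_left mult.left_commute)
    finally show ?thesis using t by simp
  qed
  have trp: "tr w' u (\<lambda>l. poly (xt l) t) = poly (\<Sum>l<k+1. smult (tr w' u (ue l)) (xt l)) t" for w' u t
    unfolding tri_expand(3)[of k "k+1" \<alpha> w' u "\<lambda>l. poly (xt l) t"] poly_sum by (simp only: poly_smult mult.commute)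
  \<comment> \<open>The identity \<open>ker\<close> is polynomial in t and therefore holds at t = 0.
    For \<open>w\<close> itself the first term is 0 and a factor t can be cancelled, which gives
    \<open>x0v\<close>.\<close>
  have x0L: "tr w' y x0 = 0" for w'
  proof -
    let ?P = "(\<Sum>l<k+1. smult (tr w' y (ue l)) (xt l)) + [:0,1:] * (\<Sum>l<k+1. smult (tr w' v (ue l)) (xt l))"
    have "?P = 0"
      by (rule poly_cofinite_zero[of "{0}"]) (use ker[of _ w'] in \<open>simp_all add: trp\<close>)
    then have "poly ?P 0 = 0" by simp
    then show ?thesis unfolding x0_def trp by simp
  qed
  have x0v: "tr w v x0 = 0"
  proof -
    have "(\<Sum>l<k+1. smult (tr w v (ue l)) (xt l)) = 0"
    proof (rule poly_cofinite_zero[of "{0}"])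
      fix t :: complex assume "t \<notin> {0}"
      then have t: "t \<noteq> 0" by simp
      show "poly (\<Sum>l<k+1. smult (tr w v (ue l)) (xt l)) t = 0" using ker[OF t, of w] w(3) t unfolding trp[symmetric] by simp
    qed simp
    then show ?thesis unfolding x0_def trp by simp
  qed
  obtain j where j: "j < 3" "v j \<noteq> 0" using v(1) by (rule nzE)
  have jp: "j \<noteq> p" using j(2) vp by auto
  obtain r where r: "r < 3" "{..<3} = {p, j, r}" "r \<noteq> p" "r \<noteq> j"
  proof -
    obtain a b where ab: "a < 3" "b < 3" "a \<noteq> b" "a \<noteq> p" "b \<noteq> p" "{..<3} = {p,a,b}" using other_two[OF p(1)] by blast
    have "j = a \<or> j = b" using ab(6) j(1) jp by blast
    then show thesis using ab that[of a] that[of b] by (auto simp: insert_commute)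
  qed
  have s3: "(\<Sum>i<3. f i) = f p + f j + f r" for f :: "nat \<Rightarrow> complex"
    unfolding r(2) using jp r(3,4) by (simp add: add.assoc)
  \<comment> \<open>Both \<open>x\<close> and \<open>x0\<close> lie over \<open>y\<close> and are
    annihilated by \<open>w\<close> in the directions \<open>y\<close> and \<open>v\<close>. A
    combination annihilated in the third direction too must be 0 by \<open>key\<close>, so they are
    proportional. The second pair handed to \<open>dependent_pairs\<close> is (0, 0).\<close>
  have "tr w (ue r) x * 0 = tr w (ue r) x0 * (0::complex)" by simp
  from dependent_pairs[OF this]
  obtain e where "\<exists>f. (e \<noteq> 0 \<or> f \<noteq> 0) \<and> e * tr w (ue r) x + f * tr w (ue r) x0 = 0 \<and> e * 0 + f * 0 = 0" by (rule exE)
  then obtain f where f: "(e \<noteq> 0 \<or> f \<noteq> 0) \<and> e * tr w (ue r) x + f * tr w (ue r) x0 = 0 \<and> e * 0 + f * 0 = 0" by (rule exE)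
  note ef = conjunct1[OF f] conjunct1[OF conjunct2[OF f]]
  define \<xi> where "\<xi> l = e * x l + f * x0 l" for l
  have \<xi>: "tr w' y' \<xi> = e * tr w' y' x + f * tr w' y' x0" for w' y' unfolding \<xi>_def tri_add tri_scale ..
  have g: "tr w (ue r) \<xi> = 0" "tr w v \<xi> = 0" "\<And>w'. tr w' y \<xi> = 0"
    unfolding \<xi> using ef(2) vx x0v x(2) x0L by simp_all
  have gj: "tr w (ue j) \<xi> = 0"
    using g(1,2) j(2) vp unfolding tri_expand(2)[of k "k+1" \<alpha> w v] s3 by simp
  have gp: "tr w (ue p) \<xi> = 0"
    using g(1) g(3)[of w] gj p(2) unfolding tri_expand(2)[of k "k+1" \<alpha> w y] s3 by simp
  have "\<forall>i<3. tr w (ue i) \<xi> = 0"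
  proof (intro allI impI)
    fix i :: nat assume "i < 3"
    then have "i \<in> {p, j, r}" unfolding r(2)[symmetric] by simp
    then show "tr w (ue i) \<xi> = 0" using g(1) gj gp by auto
  qed
  then have all: "\<And>y'. tr w y' \<xi> = 0" unfolding tri_zero_iff(2) by blast
  have "\<not> nz (k+1) \<xi>"
  proof
    assume n: "nz (k+1) \<xi>"
    show False using key[OF n w(1,2) g(3) all] w(3) by simp
  qed
  then have z: "e * x l + f * x0 l = 0" if "l < k + 1" for l using that unfolding nz_def \<xi>_def by blast
  have e0: "e \<noteq> 0"
  proof
    assume "e = 0"
    then have "\<forall>l<k+1. x0 l = 0" using z ef(1) by simp
    then show False using n0 by (auto simp: nz_def)
  qed
  define \<kappa> where "\<kappa> = - f / e"
  have xk: "x l = \<kappa> * x0 l" if "l < k + 1" for l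
    using z[OF that] e0 by (simp add: \<kappa>_def field_simps add_eq_0_iff)
  have k0: "\<kappa> \<noteq> 0"
  proof
    assume "\<kappa> = 0"
    then have "\<forall>l<k+1. x l = 0" using xk by simp
    then show False using x(1) by (auto simp: nz_def)
  qed
  show thesis by (rule that[OF nzl k0, of m xt]) (use qxt xk in \<open>simp_all add: x0_def\<close>)
qed

definition incidence :: "(complex vec \<times> complex vec) set" where
  "incidence = {(y, x). y \<in> proj_space 2 \<and> x \<in> proj_space k \<and> (\<forall>w. tr w (\<lambda>j. y $ j) (\<lambda>l. x $ l) = 0)}"

lemma map_qv: "map_vec (\<lambda>f. poly_eval f (vec 3 y)) qv = vec (k+1) (qe y)"
  by (rule eq_vecI) (simp_all add: qv_def qe_def)

lemma p2: "proj_space 2 = carrier_vec 3 - {0\<^sub>v 3}" "2 + k + 1 = k + 3"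
  by (simp_all add: proj_space_def)

lemma pk: "proj_space k = carrier_vec (k + 1) - {0\<^sub>v (k + 1)}"
  by (simp add: proj_space_def)

lemma graph_point:
  assumes "nz 3 y" "nz (k+1) (qe y)" "a \<noteq> 0"
  shows "(vec 3 y, vec (k+1) (\<lambda>l. a * qe y l)) \<in> graph_bicone 2 k qv"
proof -
  have "vec (k+1) (\<lambda>l. a * qe y l) = a \<cdot>\<^sub>v vec (k+1) (qe y)" by (rule eq_vecI) simp_all
  then have "same_point (vec (k+1) (qe y)) (vec (k+1) (\<lambda>l. a * qe y l))" unfolding same_point_def using assms(3) by blast
  moreover have n: "nz (k+1) (\<lambda>l. a * qe y l)" using assms(2,3) by (auto simp: nz_def)
  ultimately show ?thesis
    unfolding graph_bicone_def p2 pk using vec_proj[OF assms(1)] vec_proj[OF n] by (simp add: map_qv)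
qed

text \<open>The variables of the second factor follow the three of the first, so x_l is
  \<open>Var (3 + l)\<close>.\<close>

lemma incidence_forms:
  assumes i: "i < k"
  defines "F \<equiv> (\<Sum>j<3. \<Sum>l<k+1. Const (\<alpha> i j l) * (Var j * Var (3 + l)))"
  shows "F \<in> polys (2 + k + 1)" "y \<in> carrier_vec 3 \<Longrightarrow> x \<in> carrier_vec (k+1) \<Longrightarrow> poly_eval F (y @\<^sub>v x) = tr (ue i) (\<lambda>j. y $ j) (\<lambda>l. x $ l)"
proof -
  show "F \<in> polys (2 + k + 1)" unfolding F_def by (intro polys_sum polys_mult polys_closed) auto
  assume c: "y \<in> carrier_vec 3" "x \<in> carrier_vec (k+1)"
  have "tr (ue i) (\<lambda>j. y $ j) (\<lambda>l. x $ l) = (\<Sum>j<3. \<Sum>l<k+1. \<alpha> i j l * y $ j * x $ l)"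
    unfolding tri_def by (subst sum_only[OF i]) (auto simp: ue_def)
  also have "\<dots> = poly_eval F (y @\<^sub>v x)"
    unfolding F_def ev.hom_sum ev.hom_mult poly_eval_Const poly_eval_Var
    by (intro sum.cong refl) (use c in \<open>simp add: mult.assoc\<close>)
  finally show "poly_eval F (y @\<^sub>v x) = tr (ue i) (\<lambda>j. y $ j) (\<lambda>l. x $ l)" by simp
qed

lemma graph_incidence:
  assumes "(y, x) \<in> graph_bicone 2 k qv"
  shows "tr w (\<lambda>j. y $ j) (\<lambda>l. x $ l) = 0"
proof -
  have y: "y \<in> carrier_vec 3 - {0\<^sub>v 3}" using assms unfolding graph_bicone_def p2 by blast
  obtain a where a: "x = a \<cdot>\<^sub>v map_vec (\<lambda>f. poly_eval f y) qv"
    using assms unfolding graph_bicone_def same_point_def by blast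
  have ve: "map_vec (\<lambda>f. poly_eval f y) qv = vec (k+1) (qe (\<lambda>j. y $ j))"
    using map_qv[of "\<lambda>j. y $ j"] vec_of_proj[OF y] by simp
  have "tr w (\<lambda>j. y $ j) (\<lambda>l. x $ l) = tr w (\<lambda>j. y $ j) (\<lambda>l. a * qe (\<lambda>j. y $ j) l)"
    unfolding tri_def by (intro sum.cong refl) (simp add: a ve)
  also have "\<dots> = 0" unfolding tri_scale qe_kernel by simp
  finally show ?thesis .
qed

text \<open>The incidence equations vanish on the graph, hence on its closure. Conversely, over y
  outside the locus the kernel is spanned by the minors, so the point is on the graph; over the
  locus \<open>limit_direction\<close> gives a polynomial curve through the point that lies on the
  graph for all but finitely many parameters.\<close>

lemma blow_up_incidence: "blow_up 2 k qv = incidence"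
proof (rule subset_antisym; rule subrelI)
  fix y x assume b: "(y, x) \<in> blow_up 2 k qv"
  then have y: "y \<in> proj_space 2" and x: "x \<in> proj_space k" unfolding blow_up_def by blast+
  have "tr (ue i) (\<lambda>j. y $ j) (\<lambda>l. x $ l) = 0" if i: "i < k" for i
  proof -
    let ?F = "\<Sum>j<3. \<Sum>l<k+1. Const (\<alpha> i j l) * (Var j * Var (3 + l))"
    have "\<forall>(y', x')\<in>graph_bicone 2 k qv. poly_eval ?F (y' @\<^sub>v x') = 0"
    proof clarify
      fix y' x' assume g: "(y', x') \<in> graph_bicone 2 k qv"
      then have "y' \<in> carrier_vec 3" "x' \<in> carrier_vec (k+1)" unfolding graph_bicone_def p2 pk by blast+
      from incidence_forms(2)[OF i this] show "poly_eval ?F (y' @\<^sub>v x') = 0" using graph_incidence[OF g] by simp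
    qed
    then have "poly_eval ?F (y @\<^sub>v x) = 0" using b incidence_forms(1)[OF i] unfolding blow_up_def by blast
    moreover have "y \<in> carrier_vec 3" "x \<in> carrier_vec (k+1)" using y x unfolding p2 pk by blast+
    ultimately show ?thesis using incidence_forms(2)[OF i] by simp
  qed
  then have "\<forall>i<k. tr (ue i) (\<lambda>j. y $ j) (\<lambda>l. x $ l) = 0" by blast
  then show "(y, x) \<in> incidence" unfolding tri_zero_iff(1) incidence_def using x y by blast
next
  fix y x assume b: "(y, x) \<in> incidence"
  then have y: "y \<in> proj_space 2" and x: "x \<in> proj_space k"
    and t: "\<And>w. tr w (\<lambda>j. y $ j) (\<lambda>l. x $ l) = 0" unfolding incidence_def by blast+
  let ?y = "\<lambda>j. y $ j" let ?x = "\<lambda>l. x $ l"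
  have yn: "nz 3 ?y" and xn: "nz (k+1) ?x" using proj_nz y x unfolding p2 pk by blast+
  have yv: "y = vec 3 ?y" and xv: "x = vec (k+1) ?x" using vec_of_proj y x unfolding p2 pk by blast+
  have "poly_eval F (y @\<^sub>v x) = 0" if F: "F \<in> polys (2 + k + 1)" "\<forall>(y', x')\<in>graph_bicone 2 k qv. poly_eval F (y' @\<^sub>v x') = 0" for F
  proof (cases "inZ ?y")
    case False
    then obtain l where l: "l < k + 1" "qe ?y l \<noteq> 0" using qe_zero_iff[OF yn] by blast
    obtain a where a: "\<forall>e<k+1. ?x e = a * qe ?y e" using qe_unique[OF t l] by (rule exE)
    have "a \<noteq> 0" using xn a by (auto simp: nz_def)
    moreover have "nz (k+1) (qe ?y)" using l by (intro nzI[of l]) auto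
    ultimately have g: "(vec 3 ?y, vec (k+1) (\<lambda>l. a * qe ?y l)) \<in> graph_bicone 2 k qv" using graph_point[OF yn] by blast
    have "vec (k+1) (\<lambda>l. a * qe ?y l) = x" by (subst xv) (intro eq_vecI, simp_all add: a)
    then have "(y, x) \<in> graph_bicone 2 k qv" using g yv by simp
    then show ?thesis using F(2) by blast
  next
    case True
    obtain v m xt \<kappa> where v: "\<And>t. nz 3 (\<lambda>j. ?y j + t * v j)" "\<kappa> \<noteq> 0"
      "\<And>t l. l < k + 1 \<Longrightarrow> qe (\<lambda>j. ?y j + t * v j) l = t ^ m * poly (xt l) t"
      "\<And>l. l < k + 1 \<Longrightarrow> ?x l = \<kappa> * poly (xt l) 0" by (rule limit_direction[OF True xn t]) blast
    define \<phi> where "\<phi> i = (if i < 3 then [:?y i, v i:] else smult \<kappa> (xt (i - 3)))" for i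
    define P where "P = subst (\<lambda>c. [:c:]) \<phi> F"
    define X where "X t = vec (k+1) (\<lambda>l. \<kappa> * poly (xt l) t)" for t
    have PF: "poly P t = poly_eval F (vec 3 (\<lambda>j. ?y j + t * v j) @\<^sub>v X t)" for t
      unfolding P_def by (rule poly_subst[OF F(1)]) (auto simp: \<phi>_def X_def)
    obtain l1 where l1: "l1 < k + 1" "poly (xt l1) 0 \<noteq> 0" using xn v(4) by (auto simp: nz_def)
    have "P = 0"
    proof (rule poly_cofinite_zero)
      have "xt l1 \<noteq> 0" using l1(2) by auto
      then show "finite ({0} \<union> {t. poly (xt l1) t = 0})" using poly_roots_finite by simp
      fix t assume "t \<notin> {0} \<union> {t. poly (xt l1) t = 0}"
      then have t: "t \<noteq> 0" "poly (xt l1) t \<noteq> 0" by auto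
      have "nz (k+1) (qe (\<lambda>j. ?y j + t * v j))" by (rule nzI[OF l1(1)]) (use t v(3)[OF l1(1)] in simp)
      from graph_point[OF v(1) this, of "\<kappa> / t ^ m"]
      have g: "(vec 3 (\<lambda>j. ?y j + t * v j), vec (k+1) (\<lambda>l. \<kappa> / t ^ m * qe (\<lambda>j. ?y j + t * v j) l)) \<in> graph_bicone 2 k qv"
        using v(2) t(1) by simp
      have "vec (k+1) (\<lambda>l. \<kappa> / t ^ m * qe (\<lambda>j. ?y j + t * v j) l) = X t"
        unfolding X_def by (intro eq_vecI) (simp_all add: v(3) t(1))
      then show "poly P t = 0" unfolding PF using F(2) g by auto
    qed
    then have "poly_eval F (vec 3 (\<lambda>j. ?y j + 0 * v j) @\<^sub>v X 0) = 0" using PF[of 0] by simp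
    moreover have "X 0 = x" unfolding X_def by (subst xv) (intro eq_vecI, simp_all add: v(4))
    ultimately show ?thesis using yv by simp
  qed
  then show "(y, x) \<in> blow_up 2 k qv" unfolding blow_up_def using x y by blast
qed

end

text \<open>Cross products of rows invert the projection from the incidence variety.\<close>

definition cp :: "(nat \<Rightarrow> 'a::comm_ring) \<Rightarrow> (nat \<Rightarrow> 'a) \<Rightarrow> nat \<Rightarrow> 'a" where
  "cp a b j = (if j = 0 then a 1 * b 2 - a 2 * b 1 else if j = 1 then a 2 * b 0 - a 0 * b 2 else a 0 * b 1 - a 1 * b 0)"

lemma cp_parallel:
  fixes a b z :: "nat \<Rightarrow> complex"
  assumes "(\<Sum>j<3. a j * z j) = 0" "(\<Sum>j<3. b j * z j) = 0" "nz 3 (cp a b)"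
  shows "\<exists>\<kappa>. \<forall>j<3. z j = \<kappa> * cp a b j"
proof -
  have az: "a 0 * z 0 + a 1 * z 1 + a 2 * z 2 = 0" and bz: "b 0 * z 0 + b 1 * z 1 + b 2 * z 2 = 0"
    using assms(1,2) unfolding sum_lessThan_3 by simp_all
  let ?c = "cp a b"
  have "?c 0 * z 1 - ?c 1 * z 0 = b 2 * (a 0 * z 0 + a 1 * z 1 + a 2 * z 2) - a 2 * (b 0 * z 0 + b 1 * z 1 + b 2 * z 2)"
    by (simp add: cp_def algebra_simps)
  then have 01: "?c 0 * z 1 = ?c 1 * z 0" unfolding az bz by simp
  have "?c 0 * z 2 - ?c 2 * z 0 = a 1 * (b 0 * z 0 + b 1 * z 1 + b 2 * z 2) - b 1 * (a 0 * z 0 + a 1 * z 1 + a 2 * z 2)"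
    by (simp add: cp_def algebra_simps)
  then have 02: "?c 0 * z 2 = ?c 2 * z 0" unfolding az bz by simp
  have "?c 1 * z 2 - ?c 2 * z 1 = b 0 * (a 0 * z 0 + a 1 * z 1 + a 2 * z 2) - a 0 * (b 0 * z 0 + b 1 * z 1 + b 2 * z 2)"
    by (simp add: cp_def algebra_simps)
  then have 12: "?c 1 * z 2 = ?c 2 * z 1" unfolding az bz by simp
  obtain s where s: "s < 3" "?c s \<noteq> 0" using assms(3) by (rule nzE)
  have "s = 0 \<or> s = 1 \<or> s = 2" using s(1) by (auto simp: less_Suc_eq numeral_3_eq_3)
  then have "\<forall>j<3. z j * ?c s = z s * ?c j"
    unfolding all_lessThan_3 using 01 02 12 by (elim disjE) (simp_all add: mult.commute)
  then have "\<forall>j<3. z j = (z s / ?c s) * ?c j" using s(2) by (simp add: field_simps)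
  then show ?thesis by blast
qed

lemma rows_parallel:
  fixes a :: "nat \<Rightarrow> nat \<Rightarrow> complex"
  assumes "\<And>i i'. i < m \<Longrightarrow> i' < m \<Longrightarrow> \<not> nz 3 (cp (a i) (a i'))"
  shows "\<exists>\<rho>. \<forall>z. (\<Sum>j<3. \<rho> j * z j) = 0 \<longrightarrow> (\<forall>i<m. (\<Sum>j<3. a i j * z j) = 0)"
proof (cases "\<exists>i<m. nz 3 (a i)")
  case True
  then obtain i where i: "i < m" "nz 3 (a i)" by blast
  obtain s where s: "s < 3" "a i s \<noteq> 0" using i(2) by (rule nzE)
  have s': "s = 0 \<or> s = 1 \<or> s = 2" using s(1) by (auto simp: less_Suc_eq numeral_3_eq_3)
  have e: "a i' j * a i s = a i' s * a i j" if "i' < m" "j < 3" for i' j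
  proof -
    have "\<forall>j<3. cp (a i) (a i') j = 0" using assms[OF i(1) that(1)] by (auto simp: nz_def)
    then have "a i 1 * a i' 2 = a i 2 * a i' 1" "a i 2 * a i' 0 = a i 0 * a i' 2" "a i 0 * a i' 1 = a i 1 * a i' 0"
      unfolding all_lessThan_3 by (simp_all add: cp_def)
    then have "\<forall>j<3. a i' j * a i s = a i' s * a i j"
      unfolding all_lessThan_3 using s' by (elim disjE) (simp_all add: mult.commute)
    then show ?thesis using that(2) by blast
  qed
  have "(\<Sum>j<3. a i' j * z j) = 0" if z: "(\<Sum>j<3. a i j * z j) = 0" and i': "i' < m" for z i'
  proof -
    have "a i s * (\<Sum>j<3. a i' j * z j) = (\<Sum>j<3. (a i' j * a i s) * z j)"
      unfolding sum_distrib_left by (simp only: mult_ac)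
    also have "\<dots> = (\<Sum>j<3. a i' s * (a i j * z j))" by (intro sum.cong refl) (simp add: e[OF i'])
    also have "\<dots> = 0" unfolding sum_distrib_left[symmetric] z by simp
    finally show ?thesis using s(2) by simp
  qed
  then show ?thesis by (intro exI[of _ "a i"]) blast
next
  case False
  then have "\<forall>i<m. \<forall>j<3. a i j = 0" by (auto simp: nz_def)
  then show ?thesis by (intro exI[of _ "\<lambda>_. 0"]) simp
qed

text \<open>If two rows are independent, their cross product is orthogonal to every third row;
  otherwise all rows are multiples of a single one. The hypothesis is the vanishing of all 3 x 3
  minors in terms of kernel vectors.\<close>

lemma minors_kernel:
  fixes a :: "nat \<Rightarrow> nat \<Rightarrow> complex"
  assumes "\<And>f :: nat \<Rightarrow> nat. (\<And>i. i < 3 \<Longrightarrow> f i < m) \<Longrightarrow> \<exists>z. nz 3 z \<and> (\<forall>i<3. (\<Sum>j<3. a (f i) j * z j) = 0)"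
  shows "\<exists>z. nz 3 z \<and> (\<forall>i<m. (\<Sum>j<3. a i j * z j) = 0)"
proof (cases "\<exists>i<m. \<exists>i'<m. nz 3 (cp (a i) (a i'))")
  case True
  then obtain i i' where i: "i < m" "i' < m" "nz 3 (cp (a i) (a i'))" by blast
  have orth: "(\<Sum>j<3. a r j * cp (a i) (a i') j) = 0" if r: "r < m" for r
  proof -
    define f where "f n = (if n = 0 then i else if n = 1 then i' else r)" for n :: nat
    have "\<exists>z. nz 3 z \<and> (\<forall>i<3. (\<Sum>j<3. a (f i) j * z j) = 0)" by (rule assms[of f]) (use i r in \<open>simp add: f_def\<close>)
    then obtain z where z: "nz 3 z" "\<forall>i<3. (\<Sum>j<3. a (f i) j * z j) = 0" by blast
    have zz: "(\<Sum>j<3. a i j * z j) = 0" "(\<Sum>j<3. a i' j * z j) = 0" "(\<Sum>j<3. a r j * z j) = 0"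
      using z(2)[unfolded all_lessThan_3] by (simp_all add: f_def)
    obtain \<kappa> where \<kappa>: "\<forall>j<3. z j = \<kappa> * cp (a i) (a i') j" using cp_parallel[OF zz(1,2) i(3)] by (rule exE)
    have "0 = (\<Sum>j<3. \<kappa> * (a r j * cp (a i) (a i') j))" unfolding zz(3)[symmetric] by (intro sum.cong refl) (simp add: \<kappa>)
    also have "\<dots> = \<kappa> * (\<Sum>j<3. a r j * cp (a i) (a i') j)" by (rule sum_distrib_left[symmetric])
    finally have "\<kappa> * (\<Sum>j<3. a r j * cp (a i) (a i') j) = 0" by (rule sym)
    moreover have "\<kappa> \<noteq> 0" using z(1) \<kappa> by (auto simp: nz_def)
    ultimately show ?thesis by simp
  qed
  show ?thesis by (rule exI[of _ "cp (a i) (a i')"], intro conjI allI impI i(3) orth)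
next
  case False
  then have np: "\<And>i i'. i < m \<Longrightarrow> i' < m \<Longrightarrow> \<not> nz 3 (cp (a i) (a i'))" by blast
  obtain \<rho> where \<rho>: "\<forall>z. (\<Sum>j<3. \<rho> j * z j) = 0 \<longrightarrow> (\<forall>i<m. (\<Sum>j<3. a i j * z j) = 0)"
    using rows_parallel[of m a, OF np] by (rule exE)
  obtain z where z: "nz 3 z" "\<forall>e\<in>{()}. (\<Sum>j<3. \<rho> j * z j) = 0"
    using kernel_nontrivial[of "{()}" 3 "\<lambda>_. \<rho>"] by auto
  then show ?thesis using \<rho> by blast
qed

lemma (in det_tensor) X_kernel:
  assumes "x \<in> X"
  shows "\<exists>y. nz 3 y \<and> (\<forall>w. tr w y (\<lambda>l. x $ l) = 0)"
proof -
  let ?A = "tmat (c + 2) (k + 1) \<alpha>"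
  have tA: "tr (ue i) y (\<lambda>l. x $ l) = (\<Sum>j<3. poly_eval (?A $$ (i,j)) x * y j)" if "i < c + 2" for i y
    unfolding tri_expand(2)[of _ _ _ "ue i" y] using that
    by (intro sum.cong refl) (simp add: tmat_eval[where x = "\<lambda>l. x $ l"] mult.commute)
  have "\<exists>z. nz 3 z \<and> (\<forall>i<c+2. (\<Sum>j<3. poly_eval (?A $$ (i,j)) x * z j) = 0)"
  proof (rule minors_kernel)
    fix f :: "nat \<Rightarrow> nat" assume f: "\<And>i. i < 3 \<Longrightarrow> f i < c + 2"
    have A: "?A \<in> carrier_mat (c+2) 3" by (simp add: tmat_def)
    have "det (select_rows 3 ?A f) \<in> vanishing_ideal k X"
      unfolding ideal by (rule select_rows_ideal[OF A _ f]) (rule forms_polys[OF tmat_polys])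
    then have "poly_eval (det (select_rows 3 ?A f)) x = 0" using assms unfolding vanishing_ideal_def by blast
    then have "det (map_mat (\<lambda>f. poly_eval f x) (select_rows 3 ?A f)) = 0" unfolding ev.hom_det .
    also have "map_mat (\<lambda>f. poly_eval f x) (select_rows 3 ?A f) = mat 3 3 (\<lambda>(i,j). poly_eval (?A $$ (f i,j)) x)"
      by (rule eq_matI) (auto simp: select_rows_def)
    finally show "\<exists>z. nz 3 z \<and> (\<forall>i<3. (\<Sum>j<3. poly_eval (?A $$ (f i,j)) x * z j) = 0)" unfolding square_kernel .
  qed
  then obtain y where y: "nz 3 y" "\<forall>i<c+2. (\<Sum>j<3. poly_eval (?A $$ (i,j)) x * y j) = 0" by blast
  have "\<forall>i<c+2. tr (ue i) y (\<lambda>l. x $ l) = 0" using y(2) tA by simp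
  then show ?thesis using y(1) unfolding tri_zero_iff(1) by blast
qed

text \<open>Where two rows of A(x) are independent, their cross product, a vector of quadrics in x,
  spans the kernel and inverts the projection. Such rows exist at every point of the image because
  \<open>tri_kernel_unique\<close> keeps the kernel one-dimensional.\<close>

lemma (in det_tensor) embeds:
  assumes W: "\<And>y x. (y, x) \<in> W \<Longrightarrow> y \<in> proj_space 2 \<and> x \<in> proj_space k \<and> (\<forall>w. tr w (\<lambda>j. y $ j) (\<lambda>l. x $ l) = 0)"
  shows "second_projection_embeds 2 k W"
  unfolding second_projection_embeds_def
proof
  fix x0 assume "x0 \<in> snd ` W"
  then obtain y0 where W0: "(y0, x0) \<in> W" by auto
  let ?A = "tmat (c + 2) (k + 1) \<alpha>"
  define a where "a x i j = poly_eval (?A $$ (i,j)) x" for x i j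
  have tA: "tr (ue i) y (\<lambda>l. x $ l) = (\<Sum>j<3. a x i j * y j)" if "i < c + 2" for i y x
    unfolding tri_expand(2)[of _ _ _ "ue i" y] a_def using that
    by (intro sum.cong refl) (simp add: tmat_eval[where x = "\<lambda>l. x $ l"] mult.commute)
  have x0: "nz (k+1) (\<lambda>l. x0 $ l)"
    using W[OF W0] unfolding proj_space_def by (intro proj_nz) blast
  have "\<exists>i<c+2. \<exists>i'<c+2. nz 3 (cp (a x0 i) (a x0 i'))"
  proof (rule ccontr)
    assume "\<not> ?thesis"
    then obtain \<rho> where \<rho>: "\<forall>z. (\<Sum>j<3. \<rho> j * z j) = 0 \<longrightarrow> (\<forall>i<c+2. (\<Sum>j<3. a x0 i j * z j) = 0)"
      using rows_parallel[of "c+2" "a x0"] by blast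
    have zt: "\<And>w. tr w z (\<lambda>l. x0 $ l) = 0" if z: "(\<Sum>j<3. \<rho> j * z j) = 0" for z
    proof -
      have "\<forall>i<c+2. tr (ue i) z (\<lambda>l. x0 $ l) = 0" using \<rho> z tA by simp
      then show "\<And>w. tr w z (\<lambda>l. x0 $ l) = 0" unfolding tri_zero_iff(1) by blast
    qed
    obtain y where y: "nz 3 y" "\<forall>e\<in>{()}. (\<Sum>j<3. \<rho> j * y j) = 0" using kernel_nontrivial[of "{()}" 3 "\<lambda>_. \<rho>"] by auto
    obtain s where s: "s < 3" "y s \<noteq> 0" using y(1) by (rule nzE)
    have "card {0::nat,1} < 3" by simp
    from kernel_nontrivial[OF _ this, of "\<lambda>e j. if e = 0 then \<rho> j else if j = s then 1 else 0"]
    obtain y' where y': "nz 3 y'" "\<forall>e\<in>{0::nat,1}. (\<Sum>j<3. (if e = 0 then \<rho> j else if j = s then 1 else 0) * y' j) = 0" by auto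
    have r: "(\<Sum>j<3. \<rho> j * y' j) = 0" using y'(2) by simp
    have "(\<Sum>j<3. (if j = s then 1 else 0) * y' j) = 0" using y'(2) by simp
    then have "y' s = 0" by (subst (asm) sum_only[OF s(1)]) auto
    moreover have ry: "(\<Sum>j<3. \<rho> j * y j) = 0" using y(2) by simp
    ultimately show False
      using tri_kernel_unique[of "\<lambda>l. x0 $ l" y y' s, OF x0 zt[OF ry] zt[OF r] s y'(1)] by simp
  qed
  then obtain i i' where i: "i < c + 2" "i' < c + 2" "nz 3 (cp (a x0 i) (a x0 i'))" by blast
  define G where "G = vec 3 (cp (\<lambda>j. ?A $$ (i,j)) (\<lambda>j. ?A $$ (i',j)))"
  have Ge: "map_vec (\<lambda>f. poly_eval f x) G = vec 3 (cp (a x i) (a x i'))" for x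
    by (rule eq_vecI) (simp_all add: G_def cp_def a_def ev.hom_minus ev.hom_mult)
  have nzv: "vec 3 u \<noteq> 0\<^sub>v 3 \<longleftrightarrow> nz 3 u" for u :: "nat \<Rightarrow> complex"
  proof
    assume "vec 3 u \<noteq> 0\<^sub>v 3"
    then have "nz 3 (\<lambda>i. vec 3 u $ i)" by (intro proj_nz) simp
    then show "nz 3 u" by (auto simp: nz_def)
  qed (use vec_proj[of 3 u] in simp)
  have f2: "?A $$ (r,j) * ?A $$ (r',j') \<in> forms k 2" if "r < c+2" "r' < c+2" "j < 3" "j' < 3" for r r' j j'
    using forms_mult[OF tmat_polys[OF that(1,3)] tmat_polys[OF that(2,4)]] by simp
  show "\<exists>e G. G \<in> carrier_vec (2 + 1) \<and> (\<forall>j<2 + 1. G $ j \<in> forms k e) \<and>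
      map_vec (\<lambda>f. poly_eval f x0) G \<noteq> 0\<^sub>v (2 + 1) \<and>
      (\<forall>(y, x)\<in>W. map_vec (\<lambda>f. poly_eval f x) G \<noteq> 0\<^sub>v (2 + 1) \<longrightarrow> same_point (map_vec (\<lambda>f. poly_eval f x) G) y)"
  proof (rule exI[of _ 2], rule exI[of _ G], intro conjI)
    show "G \<in> carrier_vec (2 + 1)" by (simp add: G_def)
    have "cp (\<lambda>j. ?A $$ (i,j)) (\<lambda>j. ?A $$ (i',j)) j \<in> forms k 2" for j
      unfolding cp_def using f2 i(1,2) by (auto intro!: forms_diff)
    then show "\<forall>j<2+1. G $ j \<in> forms k 2" by (simp add: G_def)
    show "map_vec (\<lambda>f. poly_eval f x0) G \<noteq> 0\<^sub>v (2 + 1)" unfolding Ge using i(3) nzv by simp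
    show "\<forall>(y, x)\<in>W. map_vec (\<lambda>f. poly_eval f x) G \<noteq> 0\<^sub>v (2 + 1) \<longrightarrow> same_point (map_vec (\<lambda>f. poly_eval f x) G) y"
    proof clarify
      fix y x assume yx: "(y, x) \<in> W" and "map_vec (\<lambda>f. poly_eval f x) G \<noteq> 0\<^sub>v (2 + 1)"
      then have n: "nz 3 (cp (a x i) (a x i'))" unfolding Ge using nzv by simp
      note wy = W[OF yx]
      have "tr (ue i) (\<lambda>j. y $ j) (\<lambda>l. x $ l) = 0" "tr (ue i') (\<lambda>j. y $ j) (\<lambda>l. x $ l) = 0" using wy by blast+
      then have "(\<Sum>j<3. a x i j * y $ j) = 0" "(\<Sum>j<3. a x i' j * y $ j) = 0" using tA i by simp_all
      from cp_parallel[OF this n] obtain \<kappa> where \<kappa>: "\<forall>j<3. y $ j = \<kappa> * cp (a x i) (a x i') j" by (rule exE)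
      have y3: "y \<in> carrier_vec 3" "y \<noteq> 0\<^sub>v 3" using wy by (auto simp: proj_space_def)
      have e: "y = \<kappa> \<cdot>\<^sub>v vec 3 (cp (a x i) (a x i'))" by (rule eq_vecI) (use \<kappa> y3(1) in auto)
      have "\<kappa> \<noteq> 0"
      proof
        assume "\<kappa> = 0"
        then have "y = 0\<^sub>v 3" using \<kappa> y3(1) by (intro eq_vecI) auto
        then show False using y3(2) by blast
      qed
      then show "same_point (map_vec (\<lambda>f. poly_eval f x) G) y" unfolding same_point_def Ge using e by blast
    qed
  qed
qed

section \<open>Cubics and Bordiga surfaces\<close>

text \<open>y2 is taken off a line through y1, and y3 off a line through y1 and y2; the linear forms
  used for this make any relation between the three triangular.\<close>

lemma three_points:
  fixes P :: "(nat \<Rightarrow> complex) \<Rightarrow> bool"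
  assumes P: "\<And>\<mu>. nz 3 \<mu> \<Longrightarrow> \<exists>y. P y \<and> (\<Sum>j<3. \<mu> j * y j) \<noteq> 0"
  obtains y1 y2 y3 where "P y1" "P y2" "P y3"
    "\<And>u1 u2 u3. \<forall>j<3. u1 * y1 j + u2 * y2 j + u3 * y3 j = 0 \<Longrightarrow> u1 = 0 \<and> u2 = 0 \<and> u3 = 0"
proof -
  have "nz 3 (ue 0)" by (rule nzI[of 0]) (simp_all add: ue_def)
  from P[OF this] obtain y1 where y1: "P y1" "(\<Sum>j<3. ue 0 j * y1 j) \<noteq> 0" by blast
  obtain \<mu> where mu: "nz 3 \<mu>" "\<forall>e\<in>{()}. (\<Sum>j<3. y1 j * \<mu> j) = 0" using kernel_nontrivial[of "{()}" 3 "\<lambda>_. y1"] by auto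
  from P[OF mu(1)] obtain y2 where y2: "P y2" "(\<Sum>j<3. \<mu> j * y2 j) \<noteq> 0" by blast
  have "card {0::nat,1} < 3" by simp
  from kernel_nontrivial[OF _ this, of "\<lambda>e. if e = 0 then y1 else y2"]
  obtain \<nu> where nu: "nz 3 \<nu>" "\<forall>e\<in>{0::nat,1}. (\<Sum>j<3. (if e = 0 then y1 else y2) j * \<nu> j) = 0" by auto
  from P[OF nu(1)] obtain y3 where y3: "P y3" "(\<Sum>j<3. \<nu> j * y3 j) \<noteq> 0" by blast
  have n12: "(\<Sum>j<3. \<nu> j * y1 j) = 0" "(\<Sum>j<3. \<nu> j * y2 j) = 0" and m1: "(\<Sum>j<3. \<mu> j * y1 j) = 0"
    using nu(2) mu(2) by (simp_all add: mult.commute)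
  have "u1 = 0 \<and> u2 = 0 \<and> u3 = 0" if u: "\<forall>j<3. u1 * y1 j + u2 * y2 j + u3 * y3 j = 0" for u1 u2 u3
  proof -
    have d: "u1 * (\<Sum>j<3. g j * y1 j) + u2 * (\<Sum>j<3. g j * y2 j) + u3 * (\<Sum>j<3. g j * y3 j) = 0" for g
    proof -
      have "0 = (\<Sum>j<3. g j * (u1 * y1 j + u2 * y2 j + u3 * y3 j))" by (rule sym, rule sum.neutral) (use u in simp)
      also have "\<dots> = u1 * (\<Sum>j<3. g j * y1 j) + u2 * (\<Sum>j<3. g j * y2 j) + u3 * (\<Sum>j<3. g j * y3 j)"
        unfolding distrib_left sum.distrib sum_distrib_left by (simp only: mult_ac)
      finally show ?thesis by (rule sym)
    qed
    have u3: "u3 = 0" using d[of \<nu>] n12 y3(2) by simp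
    have u2: "u2 = 0" using d[of \<mu>] m1 y2(2) u3 by simp
    have "u1 = 0" using d[of "ue 0"] y1(2) u2 u3 by simp
    then show ?thesis using u2 u3 by blast
  qed
  then show thesis by (rule that[OF y1(1) y2(1) y3(1)])
qed

lemma det_columns:
  fixes y1 y2 y3 :: "nat \<Rightarrow> complex"
  assumes "\<And>u1 u2 u3. \<forall>j<3. u1 * y1 j + u2 * y2 j + u3 * y3 j = 0 \<Longrightarrow> u1 = 0 \<and> u2 = 0 \<and> u3 = 0"
  shows "det (mat 3 3 (\<lambda>(i,j). if j = 0 then y1 i else if j = 1 then y2 i else y3 i)) \<noteq> 0"
proof
  assume "det (mat 3 3 (\<lambda>(i,j). if j = 0 then y1 i else if j = 1 then y2 i else y3 i)) = 0"
  then obtain u where u: "nz 3 u" "\<forall>i<3. (\<Sum>j<3. (if j = 0 then y1 i else if j = 1 then y2 i else y3 i) * u j) = 0"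
    unfolding square_kernel by blast
  have "\<forall>i<3. u 0 * y1 i + u 1 * y2 i + u 2 * y3 i = 0" using u(2) unfolding sum_lessThan_3 by (simp add: mult.commute)
  from assms[OF this] have "\<forall>j<3. u j = 0" unfolding all_lessThan_3 by blast
  then show False using u(1) by (auto simp: nz_def)
qed

lemma tri_tsubst_column: "j < 3 \<Longrightarrow> tri m r (tsubst G \<alpha>) w (ue j) x = tri m r \<alpha> w (\<lambda>j'. G j' j) x"
proof -
  assume j: "j < 3"
  have "(\<Sum>j''<3. G j' j'' * ue j j'') = G j' j" for j' by (subst sum_only[OF j]) (auto simp: ue_def)
  then show ?thesis unfolding tri_tsubst by simp
qed

lemma maximal_minors_square:
  assumes "M \<in> carrier_mat n n"
  shows "maximal_minors M = {det M}"
proof -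
  have R: "R \<subseteq> {..<n} \<and> card R = n \<longleftrightarrow> R = {..<n}" for R
    by (metis card_lessThan card_subset_eq finite_lessThan order_refl)
  have "submatrix M {..<n} UNIV = M"
  proof (rule eq_matI)
    have c: "card {i. i < n \<and> i < n} = n" by simp
    have d: "dim_row (submatrix M {..<n} UNIV) = n" "dim_col (submatrix M {..<n} UNIV) = n"
      using assms by (simp_all add: dim_submatrix)
    then show "dim_row (submatrix M {..<n} UNIV) = dim_row M" "dim_col (submatrix M {..<n} UNIV) = dim_col M" using assms by auto
    fix i j assume ij: "i < dim_row M" "j < dim_col M"
    have p: "pick {..<n} i = i"
    proof -
      have "{a\<in>{..<n}. a < i} = {..<i}" using ij assms by auto
      then show ?thesis using pick_card_in_set[of i "{..<n}"] ij assms by simp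
    qed
    show "submatrix M {..<n} UNIV $$ (i,j) = M $$ (i,j)"
      using submatrix_index[of i M "{..<n}" j UNIV] ij assms by (simp add: p pick_UNIV)
  qed
  then show ?thesis unfolding maximal_minors_def using assms R by auto
qed

context det_tensor begin

text \<open>Each killed column contributes c to the sum of the h_i and each other column c + 1, so k
  + c prescribes that k - 2c columns are not killed.\<close>

lemma critical_of_columns:
  assumes "k \<ge> c + 2 \<or> c = 1" "has_dim k X (k - c)" "c \<le> k"
    and h: "h 0 + h 1 + h 2 = k + c" "\<And>j. j < 3 \<Longrightarrow> 1 \<le> h j \<and> h j < k"
    and col: "\<And>j. j < 3 \<Longrightarrow> (h j = c \<and> (\<exists>w. nz (c+2) w \<and> (\<forall>x. tr w (ue j) x = 0))) \<or>
      (h j = c + 1 \<and> (\<forall>w. nz (c+2) w \<longrightarrow> (\<exists>x. tr w (ue j) x \<noteq> 0)))"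
  shows "\<exists>P Q. is_critical_locus k h P Q X"
proof -
  have "\<exists>N. \<exists>Q. j < 3 \<longrightarrow> col_factor (c + 2) (k + 1) \<alpha> j (h j) N Q" for j
  proof (cases "j < 3")
    case True
    from col[OF True] show ?thesis
    proof
      assume a: "h j = c \<and> (\<exists>w. nz (c+2) w \<and> (\<forall>x. tr w (ue j) x = 0))"
      then obtain w where w: "nz (c+2) w" "\<And>x. tr w (ue j) x = 0" by blast
      show ?thesis using col_factor_kill[OF True w] a by simp
    next
      assume a: "h j = c + 1 \<and> (\<forall>w. nz (c+2) w \<longrightarrow> (\<exists>x. tr w (ue j) x \<noteq> 0))"
      have "col_factor (c + 2) (k + 1) \<alpha> j (c + 1) (\<lambda>i t. if i = t then 1 else 0) (\<lambda>t l. \<alpha> t j l)"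
        by (rule col_factor_full[OF True]) (use a in blast)
      then have "col_factor (c + 2) (k + 1) \<alpha> j (h j) (\<lambda>i t. if i = t then 1 else 0) (\<lambda>t l. \<alpha> t j l)" using a by simp
      then show ?thesis by (rule exI[of _ "\<lambda>i t. if i = t then 1 else 0", OF exI[of _ "\<lambda>t l. \<alpha> t j l", OF impI]])
    qed
  qed simp
  then have "\<forall>j. \<exists>N. \<exists>Q. j < 3 \<longrightarrow> col_factor (c + 2) (k + 1) \<alpha> j (h j) N Q" by (rule allI)
  from choice[OF this] obtain N where "\<forall>j. \<exists>Q. j < 3 \<longrightarrow> col_factor (c + 2) (k + 1) \<alpha> j (h j) (N j) Q" by (rule exE)
  from choice[OF this] obtain Q where "\<forall>j. j < 3 \<longrightarrow> col_factor (c + 2) (k + 1) \<alpha> j (h j) (N j) (Q j)" by (rule exE)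
  then have NQ: "\<And>j. j < 3 \<Longrightarrow> col_factor (c + 2) (k + 1) \<alpha> j (h j) (N j) (Q j)" by blast
  show ?thesis
    by (rule critical_exists[where h = h and N = N and Q = Q, OF assms(1-3) h(1)], erule h(2), erule NQ)
qed

lemma smooth_tensor_of:
  assumes kc2: "c + 2 = k"
  shows "smooth_tensor k \<alpha>"
proof
  show "2 \<le> k" using kc2 by simp
next
  fix x y w assume a: "nz (k+1) x" "nz 3 y" "nz k w" "\<And>w'. tri k (k+1) \<alpha> w' y x = 0" "\<And>y'. tri k (k+1) \<alpha> w y' x = 0"
  show "\<exists>x'. tri k (k+1) \<alpha> w y x' \<noteq> 0" by (rule tri_key[unfolded kc2, of x y w, OF a])
next
  fix y i w w' assume a: "nz 3 y" "i < k" "w i \<noteq> 0" "\<And>x. tri k (k+1) \<alpha> w y x = 0" "\<And>x. tri k (k+1) \<alpha> w' y x = 0" "nz k w'"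
  show "w' i \<noteq> 0" by (rule left_kernel_unique[unfolded kc2, of y i w w', OF a])
qed

lemma cubic:
  assumes c: "c = 1"
  defines "F \<equiv> det (tmat 3 (k + 1) \<alpha>)"
  shows "F \<in> forms k 3" "F \<noteq> 0" "vanishing_ideal k X = Idl\<^bsub>coord_ring k\<^esub> {F}"
proof -
  have c2: "c + 2 = 3" using c by simp
  have A: "tmat 3 (k + 1) \<alpha> \<in> carrier_mat 3 3" by (simp add: tmat_def)
  have "F \<in> forms k (\<Sum>j\<in>{..<3::nat}. 1)" unfolding F_def
    by (rule forms_det[OF A, where n = k and e = "\<lambda>_. 1"]) (rule tmat_polys[unfolded c2])
  then show FF: "F \<in> forms k 3" by simp
  show I: "vanishing_ideal k X = Idl\<^bsub>coord_ring k\<^esub> {F}"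
    using ideal unfolding c2 maximal_minors_square[OF A] F_def .
  show "F \<noteq> 0"
  proof
    assume F0: "F = 0"
    have "Idl\<^bsub>coord_ring k\<^esub> {F} \<subseteq> {0}"
    proof -
      have "pideal k {0}" by (simp add: pideal_def)
      then show ?thesis unfolding F0 by (intro Idl_minimal) auto
    qed
    then have "set fs \<subseteq> {0}" using I fs(2) pideal_Idl(2)[OF fs(1)] by blast
    obtain v where "v \<in> X" using nonempty by blast
    have "c = 0" by (rule jacobian_rank_0[OF rank[OF \<open>v \<in> X\<close>]]) (use \<open>set fs \<subseteq> {0}\<close> in \<open>auto simp: partial_deriv_def\<close>)
    then show False using c1 by simp
  qed
qed

text \<open>If all singular members of the pencils lay on the line \<open>\<mu>\<close>, then replacing a row of the matrix by \<open>\<mu>\<close> would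
  give quadrics through \<open>X\<close>; these vanish identically, as the ideal is generated by a cubic.\<close>

lemma cubic_noncollinear:
  assumes c: "c = 1" and k: "k = 2" and \<mu>: "nz 3 \<mu>"
  shows "\<exists>y. (nz 3 y \<and> (\<exists>w. nz (c+2) w \<and> (\<forall>x. tr w y x = 0))) \<and> (\<Sum>j<3. \<mu> j * y j) \<noteq> 0"
proof (rule ccontr)
  assume "\<not> ?thesis"
  then have H: "(\<Sum>j<3. \<mu> j * y j) = 0" if "nz 3 y" "nz (c+2) w" "\<And>x. tr w y x = 0" for y w using that by blast
  have c2: "c + 2 = 3" and k1: "k + 1 = 3" using c k by simp_all
  let ?A = "tmat 3 (k + 1) \<alpha>"
  have A: "?A \<in> carrier_mat 3 3" by (simp add: tmat_def)
  define T where "T = transpose_mat ?A"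
  have T: "T \<in> carrier_mat 3 3" by (simp add: T_def tmat_def)
  have Ti: "T $$ (j,r) = ?A $$ (r,j)" if "r < 3" "j < 3" for r j using that A by (simp add: T_def)
  note F = cubic[OF c]
  have dT: "det T = det ?A" unfolding T_def by (rule det_transpose[OF A])
  \<comment> \<open>The matrix is transposed, so its column \<open>s\<close> is the row that is
    replaced by \<mu>.\<close>
  define B where "B s = mat 3 3 (\<lambda>(j,r). if r = s then Const (\<mu> j) else T $$ (j,r))" for s
  have B: "B s \<in> carrier_mat 3 3" for s by (simp add: B_def)
  have Bf: "det (B s) = (\<Sum>j<3. Const (\<mu> j) * cofactor T j s)" if s: "s < 3" for s
  proof -
    have "det (B s) = (\<Sum>j<3. B s $$ (j,s) * cofactor (B s) j s)" by (rule laplace_expansion_column[OF B s])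
    also have "\<dots> = (\<Sum>j<3. Const (\<mu> j) * cofactor T j s)"
    proof (intro sum.cong refl arg_cong2[of _ _ _ _ "(*)"])
      fix j :: nat assume "j \<in> {..<3}"
      then have j: "j < 3" by simp
      show "B s $$ (j,s) = Const (\<mu> j)" using j s by (simp add: B_def)
      have "mat_delete (B s) j s = mat_delete T j s"
        by (rule eq_matI) (use j s T in \<open>auto simp: mat_delete_def B_def\<close>)
      then show "cofactor (B s) j s = cofactor T j s" by (simp add: cofactor_def)
    qed
    finally show ?thesis .
  qed
  have B0: "det (B s) = 0" if s: "s < 3" for s
  proof -
    have "det (B s) \<in> forms k (\<Sum>r<3. if r = s then 0 else 1)"
    proof (rule forms_det[OF B])
      fix j r :: nat assume jr: "j < 3" "r < 3"
      have "?A $$ (r,j) \<in> forms k 1" by (rule tmat_polys[unfolded c2, OF jr(2,1)])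
      then show "B s $$ (j,r) \<in> forms k (if r = s then 0 else 1)" using jr by (simp add: B_def Ti)
    qed
    moreover have "(\<Sum>r<3. if r = s then 0 else 1::nat) = 2"
    proof -
      have "s = 0 \<or> s = 1 \<or> s = 2" using s by (auto simp: less_Suc_eq numeral_3_eq_3)
      then show ?thesis unfolding sum_lessThan_3 by auto
    qed
    ultimately have B2: "det (B s) \<in> forms k 2" by simp
    have "det (B s) \<in> vanishing_ideal k X"
      unfolding vanishing_ideal_def
    proof (intro CollectI conjI ballI)
      show "det (B s) \<in> polys k" using forms_polys[OF B2] .
      fix x assume x: "x \<in> X"
      obtain y where y: "nz 3 y" "\<And>w. tr w y (\<lambda>l. x $ l) = 0" using X_kernel[OF x] by blast
      have x3: "nz 3 (\<lambda>l. x $ l)"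
        using x X_proj unfolding proj_space_def k1 by (intro proj_nz) blast
      have "\<forall>i<3. (\<Sum>l<3. tr (ue i) y (ue l) * x $ l) = 0"
      proof (intro allI impI)
        fix i :: nat assume "i < 3"
        show "(\<Sum>l<3. tr (ue i) y (ue l) * x $ l) = 0"
          using y(2)[of "ue i"] tri_expand(3)[of "c+2" "k+1" \<alpha> "ue i" y "\<lambda>l. x $ l"] unfolding k1
          by (simp add: mult.commute)
      qed
      \<comment> \<open>For k = 2 the matrix contracted with \<open>y\<close> is square, so the
        kernel vector x yields a left kernel vector, and \<open>H\<close> puts y on the line
        \<mu>.\<close>
      then have "\<exists>x. nz 3 x \<and> (\<forall>i<3. (\<Sum>l<3. tr (ue i) y (ue l) * x l) = 0)" using x3 by (intro exI[of _ "\<lambda>l. x $ l"] conjI)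
      from iffD1[OF square_kernel_iff this]
      obtain w where "nz 3 w \<and> (\<forall>l<3. (\<Sum>i<3. w i * tr (ue i) y (ue l)) = 0)" by (rule exE)
      then have w: "nz 3 w" "\<forall>l<3. (\<Sum>i<3. w i * tr (ue i) y (ue l)) = 0" by (rule conjunct1, rule conjunct2)
      have "tr w y (ue l) = 0" if l: "l < k + 1" for l
      proof -
        have "l < 3" using l k1 by simp
        have "tr w y (ue l) = (\<Sum>i<c+2. w i * tr (ue i) y (ue l))" by (rule tri_expand(1))
        then show ?thesis using w(2)[rule_format, OF \<open>l < 3\<close>] unfolding c2 by simp
      qed
      then have "\<forall>l<k+1. tr w y (ue l) = 0" by blast
      then have "\<And>x. tr w y x = 0" unfolding tri_zero_iff(3) by blast
      from H[OF y(1) _ this] w(1) have my: "(\<Sum>j<3. \<mu> j * y j) = 0" unfolding c2 by blast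
      have "map_mat (\<lambda>f. poly_eval f x) (B s) = mat 3 3 (\<lambda>(j,r). if r = s then \<mu> j else poly_eval (?A $$ (r,j)) x)"
        by (rule eq_matI) (auto simp: B_def Ti)
      moreover have "det (mat 3 3 (\<lambda>(j,r). if r = s then \<mu> j else poly_eval (?A $$ (r,j)) x)) = 0"
      proof (rule square_det_left_0I[OF y(1)], intro allI impI)
        fix r :: nat assume r: "r < 3"
        show "(\<Sum>j<3. y j * (if r = s then \<mu> j else poly_eval (?A $$ (r,j)) x)) = 0"
        proof (cases "r = s")
          case True
          then show ?thesis using my by (simp add: mult.commute)
        next
          case False
          have "(\<Sum>j<3. y j * poly_eval (?A $$ (r,j)) x) = (\<Sum>j<3. y j * tr (ue r) (ue j) (\<lambda>l. x $ l))"
            unfolding c2 by (intro sum.cong refl) (use r in \<open>simp add: tmat_eval[where x = "\<lambda>l. x $ l"]\<close>)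
          also have "\<dots> = tr (ue r) y (\<lambda>l. x $ l)" by (rule tri_expand(2)[symmetric])
          finally show ?thesis using y(2) False by simp
        qed
      qed
      ultimately show "poly_eval (det (B s)) x = 0" unfolding ev.hom_det[symmetric] by simp
    qed
    then have "det (B s) \<in> Idl\<^bsub>coord_ring k\<^esub> ((\<lambda>_. det ?A) ` {..<1::nat})" unfolding F(3) by (simp add: One_nat_def lessThan_Suc)
    then obtain a where a: "a 0 \<in> polys k" "det (B s) = a 0 * det ?A"
      unfolding Idl_eq_combinations[of 1 "\<lambda>_. det ?A" k, OF forms_polys[OF F(1)]] by (auto simp: lessThan_Suc One_nat_def)
    \<comment> \<open>A quadric that is a multiple of a cubic form vanishes.\<close>
    have "det (B s) = hc 2 (det ?A * a 0)" using hc_of_form[OF B2, of 2] a(2) by (simp add: mult.commute)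
    also have "\<dots> = 0" using hc_form_mult[OF F(1) a(1), of 2] by simp
    finally show ?thesis .
  qed
  \<comment> \<open>By the adjugate identity these quadrics combine to \<mu>_i times the
    cubic.\<close>
  have "Const (\<mu> i) * det ?A = 0" if i: "i < 3" for i
  proof -
    have "0 = (\<Sum>s<3. T $$ (i,s) * det (B s))" by (rule sym, rule sum.neutral) (simp add: B0)
    also have "\<dots> = (\<Sum>s<3. T $$ (i,s) * (\<Sum>j<3. Const (\<mu> j) * cofactor T j s))" by (intro sum.cong refl) (simp add: Bf)
    also have "\<dots> = (\<Sum>j<3. Const (\<mu> j) * (\<Sum>s<3. T $$ (i,s) * cofactor T j s))"
      unfolding sum_distrib_left by (subst sum.swap) (simp only: mult_ac)
    also have "\<dots> = (\<Sum>j<3. Const (\<mu> j) * (if i = j then det T else 0))"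
      by (intro sum.cong refl) (use cofactor_sum_row[OF T i] in simp)
    also have "\<dots> = Const (\<mu> i) * det ?A" unfolding dT by (subst sum_only[OF i]) auto
    finally show ?thesis by (rule sym)
  qed
  then have "\<mu> i = 0" if "i < 3" for i using F(2) that by simp
  then show False using \<mu> by (auto simp: nz_def)
qed

section \<open>The cases k = 2, 3, 4\<close>

lemma critical_plane_cubic:
  assumes c: "c = 1" and k: "k = 2" and dim: "has_dim k X (k - c)"
  shows "\<exists>P Q. is_critical_locus k (\<lambda>_. 1) P Q X"
proof -
  obtain y1 y2 y3 where y: "nz 3 y1 \<and> (\<exists>w. nz (c+2) w \<and> (\<forall>x. tr w y1 x = 0))"
    "nz 3 y2 \<and> (\<exists>w. nz (c+2) w \<and> (\<forall>x. tr w y2 x = 0))" "nz 3 y3 \<and> (\<exists>w. nz (c+2) w \<and> (\<forall>x. tr w y3 x = 0))"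
    and ind: "\<And>u1 u2 u3. \<forall>j<3. u1 * y1 j + u2 * y2 j + u3 * y3 j = 0 \<Longrightarrow> u1 = 0 \<and> u2 = 0 \<and> u3 = 0"
    by (rule three_points[OF cubic_noncollinear[OF c k]]) blast+
  define G where "G i j = (if j = 0 then y1 i else if j = 1 then y2 i else y3 i)" for i j :: nat
  have dG: "det (mat 3 3 (\<lambda>(i,j). G i j)) \<noteq> 0" unfolding G_def by (rule det_columns[OF ind])
  interpret D: det_tensor k c X fs "tsubst G \<alpha>" by (rule det_tensor_tsubst[OF dG])
  have "\<exists>w. nz (c+2) w \<and> (\<forall>x. D.tr w (ue j) x = 0)" if j: "j < 3" for j
  proof -
    have "(\<lambda>j'. G j' j) = (if j = 0 then y1 else if j = 1 then y2 else y3)" by (rule ext) (simp add: G_def)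
    then have "(\<lambda>j'. G j' j) = y1 \<or> (\<lambda>j'. G j' j) = y2 \<or> (\<lambda>j'. G j' j) = y3" by (simp split: if_splits)
    then show ?thesis unfolding tri_tsubst_column[OF j] using y by auto
  qed
  then show ?thesis by (intro D.critical_of_columns[OF _ dim]) (use c k in auto)
qed

lemma critical_cubic_surface:
  assumes c: "c = 1" and k: "k = 3" and dim: "has_dim k X (k - c)" and lf: "line_free k \<alpha>"
  shows "\<exists>P Q. is_critical_locus k (\<lambda>j. if j = 2 then 2 else 1) P Q X"
proof -
  interpret L: line_free k \<alpha> by (rule lf)
  have c2: "c + 2 = k" using c k by simp
  obtain y1 y2 y3 where y: "L.inZ y1" "L.inZ y2" "L.inZ y3"
    and ind: "\<And>u1 u2 u3. \<forall>j<3. u1 * y1 j + u2 * y2 j + u3 * y3 j = 0 \<Longrightarrow> u1 = 0 \<and> u2 = 0 \<and> u3 = 0"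
    by (rule three_points[OF L.Z_noncollinear]) blast+
  have y12: "y1 2 \<noteq> 0" by (rule L.normalize(1)[OF y(1)])
  \<comment> \<open>A combination of y1 and y3 on the line y_2 = 0, which misses the locus, so no
    row vector kills this column; the coefficient of y3 is nonzero, so independence is
    preserved.\<close>
  define z where "z j = y1 2 * y3 j - y3 2 * y1 j" for j
  have ind': "u1 = 0 \<and> u2 = 0 \<and> u3 = 0" if u: "\<forall>j<3. u1 * y1 j + u2 * y2 j + u3 * z j = 0" for u1 u2 u3
  proof -
    have "\<forall>j<3. (u1 - u3 * y3 2) * y1 j + u2 * y2 j + (u3 * y1 2) * y3 j = 0" using u by (simp add: z_def algebra_simps)
    from ind[OF this] show ?thesis using y12 by auto
  qed
  define G where "G i j = (if j = 0 then y1 i else if j = 1 then y2 i else z i)" for i j :: nat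
  have dG: "det (mat 3 3 (\<lambda>(i,j). G i j)) \<noteq> 0" unfolding G_def by (rule det_columns[OF ind'])
  interpret D: det_tensor k c X fs "tsubst G \<alpha>" by (rule det_tensor_tsubst[OF dG])
  have z: "nz 3 z"
  proof (rule ccontr)
    assume "\<not> nz 3 z"
    then have "\<forall>j<3. 0 * y1 j + 0 * y2 j + 1 * z j = 0" by (auto simp: nz_def)
    from ind'[OF this] show False by simp
  qed
  have G2: "(\<lambda>j'. G j' 2) = z" by (simp add: G_def)
  have kill: "\<exists>w. nz (c+2) w \<and> (\<forall>x. D.tr w (ue j) x = 0)" if j: "j < 3" "j \<noteq> 2" for j
  proof -
    have "(\<lambda>j'. G j' j) = (if j = 0 then y1 else if j = 1 then y2 else z)" by (rule ext) (simp add: G_def)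
    moreover have "j = 0 \<or> j = 1" using j by linarith
    ultimately have "(\<lambda>j'. G j' j) = y1 \<or> (\<lambda>j'. G j' j) = y2" by auto
    then show ?thesis unfolding tri_tsubst_column[OF j(1)] c2 using y(1,2) unfolding L.inZ_def by auto
  qed
  have full: "\<forall>w. nz (c+2) w \<longrightarrow> (\<exists>x. D.tr w (ue 2) x \<noteq> 0)"
  proof (intro allI impI)
    fix w :: "nat \<Rightarrow> complex" assume w: "nz (c+2) w"
    have "z 2 = 0" by (simp add: z_def)
    from L.lf[OF z this w[unfolded c2]] show "\<exists>x. D.tr w (ue 2) x \<noteq> 0"
      unfolding tri_tsubst_column[of 2, simplified] c2 G2 .
  qed
  show ?thesis
  proof (rule D.critical_of_columns[OF _ dim])
    fix j :: nat assume j: "j < 3"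
    show "((if j = 2 then 2 else 1) = c \<and> (\<exists>w. nz (c+2) w \<and> (\<forall>x. D.tr w (ue j) x = 0))) \<or>
      ((if j = 2 then 2 else 1) = c + 1 \<and> (\<forall>w. nz (c+2) w \<longrightarrow> (\<exists>x. D.tr w (ue j) x \<noteq> 0)))"
    proof (cases "j = 2")
      case True
      then show ?thesis using full c by simp
    next
      case False
      then show ?thesis using kill[OF j False] c by simp
    qed
  qed (use c k in auto)
qed

lemma critical_fourspace:
  assumes c: "c = 2" and k: "k = 4" and dim: "has_dim k X (k - c)" and lf: "line_free k \<alpha>"
  shows "\<exists>P Q. is_critical_locus k (\<lambda>_. 2) P Q X"
proof -
  interpret L: line_free k \<alpha> by (rule lf)
  have c2: "c + 2 = k" using c k by simp
  obtain y1 y2 y3 where y: "L.inZ y1" "L.inZ y2" "L.inZ y3"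
    and ind: "\<And>u1 u2 u3. \<forall>j<3. u1 * y1 j + u2 * y2 j + u3 * y3 j = 0 \<Longrightarrow> u1 = 0 \<and> u2 = 0 \<and> u3 = 0"
    by (rule three_points[OF L.Z_noncollinear]) blast+
  define G where "G i j = (if j = 0 then y1 i else if j = 1 then y2 i else y3 i)" for i j :: nat
  have dG: "det (mat 3 3 (\<lambda>(i,j). G i j)) \<noteq> 0" unfolding G_def by (rule det_columns[OF ind])
  interpret D: det_tensor k c X fs "tsubst G \<alpha>" by (rule det_tensor_tsubst[OF dG])
  have "\<exists>w. nz (c+2) w \<and> (\<forall>x. D.tr w (ue j) x = 0)" if j: "j < 3" for j
  proof -
    have "(\<lambda>j'. G j' j) = (if j = 0 then y1 else if j = 1 then y2 else y3)" by (rule ext) (simp add: G_def)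
    then have "(\<lambda>j'. G j' j) = y1 \<or> (\<lambda>j'. G j' j) = y2 \<or> (\<lambda>j'. G j' j) = y3" by (simp split: if_splits)
    then show ?thesis unfolding tri_tsubst_column[OF j] c2 using y unfolding L.inZ_def by auto
  qed
  then show ?thesis by (intro D.critical_of_columns[OF _ dim]) (use c k in auto)
qed

text \<open>Points of X are the x for which A(x) y = 0 has a nonzero solution y, so X is the image
  of the incidence variety, which is the blow-up. The ten points are k(k+1)/2 for k = 4.\<close>

lemma bordiga:
  assumes c: "c = 2" and k: "k = 4" and lf: "line_free k \<alpha>"
  shows "bordiga_surface X"
proof -
  interpret L: line_free k \<alpha> by (rule lf)
  have c2: "c + 2 = k" using c k by simp
  have X: "X = snd ` L.incidence"
  proof (rule subset_antisym; rule subsetI)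
    fix x assume x: "x \<in> X"
    obtain y where y: "nz 3 y" "\<forall>w. tr w y (\<lambda>l. x $ l) = 0" using X_kernel[OF x] by blast
    have "vec 3 y \<in> proj_space 2" unfolding L.p2 by (rule vec_proj[OF y(1)])
    moreover have "\<forall>w. tri k (k+1) \<alpha> w (\<lambda>j. vec 3 y $ j) (\<lambda>l. x $ l) = 0" using y(2) unfolding c2 L.tr_vec3 .
    ultimately have "(vec 3 y, x) \<in> L.incidence" using x X_proj unfolding L.incidence_def by blast
    then show "x \<in> snd ` L.incidence" by force
  next
    fix x assume "x \<in> snd ` L.incidence"
    then obtain y where "(y, x) \<in> L.incidence" by auto
    then have y: "y \<in> proj_space 2" "x \<in> proj_space k" "\<And>w. tr w (\<lambda>j. y $ j) (\<lambda>l. x $ l) = 0"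
      unfolding L.incidence_def c2 by blast+
    have n: "nz 3 (\<lambda>j. y $ j)" "nz (k+1) (\<lambda>l. x $ l)" using y(1,2) proj_nz unfolding L.p2 L.pk by blast+
    have "vec (k+1) (\<lambda>l. x $ l) \<in> X" by (rule kernel_in_X_iff[OF n(2,1) y(3)])
    moreover have "x = vec (k+1) (\<lambda>l. x $ l)" by (rule vec_of_proj) (use y(2) in \<open>simp add: L.pk\<close>)
    ultimately show "x \<in> X" by simp
  qed
  have k5: "k + 1 = 5" "k - 1 = 3" using k by simp_all
  have "card (exps 3) = 10"
  proof -
    have "card (exps 3) = (\<Sum>a\<le>3. Suc (3 - a))" unfolding exps_def by (subst card_SigmaI) auto
    also have "\<dots> = 10" by (simp add: numeral_eq_Suc One_nat_def)
    finally show ?thesis .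
  qed
  then have cR: "card L.reps = 10" using L.reps(2) unfolding k5 by simp
  have emb: "second_projection_embeds 2 k (blow_up 2 k L.qv)"
    unfolding L.blow_up_incidence by (rule embeds) (unfold c2 L.incidence_def, simp)
  show ?thesis
    unfolding bordiga_surface_def
  proof (rule exI[of _ L.reps], rule exI[of _ "point_set L.reps"], rule exI[of _ L.qv], intro conjI refl)
    show "linear_resolution 2 4 5 4 (point_set L.reps)" using L.linear_resolution_point_set unfolding k5 k by simp
    show "linear_system_basis 2 4 5 (point_set L.reps) L.qv" using L.linear_system_basis_point_set unfolding k5 k by simp
    show "second_projection_embeds 2 4 (blow_up 2 4 L.qv)" using emb k by simp
    show "X = snd ` blow_up 2 4 L.qv" using X L.blow_up_incidence k by simp
  qed (fact L.reps(1) cR L.reps(3))+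
qed

end

theorem theorem6p1:
  fixes c k :: nat and X :: "complex vec set" and A :: "cpoly mat"
  assumes "c \<ge> 1" and "k = 2 * c \<or> k = 2 * c + 1"
    and "smooth_variety k X" and "has_dim k X (k - c)"
    and "A \<in> carrier_mat (c + 2) 3" and "\<And>i j. i < c + 2 \<Longrightarrow> j < 3 \<Longrightarrow> A $$ (i, j) \<in> forms k 1"
    and "vanishing_ideal k X = Idl\<^bsub>coord_ring k\<^esub> (maximal_minors A)"
  shows "((\<exists>h P Q. h 0 + h 1 + h 2 = k + c \<and> is_critical_locus k h P Q X) \<longleftrightarrow>
            (k = 2 \<and> smooth_variety 2 X \<and> cubic_hypersurface 2 X) \<or>
            (k = 3 \<and> smooth_variety 3 X \<and> cubic_hypersurface 3 X) \<or>
            (k = 4 \<and> bordiga_surface X)) \<and>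
         ((\<exists>h P Q. h 0 + h 1 + h 2 = k + c \<and> is_critical_locus k h P Q X) \<longrightarrow> c \<le> 2)"
proof -
  let ?crit = "\<exists>h P Q. h 0 + h 1 + h 2 = k + c \<and> is_critical_locus k h P Q X"
  have ck: "c \<le> k" "k \<ge> c + 1" using assms(1,2) by linarith+
  obtain fs where "smooth_codim k c X fs" using smooth_codimI[OF assms(1) ck(1) assms(3,4)] by (rule exE)
  then interpret S: smooth_codim k c X fs .
  have "\<forall>i. \<exists>b. \<forall>j. i < c + 2 \<longrightarrow> j < 3 \<longrightarrow> A $$ (i,j) = (\<Sum>l\<le>k. Const (b j l) * Var l)"
  proof
    fix i
    have "\<forall>j. \<exists>b. i < c + 2 \<longrightarrow> j < 3 \<longrightarrow> A $$ (i,j) = (\<Sum>l\<le>k. Const (b l) * Var l)"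
      using forms_1[OF assms(6)] by blast
    from choice[OF this] show "\<exists>b. \<forall>j. i < c + 2 \<longrightarrow> j < 3 \<longrightarrow> A $$ (i,j) = (\<Sum>l\<le>k. Const (b j l) * Var l)" .
  qed
  from choice[OF this] obtain \<alpha> where \<alpha>: "\<forall>i. \<forall>j. i < c + 2 \<longrightarrow> j < 3 \<longrightarrow> A $$ (i,j) = (\<Sum>l\<le>k. Const (\<alpha> i j l) * Var l)" by (rule exE)
  have atMost: "{..k} = {..<k+1}" by auto
  have "A = tmat (c + 2) (k + 1) \<alpha>"
    by (rule eq_matI) (use assms(5) \<alpha> in \<open>auto simp: tmat_def atMost\<close>)
  then interpret D: det_tensor k c X fs \<alpha>
    by unfold_locales (use assms(7) ck(2) in simp_all)
  \<comment> \<open>A change of the coordinates y moves a line missing the points to y_2 = 0 and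
    leaves the ideal of X unchanged.\<close>
  have lines: "\<exists>\<beta>. det_tensor k c X fs \<beta> \<and> line_free k \<beta>" if "c + 2 = k"
  proof -
    interpret T: smooth_tensor k \<alpha> by (rule D.smooth_tensor_of[OF that])
    obtain G where G: "det (mat 3 3 (\<lambda>(i,j). G i j)) \<noteq> 0 \<and> line_free k (tsubst G \<alpha>)"
      using T.line_free_coordinates by (rule exE)
    then show ?thesis using D.det_tensor_tsubst by blast
  qed
  have cubic: "cubic_hypersurface k X" if "c = 1"
    unfolding cubic_hypersurface_def by (rule bexI[OF _ D.cubic(1)[OF that]]) (use D.cubic(2,3)[OF that] in blast)
  \<comment> \<open>For k = 2c or k = 2c + 1 the bound k \<le> c + 2 leaves exactly three
    pairs.\<close>
  consider "c = 1" "k = 2" | "c = 1" "k = 3" | "c = 2" "k = 4" | "k \<ge> c + 3" using assms(1,2) by linarith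
  then show ?thesis
  proof cases
    case 1
    obtain P Q where PQ: "is_critical_locus k (\<lambda>_. 1) P Q X" using D.critical_plane_cubic[OF 1 assms(4)] by blast
    have ?crit
      by (rule exI[of _ "\<lambda>_. 1"], rule exI[of _ P], rule exI[of _ Q], rule conjI[OF _ PQ]) (use 1 in simp)
    then show ?thesis using 1 assms(3) cubic by simp
  next
    case 2
    then obtain \<beta> where \<beta>: "det_tensor k c X fs \<beta>" "line_free k \<beta>" using lines by auto
    interpret B: det_tensor k c X fs \<beta> by (rule \<beta>(1))
    let ?h = "\<lambda>j. if j = 2 then 2 else 1 :: nat"
    obtain P Q where PQ: "is_critical_locus k ?h P Q X" using B.critical_cubic_surface[OF 2 assms(4) \<beta>(2)] by blast
    have ?crit
      by (rule exI[of _ ?h], rule exI[of _ P], rule exI[of _ Q], rule conjI[OF _ PQ]) (use 2 in simp)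
    then show ?thesis using 2 assms(3) cubic by simp
  next
    case 3
    then obtain \<beta> where \<beta>: "det_tensor k c X fs \<beta>" "line_free k \<beta>" using lines by auto
    interpret B: det_tensor k c X fs \<beta> by (rule \<beta>(1))
    obtain P Q where PQ: "is_critical_locus k (\<lambda>_. 2) P Q X" using B.critical_fourspace[OF 3 assms(4) \<beta>(2)] by blast
    have ?crit
      by (rule exI[of _ "\<lambda>_. 2"], rule exI[of _ P], rule exI[of _ Q], rule conjI[OF _ PQ]) (use 3 in simp)
    moreover have "bordiga_surface X" by (rule B.bordiga[OF 3 \<beta>(2)])
    ultimately show ?thesis using 3 by simp
  next
    case 4
    \<comment> \<open>Both sides of the equivalence fail: k \<ge> c + 3 and k \<le> 2c + 1 give k
      \<ge> 5.\<close>
    have "k \<le> 2 * c + 1" using assms(2) by auto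
    then have "\<not> ?crit" using S.not_critical[OF 4] by blast
    moreover have "k \<noteq> 2" "k \<noteq> 3" "k \<noteq> 4" using 4 assms(1,2) by linarith+
    ultimately show ?thesis by blast
  qed
qed

end
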